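(* Let $\mathcal{D}\subset\mathbb{R}^2$ be a bounded, convex, polygonal domain and let $(\mathcal{T}_h)_{h\in(0,1]}$ be a family of admissible and quasi-uniform triangulations of $\mathcal{D}$. Let $f\in L^p(\mathcal{D})$ with $p\in(2,\infty]$, let $u\in H^1_0(\mathcal{D})$ be the weak solution of the Poisson problem $-\Delta u=f$ in $\mathcal{D}$, $u=0$ on $\partial\mathcal{D}$, and assume $u\in H^1_0(\mathcal{D})\cap H^2(\mathcal{D})$. For $h\in(0,1]$ let $u_h^{IS}\colon\Omega\to S_h$ be the ($\mathbb{P}$-a.s. unique) solution of the discrete problem: $\mathbb{P}$-almost surely, $\int_{\mathcal{D}}\nabla u_h^{IS}\cdot\nabla v_h\,\mathrm{d}x=F_{IS}(v_h)$ for all $v_h\in S_h$. Then there exists $C\in(0,\infty)$, independent of $h$, such that for every $h\in(0,1]$ $$\|u_h^{IS}-u\|_{L^2(\Omega;H^1_0(\mathcal{D}))}\le C h\|u\|_{H^2(\mathcal{D})}+C\,\ell_h^{\frac12+\frac1p}\,h^{1-\frac2p}\,\|f\|_{L^p(\mathcal{D})},$$ where $\ell_h=\max(1,\log(1/h))$ (and $\frac1\infty:=0$).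
   Context: Triangulations: for each $h\in(0,1]$, $\mathcal{T}_h$ is a finite set of pairwise disjoint open triangles $T\subset\mathcal{D}$ with $\bigcup_{T\in\mathcal{T}_h}\overline{T}=\overline{\mathcal{D}}$, such that no vertex of a triangle lies in the interior of an edge of another triangle (admissibility); $h$ is the maximal edge length of the triangles in $\mathcal{T}_h$, and $|T|$ is the area of $T$. The family is quasi-uniform if the interior angles of all triangles are bounded below by a positive constant independent of $h$, and there is $c\in(0,\infty)$ with $|T|\ge c h^2$ for every $h\in(0,1]$ and $T\in\mathcal{T}_h$. Finite element space: $S_h=\{v_h\in C(\overline{\mathcal{D}}): v_h=0\text{ on }\partial\mathcal{D},\ v_h|_T\text{ is a polynomial of degree}\le1\ \forall T\in\mathcal{T}_h\}$, $N_h=\dim S_h$, with Lagrange basis $(\varphi_j)_{j=1}^{N_h}$, $\varphi_j(z_i)=\delta_{i,j}$, where $(z_i)_{i=1}^{N_h}$ are the interior nodes of $\mathcal{T}_h$. Importance sampling estimator: $(\Omega,\mathcal{F},\mathbb{P})$ is a probability space and, for each $h$, $(Y_{T,j})$, indexed by $T\in\mathcal{T}_h$ and $j\in\{1,\dots,N_h\}$ with $T\cap\mathrm{supp}(\varphi_j)\neq\emptyset$, is an independent family of random variables, $Y_{T,j}$ having probability density $p_{T,j}(x)=3|T|^{-1}\varphi_j(x)\mathbb{I}_T(x)$. For $v_h=\sum_{j=1}^{N_h}v_j\varphi_j\in S_h$, $$F_{IS}(v_h)=\frac13\sum_{T\in\mathcal{T}_h}|T|\sum_{\substack{j=1\\ T\cap\mathrm{supp}(\varphi_j)\ne\emptyset}}^{N_h}v_j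 f(Y_{T,j}).$$ Norms: $|v|_{H^1(\mathcal{D})}=(\int_{\mathcal{D}}|\nabla v|^2\,\mathrm{d}x)^{1/2}$ is used as the norm on $H^1_0(\mathcal{D})$, and $\|X\|_{L^2(\Omega;H^1_0(\mathcal{D}))}=(\mathbb{E}[|X|_{H^1(\mathcal{D})}^2])^{1/2}$. *)

theory Defs
  imports
    "HOL-Probability.Probability"
    "HOL-Library.Function_Algebras"
begin

type_synonym plane = "real ^ 2"

text \<open>Functions on a domain \<open>D\<close> are total functions on the plane of which only the values on \<open>D\<close>
  matter; every integral over \<open>D\<close> is taken with respect to \<^term>\<open>lebesgue_on D\<close>.\<close>


section \<open>Lebesgue spaces\<close>

definition in_Lp :: "plane set \<Rightarrow> ennreal \<Rightarrow> (plane \<Rightarrow> real) \<Rightarrow> bool" where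
  "in_Lp D p f \<longleftrightarrow> f \<in> borel_measurable (lebesgue_on D) \<and>
     (if p = \<infinity> then esssup (lebesgue_on D) (\<lambda>x. ennreal \<bar>f x\<bar>) < \<infinity>
      else integrable (lebesgue_on D) (\<lambda>x. \<bar>f x\<bar> powr enn2real p))"

text \<open>Meaningful only for functions satisfying \<^const>\<open>in_Lp\<close>.\<close>

definition Lp_norm :: "plane set \<Rightarrow> ennreal \<Rightarrow> (plane \<Rightarrow> real) \<Rightarrow> real" where
  "Lp_norm D p f =
     (if p = \<infinity> then enn2real (esssup (lebesgue_on D) (\<lambda>x. ennreal \<bar>f x\<bar>))
      else (LINT x|lebesgue_on D. \<bar>f x\<bar> powr enn2real p) powr (1 / enn2real p))"

definition loc_integrable :: "plane set \<Rightarrow> (plane \<Rightarrow> real) \<Rightarrow> bool" where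
  "loc_integrable D f \<longleftrightarrow> (\<forall>K. compact K \<and> K \<subseteq> D \<longrightarrow> f absolutely_integrable_on K)"


section \<open>Weak derivatives and Sobolev spaces\<close>

definition partial_deriv :: "2 \<Rightarrow> (plane \<Rightarrow> real) \<Rightarrow> plane \<Rightarrow> real" where
  "partial_deriv i f x = frechet_derivative f (at x) (axis i 1)"

primrec Ck :: "nat \<Rightarrow> (plane \<Rightarrow> real) \<Rightarrow> bool" where
  "Ck 0 f \<longleftrightarrow> continuous_on UNIV f"
| "Ck (Suc k) f \<longleftrightarrow> (\<forall>x. f differentiable (at x)) \<and> (\<forall>i. Ck k (partial_deriv i f))"

definition test_function :: "plane set \<Rightarrow> (plane \<Rightarrow> real) \<Rightarrow> bool" where
  "test_function D \<phi> \<longleftrightarrow>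
     (\<forall>k. Ck k \<phi>) \<and> (\<exists>K. compact K \<and> K \<subseteq> D \<and> (\<forall>x. x \<notin> K \<longrightarrow> \<phi> x = 0))"

definition has_weak_partial ::
  "plane set \<Rightarrow> 2 \<Rightarrow> (plane \<Rightarrow> real) \<Rightarrow> (plane \<Rightarrow> real) \<Rightarrow> bool" where
  "has_weak_partial D i v g \<longleftrightarrow> loc_integrable D v \<and> loc_integrable D g \<and>
     (\<forall>\<phi>. test_function D \<phi> \<longrightarrow>
        (LINT x|lebesgue_on D. v x * partial_deriv i \<phi> x) = - (LINT x|lebesgue_on D. g x * \<phi> x))"

text \<open>A weak derivative is determined only up to a null set of \<open>D\<close>; we pick a representative.
  Below it enters only through integrals over \<open>D\<close> and through the properties of being square
  integrable or weakly differentiable, none of which depends on this choice.\<close>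

definition weak_partial :: "plane set \<Rightarrow> 2 \<Rightarrow> (plane \<Rightarrow> real) \<Rightarrow> plane \<Rightarrow> real" where
  "weak_partial D i v = (SOME g. has_weak_partial D i v g)"

definition weak_grad :: "plane set \<Rightarrow> (plane \<Rightarrow> real) \<Rightarrow> plane \<Rightarrow> plane" where
  "weak_grad D v x = (\<chi> i. weak_partial D i v x)"

definition H1 :: "plane set \<Rightarrow> (plane \<Rightarrow> real) set" where
  "H1 D = {v. in_Lp D 2 v \<and> (\<forall>i. \<exists>g. has_weak_partial D i v g \<and> in_Lp D 2 g)}"

definition H2 :: "plane set \<Rightarrow> (plane \<Rightarrow> real) set" where
  "H2 D = {v \<in> H1 D. \<forall>i. weak_partial D i v \<in> H1 D}"

definition H1_seminorm :: "plane set \<Rightarrow> (plane \<Rightarrow> real) \<Rightarrow> real" where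
  "H1_seminorm D v = sqrt (LINT x|lebesgue_on D. (norm (weak_grad D v x))\<^sup>2)"

definition H1_norm :: "plane set \<Rightarrow> (plane \<Rightarrow> real) \<Rightarrow> real" where
  "H1_norm D v = sqrt ((Lp_norm D 2 v)\<^sup>2 + (H1_seminorm D v)\<^sup>2)"

definition H2_norm :: "plane set \<Rightarrow> (plane \<Rightarrow> real) \<Rightarrow> real" where
  "H2_norm D v = sqrt ((Lp_norm D 2 v)\<^sup>2 + (\<Sum>i\<in>UNIV. (Lp_norm D 2 (weak_partial D i v))\<^sup>2)
     + (\<Sum>i\<in>UNIV. \<Sum>j\<in>UNIV. (Lp_norm D 2 (weak_partial D j (weak_partial D i v)))\<^sup>2))"

text \<open>The closure of the test functions in \<open>H\<^sup>1\<close>.\<close>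

definition H10 :: "plane set \<Rightarrow> (plane \<Rightarrow> real) set" where
  "H10 D = {v \<in> H1 D. \<exists>\<phi>. (\<forall>n. test_function D (\<phi> n)) \<and>
     (\<lambda>n. H1_norm D (\<lambda>x. \<phi> n x - v x)) \<longlonglongrightarrow> 0}"

definition dirichlet_form :: "plane set \<Rightarrow> (plane \<Rightarrow> real) \<Rightarrow> (plane \<Rightarrow> real) \<Rightarrow> real" where
  "dirichlet_form D v w = (LINT x|lebesgue_on D. weak_grad D v x \<bullet> weak_grad D w x)"

definition weak_solution_Poisson ::
  "plane set \<Rightarrow> (plane \<Rightarrow> real) \<Rightarrow> (plane \<Rightarrow> real) \<Rightarrow> bool" where
  "weak_solution_Poisson D f u \<longleftrightarrow> u \<in> H10 D \<and>
     (\<forall>v\<in>H10 D. dirichlet_form D u v = (LINT x|lebesgue_on D. f x * v x))"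


section \<open>Triangulations\<close>

definition convex_polygonal_domain :: "plane set \<Rightarrow> bool" where
  "convex_polygonal_domain D \<longleftrightarrow>
     D \<noteq> {} \<and> open D \<and> bounded D \<and> convex D \<and> polytope (closure D)"

definition open_triangle :: "plane set \<Rightarrow> bool" where
  "open_triangle T \<longleftrightarrow> (\<exists>a b c. \<not> collinear {a, b, c} \<and> T = interior (convex hull {a, b, c}))"

definition vertices :: "plane set \<Rightarrow> plane set" where
  "vertices T = {a. a extreme_point_of (closure T)}"

definition edges :: "plane set \<Rightarrow> plane set set" where
  "edges T = {e. e edge_of (closure T)}"

definition area :: "plane set \<Rightarrow> real" where
  "area T = measure lebesgue T"

text \<open>The length of an edge is its diameter.\<close>

definition max_edge_length :: "plane set set \<Rightarrow> real" where
  "max_edge_length \<T> = Max (\<Union>T\<in>\<T>. diameter ` edges T)"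

definition admissible_triangulation :: "plane set \<Rightarrow> plane set set \<Rightarrow> bool" where
  "admissible_triangulation D \<T> \<longleftrightarrow>
     finite \<T> \<and> pairwise disjnt \<T> \<and>
     (\<forall>T\<in>\<T>. open_triangle T \<and> T \<subseteq> D) \<and>
     (\<Union>T\<in>\<T>. closure T) = closure D \<and>
     (\<forall>T\<in>\<T>. \<forall>T'\<in>\<T>. T \<noteq> T' \<longrightarrow>
        (\<forall>a\<in>vertices T. \<forall>e\<in>edges T'. a \<notin> rel_interior e))"

definition angle_at :: "plane \<Rightarrow> plane \<Rightarrow> plane \<Rightarrow> real" where
  "angle_at a b c = arccos (((b - a) \<bullet> (c - a)) / (norm (b - a) * norm (c - a)))"

definition interior_angles :: "plane set \<Rightarrow> real set" where
  "interior_angles T = {angle_at a b c | a b c.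
     {a, b, c} \<subseteq> vertices T \<and> a \<noteq> b \<and> a \<noteq> c \<and> b \<noteq> c}"

definition quasi_uniform :: "(real \<Rightarrow> plane set set) \<Rightarrow> bool" where
  "quasi_uniform \<T> \<longleftrightarrow>
     (\<exists>\<theta>>0. \<forall>h\<in>{0<..1}. \<forall>T\<in>\<T> h. \<forall>\<alpha>\<in>interior_angles T. \<theta> \<le> \<alpha>) \<and>
     (\<exists>c>0. \<forall>h\<in>{0<..1}. \<forall>T\<in>\<T> h. c * h\<^sup>2 \<le> area T)"

text \<open>The parameter \<open>h\<close> is the mesh size of the triangulation it indexes.\<close>

definition triangulation_family :: "plane set \<Rightarrow> (real \<Rightarrow> plane set set) \<Rightarrow> bool" where
  "triangulation_family D \<T> \<longleftrightarrow>
     (\<forall>h\<in>{0<..1}. admissible_triangulation D (\<T> h) \<and> max_edge_length (\<T> h) = h)"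


section \<open>Finite element spaces\<close>

text \<open>A continuous function on \<^term>\<open>closure D\<close> vanishing on the boundary is represented by its
  extension by zero to the plane, so that the elements of the finite element space are uniquely
  represented and form a vector space under pointwise operations.\<close>

definition fe_space :: "plane set \<Rightarrow> plane set set \<Rightarrow> (plane \<Rightarrow> real) set" where
  "fe_space D \<T> = {v. continuous_on (closure D) v \<and> (\<forall>x. x \<notin> D \<longrightarrow> v x = 0) \<and>
     (\<forall>T\<in>\<T>. \<exists>a b. \<forall>x\<in>T. v x = a \<bullet> x + b)}"

definition fun_scale :: "real \<Rightarrow> (plane \<Rightarrow> real) \<Rightarrow> plane \<Rightarrow> real" where
  "fun_scale c v x = c * v x"

lemma vector_space_fun_scale: "vector_space fun_scale"
  by unfold_locales (auto simp: fun_scale_def fun_eq_iff algebra_simps)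

definition fe_dim :: "plane set \<Rightarrow> plane set set \<Rightarrow> nat" where
  "fe_dim D \<T> = vector_space.dim fun_scale (fe_space D \<T>)"

definition interior_nodes :: "plane set \<Rightarrow> plane set set \<Rightarrow> plane set" where
  "interior_nodes D \<T> = (\<Union>T\<in>\<T>. vertices T) \<inter> D"

definition lagrange_basis ::
  "plane set \<Rightarrow> plane set set \<Rightarrow> (nat \<Rightarrow> plane) \<Rightarrow> (nat \<Rightarrow> plane \<Rightarrow> real) \<Rightarrow> bool" where
  "lagrange_basis D \<T> z \<phi> \<longleftrightarrow>
     bij_betw z {1..fe_dim D \<T>} (interior_nodes D \<T>) \<and>
     (\<forall>j\<in>{1..fe_dim D \<T>}. \<phi> j \<in> fe_space D \<T> \<and>
        (\<forall>i\<in>{1..fe_dim D \<T>}. \<phi> j (z i) = (if i = j then 1 else 0)))"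

definition supp :: "(plane \<Rightarrow> real) \<Rightarrow> plane set" where
  "supp \<phi> = closure {x. \<phi> x \<noteq> 0}"

text \<open>Only the coefficients with index in \<open>{1..N}\<close> are determined by \<open>v\<close>.\<close>

definition fe_coeff ::
  "nat \<Rightarrow> (nat \<Rightarrow> plane \<Rightarrow> real) \<Rightarrow> (plane \<Rightarrow> real) \<Rightarrow> nat \<Rightarrow> real" where
  "fe_coeff N \<phi> v = (SOME c. v = (\<lambda>x. \<Sum>j=1..N. c j * \<phi> j x))"


section \<open>The importance sampling estimator\<close>

definition sample_index ::
  "plane set \<Rightarrow> plane set set \<Rightarrow> (nat \<Rightarrow> plane \<Rightarrow> real) \<Rightarrow> (plane set \<times> nat) set" where
  "sample_index D \<T> \<phi> = {(T, j). T \<in> \<T> \<and> j \<in> {1..fe_dim D \<T>} \<and> T \<inter> supp (\<phi> j) \<noteq> {}}"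

definition IS_density :: "(nat \<Rightarrow> plane \<Rightarrow> real) \<Rightarrow> plane set \<Rightarrow> nat \<Rightarrow> plane \<Rightarrow> real" where
  "IS_density \<phi> T j x = 3 / area T * \<phi> j x * indicator T x"

definition IS_samples ::
  "'w measure \<Rightarrow> plane set \<Rightarrow> plane set set \<Rightarrow> (nat \<Rightarrow> plane \<Rightarrow> real) \<Rightarrow>
   (plane set \<Rightarrow> nat \<Rightarrow> 'w \<Rightarrow> plane) \<Rightarrow> bool" where
  "IS_samples M D \<T> \<phi> Y \<longleftrightarrow>
     prob_space.indep_vars M (\<lambda>_. borel) (\<lambda>(T, j). Y T j) (sample_index D \<T> \<phi>) \<and>
     (\<forall>(T, j)\<in>sample_index D \<T> \<phi>.
        distributed M lborel (Y T j) (\<lambda>x. ennreal (IS_density \<phi> T j x)))"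

definition F_IS ::
  "plane set \<Rightarrow> plane set set \<Rightarrow> (nat \<Rightarrow> plane \<Rightarrow> real) \<Rightarrow> (plane \<Rightarrow> real) \<Rightarrow>
   (plane set \<Rightarrow> nat \<Rightarrow> 'w \<Rightarrow> plane) \<Rightarrow> 'w \<Rightarrow> (plane \<Rightarrow> real) \<Rightarrow> real" where
  "F_IS D \<T> \<phi> f Y \<omega> v =
     1 / 3 * (\<Sum>T\<in>\<T>. area T *
       (\<Sum>j | j \<in> {1..fe_dim D \<T>} \<and> T \<inter> supp (\<phi> j) \<noteq> {}.
          fe_coeff (fe_dim D \<T>) \<phi> v j * f (Y T j \<omega>)))"

definition IS_solution ::
  "'w measure \<Rightarrow> plane set \<Rightarrow> plane set set \<Rightarrow> (nat \<Rightarrow> plane \<Rightarrow> real) \<Rightarrow> (plane \<Rightarrow> real) \<Rightarrow>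
   (plane set \<Rightarrow> nat \<Rightarrow> 'w \<Rightarrow> plane) \<Rightarrow> ('w \<Rightarrow> plane \<Rightarrow> real) \<Rightarrow> bool" where
  "IS_solution M D \<T> \<phi> f Y U \<longleftrightarrow>
     (\<forall>\<omega>\<in>space M. U \<omega> \<in> fe_space D \<T>) \<and>
     (AE \<omega> in M. \<forall>v\<in>fe_space D \<T>. dirichlet_form D (U \<omega>) v = F_IS D \<T> \<phi> f Y \<omega> v)"

text \<open>The norm of \<open>L\<^sup>2(\<Omega>; H\<^sup>1\<^sub>0(D))\<close>, with value \<open>\<infinity>\<close> if the second moment is infinite.  Since the
  nonnegative integral does not change under modification on a null set, no measurability is needed
  for random functions that are only determined almost surely.\<close>

definition L2_H10_norm :: "'w measure \<Rightarrow> plane set \<Rightarrow> ('w \<Rightarrow> plane \<Rightarrow> real) \<Rightarrow> ennreal" where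
  "L2_H10_norm M D X =
     (let E = (\<integral>\<^sup>+ \<omega>. ennreal ((H1_seminorm D (X \<omega>))\<^sup>2) \<partial>M)
      in if E = \<infinity> then \<infinity> else ennreal (sqrt (enn2real E)))"

definition ell :: "real \<Rightarrow> real" where
  "ell h = max 1 (ln (1 / h))"

end

theory Submission
  imports Defs
begin

text \<open>
  Let \<open>u\<^sub>h\<close> be the Galerkin solution with exact load.  By Pythagoras in the energy inner product, the squared
  error splits into that of \<open>u\<^sub>I\<^sub>S - u\<^sub>h\<close> and that of \<open>u\<^sub>h - u\<close>.

  The first part is the energy of \<open>\<Sum>\<^sub>j \<xi>\<^sub>j G\<^sub>j\<close>, where \<open>G\<^sub>j\<close> is the discrete Green function at the node \<open>z\<^sub>j\<close> and
  \<open>\<xi>\<^sub>j\<close> is the sampling error of the \<open>j\<close>-th load.  These errors are centred and uncorrelated, with variances at most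
  \<open>h\<^sup>2 / 3\<close> times the integral of \<open>f\<^sup>2 \<phi>\<^sub>j\<close>, so only the energies \<open>G\<^sub>j(z\<^sub>j)\<close> matter.  The discrete Sobolev
  inequality bounds them by a multiple of \<open>ell h\<close>.  Hence the mean energy is at most a constant times
  \<open>ell h * h\<^sup>2\<close> times the squared \<open>L\<^sup>2\<close> norm of \<open>f\<close>, which is stronger than what is claimed.

  The second part is a best approximation error.  Point values of \<open>u\<close> are avoided by interpolating smooth functions
  \<open>w\<^sub>n\<close> that converge to \<open>u\<close> in \<open>H\<^sup>2(D)\<close>.  The interpolant ignores the boundary vertices, which is harmless in
  the limit because \<open>w\<^sub>n\<close> tends to zero there by a Friedrichs inequality near the vertex.
\<close>

section \<open>Calculus in the plane and smooth bump functions\<close>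

text \<open>In two dimensions \<open>H\<^sup>1\<close> is not contained in the continuous functions,
  so energy alone cannot bound nodal values. What rescues the bound is that a finite element
  function is Lipschitz with constant at most its energy norm divided by \<open>sqrt cq * h\<close>:
  below scale \<open>h\<close> it hardly varies, and the scales from \<open>h\<close> up to the
  diameter are counted logarithmically. Independence leaves only the diagonal of the quadratic form
  of the noise, and since the \<open>\<phi>\<^sub>j\<close> sum to at most 1, the local variances
  add up to one integral of \<open>f\<^sup>2\<close>. As \<open>h \<le> 1 \<le> ell h\<close> and
  \<open>0 \<le> 1/p \<le> 1/2\<close>, the resulting \<open>sqrt (ell h) * h\<close> lies below the
  powers in the claim. Sobolev functions are given only up to null sets and \<open>H10\<close> is a
  closure, so neither \<open>u\<close> nor its boundary values can be evaluated. Borel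
  representatives extended by zero bring all integrals to \<open>lborel\<close>. Convexity supplies
  the geometry: dilation about an interior point makes room for mollification, and a supporting line
  at a boundary point forces functions of \<open>H10\<close> to be small near it.\<close>

lemma has_derivative_partial_deriv:
  assumes "(\<phi> has_derivative \<phi>') (at x)"
  shows "partial_deriv i \<phi> x = \<phi>' (axis i 1)"
  unfolding partial_deriv_def using frechet_derivative_at[OF assms] by simp

definition grad :: "(plane \<Rightarrow> real) \<Rightarrow> plane \<Rightarrow> plane" where
  "grad \<phi> x = (\<chi> i. partial_deriv i \<phi> x)"

lemma grad_nth [simp]: "grad \<phi> x $ i = partial_deriv i \<phi> x"
  by (simp add: grad_def)

lemma linear_eq_inner_axis:
  fixes L :: "plane \<Rightarrow> real"
  assumes "linear L"
  shows "L d = (\<chi> i. L (axis i 1)) \<bullet> d"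
proof -
  have "L d = L (\<Sum>i\<in>UNIV. d $ i *\<^sub>R axis i 1)"
    by (metis (no_types) basis_expansion scalar_mult_eq_scaleR)
  also have "\<dots> = (\<Sum>i\<in>UNIV. d $ i * L (axis i 1))"
    using assms by (simp add: linear_sum linear_cmul)
  finally show ?thesis by (simp add: inner_vec_def mult.commute)
qed

lemma has_derivative_grad:
  assumes "\<phi> differentiable (at x)"
  shows "(\<phi> has_derivative (\<lambda>d. grad \<phi> x \<bullet> d)) (at x)"
proof -
  have d: "(\<phi> has_derivative frechet_derivative \<phi> (at x)) (at x)"
    using assms by (simp add: frechet_derivative_works)
  have "frechet_derivative \<phi> (at x) = (\<lambda>d. grad \<phi> x \<bullet> d)"
    unfolding grad_def partial_deriv_def
    by (rule ext) (rule linear_eq_inner_axis[OF linear_frechet_derivative[OF assms]])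
  with d show ?thesis by simp
qed

lemma Ck_continuous: "Ck k f \<Longrightarrow> continuous_on UNIV f"
  by (cases k) (auto simp: continuous_on_eq_continuous_at differentiable_imp_continuous_within)

lemma Ck_SucD: "Ck (Suc k) f \<Longrightarrow> Ck k f"
proof (induction k arbitrary: f)
  case 0 then show ?case using Ck_continuous by (metis Ck.simps(1))
next
  case (Suc k) then show ?case by (metis Ck.simps(2))
qed

lemma Ck_const: "Ck k (\<lambda>x. c)"
proof (induction k arbitrary: c)
  case (Suc k)
  have "partial_deriv i (\<lambda>x. c) = (\<lambda>x. 0)" for i
    by (rule ext, subst has_derivative_partial_deriv) (auto intro: derivative_intros)
  then show ?case using Suc by simp
qed auto

lemma partial_deriv_add:
  assumes "f differentiable (at x)" "g differentiable (at x)"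
  shows "partial_deriv i (\<lambda>x. f x + g x) x = partial_deriv i f x + partial_deriv i g x"
  by (subst has_derivative_partial_deriv[OF has_derivative_add[OF has_derivative_grad[OF assms(1)] has_derivative_grad[OF assms(2)]]])
     (simp add: inner_axis)

lemma Ck_add: "Ck k f \<Longrightarrow> Ck k g \<Longrightarrow> Ck k (\<lambda>x. f x + g x)"
proof (induction k arbitrary: f g)
  case (Suc k)
  have "partial_deriv i (\<lambda>x. f x + g x) = (\<lambda>x. partial_deriv i f x + partial_deriv i g x)" for i
    using Suc.prems by (auto simp: partial_deriv_add)
  then show ?case using Suc by (auto intro: differentiable_add)
qed (auto intro!: continuous_intros)

lemma partial_deriv_mult:
  assumes "f differentiable (at x)" "g differentiable (at x)"
  shows "partial_deriv i (\<lambda>x. f x * g x) x = f x * partial_deriv i g x + partial_deriv i f x * g x"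
  by (subst has_derivative_partial_deriv[OF has_derivative_mult[OF has_derivative_grad[OF assms(1)] has_derivative_grad[OF assms(2)]]])
     (simp add: inner_axis)

lemma Ck_mult: "Ck k f \<Longrightarrow> Ck k g \<Longrightarrow> Ck k (\<lambda>x. f x * g x)"
proof (induction k arbitrary: f g)
  case (Suc k)
  have "partial_deriv i (\<lambda>x. f x * g x) = (\<lambda>x. f x * partial_deriv i g x + partial_deriv i f x * g x)" for i
    using Suc.prems by (auto simp: partial_deriv_mult)
  moreover have "Ck k (\<lambda>x. f x * partial_deriv i g x + partial_deriv i f x * g x)" for i
    using Suc.prems by (intro Ck_add Suc.IH Ck_SucD[of k f] Ck_SucD[of k g]) auto
  ultimately show ?case using Suc.prems by (auto intro: differentiable_mult)
qed (auto intro!: continuous_intros)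

lemma partial_deriv_affine:
  assumes "f differentiable (at (d + c *\<^sub>R x))"
  shows "partial_deriv i (\<lambda>x. f (d + c *\<^sub>R x)) x = c * partial_deriv i f (d + c *\<^sub>R x)"
    and "(\<lambda>x. f (d + c *\<^sub>R x)) differentiable (at x)"
proof -
  have "((\<lambda>x. d + c *\<^sub>R x) has_derivative (\<lambda>h. c *\<^sub>R h)) (at x)"
    by (auto intro!: derivative_eq_intros)
  from has_derivative_compose[OF this has_derivative_grad[OF assms]]
  have *: "((\<lambda>x. f (d + c *\<^sub>R x)) has_derivative (\<lambda>h. grad f (d + c *\<^sub>R x) \<bullet> (c *\<^sub>R h))) (at x)" .
  show "partial_deriv i (\<lambda>x. f (d + c *\<^sub>R x)) x = c * partial_deriv i f (d + c *\<^sub>R x)"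
    by (subst has_derivative_partial_deriv[OF *]) (simp add: inner_axis)
  show "(\<lambda>x. f (d + c *\<^sub>R x)) differentiable (at x)"
    using * by (rule differentiableI)
qed

lemma Ck_affine: "Ck k f \<Longrightarrow> Ck k (\<lambda>x. f (d + c *\<^sub>R x))"
proof (induction k arbitrary: f)
  case 0 then show ?case
    by (auto intro!: continuous_on_compose2[of UNIV f] continuous_intros)
next
  case (Suc k)
  have "partial_deriv i (\<lambda>x. f (d + c *\<^sub>R x)) = (\<lambda>x. c * partial_deriv i f (d + c *\<^sub>R x))" for i
    using Suc.prems partial_deriv_affine(1) by fastforce
  moreover have "Ck k (\<lambda>x. c * partial_deriv i f (d + c *\<^sub>R x))" for i
    using Suc.prems by (intro Ck_mult Ck_const Suc.IH) auto
  ultimately show ?case using Suc.prems partial_deriv_affine(2) by auto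
qed

section \<open>Smooth cutoff functions built from exp (-1/t)\<close>

primrec Ck1 :: "nat \<Rightarrow> (real \<Rightarrow> real) \<Rightarrow> bool" where
  "Ck1 0 f \<longleftrightarrow> continuous_on UNIV f"
| "Ck1 (Suc n) f \<longleftrightarrow> (\<exists>f'. (\<forall>x. (f has_real_derivative f' x) (at x)) \<and> Ck1 n f')"

lemma Ck1_lincomb: "Ck1 n f \<Longrightarrow> Ck1 n g \<Longrightarrow> Ck1 n (\<lambda>x. a * f x + b * g x)"
proof (induction n arbitrary: f g)
  case (Suc n)
  from Suc.prems obtain f' g' where
    "\<forall>x. (f has_real_derivative f' x) (at x)" "\<forall>x. (g has_real_derivative g' x) (at x)"
    "Ck1 n f'" "Ck1 n g'" by auto
  then show ?case using Suc.IH[of f' g']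
    by (auto intro!: exI[of _ "\<lambda>x. a * f' x + b * g' x"] derivative_eq_intros)
qed (auto intro!: continuous_intros)

lemma Ck_coord: "Ck1 n F \<Longrightarrow> Ck n (\<lambda>x. F (a + c * x $ i))"
proof (induction n arbitrary: F)
  case 0 then show ?case
    by (auto intro!: continuous_on_compose2[of UNIV F] continuous_intros)
next
  case (Suc n)
  then obtain F' where F': "\<And>x. (F has_real_derivative F' x) (at x)" "Ck1 n F'" by auto
  have d: "((\<lambda>x::plane. F (a + c * x $ i)) has_derivative (\<lambda>h. F' (a + c * x $ i) * (c * h $ i))) (at x)" for x
  proof -
    have "((\<lambda>x::plane. a + c * x $ i) has_derivative (\<lambda>h. c * h $ i)) (at x)"
      by (auto intro!: derivative_eq_intros bounded_linear.has_derivative[OF bounded_linear_vec_nth])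
    from has_derivative_compose[OF this has_field_derivative_imp_has_derivative[OF F'(1)]]
    show ?thesis by simp
  qed
  have "partial_deriv j (\<lambda>x. F (a + c * x $ i)) = (\<lambda>x. (c * axis j 1 $ i) * F' (a + c * x $ i))" for j
    by (rule ext) (subst has_derivative_partial_deriv[OF d], simp)
  moreover have "Ck n (\<lambda>x. (c * axis j 1 $ i) * F' (a + c * x $ i))" for j :: 2
    by (intro Ck_mult Ck_const Suc.IH F')
  ultimately show ?case using d by (auto intro: differentiableI)
qed

text \<open>Including the powers of \<open>1/t\<close> makes the linear span of these functions closed under differentiation.\<close>

definition bump :: "nat \<Rightarrow> real \<Rightarrow> real" where
  "bump k t = (if t > 0 then inverse t ^ k * exp (- inverse t) else 0)"

lemma bump_right_limit: "((\<lambda>t::real. inverse t ^ k * exp (- inverse t)) \<longlongrightarrow> 0) (at_right 0)"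
proof -
  have "((\<lambda>t::real. t ^ k / exp t) \<longlongrightarrow> 0) at_top" by (rule tendsto_power_div_exp_0)
  from filterlim_compose[OF this filterlim_inverse_at_top_right]
  show ?thesis by (simp add: exp_minus field_simps)
qed

lemma bump_derivative:
  "(bump k has_real_derivative (bump (k + 2) t - k * bump (k + 1) t)) (at t)"
proof (cases "t = 0")
  case False
  show ?thesis
  proof (cases "t > 0")
    case True
    have "((\<lambda>t::real. inverse t ^ k * exp (- inverse t)) has_real_derivative
        (bump (k + 2) t - k * bump (k + 1) t)) (at t)"
    proof (cases k)
      case 0 then show ?thesis using True
        by (auto intro!: derivative_eq_intros simp: bump_def field_simps power2_eq_square)
    next
      case (Suc j)
      have 1: "((\<lambda>t. inverse t ^ Suc j) has_real_derivative
          (1 + real j) * (- (inverse t * 1 * inverse t) * inverse t ^ j)) (at t)"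
        using True by (intro DERIV_power_Suc DERIV_inverse' DERIV_ident) auto
      have 2: "((\<lambda>t. exp (- inverse t)) has_real_derivative exp (- inverse t) * (inverse t * 1 * inverse t)) (at t)"
        using True by (auto intro!: derivative_eq_intros)
      show ?thesis unfolding Suc
        by (rule DERIV_cong[OF DERIV_mult[OF 1 2]]) (use True in \<open>simp add: bump_def algebra_simps\<close>)
    qed
    moreover have "\<forall>\<^sub>F x in nhds t. inverse x ^ k * exp (- inverse x) = bump k x"
      using eventually_nhds_in_open[of "{0<..}" t] True by (auto simp: bump_def elim: eventually_mono)
    ultimately show ?thesis by (subst DERIV_cong_ev[OF refl _ refl]) (auto elim: eventually_mono)
  next
    case neg: False
    have "\<forall>\<^sub>F x in nhds t. bump k x = 0"
      using eventually_nhds_in_open[of "{..<0}" t] neg False by (auto simp: bump_def elim: eventually_mono)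
    moreover have "((\<lambda>_. 0) has_real_derivative (bump (k + 2) t - k * bump (k + 1) t)) (at t)"
      using neg by (auto simp: bump_def)
    ultimately show ?thesis by (subst DERIV_cong_ev[OF refl _ refl]) (auto elim: eventually_mono)
  qed
next
  case True
  \<comment> \<open>At the kink the difference quotient \<open>bump k y / y\<close> is
    \<open>bump (k + 1) y\<close> for positive \<open>y\<close> and 0 for negative \<open>y\<close>,
    so both one-sided limits vanish.\<close>
  have r: "((\<lambda>y. bump k y / y) \<longlongrightarrow> 0) (at_right 0)"
    by (rule Lim_transform_eventually[OF bump_right_limit[of "k+1"]])
      (auto simp: eventually_at_right_field bump_def field_simps intro!: exI[of _ 1])
  have l: "((\<lambda>y. bump k y / y) \<longlongrightarrow> 0) (at_left 0)"
    by (rule Lim_transform_eventually[OF tendsto_const])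
      (auto simp: eventually_at_left_field bump_def intro!: exI[of _ "-1"])
  have "((\<lambda>y. bump k y / y) \<longlongrightarrow> 0) (at 0)" using l r by (rule filterlim_split_at)
  then have "(bump k has_real_derivative 0) (at 0)"
    by (simp add: has_field_derivative_iff bump_def[of k 0])
  then show ?thesis using True by (simp add: bump_def)
qed

lemma Ck1_bump: "Ck1 n (bump k)"
proof (induction n arbitrary: k)
  case 0 show ?case
    by (auto intro!: continuous_at_imp_continuous_on DERIV_isCont[OF bump_derivative])
next
  case (Suc n)
  have "Ck1 n (\<lambda>t. 1 * bump (k + 2) t + - real k * bump (k + 1) t)" by (intro Ck1_lincomb Suc)
  then show ?case using bump_derivative[of k]
    by (auto intro!: exI[of _ "\<lambda>t. bump (k + 2) t - real k * bump (k + 1) t"] simp: algebra_simps)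
qed

lemma bump_bounds: "0 \<le> bump 0 t" "bump 0 t \<le> 1" "0 < t \<Longrightarrow> 0 < bump 0 t" "t \<le> 0 \<Longrightarrow> bump 0 t = 0"
  by (auto simp: bump_def)

text \<open>The parameter \<open>n\<close> steepens the flanks: \<open>bump 0 (n * s)\<close> equals
  \<open>exp (- 1 / (n * s))\<close> for \<open>s > 0\<close> and tends to 1, while the support
  stays inside the box.\<close>

definition box_bump :: "plane \<Rightarrow> plane \<Rightarrow> real \<Rightarrow> plane \<Rightarrow> real" where
  "box_bump a b n x = (\<Prod>i\<in>{1,2}. bump 0 (n * (x $ i - a $ i)) * bump 0 (n * (b $ i - x $ i)))"

lemma all_2: "(\<forall>i::2. P i) \<longleftrightarrow> P 1 \<and> P 2"
  by (metis exhaust_2)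

lemma box_bump_Ck: "Ck k (box_bump a b n)"
proof -
  have 1: "Ck k (\<lambda>x. bump 0 (- n * a $ i + n * x $ i) * bump 0 (n * b $ i + (- n) * x $ i))" for i
    by (intro Ck_mult Ck_coord Ck1_bump)
  have "box_bump a b n = (\<lambda>x. (bump 0 (- n * a $ 1 + n * x $ 1) * bump 0 (n * b $ 1 + (- n) * x $ 1))
     * (bump 0 (- n * a $ 2 + n * x $ 2) * bump 0 (n * b $ 2 + (- n) * x $ 2)))"
    by (auto simp: box_bump_def fun_eq_iff algebra_simps)
  then show ?thesis using Ck_mult[OF 1[of 1] 1[of 2]] by simp
qed

lemma box_bump_bounds: "0 \<le> box_bump a b n x" "box_bump a b n x \<le> 1"
  by (auto simp: box_bump_def bump_bounds intro!: mult_le_one)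

lemma mem_box_plane: "x \<in> box a b \<longleftrightarrow> (\<forall>i. a $ i < x $ i \<and> x $ i < b $ i)"
  "x \<in> cbox a b \<longleftrightarrow> (\<forall>i. a $ i \<le> x $ i \<and> x $ i \<le> b $ i)" for x a b :: plane
  by (auto simp: mem_box_cart)

lemma box_bump_support: "n > 0 \<Longrightarrow> x \<notin> box a b \<Longrightarrow> box_bump a b n x = 0"
  by (auto simp: mem_box_plane all_2 box_bump_def bump_bounds mult_nonneg_nonpos not_less)

lemma box_bump_tendsto: "(\<lambda>n. box_bump a b (real (Suc n)) x) \<longlonglongrightarrow> indicator (box a b) x"
proof (cases "x \<in> box a b")
  case True
  have b: "(\<lambda>n. bump 0 (real (Suc n) * s)) \<longlonglongrightarrow> 1" if "s > 0" for s
  proof -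
    have "(\<lambda>n. - inverse (real (Suc n)) * inverse s) \<longlonglongrightarrow> - 0 * inverse s"
      by (intro tendsto_intros LIMSEQ_inverse_real_of_nat)
    then have "(\<lambda>n. exp (- inverse (real (Suc n)) * inverse s)) \<longlonglongrightarrow> exp 0"
      by (intro tendsto_intros) auto
    then show ?thesis using that by (simp add: bump_def)
  qed
  have "(\<lambda>n. box_bump a b (real (Suc n)) x) \<longlonglongrightarrow> (\<Prod>i\<in>{1,2::2}. 1 * 1)"
    unfolding box_bump_def using True
    by (intro tendsto_prod tendsto_mult b) (auto simp: mem_box_plane)
  then show ?thesis using True by simp
next
  case False
  then show ?thesis by (simp add: box_bump_support)
qed

lemma test_function_box_bump:
  assumes "n > 0" "cbox a b \<subseteq> D"
  shows "test_function D (box_bump a b n)"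
  unfolding test_function_def
  using box_bump_Ck box_bump_support[OF assms(1), of _ a b] assms(2) box_subset_cbox[of a b]
  by (metis compact_cbox subset_iff)

section \<open>Bounds and closure properties of test functions\<close>

lemma test_function_continuous: "test_function D \<phi> \<Longrightarrow> continuous_on UNIV \<phi>"
  by (metis Ck.simps(1) test_function_def)

lemma test_function_differentiable: "test_function D \<phi> \<Longrightarrow> \<phi> differentiable (at x)"
  by (metis Ck.simps(2) test_function_def)

lemma test_function_partial:
  assumes "test_function D \<phi>" shows "test_function D (partial_deriv i \<phi>)"
proof -
  obtain K where K: "compact K" "K \<subseteq> D" "\<And>x. x \<notin> K \<Longrightarrow> \<phi> x = 0"
    using assms by (auto simp: test_function_def)
  have "partial_deriv i \<phi> x = 0" if "x \<notin> K" for x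
  proof -
    have "open (- K)" using K(1) compact_imp_closed by auto
    then have "(\<phi> has_derivative (\<lambda>_. 0)) (at x)"
      by (rule has_derivative_transform_within_open[OF has_derivative_const[of 0]]) (use that K in auto)
    then show ?thesis by (simp add: has_derivative_partial_deriv)
  qed
  moreover have "\<forall>k. Ck k (partial_deriv i \<phi>)"
    using assms by (metis Ck.simps(2) test_function_def)
  ultimately show ?thesis using K unfolding test_function_def by blast
qed

lemma test_function_mono: "test_function D \<phi> \<Longrightarrow> D \<subseteq> D' \<Longrightarrow> test_function D' \<phi>"
  unfolding test_function_def by blast

lemma test_function_zero: "test_function D \<phi> \<Longrightarrow> x \<notin> D \<Longrightarrow> \<phi> x = 0"
  unfolding test_function_def by blast

lemma test_function_bounded:
  assumes "test_function D \<phi>" obtains B where "0 \<le> B" "\<And>x. \<bar>\<phi> x\<bar> \<le> B"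
proof -
  obtain K where K: "compact K" "\<And>x. x \<notin> K \<Longrightarrow> \<phi> x = 0"
    using assms by (auto simp: test_function_def)
  have "compact (\<phi> ` K)"
    using K(1) test_function_continuous[OF assms] by (metis compact_continuous_image continuous_on_subset subset_UNIV)
  then obtain B where "\<And>y. y \<in> \<phi> ` K \<Longrightarrow> \<bar>y\<bar> \<le> B"
    by (metis bounded_iff compact_imp_bounded real_norm_def)
  then have "\<bar>\<phi> x\<bar> \<le> max B 0" for x using K(2)[of x] by (cases "x \<in> K") (auto simp: le_max_iff_disj)
  then show ?thesis using that[of "max B 0"] by auto
qed

lemma test_function_grad_bounded:
  assumes "test_function D \<phi>" obtains B where "0 \<le> B" "\<And>x. norm (grad \<phi> x) \<le> B"
proof -
  obtain B1 where B1: "0 \<le> B1" "\<And>x. \<bar>partial_deriv 1 \<phi> x\<bar> \<le> B1"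
    using test_function_bounded[OF test_function_partial[OF assms]] by metis
  obtain B2 where B2: "0 \<le> B2" "\<And>x. \<bar>partial_deriv 2 \<phi> x\<bar> \<le> B2"
    using test_function_bounded[OF test_function_partial[OF assms]] by metis
  have "norm (grad \<phi> x) \<le> B1 + B2" for x
    using norm_le_l1_cart[of "grad \<phi> x"] B1(2)[of x] B2(2)[of x] by (simp add: sum_2)
  then show ?thesis using B1 B2 that[of "B1+B2"] by auto
qed

lemma test_function_lipschitz:
  assumes "test_function D \<phi>" obtains B where "0 \<le> B" "\<And>x y. \<bar>\<phi> x - \<phi> y\<bar> \<le> B * norm (x - y)"
proof -
  obtain B where B: "0 \<le> B" "\<And>x. norm (grad \<phi> x) \<le> B" using test_function_grad_bounded[OF assms] by metis
  have "norm (\<phi> x - \<phi> y) \<le> B * norm (x - y)" for x y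
  proof (rule differentiable_bound[of UNIV])
    fix z show "(\<phi> has_derivative (\<lambda>d. grad \<phi> z \<bullet> d)) (at z within UNIV)"
      using has_derivative_grad[OF test_function_differentiable[OF assms]] by simp
    show "onorm (\<lambda>d. grad \<phi> z \<bullet> d) \<le> B"
    proof (rule onorm_bound)
      show "norm (grad \<phi> z \<bullet> d) \<le> B * norm d" for d
        unfolding real_norm_def
        by (rule order_trans[OF Cauchy_Schwarz_ineq2]) (rule mult_right_mono[OF B(2) norm_ge_zero])
    qed (rule B)
  qed auto
  then show ?thesis using that[of B] B by auto
qed

lemma test_function_affine:
  assumes "test_function UNIV \<phi>" "c \<noteq> 0"
  shows "test_function UNIV (\<lambda>x. \<phi> (d + c *\<^sub>R x))"
proof -
  obtain K where K: "compact K" "\<And>x. x \<notin> K \<Longrightarrow> \<phi> x = 0" "\<forall>k. Ck k \<phi>"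
    using assms by (auto simp: test_function_def)
  have *: "(\<lambda>x. (- inverse c) *\<^sub>R d + inverse c *\<^sub>R x) (d + c *\<^sub>R x) = x" for x
    using assms by (simp add: algebra_simps)
  let ?K = "(\<lambda>x. (- inverse c) *\<^sub>R d + inverse c *\<^sub>R x) ` K"
  have "compact ?K" by (intro compact_continuous_image K continuous_intros)
  moreover have "\<phi> (d + c *\<^sub>R x) = 0" if "x \<notin> ?K" for x
    using * that K(2) by (metis imageI)
  ultimately show ?thesis using K(3) Ck_affine unfolding test_function_def by (meson subset_UNIV)
qed

lemma test_function_cmult:
  assumes "test_function D \<phi>" shows "test_function D (\<lambda>x. c * \<phi> x)"
proof -
  obtain K where K: "compact K" "K \<subseteq> D" "\<And>x. x \<notin> K \<Longrightarrow> \<phi> x = 0" "\<And>k. Ck k \<phi>"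
    using assms by (auto simp: test_function_def)
  then show ?thesis unfolding test_function_def by (intro conjI allI Ck_mult Ck_const exI[of _ K]) auto
qed

lemma test_function_integrable:
  assumes "test_function D \<phi>" shows "integrable lborel \<phi>"
proof -
  obtain K where K: "compact K" "\<And>x. x \<notin> K \<Longrightarrow> \<phi> x = 0"
    using assms by (auto simp: test_function_def)
  have "integrable lborel (\<lambda>x. indicator K x *\<^sub>R \<phi> x)"
    using borel_integrable_compact[OF K(1), of \<phi>] test_function_continuous[OF assms]
    by (metis continuous_on_subset subset_UNIV)
  moreover have "(\<lambda>x. indicator K x *\<^sub>R \<phi> x) = \<phi>"
    by (rule ext) (use K(2) in \<open>auto simp: indicator_def\<close>)
  ultimately show ?thesis by simp
qed

lemma test_function_measurable [measurable_dest]: "test_function D \<phi> \<Longrightarrow> \<phi> \<in> borel_measurable borel"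
  using test_function_continuous borel_measurable_continuous_onI by blast

section \<open>Affine substitutions and the fundamental lemma of the calculus of variations\<close>

lemma nn_integral_lborel_affine:
  fixes f :: "plane \<Rightarrow> ennreal"
  assumes [measurable]: "f \<in> borel_measurable borel" and c: "c \<noteq> 0"
  shows "(\<integral>\<^sup>+x. f (t + c *\<^sub>R x) \<partial>lborel) = ennreal (1 / c\<^sup>2) * (\<integral>\<^sup>+x. f x \<partial>lborel)"
proof -
  have "(\<integral>\<^sup>+x. f x \<partial>lborel) = ennreal (c\<^sup>2) * (\<integral>\<^sup>+x. f (t + c *\<^sub>R x) \<partial>lborel)"
    by (subst lborel_affine[OF c, of t]) (simp add: nn_integral_density nn_integral_distr nn_integral_cmult)
  then show ?thesis using c
    by (simp add: mult.assoc[symmetric] flip: ennreal_mult)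
qed

lemma integral_lborel_affine:
  fixes f :: "plane \<Rightarrow> real"
  assumes [measurable]: "f \<in> borel_measurable borel" and c: "c \<noteq> 0"
  shows "(\<integral>x. f (t + c *\<^sub>R x) \<partial>lborel) = (\<integral>x. f x \<partial>lborel) / c\<^sup>2"
proof -
  have "(\<integral>x. f x \<partial>lborel) = c\<^sup>2 * (\<integral>x. f (t + c *\<^sub>R x) \<partial>lborel)"
    by (subst lborel_affine[OF c, of t]) (simp add: integral_density integral_distr)
  then show ?thesis using c by simp
qed

lemma integrable_lborel_affine:
  fixes f :: "plane \<Rightarrow> real"
  assumes f: "integrable lborel f" and c: "c \<noteq> 0"
  shows "integrable lborel (\<lambda>x. f (t + c *\<^sub>R x))"
proof -
  have [measurable]: "f \<in> borel_measurable borel" using f by auto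
  have "integrable lborel f \<longleftrightarrow> integrable lborel (\<lambda>x. c\<^sup>2 * f (t + c *\<^sub>R x))"
    by (subst lborel_affine[OF c, of t]) (simp add: integrable_density integrable_distr_eq)
  then show ?thesis using f c by simp
qed

text \<open>Cauchy-Schwarz for the integral of \<open>F'\<close>, read off from the nonnegative
  integral of \<open>(F' - m)\<^sup>2\<close> with the mean slope \<open>m\<close>. The right side
  is a nonnegative integral so that the bound can be integrated over families of rays and treated
  with Tonelli's theorem.\<close>

lemma ftc_square:
  fixes F F' :: "real \<Rightarrow> real"
  assumes ab: "a \<le> b" and F: "\<And>t. a \<le> t \<Longrightarrow> t \<le> b \<Longrightarrow> (F has_real_derivative F' t) (at t)"
    and c: "continuous_on {a..b} F'"
  shows "ennreal ((F b - F a)\<^sup>2) \<le> ennreal (b - a) * (\<integral>\<^sup>+t. ennreal ((F' t)\<^sup>2) * indicator {a..b} t \<partial>lborel)"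
proof (cases "a = b")
  case False
  then have ab': "a < b" using ab by simp
  define m where "m = (F b - F a) / (b - a)"
  have I1: "(F' has_integral (F b - F a)) {a..b}"
    using ab F by (intro fundamental_theorem_of_calculus)
      (auto simp: has_real_derivative_iff_has_vector_derivative[symmetric] intro: has_field_derivative_at_within)
  have i2: "(\<lambda>t. (F' t)\<^sup>2) integrable_on {a..b}"
    by (intro integrable_continuous_real continuous_intros c)
  define S where "S = integral {a..b} (\<lambda>t. (F' t)\<^sup>2)"
  have I2: "((\<lambda>t. (F' t)\<^sup>2) has_integral S) {a..b}"
    unfolding S_def using i2 by (rule integrable_integral)
  have "((\<lambda>t. (F' t)\<^sup>2 - 2 * m * F' t + m\<^sup>2) has_integral (S - 2 * m * (F b - F a) + (b - a) * m\<^sup>2)) {a..b}"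
    using has_integral_add[OF has_integral_diff[OF I2 has_integral_mult_right[OF I1, of "2*m"]] has_integral_const_real[of "m\<^sup>2" a b]] ab
    by simp
  then have "0 \<le> S - 2 * m * (F b - F a) + (b - a) * m\<^sup>2"
    by (rule has_integral_nonneg) (metis (no_types, lifting) power2_diff add.commute add_diff_eq mult.commute mult.left_commute zero_le_power2 diff_add_eq)
  moreover have "F b - F a = m * (b - a)" using ab' by (simp add: m_def)
  ultimately have "m\<^sup>2 * (b - a) \<le> S" by (simp add: power2_eq_square algebra_simps)
  then have "m\<^sup>2 * (b - a) * (b - a) \<le> S * (b - a)" using ab by (intro mult_right_mono) auto
  then have le: "(F b - F a)\<^sup>2 \<le> (b - a) * S"
    unfolding \<open>F b - F a = m * (b - a)\<close> by (simp add: power2_eq_square mult_ac)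
  have "(\<integral>\<^sup>+t. ennreal ((F' t)\<^sup>2) * indicator {a..b} t \<partial>lborel) = ennreal S"
    using nn_integral_has_integral_lebesgue[OF _ I2]
    by (simp add: ennreal_mult' ennreal_indicator mult.commute)
  moreover have "0 \<le> S" using I2 by (rule has_integral_nonneg) auto
  ultimately show ?thesis using le ab by (simp add: ennreal_mult'[symmetric] ennreal_leI)
qed auto

lemma lborel_Fubini:
  fixes f :: "'a::euclidean_space \<Rightarrow> 'b::euclidean_space \<Rightarrow> ennreal"
  assumes "case_prod f \<in> borel_measurable (lborel \<Otimes>\<^sub>M lborel)"
  shows "(\<integral>\<^sup>+y. \<integral>\<^sup>+x. f x y \<partial>lborel \<partial>lborel) = (\<integral>\<^sup>+x. \<integral>\<^sup>+y. f x y \<partial>lborel \<partial>lborel)"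
  by (rule pair_sigma_finite.Fubini'[OF _ assms]) (intro pair_sigma_finite.intro sigma_finite_lborel)

text \<open>Jensen's inequality for the square under the probability density
  \<open>\<kappa>\<close>, from the nonnegativity of the variance. If
  \<open>\<kappa> * g\<^sup>2\<close> is not integrable, the right side is infinite and the claim is
  trivial.\<close>

lemma integral_square_le:
  fixes \<kappa> g :: "'a \<Rightarrow> real"
  assumes \<kappa>: "\<And>x. 0 \<le> \<kappa> x" "integrable M \<kappa>" "(\<integral>x. \<kappa> x \<partial>M) = 1"
    and [measurable]: "g \<in> borel_measurable M"
  shows "ennreal ((\<integral>x. \<kappa> x * g x \<partial>M)\<^sup>2) \<le> (\<integral>\<^sup>+x. ennreal (\<kappa> x) * ennreal ((g x)\<^sup>2) \<partial>M)"
proof (cases "integrable M (\<lambda>x. \<kappa> x * (g x)\<^sup>2)")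
  case True
  have [measurable]: "\<kappa> \<in> borel_measurable M" using \<kappa> by auto
  have y: "\<bar>y\<bar> \<le> 1 + y\<^sup>2" for y :: real
  proof -
    have "0 \<le> (\<bar>y\<bar> - 1)\<^sup>2" by simp
    then have "2 * \<bar>y\<bar> \<le> 1 + y\<^sup>2" by (simp add: power2_diff)
    then show ?thesis by linarith
  qed
  have b: "norm (\<kappa> x * g x) \<le> norm (\<kappa> x + \<kappa> x * (g x)\<^sup>2)" for x
  proof -
    have "\<kappa> x * \<bar>g x\<bar> \<le> \<kappa> x * (1 + (g x)\<^sup>2)" using y \<kappa>(1) by (rule mult_left_mono)
    then show ?thesis using \<kappa>(1)[of x] by (simp add: abs_mult distrib_left)
  qed
  have i: "integrable M (\<lambda>x. \<kappa> x * g x)"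
    by (rule Bochner_Integration.integrable_bound[of _ "\<lambda>x. \<kappa> x + \<kappa> x * (g x)\<^sup>2"]) (use True \<kappa> b in auto)
  define m where "m = (\<integral>x. \<kappa> x * g x \<partial>M)"
  have "0 \<le> (\<integral>x. \<kappa> x * (g x - m)\<^sup>2 \<partial>M)" by (intro Bochner_Integration.integral_nonneg) (use \<kappa> in auto)
  also have "(\<lambda>x. \<kappa> x * (g x - m)\<^sup>2) = (\<lambda>x. \<kappa> x * (g x)\<^sup>2 - (2 * m) * (\<kappa> x * g x) + m\<^sup>2 * \<kappa> x)"
    by (auto simp: power2_eq_square algebra_simps)
  also have "(\<integral>x. \<kappa> x * (g x)\<^sup>2 - (2 * m) * (\<kappa> x * g x) + m\<^sup>2 * \<kappa> x \<partial>M)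
      = (\<integral>x. \<kappa> x * (g x)\<^sup>2 \<partial>M) - (2 * m) * m + m\<^sup>2 * 1"
    using True i \<kappa> by (simp add: m_def[symmetric])
  finally have "m\<^sup>2 \<le> (\<integral>x. \<kappa> x * (g x)\<^sup>2 \<partial>M)" by (simp add: power2_eq_square)
  then show ?thesis using True \<kappa>
    by (simp add: m_def ennreal_mult'[symmetric] nn_integral_eq_integral ennreal_leI)
next
  case False
  have [measurable]: "\<kappa> \<in> borel_measurable M" using \<kappa> by auto
  have "(\<integral>\<^sup>+x. ennreal (\<kappa> x) * ennreal ((g x)\<^sup>2) \<partial>M) = \<infinity>"
    using False \<kappa> by (auto simp: integrable_iff_bounded ennreal_mult'[symmetric] abs_mult less_top[symmetric])
  then show ?thesis by simp
qed

text \<open>Boxes form an intersection-stable generator of the Borel sets, and the sets over which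
  \<open>h\<close> integrates to zero form a Dynkin system; the vanishing total integral takes care
  of complements.\<close>

lemma integral_box_zero_imp_AE_zero:
  fixes h :: "plane \<Rightarrow> real"
  assumes h: "integrable lborel h"
    and 0: "\<And>a b. (\<integral>x. indicator (box a b) x * h x \<partial>lborel) = 0" and 1: "(\<integral>x. h x \<partial>lborel) = 0"
  shows "AE x in lborel. h x = 0"
proof (rule density_unique_real[OF h integrable_zero])
  have [measurable]: "h \<in> borel_measurable borel" using h by auto
  fix A :: "plane set" assume A: "A \<in> sets lborel"
  let ?E = "range (\<lambda>(a, b). box a b :: plane set)"
  have "Int_stable ?E" by (auto simp: Int_stable_def box_Int_box)
  moreover have "?E \<subseteq> Pow UNIV" by auto
  moreover have "A \<in> sigma_sets UNIV ?E" using A by (simp add: borel_eq_box)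
  ultimately have "(\<integral>x. indicator A x * h x \<partial>lborel) = 0"
  proof (induction rule: sigma_sets_induct_disjoint)
    case (basic A) then show ?case using 0 by auto
  next
    case empty then show ?case by simp
  next
    case (compl A)
    then have [measurable]: "A \<in> sets borel" by (simp add: borel_eq_box)
    have "(\<integral>x. indicator (UNIV - A) x * h x \<partial>lborel) = (\<integral>x. h x - indicator A x * h x \<partial>lborel)"
      by (intro Bochner_Integration.integral_cong) (auto simp: indicator_def)
    also have "\<dots> = 0"
      using compl.IH 1 h by (subst Bochner_Integration.integral_diff)
        (auto intro!: integrable_real_mult_indicator simp: mult.commute[of "indicator A _"])
    finally show ?case .
  next
    case (union A)
    then have [measurable]: "A i \<in> sets borel" for i by (auto simp: borel_eq_box)
    have "(LINT x:(\<Union>i. A i)|lborel. h x) = (\<Sum>i. (LINT x:(A i)|lborel. h x))"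
    proof (rule lebesgue_integral_countable_add)
      show "A i \<inter> A j = {}" if "i \<noteq> j" for i j using union(1) that by (auto simp: disjoint_family_on_def)
      show "set_integrable lborel (\<Union>i. A i) h"
        unfolding set_integrable_def using h by (intro integrable_mult_indicator) auto
    qed auto
    then show ?case using union by (simp add: set_lebesgue_integral_def)
  qed
  then show "(LINT x:A|lborel. h x) = (LINT x:A|lborel. 0)"
    by (simp add: set_lebesgue_integral_def)
qed

lemma lebesgue_on_integral:
  fixes f :: "plane \<Rightarrow> real"
  assumes "D \<in> sets lebesgue"
  shows "(LINT x|lebesgue_on D. f x) = (LINT x|lebesgue. indicator D x * f x)"
    and "integrable (lebesgue_on D) f \<longleftrightarrow> integrable lebesgue (\<lambda>x. indicator D x * f x)"
  using assms by (simp_all add: integral_restrict_space integrable_restrict_space)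

lemma loc_integrable_cbox:
  assumes "loc_integrable D g" "cbox a b \<subseteq> D"
  shows "integrable lebesgue (\<lambda>x. indicator (cbox a b) x * g x)"
  using assms unfolding loc_integrable_def set_integrable_def by (auto dest: spec[of _ "cbox a b"])

lemma open_lebesgue [simp, intro]: "open D \<Longrightarrow> D \<in> sets lebesgue" for D :: "plane set"
  by (simp add: lebesgue_openin)

text \<open>Products of bumps in the coordinates converge boundedly to indicators of boxes, so \<open>g\<close> has vanishing
  integral over every box in \<open>D\<close>.\<close>

lemma fundamental_lemma:
  assumes D: "open D" and g: "loc_integrable D g"
    and 0: "\<And>\<phi>. test_function D \<phi> \<Longrightarrow> (LINT x|lebesgue_on D. g x * \<phi> x) = 0"
  shows "AE x in lebesgue. x \<in> D \<longrightarrow> g x = 0"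
proof -
  have box0: "(LINT x|lebesgue. indicator (box c d) x * g x) = 0" if cd: "cbox c d \<subseteq> D" for c d
  proof -
    have i: "integrable lebesgue (\<lambda>x. indicator (cbox c d) x * g x)" by (rule loc_integrable_cbox[OF g cd])
    define \<phi> where "\<phi> n = box_bump c d (real (Suc n))" for n
    have t: "test_function D (\<phi> n)" for n unfolding \<phi>_def by (rule test_function_box_bump[OF _ cd]) auto
    have [measurable]: "\<phi> n \<in> borel_measurable lebesgue" for n
      using test_function_measurable[OF t] by (auto intro: measurable_completion)
    define q where "q x = indicator (cbox c d) x * g x" for x
    have i: "integrable lebesgue q" using i by (simp add: q_def[abs_def])
    have [measurable]: "q \<in> borel_measurable lebesgue" "box c d \<in> sets lebesgue" using i by auto
    have s: "\<phi> n x = 0" if "x \<notin> box c d" for n x unfolding \<phi>_def by (rule box_bump_support[OF _ that]) auto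
    have "(\<lambda>n. LINT x|lebesgue. q x * \<phi> n x) \<longlonglongrightarrow>
      (LINT x|lebesgue. q x * indicator (box c d) x)"
    proof (rule integral_dominated_convergence[where w="\<lambda>x. \<bar>q x\<bar>"])
      show "AE x in lebesgue. (\<lambda>n. q x * \<phi> n x)
         \<longlonglongrightarrow> q x * indicator (box c d) x"
        unfolding \<phi>_def by (intro AE_I2 tendsto_intros box_bump_tendsto)
      show "AE x in lebesgue. norm (q x * \<phi> n x) \<le> \<bar>q x\<bar>" for n
        using box_bump_bounds[of c d "real (Suc n)"]
        by (intro AE_I2) (auto simp: \<phi>_def abs_mult intro!: mult_left_le)
    qed (use i in \<open>auto intro: integrable_abs\<close>)
    moreover have "(LINT x|lebesgue. q x * \<phi> n x) = 0" for n
    proof -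
      have "(\<lambda>x. q x * \<phi> n x) = (\<lambda>x. indicator D x * (g x * \<phi> n x))"
        using s[of _ n] cd box_subset_cbox[of c d] by (fastforce simp: indicator_def q_def)
      then show ?thesis using 0[OF t[of n]] D by (simp add: lebesgue_on_integral)
    qed
    moreover have "(\<lambda>x. q x * indicator (box c d) x) = (\<lambda>x. indicator (box c d) x * g x)"
      using box_subset_cbox[of c d] by (auto simp: indicator_def q_def fun_eq_iff)
    ultimately have "(\<lambda>n. 0) \<longlonglongrightarrow> (LINT x|lebesgue. indicator (box c d) x * g x)" by simp
    then show ?thesis by (simp add: LIMSEQ_const_iff)
  qed
  have cb: "AE x in lebesgue. x \<in> cbox a b \<longrightarrow> g x = 0" if ab: "cbox a b \<subseteq> D" for a b
  proof -
    define h where "h x = indicator (box a b) x * g x" for x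
    have "integrable lebesgue (\<lambda>x. indicator (box a b) x * (indicator (cbox a b) x * g x))"
      using integrable_mult_indicator[OF _ loc_integrable_cbox[OF g ab], of "box a b"] by auto
    moreover have "(\<lambda>x. indicator (box a b) x * (indicator (cbox a b) x * g x)) = h"
      using box_subset_cbox[of a b] by (auto simp: h_def indicator_def fun_eq_iff)
    ultimately have h: "integrable lebesgue h" by simp
    then obtain h' where h'[measurable]: "h' \<in> borel_measurable lborel" and eq: "AE x in lborel. h x = h' x"
      using completion_ex_borel_measurable_real[of h lborel] by auto
    have eq': "AE x in lebesgue. h x = h' x" using eq by (rule AE_completion)
    have [measurable]: "h \<in> borel_measurable lebesgue" "h' \<in> borel_measurable lebesgue"
      using h by (auto intro: measurable_completion)
    have "integrable lebesgue h'"
      by (rule Bochner_Integration.integrable_cong_AE_imp[OF h _ eq']) auto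
    then have h'i: "integrable lborel h'" by (simp add: integrable_completion)
    \<comment> \<open>An arbitrary box meets \<open>box a b\<close> in a box whose closure stays
      inside \<open>D\<close>, so the integrals over boxes of the first step cover all boxes of the
      plane.\<close>
    have z: "(\<integral>x. indicator (box c d) x * h' x \<partial>lborel) = 0" for c d
    proof -
      obtain e f where ef: "box c d \<inter> box a b = box e f" using box_Int_box[of c d a b] by blast
      have "(\<integral>x. indicator (box c d) x * h' x \<partial>lborel) = (\<integral>x. indicator (box c d) x * h' x \<partial>lebesgue)"
        by (rule integral_completion[symmetric]) auto
      also have "\<dots> = (\<integral>x. indicator (box c d) x * h x \<partial>lebesgue)"
      proof (rule integral_cong_AE)
        show "AE x in lebesgue. indicator (box c d) x * h' x = indicator (box c d) x * h x"
          using eq' by eventually_elim simp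
      qed (auto intro!: borel_measurable_times borel_measurable_indicator)
      also have "(\<lambda>x. indicator (box c d) x * h x) = (\<lambda>x. indicator (box e f) x * g x)"
        by (auto simp: h_def indicator_def ef[symmetric] fun_eq_iff)
      also have "(\<integral>x. indicator (box e f) x * g x \<partial>lebesgue) = 0"
      proof (cases "box e f = {}")
        case False
        have "cbox e f = closure (box e f)" using closure_box[OF False] by simp
        also have "\<dots> \<subseteq> closure (box a b)" using ef by (metis Int_lower2 closure_mono)
        also have "\<dots> \<subseteq> cbox a b" by (metis closure_minimal box_subset_cbox closed_cbox)
        finally show ?thesis using ab box0 by blast
      qed auto
      finally show ?thesis .
    qed
    have "AE x in lborel. h' x = 0"
    proof (rule integral_box_zero_imp_AE_zero[OF h'i z])
      have "AE x in lborel. h' x = indicator (box a b) x * h' x"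
        using eq by eventually_elim (auto simp: h_def indicator_def)
      then have "(\<integral>x. h' x \<partial>lborel) = (\<integral>x. indicator (box a b) x * h' x \<partial>lborel)"
        by (intro integral_cong_AE) auto
      then show "(\<integral>x. h' x \<partial>lborel) = 0" using z by simp
    qed
    with eq have "AE x in lborel. x \<in> box a b \<longrightarrow> g x = 0"
      by eventually_elim (auto simp: h_def)
    then have 1: "AE x in lebesgue. x \<in> box a b \<longrightarrow> g x = 0" by (rule AE_completion)
    have "AE x in lebesgue. x \<notin> cbox a b - box a b"
      using negligible_frontier_interval[of a b] by (intro AE_not_in) (simp add: negligible_iff_null_sets)
    with 1 show ?thesis by eventually_elim auto
  qed
  \<comment> \<open>Countably many closed boxes exhaust \<open>D\<close>, so their exceptional null
    sets unite to a null set.\<close>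
  obtain C where C: "countable C" "C \<subseteq> Pow D" "\<And>X. X \<in> C \<Longrightarrow> \<exists>a b. X = cbox a b" "\<Union>C = D"
    by (rule open_countable_Union_open_cbox[OF D], rule that)
  have "AE x in lebesgue. x \<in> X \<longrightarrow> g x = 0" if "X \<in> C" for X
  proof -
    obtain a b where "X = cbox a b" using C(3) \<open>X \<in> C\<close> by blast
    moreover have "X \<subseteq> D" using C(2) \<open>X \<in> C\<close> by blast
    ultimately show ?thesis using cb by simp
  qed
  then have "AE x in lebesgue. \<forall>X\<in>C. x \<in> X \<longrightarrow> g x = 0"
    using AE_ball_countable[OF C(1), of "\<lambda>x X. x \<in> X \<longrightarrow> g x = 0" lebesgue] by blast
  then show ?thesis by eventually_elim (use C in auto)
qed

section \<open>Weak derivatives of Lipschitz functions and convolutions\<close>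

text \<open>Discrete integration by parts for the difference quotients, followed by dominated convergence.\<close>

lemma lipschitz_weak_derivative:
  fixes v G :: "plane \<Rightarrow> real"
  assumes L: "\<And>x y. \<bar>v x - v y\<bar> \<le> L * norm (x - y)" and v: "integrable lborel v"
    and [measurable]: "G \<in> borel_measurable borel"
    and G: "AE x in lborel. (\<lambda>n. (v (x + (1 / real (Suc n)) *\<^sub>R axis i 1) - v x) * real (Suc n)) \<longlonglongrightarrow> G x"
    and \<phi>: "test_function UNIV \<phi>"
  shows "(\<integral>x. v x * partial_deriv i \<phi> x \<partial>lborel) = - (\<integral>x. G x * \<phi> x \<partial>lborel)"
proof -
  define e :: plane where "e = axis i 1"
  define t where "t n = 1 / real (Suc n)" for n
  have t0: "t \<longlonglongrightarrow> 0" unfolding t_def by (rule LIMSEQ_Suc[OF lim_1_over_n])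
  have tpos: "t n > 0" and tinv: "real (Suc n) = 1 / t n" for n by (auto simp: t_def)
  have [measurable]: "v \<in> borel_measurable borel" using v by auto
  have [measurable]: "\<phi> \<in> borel_measurable borel" "partial_deriv i \<phi> \<in> borel_measurable borel"
    using test_function_measurable[OF \<phi>] test_function_measurable[OF test_function_partial[OF \<phi>]] by auto
  have L0: "0 \<le> L" using L[of e 0] abs_ge_zero[of "v e - v 0"] by (simp add: e_def)
  obtain K where K: "0 \<le> K" "\<And>x. \<bar>\<phi> x\<bar> \<le> K" using test_function_bounded[OF \<phi>] by metis
  obtain B where B: "0 \<le> B" "\<And>x y. \<bar>\<phi> x - \<phi> y\<bar> \<le> B * norm (x - y)" using test_function_lipschitz[OF \<phi>] by metis
  have ne: "norm e = 1" by (simp add: e_def)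
  have i\<phi>: "integrable lborel \<phi>" by (rule test_function_integrable[OF \<phi>])
  have lim1: "(\<lambda>n. \<integral>x. (v (x + t n *\<^sub>R e) - v x) * (1 / t n) * \<phi> x \<partial>lborel) \<longlonglongrightarrow> (\<integral>x. G x * \<phi> x \<partial>lborel)"
  proof (rule integral_dominated_convergence[where w="\<lambda>x. L * \<bar>\<phi> x\<bar>"])
    show "AE x in lborel. (\<lambda>n. (v (x + t n *\<^sub>R e) - v x) * (1 / t n) * \<phi> x) \<longlonglongrightarrow> G x * \<phi> x"
      using G by eventually_elim (intro tendsto_mult tendsto_const, simp add: t_def e_def)
    show "AE x in lborel. norm ((v (x + t n *\<^sub>R e) - v x) * (1 / t n) * \<phi> x) \<le> L * \<bar>\<phi> x\<bar>" for n
    proof (rule AE_I2)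
      fix x
      have "\<bar>v (x + t n *\<^sub>R e) - v x\<bar> \<le> L * t n" using L[of "x + t n *\<^sub>R e" x] tpos[of n] ne by simp
      then have "\<bar>(v (x + t n *\<^sub>R e) - v x) * (1 / t n)\<bar> \<le> L" using tpos[of n]
        by (simp add: abs_mult divide_le_eq)
      then show "norm ((v (x + t n *\<^sub>R e) - v x) * (1 / t n) * \<phi> x) \<le> L * \<bar>\<phi> x\<bar>"
        unfolding real_norm_def abs_mult[of _ "\<phi> x"] by (rule mult_right_mono) simp
    qed
  qed (use i\<phi> in auto)
  have iv: "integrable lborel (\<lambda>x. v x * \<psi> x)" if "\<psi> \<in> borel_measurable borel" "\<And>x. \<bar>\<psi> x\<bar> \<le> C" for \<psi> C
  proof (rule Bochner_Integration.integrable_bound[of _ "\<lambda>x. C * v x"])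
    have "0 \<le> C" using that(2)[of 0] by simp
    then show "AE x in lborel. norm (v x * \<psi> x) \<le> norm (C * v x)"
      using that(2) by (intro AE_I2) (auto simp: abs_mult mult.commute[of "\<bar>v _\<bar>"] intro!: mult_right_mono)
  qed (use v that in auto)
  \<comment> \<open>Translation invariance moves the shift from \<open>v\<close> to
    \<open>\<phi>\<close>, where it changes direction.\<close>
  have eq: "(\<integral>x. (v (x + t n *\<^sub>R e) - v x) * (1 / t n) * \<phi> x \<partial>lborel)
     = (\<integral>x. v x * ((\<phi> (x + (- t n) *\<^sub>R e) - \<phi> x) * (1 / t n)) \<partial>lborel)" for n
  proof -
    have i1: "integrable lborel (\<lambda>x. v x * \<phi> x)" by (rule iv) (use K in auto)
    have i2: "integrable lborel (\<lambda>x. v x * \<phi> (x + (- t n) *\<^sub>R e))" by (rule iv) (use K in auto)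
    have i3: "integrable lborel (\<lambda>x. v (x + t n *\<^sub>R e) * \<phi> x)"
      using integrable_lborel_affine[OF i2, of 1 "t n *\<^sub>R e"] by (simp add: add.commute)
    have e3: "(\<integral>x. v (x + t n *\<^sub>R e) * \<phi> x \<partial>lborel) = (\<integral>x. v x * \<phi> (x + (- t n) *\<^sub>R e) \<partial>lborel)"
      using integral_lborel_affine[of "\<lambda>x. v x * \<phi> (x + (- t n) *\<^sub>R e)" 1 "t n *\<^sub>R e"] by (simp add: add.commute)
    have "(\<integral>x. (v (x + t n *\<^sub>R e) - v x) * (1 / t n) * \<phi> x \<partial>lborel)
       = (\<integral>x. (1 / t n) * (v (x + t n *\<^sub>R e) * \<phi> x - v x * \<phi> x) \<partial>lborel)"
      by (intro Bochner_Integration.integral_cong) (auto simp: algebra_simps)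
    also have "\<dots> = (1 / t n) * ((\<integral>x. v x * \<phi> (x + (- t n) *\<^sub>R e) \<partial>lborel) - (\<integral>x. v x * \<phi> x \<partial>lborel))"
      using i1 i3 e3 by simp
    also have "\<dots> = (\<integral>x. (1 / t n) * (v x * \<phi> (x + (- t n) *\<^sub>R e) - v x * \<phi> x) \<partial>lborel)"
      using i1 i2 by simp
    also have "\<dots> = (\<integral>x. v x * ((\<phi> (x + (- t n) *\<^sub>R e) - \<phi> x) * (1 / t n)) \<partial>lborel)"
      by (intro Bochner_Integration.integral_cong) (auto simp: algebra_simps)
    finally show ?thesis .
  qed
  \<comment> \<open>The backward shift is divided by \<open>t n\<close> and not by
    \<open>- t n\<close>; this produces the minus sign of integration by parts.\<close>
  have "(\<lambda>n. \<integral>x. v x * ((\<phi> (x + (- t n) *\<^sub>R e) - \<phi> x) * (1 / t n)) \<partial>lborel) \<longlonglongrightarrow>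
      (\<integral>x. v x * (- partial_deriv i \<phi> x) \<partial>lborel)"
  proof (rule integral_dominated_convergence[where w="\<lambda>x. B * \<bar>v x\<bar>"])
    show "AE x in lborel. (\<lambda>n. v x * ((\<phi> (x + (- t n) *\<^sub>R e) - \<phi> x) * (1 / t n))) \<longlonglongrightarrow> v x * (- partial_deriv i \<phi> x)"
    proof (intro AE_I2 tendsto_mult tendsto_const)
      fix x
      have "((\<lambda>s. \<phi> (x + s *\<^sub>R e)) has_derivative (\<lambda>s. grad \<phi> x \<bullet> (s *\<^sub>R e))) (at 0)"
      proof (rule has_derivative_compose[of "\<lambda>s. x + s *\<^sub>R e" _ _ _ \<phi>])
        show "((\<lambda>s. x + s *\<^sub>R e) has_derivative (\<lambda>s. s *\<^sub>R e)) (at 0)" by (auto intro!: derivative_eq_intros)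
        show "(\<phi> has_derivative (\<lambda>d. grad \<phi> x \<bullet> d)) (at (x + 0 *\<^sub>R e))"
          using has_derivative_grad[OF test_function_differentiable[OF \<phi>]] by simp
      qed
      moreover have "(\<lambda>s. grad \<phi> x \<bullet> (s *\<^sub>R e)) = (*) (partial_deriv i \<phi> x)"
        by (auto simp: e_def inner_axis)
      ultimately have "((\<lambda>s. \<phi> (x + s *\<^sub>R e)) has_real_derivative partial_deriv i \<phi> x) (at 0)"
        by (simp add: has_field_derivative_def)
      then have l: "((\<lambda>s. (\<phi> (x + s *\<^sub>R e) - \<phi> x) / s) \<longlongrightarrow> partial_deriv i \<phi> x) (at 0)"
        by (simp add: has_field_derivative_iff)
      have "filterlim (\<lambda>n. - t n) (at 0) sequentially"
        using tendsto_minus[OF t0] by (simp add: filterlim_at t_def)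
      from tendsto_minus[OF filterlim_compose[OF l this]]
      show "(\<lambda>n. (\<phi> (x + (- t n) *\<^sub>R e) - \<phi> x) * (1 / t n)) \<longlonglongrightarrow> - partial_deriv i \<phi> x"
        by simp
    qed
    show "AE x in lborel. norm (v x * ((\<phi> (x + (- t n) *\<^sub>R e) - \<phi> x) * (1 / t n))) \<le> B * \<bar>v x\<bar>" for n
    proof (rule AE_I2)
      fix x
      have "\<bar>\<phi> (x + (- t n) *\<^sub>R e) - \<phi> x\<bar> \<le> B * t n"
        using B(2)[of "x + (- t n) *\<^sub>R e" x] tpos[of n] ne by simp
      then have "\<bar>(\<phi> (x + (- t n) *\<^sub>R e) - \<phi> x) * (1 / t n)\<bar> \<le> B" using tpos[of n]
        by (simp add: abs_mult divide_le_eq)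
      then show "norm (v x * ((\<phi> (x + (- t n) *\<^sub>R e) - \<phi> x) * (1 / t n))) \<le> B * \<bar>v x\<bar>"
        unfolding real_norm_def abs_mult[of "v x"] mult.commute[of "\<bar>v x\<bar>"] by (rule mult_right_mono) simp
    qed
  qed (use v in auto)
  with lim1 have "(\<integral>x. G x * \<phi> x \<partial>lborel) = (\<integral>x. v x * (- partial_deriv i \<phi> x) \<partial>lborel)"
    unfolding eq by (rule LIMSEQ_unique)
  then show ?thesis by simp
qed

lemma test_function_weak_derivative:
  assumes "test_function D v" "test_function UNIV \<phi>"
  shows "(\<integral>x. v x * partial_deriv i \<phi> x \<partial>lborel) = - (\<integral>x. partial_deriv i v x * \<phi> x \<partial>lborel)"
proof -
  obtain B where B: "0 \<le> B" "\<And>x y. \<bar>v x - v y\<bar> \<le> B * norm (x - y)" using test_function_lipschitz[OF assms(1)] by metis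
  show ?thesis
  proof (rule lipschitz_weak_derivative[OF B(2) _ _ _ assms(2)])
    show "integrable lborel v" by (rule test_function_integrable[OF assms(1)])
    show "partial_deriv i v \<in> borel_measurable borel"
      by (rule test_function_measurable[OF test_function_partial[OF assms(1)]])
    show "AE x in lborel. (\<lambda>n. (v (x + (1 / real (Suc n)) *\<^sub>R axis i 1) - v x) * real (Suc n)) \<longlonglongrightarrow> partial_deriv i v x"
    proof (rule AE_I2)
      fix x
      have "((\<lambda>s. v (x + s *\<^sub>R axis i 1)) has_derivative (\<lambda>s. grad v x \<bullet> (s *\<^sub>R axis i 1))) (at 0)"
      proof (rule has_derivative_compose[of "\<lambda>s. x + s *\<^sub>R axis i 1" _ _ _ v])
        show "((\<lambda>s. x + s *\<^sub>R axis i 1) has_derivative (\<lambda>s. s *\<^sub>R axis i 1)) (at 0)" by (auto intro!: derivative_eq_intros)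
        show "(v has_derivative (\<lambda>d. grad v x \<bullet> d)) (at (x + 0 *\<^sub>R axis i 1))"
          using has_derivative_grad[OF test_function_differentiable[OF assms(1)]] by simp
      qed
      moreover have "(\<lambda>s. grad v x \<bullet> (s *\<^sub>R axis i 1)) = (*) (partial_deriv i v x)"
        by (auto simp: inner_axis)
      ultimately have "((\<lambda>s. v (x + s *\<^sub>R axis i 1)) has_real_derivative partial_deriv i v x) (at 0)"
        by (simp add: has_field_derivative_def)
      then have l: "((\<lambda>s. (v (x + s *\<^sub>R axis i 1) - v x) / s) \<longlongrightarrow> partial_deriv i v x) (at 0)"
        by (simp add: has_field_derivative_iff)
      have "filterlim (\<lambda>n. 1 / real (Suc n)) (at 0) sequentially"
        using LIMSEQ_Suc[OF lim_1_over_n[where 'a=real]] by (simp add: filterlim_at)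
      from filterlim_compose[OF l this]
      show "(\<lambda>n. (v (x + (1 / real (Suc n)) *\<^sub>R axis i 1) - v x) * real (Suc n)) \<longlonglongrightarrow> partial_deriv i v x"
        by simp
    qed
  qed
qed

section \<open>Convolution with a test function\<close>

definition conv :: "(plane \<Rightarrow> real) \<Rightarrow> (plane \<Rightarrow> real) \<Rightarrow> plane \<Rightarrow> real" where
  "conv \<kappa> g x = (\<integral>z. \<kappa> (x - z) * g z \<partial>lborel)"

lemma test_function_reflect:
  assumes "test_function UNIV \<kappa>"
  shows "test_function UNIV (\<lambda>z. \<kappa> (x - z))"
  using test_function_affine[OF assms, of "-1" x] by simp

lemma conv_integrable:
  assumes "test_function UNIV \<kappa>" "integrable lborel g"
  shows "integrable lborel (\<lambda>z. \<kappa> (x - z) * g z)"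
proof -
  obtain K where K: "0 \<le> K" "\<And>x. \<bar>\<kappa> x\<bar> \<le> K" using test_function_bounded[OF assms(1)] by metis
  have [measurable]: "\<kappa> \<in> borel_measurable borel" "g \<in> borel_measurable borel"
    using test_function_measurable[OF assms(1)] assms(2) by auto
  show ?thesis
    by (rule Bochner_Integration.integrable_bound[of _ "\<lambda>z. K * g z"])
      (use K assms(2) in \<open>auto simp: abs_mult intro!: mult_right_mono\<close>)
qed

text \<open>Differentiation under the integral by dominated convergence along sequences: the
  normalised Taylor remainder of the kernel tends to zero pointwise and is at most
  \<open>B + C\<close>, the Lipschitz constant plus the bound of the gradient.\<close>

lemma conv_has_derivative:
  assumes \<kappa>: "test_function UNIV \<kappa>" and g: "integrable lborel g"
  shows "(conv \<kappa> g has_derivative (\<lambda>d. (\<chi> i. conv (partial_deriv i \<kappa>) g x) \<bullet> d)) (at x)"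
  unfolding has_derivative_at tendsto_at_iff_sequentially
proof (intro conjI allI impI)
  show "bounded_linear (\<lambda>d. (\<chi> i. conv (partial_deriv i \<kappa>) g x) \<bullet> d)" by (rule bounded_linear_inner_right)
  fix X :: "nat \<Rightarrow> plane" assume X: "\<forall>i. X i \<in> UNIV - {0}" "X \<longlonglongrightarrow> 0"
  have [measurable]: "\<kappa> \<in> borel_measurable borel" "g \<in> borel_measurable borel" "partial_deriv i \<kappa> \<in> borel_measurable borel" for i
    using test_function_measurable[OF \<kappa>] g test_function_measurable[OF test_function_partial[OF \<kappa>]] by auto
  obtain B where B: "0 \<le> B" "\<And>x y. \<bar>\<kappa> x - \<kappa> y\<bar> \<le> B * norm (x - y)" using test_function_lipschitz[OF \<kappa>] by metis
  obtain C where C: "0 \<le> C" "\<And>x. norm (grad \<kappa> x) \<le> C" using test_function_grad_bounded[OF \<kappa>] by metis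
  have [measurable]: "(\<lambda>z. grad \<kappa> (x - z) \<bullet> d) \<in> borel_measurable borel" for d
    unfolding inner_vec_def by simp
  define R where "R n z = (\<kappa> (x - z + X n) - \<kappa> (x - z) - grad \<kappa> (x - z) \<bullet> X n) / norm (X n)" for n z
  have [measurable]: "R n \<in> borel_measurable borel" for n unfolding R_def by measurable
  have "(\<lambda>n. \<integral>z. R n z * g z \<partial>lborel) \<longlonglongrightarrow> (\<integral>z. 0 * g z \<partial>lborel)"
  proof (rule integral_dominated_convergence[where w="\<lambda>z. (B + C) * \<bar>g z\<bar>"])
    show "AE z in lborel. (\<lambda>n. R n z * g z) \<longlonglongrightarrow> 0 * g z"
    proof (intro AE_I2 tendsto_mult tendsto_const)
      fix z
      have "(\<kappa> has_derivative (\<lambda>d. grad \<kappa> (x - z) \<bullet> d)) (at (x - z))"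
        by (rule has_derivative_grad[OF test_function_differentiable[OF \<kappa>]])
      then have "(\<lambda>n. norm (\<kappa> (x - z + X n) - \<kappa> (x - z) - grad \<kappa> (x - z) \<bullet> X n) / norm (X n)) \<longlonglongrightarrow> 0"
        using X unfolding has_derivative_at tendsto_at_iff_sequentially by (auto simp: o_def)
      then have "(\<lambda>n. norm (R n z)) \<longlonglongrightarrow> 0" unfolding R_def by simp
      then show "(\<lambda>n. R n z) \<longlonglongrightarrow> 0" by (rule tendsto_norm_zero_cancel)
    qed
    show "AE z in lborel. norm (R n z * g z) \<le> (B + C) * \<bar>g z\<bar>" for n
    proof (rule AE_I2)
      fix z
      have "\<bar>\<kappa> (x - z + X n) - \<kappa> (x - z)\<bar> \<le> B * norm (X n)"
        using B(2)[of "x - z + X n" "x - z"] by simp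
      moreover have "\<bar>grad \<kappa> (x - z) \<bullet> X n\<bar> \<le> C * norm (X n)"
        by (rule order_trans[OF Cauchy_Schwarz_ineq2]) (rule mult_right_mono[OF C(2) norm_ge_zero])
      ultimately have "\<bar>\<kappa> (x - z + X n) - \<kappa> (x - z) - grad \<kappa> (x - z) \<bullet> X n\<bar> \<le> (B + C) * norm (X n)"
        unfolding distrib_right by linarith
      then have "\<bar>R n z\<bar> \<le> B + C" using X(1) by (simp add: R_def divide_le_eq)
      then show "norm (R n z * g z) \<le> (B + C) * \<bar>g z\<bar>"
        unfolding real_norm_def abs_mult by (rule mult_right_mono) simp
    qed
  qed (use g in auto)
  moreover have "(\<integral>z. R n z * g z \<partial>lborel) = (conv \<kappa> g (x + X n) - conv \<kappa> g x - (\<chi> i. conv (partial_deriv i \<kappa>) g x) \<bullet> X n) / norm (X n)" for n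
  proof -
    have i1: "integrable lborel (\<lambda>z. \<kappa> (x + X n - z) * g z)" "integrable lborel (\<lambda>z. \<kappa> (x - z) * g z)"
      "integrable lborel (\<lambda>z. partial_deriv i \<kappa> (x - z) * g z)" for i
      using conv_integrable[OF \<kappa> g] conv_integrable[OF test_function_partial[OF \<kappa>] g] by auto
    have "(\<integral>z. R n z * g z \<partial>lborel) = (\<integral>z. (\<kappa> (x + X n - z) * g z - \<kappa> (x - z) * g z
        - (X n $ 1 * (partial_deriv 1 \<kappa> (x - z) * g z) + X n $ 2 * (partial_deriv 2 \<kappa> (x - z) * g z))) / norm (X n) \<partial>lborel)"
      by (intro Bochner_Integration.integral_cong)
         (auto simp: R_def inner_vec_def sum_2 algebra_simps diff_divide_distrib add_divide_distrib)
    also have "\<dots> = (conv \<kappa> g (x + X n) - conv \<kappa> g x - (\<chi> i. conv (partial_deriv i \<kappa>) g x) \<bullet> X n) / norm (X n)"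
      using i1 by (simp add: conv_def inner_vec_def sum_2 mult.commute)
    finally show ?thesis .
  qed
  ultimately have "(\<lambda>n. (conv \<kappa> g (x + X n) - conv \<kappa> g x - (\<chi> i. conv (partial_deriv i \<kappa>) g x) \<bullet> X n) / norm (X n)) \<longlonglongrightarrow> 0"
    by simp
  then have "(\<lambda>n. norm ((conv \<kappa> g (x + X n) - conv \<kappa> g x - (\<chi> i. conv (partial_deriv i \<kappa>) g x) \<bullet> X n) / norm (X n))) \<longlonglongrightarrow> 0"
    by (rule tendsto_norm_zero)
  then show "((\<lambda>h. norm (conv \<kappa> g (x + h) - conv \<kappa> g x - (\<chi> i. conv (partial_deriv i \<kappa>) g x) \<bullet> h) / norm h) \<circ> X) \<longlonglongrightarrow> 0"
    by (simp add: o_def)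
qed

lemma partial_deriv_conv:
  assumes "test_function UNIV \<kappa>" "integrable lborel g"
  shows "partial_deriv i (conv \<kappa> g) = conv (partial_deriv i \<kappa>) g"
  by (rule ext, subst has_derivative_partial_deriv[OF conv_has_derivative[OF assms]]) (simp add: inner_axis)

lemma conv_Ck:
  assumes "test_function UNIV \<kappa>" "integrable lborel g"
  shows "Ck k (conv \<kappa> g)"
  using assms(1)
proof (induction k arbitrary: \<kappa>)
  case 0
  then have "isCont (conv \<kappa> g) x" for x
    by (rule has_derivative_continuous[OF conv_has_derivative[OF _ assms(2)]])
  then show ?case by (simp add: continuous_on_eq_continuous_at)
next
  case (Suc k)
  then show ?case
    using conv_has_derivative[OF _ assms(2)] test_function_partial
    by (auto simp: partial_deriv_conv[OF _ assms(2)] intro: differentiableI)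
qed

text \<open>The counterpart of \<open>has_weak_partial\<close> for integrals over the whole plane.
  Test functions and their derivatives vanish off \<open>D\<close>, so only values on
  \<open>D\<close> enter. Unlike \<open>weak_partial\<close> it is a relation, and no representative
  is chosen.\<close>

definition weak_deriv_on :: "plane set \<Rightarrow> 2 \<Rightarrow> (plane \<Rightarrow> real) \<Rightarrow> (plane \<Rightarrow> real) \<Rightarrow> bool" where
  "weak_deriv_on D i v g \<longleftrightarrow> (\<forall>\<phi>. test_function D \<phi> \<longrightarrow>
     (\<integral>x. v x * partial_deriv i \<phi> x \<partial>lborel) = - (\<integral>x. g x * \<phi> x \<partial>lborel))"

text \<open>The reflected kernel \<open>\<lambda>z. \<kappa> (x - z)\<close> is itself an admissible
  test function on \<open>D\<close> as soon as \<open>x - K\<close> lies in \<open>D\<close>; the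
  sign from the reflection cancels the sign in the definition of the weak derivative.\<close>

lemma conv_weak_deriv:
  assumes \<kappa>: "test_function UNIV \<kappa>" and w: "weak_deriv_on D i v g"
    and K: "compact K" "\<And>z. z \<notin> K \<Longrightarrow> \<kappa> z = 0" "\<And>z. z \<in> K \<Longrightarrow> x - z \<in> D"
  shows "conv (partial_deriv i \<kappa>) v x = conv \<kappa> g x"
proof -
  let ?\<phi> = "\<lambda>z. \<kappa> (x - z)"
  have t: "test_function UNIV ?\<phi>" by (rule test_function_reflect[OF \<kappa>])
  have "compact ((\<lambda>z. x - z) ` K)" by (intro compact_continuous_image K continuous_intros)
  moreover have "(\<lambda>z. x - z) ` K \<subseteq> D" using K by auto
  moreover have "?\<phi> z = 0" if "z \<notin> (\<lambda>z. x - z) ` K" for z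
    using that K(2)[of "x - z"] by (metis (no_types, lifting) diff_diff_eq2 add_diff_cancel_left' imageI)
  ultimately have "test_function D ?\<phi>" using t unfolding test_function_def by blast
  moreover have "partial_deriv i ?\<phi> z = - partial_deriv i \<kappa> (x - z)" for z
    using partial_deriv_affine(1)[of \<kappa> x "-1" z i] test_function_differentiable[OF \<kappa>] by simp
  ultimately have "(\<integral>z. v z * - partial_deriv i \<kappa> (x - z) \<partial>lborel) = - (\<integral>z. g z * \<kappa> (x - z) \<partial>lborel)"
    using w by (auto simp: weak_deriv_on_def)
  then show ?thesis by (simp add: conv_def mult.commute)
qed

section \<open>Mollification\<close>

lemma square_sum3: "(a + b + c)\<^sup>2 \<le> 3 * a\<^sup>2 + 3 * b\<^sup>2 + 3 * (c::real)\<^sup>2"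
proof -
  have "0 \<le> (a - b)\<^sup>2 + (b - c)\<^sup>2 + (a - c)\<^sup>2" by simp
  then show ?thesis by (simp add: power2_eq_square algebra_simps)
qed

lemma square_sum2: "(a + b)\<^sup>2 \<le> 2 * a\<^sup>2 + 2 * (b::real)\<^sup>2"
proof -
  have "0 \<le> (a - b)\<^sup>2" by simp
  then show ?thesis by (simp add: power2_eq_square algebra_simps)
qed

lemma mollifier_exists:
  "\<exists>\<rho>. test_function UNIV \<rho> \<and> (\<forall>x. 0 \<le> \<rho> x) \<and> (\<forall>x. x \<notin> cball 0 1 \<longrightarrow> \<rho> x = 0) \<and> (\<integral>x. \<rho> x \<partial>lborel) = 1"
proof -
  \<comment> \<open>A square of half side 1/2 fits into the unit ball because the sum of the
    absolute coordinates dominates the norm.\<close>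
  define a b :: plane where "a = (\<chi> i. - (1/2))" and "b = (\<chi> i. 1/2)"
  define \<rho>0 where "\<rho>0 = box_bump a b 1"
  have t: "test_function UNIV \<rho>0" unfolding \<rho>0_def by (rule test_function_box_bump) auto
  have nn: "0 \<le> \<rho>0 x" for x unfolding \<rho>0_def by (rule box_bump_bounds)
  have s: "\<rho>0 x = 0" if "x \<notin> cball 0 1" for x
  proof -
    have "x \<notin> box a b"
    proof
      assume "x \<in> box a b"
      then have "\<bar>x $ 1\<bar> \<le> 1/2" "\<bar>x $ 2\<bar> \<le> 1/2" 
        unfolding mem_box_plane a_def b_def all_2 by auto
      then have "norm x \<le> 1" using norm_le_l1_cart[of x] by (simp add: sum_2)
      then show False using that by simp
    qed
    then show ?thesis unfolding \<rho>0_def by (intro box_bump_support) auto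
  qed
  have i: "integrable lborel \<rho>0" by (rule test_function_integrable[OF t])
  have pos: "0 < \<rho>0 x" if "x \<in> box a b" for x
    using that by (auto simp: \<rho>0_def box_bump_def mem_box_plane intro!: mult_pos_pos bump_bounds)
  have "(\<integral>x. \<rho>0 x \<partial>lborel) \<noteq> 0"
  proof
    assume "(\<integral>x. \<rho>0 x \<partial>lborel) = 0"
    then have "AE x in lborel. \<rho>0 x = 0" using integral_nonneg_eq_0_iff_AE[OF i] nn by auto
    then have "AE x in lborel. x \<notin> box a b" by eventually_elim (use pos in force)
    then have "emeasure lborel (box a b) = 0" by (subst (asm) AE_iff_null_sets[symmetric]) auto
    moreover have "emeasure lborel (box a b) = ennreal (\<Prod>i\<in>Basis. (b - a) \<bullet> i)"
      by (rule emeasure_lborel_box) (auto simp: a_def b_def Basis_vec_def inner_axis)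
    moreover have "(\<Prod>i\<in>Basis. (b - a) \<bullet> i) = 1"
      by (auto simp: a_def b_def Basis_vec_def inner_axis intro!: prod.neutral)
    ultimately show False by simp
  qed
  moreover have "0 \<le> (\<integral>x. \<rho>0 x \<partial>lborel)" using nn by (intro Bochner_Integration.integral_nonneg)
  ultimately have I: "0 < (\<integral>x. \<rho>0 x \<partial>lborel)" by linarith
  define \<rho> where "\<rho> x = inverse (\<integral>x. \<rho>0 x \<partial>lborel) * \<rho>0 x" for x
  have "test_function UNIV \<rho>" unfolding \<rho>_def[abs_def] by (rule test_function_cmult[OF t])
  moreover have "(\<integral>x. \<rho> x \<partial>lborel) = 1" using I by (simp add: \<rho>_def)
  moreover have "0 \<le> \<rho> x" for x using nn[of x] I by (simp add: \<rho>_def)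
  moreover have "\<rho> x = 0" if "x \<notin> cball 0 1" for x using s[OF that] by (simp add: \<rho>_def)
  ultimately show ?thesis by blast
qed

definition rho :: "plane \<Rightarrow> real" where
  "rho = (SOME \<rho>. test_function UNIV \<rho> \<and> (\<forall>x. 0 \<le> \<rho> x) \<and> (\<forall>x. x \<notin> cball 0 1 \<longrightarrow> \<rho> x = 0) \<and> (\<integral>x. \<rho> x \<partial>lborel) = 1)"

lemma rho: "test_function UNIV rho" "0 \<le> rho x" "x \<notin> cball 0 1 \<Longrightarrow> rho x = 0" "(\<integral>x. rho x \<partial>lborel) = 1"
  using someI_ex[OF mollifier_exists] unfolding rho_def[symmetric] by auto

lemma rho_measurable [measurable]: "rho \<in> borel_measurable borel"
  by (rule test_function_measurable[OF rho(1)])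

lemma rho_integrable: "integrable lborel rho"
  by (rule test_function_integrable[OF rho(1)])

lemma nn_integral_rho: "(\<integral>\<^sup>+x. ennreal (rho x) \<partial>lborel) = 1"
  using rho nn_integral_eq_integral[OF rho_integrable] by simp

text \<open>The summand \<open>0 +\<close> brings the argument into the shape
  \<open>d + c *\<^sub>R x\<close> to which \<open>test_function_affine\<close> applies.\<close>

definition rho_scaled :: "real \<Rightarrow> plane \<Rightarrow> real" where
  "rho_scaled \<epsilon> x = 1 / \<epsilon>\<^sup>2 * rho (0 + (1 / \<epsilon>) *\<^sub>R x)"

lemma rho_scaled_test: "\<epsilon> > 0 \<Longrightarrow> test_function UNIV (rho_scaled \<epsilon>)"
  unfolding rho_scaled_def[abs_def] by (intro test_function_cmult test_function_affine rho) auto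

lemma rho_scaled_support: "\<epsilon> > 0 \<Longrightarrow> x \<notin> cball 0 \<epsilon> \<Longrightarrow> rho_scaled \<epsilon> x = 0"
  unfolding rho_scaled_def by (subst rho(3)) (auto simp: field_simps)

definition moll :: "real \<Rightarrow> (plane \<Rightarrow> real) \<Rightarrow> plane \<Rightarrow> real" where
  "moll \<epsilon> g = conv (rho_scaled \<epsilon>) g"

text \<open>The substitution \<open>z = x - \<epsilon> w\<close> has Jacobian
  \<open>\<epsilon>\<^sup>2\<close>, which cancels the normalisation. In this form the probability
  density is fixed and \<open>\<epsilon>\<close> sits in the argument of \<open>g\<close>, as limits
  and Jensen's inequality require.\<close>

lemma moll_eq:
  assumes [measurable]: "g \<in> borel_measurable borel" and "\<epsilon> > 0"
  shows "moll \<epsilon> g x = (\<integral>w. rho w * g (x - \<epsilon> *\<^sub>R w) \<partial>lborel)"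
proof -
  have [measurable]: "rho_scaled \<epsilon> \<in> borel_measurable borel"
    by (rule test_function_measurable[OF rho_scaled_test[OF assms(2)]])
  have "(\<integral>w. rho_scaled \<epsilon> (x - (x + (- \<epsilon>) *\<^sub>R w)) * g (x + (- \<epsilon>) *\<^sub>R w) \<partial>lborel) = moll \<epsilon> g x / \<epsilon>\<^sup>2"
    using integral_lborel_affine[of "\<lambda>z. rho_scaled \<epsilon> (x - z) * g z" "- \<epsilon>" x] assms(2)
    by (simp add: moll_def conv_def)
  moreover have "(\<lambda>w. rho_scaled \<epsilon> (x - (x + (- \<epsilon>) *\<^sub>R w)) * g (x + (- \<epsilon>) *\<^sub>R w)) = (\<lambda>w. (rho w * g (x - \<epsilon> *\<^sub>R w)) / \<epsilon>\<^sup>2)"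
    using assms(2) by (auto simp: rho_scaled_def fun_eq_iff)
  ultimately show ?thesis using assms(2) by simp
qed

lemma moll_Ck: "integrable lborel g \<Longrightarrow> \<epsilon> > 0 \<Longrightarrow> Ck k (moll \<epsilon> g)"
  unfolding moll_def by (rule conv_Ck[OF rho_scaled_test])

lemma partial_deriv_moll:
  assumes "integrable lborel g" "\<epsilon> > 0" "weak_deriv_on D i g g'" "cball x \<epsilon> \<subseteq> D"
  shows "partial_deriv i (moll \<epsilon> g) x = moll \<epsilon> g' x"
  unfolding moll_def partial_deriv_conv[OF rho_scaled_test[OF assms(2)] assms(1)]
  by (rule conv_weak_deriv[OF rho_scaled_test[OF assms(2)] assms(3), of "cball 0 \<epsilon>"])
     (use assms rho_scaled_support in \<open>auto simp: dist_norm subset_iff\<close>)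

text \<open>Both derivatives fall on the kernel and are handed over to \<open>g\<close> one at a
  time, the outer one first. The order is thereby reversed: \<open>g''\<close> is the weak
  \<open>i\<close>-th derivative of the weak \<open>j\<close>-th derivative, so mixed weak
  derivatives are never exchanged.\<close>

lemma partial_deriv2_moll:
  assumes "integrable lborel g" "\<epsilon> > 0" "weak_deriv_on D j g g'" "weak_deriv_on D i g' g''" "cball x \<epsilon> \<subseteq> D"
  shows "partial_deriv j (partial_deriv i (moll \<epsilon> g)) x = moll \<epsilon> g'' x"
proof -
  have t: "test_function UNIV (rho_scaled \<epsilon>)" by (rule rho_scaled_test[OF assms(2)])
  have t': "test_function UNIV (partial_deriv i (rho_scaled \<epsilon>))" by (rule test_function_partial[OF t])
  have z: "partial_deriv i (rho_scaled \<epsilon>) z = 0" if "z \<notin> cball 0 \<epsilon>" for z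
  proof -
    have "open (- cball 0 \<epsilon> :: plane set)" by auto
    then have "(rho_scaled \<epsilon> has_derivative (\<lambda>_. 0)) (at z)"
      by (rule has_derivative_transform_within_open[OF has_derivative_const[of 0]])
        (use that rho_scaled_support[OF assms(2)] in auto)
    then show ?thesis by (simp add: has_derivative_partial_deriv)
  qed
  have "partial_deriv j (partial_deriv i (moll \<epsilon> g)) x = conv (partial_deriv j (partial_deriv i (rho_scaled \<epsilon>))) g x"
    unfolding moll_def partial_deriv_conv[OF t assms(1)] partial_deriv_conv[OF t' assms(1)] ..
  also have "\<dots> = conv (partial_deriv i (rho_scaled \<epsilon>)) g' x"
    by (rule conv_weak_deriv[OF t' assms(3), of "cball 0 \<epsilon>"]) (use assms z in \<open>auto simp: dist_norm subset_iff\<close>)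
  also have "\<dots> = conv (rho_scaled \<epsilon>) g'' x"
    by (rule conv_weak_deriv[OF t assms(4), of "cball 0 \<epsilon>"])
       (use assms rho_scaled_support in \<open>auto simp: dist_norm subset_iff\<close>)
  finally show ?thesis unfolding moll_def .
qed

lemma clamp_bounds: "\<bar>max (- N) (min N y)\<bar> \<le> N" if "0 \<le> N" for y N :: real
  using that by linarith

lemma clamp_dist: "\<bar>y - max (- N) (min N y)\<bar> \<le> \<bar>y\<bar>" if "0 \<le> N" for y N :: real
  using that by linarith

lemma nn_integral_square_add:
  assumes [measurable]: "f \<in> borel_measurable M" "g \<in> borel_measurable M" "B \<in> sets M"
  shows "(\<integral>\<^sup>+x\<in>B. ennreal ((f x + g x)\<^sup>2) \<partial>M)
    \<le> 2 * (\<integral>\<^sup>+x\<in>B. ennreal ((f x)\<^sup>2) \<partial>M) + 2 * (\<integral>\<^sup>+x\<in>B. ennreal ((g x :: real)\<^sup>2) \<partial>M)"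
proof -
  have "(\<integral>\<^sup>+x\<in>B. ennreal ((f x + g x)\<^sup>2) \<partial>M)
    \<le> (\<integral>\<^sup>+x. 2 * (ennreal ((f x)\<^sup>2) * indicator B x) + 2 * (ennreal ((g x)\<^sup>2) * indicator B x) \<partial>M)"
  proof (rule nn_integral_mono)
    fix x
    have "ennreal ((f x + g x)\<^sup>2) \<le> ennreal (2 * (f x)\<^sup>2 + 2 * (g x)\<^sup>2)" by (intro ennreal_leI square_sum2)
    then show "ennreal ((f x + g x)\<^sup>2) * indicator B x
       \<le> 2 * (ennreal ((f x)\<^sup>2) * indicator B x) + 2 * (ennreal ((g x)\<^sup>2) * indicator B x)"
      by (simp add: indicator_def ennreal_plus ennreal_mult)
  qed
  also have "\<dots> = 2 * (\<integral>\<^sup>+x\<in>B. ennreal ((f x)\<^sup>2) \<partial>M) + 2 * (\<integral>\<^sup>+x\<in>B. ennreal ((g x)\<^sup>2) \<partial>M)"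
    by (simp add: nn_integral_add nn_integral_cmult)
  finally show ?thesis .
qed

lemma nn_integral_tendsto_zero:
  fixes f :: "nat \<Rightarrow> 'a \<Rightarrow> real" and w :: "'a \<Rightarrow> ennreal"
  assumes [measurable]: "\<And>n. f n \<in> borel_measurable M" "w \<in> borel_measurable M"
    and "AE x in M. (\<lambda>n. f n x) \<longlonglongrightarrow> 0"
    and "\<And>n. AE x in M. ennreal (f n x) \<le> w x" and "(\<integral>\<^sup>+x. w x \<partial>M) < \<infinity>"
  shows "(\<lambda>n. \<integral>\<^sup>+x. ennreal (f n x) \<partial>M) \<longlonglongrightarrow> 0"
proof -
  have "(\<lambda>n. \<integral>\<^sup>+x. ennreal (f n x) \<partial>M) \<longlonglongrightarrow> (\<integral>\<^sup>+x. 0 \<partial>M)"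
  proof (rule nn_integral_dominated_convergence[where w=w])
    show "AE x in M. (\<lambda>n. ennreal (f n x)) \<longlonglongrightarrow> 0"
      using assms(3) by eventually_elim (use tendsto_ennrealI in fastforce)
  qed (use assms in auto)
  then show ?thesis by simp
qed

text \<open>Truncation at level \<open>N\<close> comes first, then an almost everywhere
  approximation of the truncation by continuous functions. Clamping these at the same level provides
  the constant majorant for dominated convergence on the bounded set \<open>B\<close>. Each error is
  below \<open>\<eta> / 4\<close> because squaring a sum costs a factor 2.\<close>

lemma L2_continuous_dense:
  fixes g :: "plane \<Rightarrow> real"
  assumes g[measurable]: "g \<in> borel_measurable borel" and fin: "(\<integral>\<^sup>+x. ennreal ((g x)\<^sup>2) \<partial>lborel) < \<infinity>"
    and B: "bounded B" "B \<in> sets borel" and \<eta>: "(0::real) < \<eta>"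
  obtains k K where "continuous_on UNIV k" "\<And>x. \<bar>k x\<bar> \<le> (K::real)"
    "(\<integral>\<^sup>+x\<in>B. ennreal ((g x - k x)\<^sup>2) \<partial>lborel) \<le> ennreal \<eta>"
proof -
  have [measurable]: "B \<in> sets borel" by fact
  define c where "c N y = max (- real N) (min (real N) y)" for N y
  have cm[measurable]: "c N \<in> borel_measurable borel" for N unfolding c_def[abs_def] by measurable
  have "(\<lambda>N. \<integral>\<^sup>+x. ennreal ((g x - c N (g x))\<^sup>2) \<partial>lborel) \<longlonglongrightarrow> 0"
  proof (rule nn_integral_tendsto_zero[where w="\<lambda>x. ennreal ((g x)\<^sup>2)"])
    show "AE x in lborel. (\<lambda>N. (g x - c N (g x))\<^sup>2) \<longlonglongrightarrow> 0"
    proof (rule AE_I2)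
      fix x
      obtain N0 where "\<bar>g x\<bar> \<le> real N0" using real_arch_simple by blast
      have "(g x - c N (g x))\<^sup>2 = 0" if "N0 \<le> N" for N
      proof -
        have "\<bar>g x\<bar> \<le> real N" using \<open>\<bar>g x\<bar> \<le> real N0\<close> that by linarith
        then have "c N (g x) = g x" unfolding c_def by linarith
        then show ?thesis by simp
      qed
      then show "(\<lambda>N. (g x - c N (g x))\<^sup>2) \<longlonglongrightarrow> 0"
        by (intro tendsto_eventually) (auto simp: eventually_sequentially)
    qed
    show "AE x in lborel. ennreal ((g x - c N (g x))\<^sup>2) \<le> ennreal ((g x)\<^sup>2)" for N
      using clamp_dist[of "real N"] by (intro AE_I2 ennreal_leI) (simp add: c_def abs_le_square_iff[symmetric])
  qed (use fin in auto)
  then have "\<forall>\<^sub>F N in sequentially. (\<integral>\<^sup>+x. ennreal ((g x - c N (g x))\<^sup>2) \<partial>lborel) < ennreal (\<eta> / 4)"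
    by (rule order_tendstoD) (use \<eta> in auto)
  then obtain N where N: "(\<integral>\<^sup>+x. ennreal ((g x - c N (g x))\<^sup>2) \<partial>lborel) < ennreal (\<eta> / 4)"
    by (auto simp: eventually_sequentially)
  define gN where "gN x = c N (g x)" for x
  have gNm[measurable]: "gN \<in> borel_measurable borel" unfolding gN_def[abs_def] by measurable
  \<comment> \<open>This notion of measurability means being a limit of continuous functions off a
    negligible set, which supplies the approximants \<open>q n\<close>.\<close>
  have "gN measurable_on UNIV"
    by (rule lebesgue_measurable_imp_measurable_on) (auto intro: measurable_completion)
  then obtain Z q where Z: "negligible Z" and q: "\<And>n. continuous_on UNIV (q n)"
    and lim: "\<And>x. x \<notin> Z \<Longrightarrow> (\<lambda>n. q n x) \<longlonglongrightarrow> gN x"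
    unfolding measurable_on_def by auto
  have qm[measurable]: "q n \<in> borel_measurable borel" for n using q by (rule borel_measurable_continuous_onI)
  have AEZ: "AE x in lborel. x \<notin> Z"
  proof -
    have "AE x in lebesgue. x \<notin> Z" using Z by (intro AE_not_in) (simp add: negligible_iff_null_sets)
    then show ?thesis by (simp only: AE_completion_iff)
  qed
  have finB: "emeasure lborel B < \<infinity>" using B by (intro emeasure_bounded_finite)
  have "(\<lambda>n. \<integral>\<^sup>+x. ennreal ((gN x - c N (q n x))\<^sup>2 * indicator B x) \<partial>lborel) \<longlonglongrightarrow> 0"
  proof (rule nn_integral_tendsto_zero[where w="\<lambda>x. ennreal ((2 * real N)\<^sup>2) * indicator B x"])
    show "AE x in lborel. (\<lambda>n. (gN x - c N (q n x))\<^sup>2 * indicator B x) \<longlonglongrightarrow> 0"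
      using AEZ
    proof eventually_elim
      fix x assume "x \<notin> Z"
      then have "(\<lambda>n. q n x) \<longlonglongrightarrow> gN x" by (rule lim)
      then have "(\<lambda>n. c N (q n x)) \<longlonglongrightarrow> c N (gN x)" unfolding c_def by (intro tendsto_intros)
      moreover have "c N (gN x) = gN x" unfolding gN_def c_def by linarith
      ultimately have "(\<lambda>n. (gN x - c N (q n x))\<^sup>2 * indicator B x) \<longlonglongrightarrow> (gN x - gN x)\<^sup>2 * indicator B x"
        by (intro tendsto_intros) auto
      then show "(\<lambda>n. (gN x - c N (q n x))\<^sup>2 * indicator B x) \<longlonglongrightarrow> 0" by simp
    qed
    show "AE x in lborel. ennreal ((gN x - c N (q n x))\<^sup>2 * indicator B x) \<le> ennreal ((2 * real N)\<^sup>2) * indicator B x" for n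
    proof (rule AE_I2)
      fix x
      have "\<bar>gN x - c N (q n x)\<bar> \<le> 2 * real N"
        using clamp_bounds[of "real N" "g x"] clamp_bounds[of "real N" "q n x"] unfolding gN_def c_def by linarith
      then have "(gN x - c N (q n x))\<^sup>2 \<le> (2 * real N)\<^sup>2" by (subst abs_le_square_iff[symmetric]) simp
      then show "ennreal ((gN x - c N (q n x))\<^sup>2 * indicator B x) \<le> ennreal ((2 * real N)\<^sup>2) * indicator B x"
        by (auto simp: indicator_def intro: ennreal_leI)
    qed
    show "(\<integral>\<^sup>+x. ennreal ((2 * real N)\<^sup>2) * indicator B x \<partial>lborel) < \<infinity>"
      using finB by (simp add: nn_integral_cmult_indicator ennreal_mult_less_top)
  qed measurable
  then have "\<forall>\<^sub>F n in sequentially. (\<integral>\<^sup>+x. ennreal ((gN x - c N (q n x))\<^sup>2 * indicator B x) \<partial>lborel) < ennreal (\<eta> / 4)"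
    by (rule order_tendstoD) (use \<eta> in auto)
  then obtain n where n: "(\<integral>\<^sup>+x. ennreal ((gN x - c N (q n x))\<^sup>2 * indicator B x) \<partial>lborel) < ennreal (\<eta> / 4)"
    by (auto simp: eventually_sequentially)
  define k where "k x = c N (q n x)" for x
  have "(\<integral>\<^sup>+x\<in>B. ennreal ((g x - k x)\<^sup>2) \<partial>lborel) = (\<integral>\<^sup>+x\<in>B. ennreal (((g x - gN x) + (gN x - k x))\<^sup>2) \<partial>lborel)"
    by simp
  also have "\<dots> \<le> 2 * (\<integral>\<^sup>+x\<in>B. ennreal ((g x - gN x)\<^sup>2) \<partial>lborel) + 2 * (\<integral>\<^sup>+x\<in>B. ennreal ((gN x - k x)\<^sup>2) \<partial>lborel)"
    by (rule nn_integral_square_add) (auto simp: k_def)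
  also have "\<dots> \<le> 2 * ennreal (\<eta> / 4) + 2 * ennreal (\<eta> / 4)"
  proof (intro add_mono mult_left_mono)
    have "(\<integral>\<^sup>+x\<in>B. ennreal ((g x - gN x)\<^sup>2) \<partial>lborel) \<le> (\<integral>\<^sup>+x. ennreal ((g x - c N (g x))\<^sup>2) \<partial>lborel)"
      by (intro nn_integral_mono) (auto simp: gN_def indicator_def)
    then show "(\<integral>\<^sup>+x\<in>B. ennreal ((g x - gN x)\<^sup>2) \<partial>lborel) \<le> ennreal (\<eta> / 4)" using N by simp
    show "(\<integral>\<^sup>+x\<in>B. ennreal ((gN x - k x)\<^sup>2) \<partial>lborel) \<le> ennreal (\<eta> / 4)"
      using n by (simp add: k_def ennreal_mult'' ennreal_indicator)
  qed auto
  also have "\<dots> = ennreal \<eta>"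
    using \<eta> by (simp add: ennreal_plus[symmetric] ennreal_mult'[symmetric] ennreal_numeral[symmetric] del: ennreal_plus ennreal_numeral)
  finally have e: "(\<integral>\<^sup>+x\<in>B. ennreal ((g x - k x)\<^sup>2) \<partial>lborel) \<le> ennreal \<eta>" .
  have "continuous_on UNIV k" unfolding k_def[abs_def] c_def by (intro continuous_intros q)
  moreover have "\<bar>k x\<bar> \<le> real N" for x unfolding k_def c_def by (rule clamp_bounds) simp
  ultimately show ?thesis using e that by blast
qed

lemma square_integrable_imp_integrable:
  fixes f :: "plane \<Rightarrow> real"
  assumes [measurable]: "f \<in> borel_measurable borel" and fin: "(\<integral>\<^sup>+x. ennreal ((f x)\<^sup>2) \<partial>lborel) < \<infinity>"
    and B: "bounded B" "\<And>x. x \<notin> B \<Longrightarrow> f x = 0"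
  shows "integrable lborel f"
proof -
  obtain R where R: "B \<subseteq> cball 0 R" using B(1) unfolding bounded_iff subset_iff mem_cball_0 by blast
  have "emeasure lborel (cball 0 R :: plane set) < \<infinity>" by (intro emeasure_bounded_finite) auto
  then have 1: "integrable lborel (indicator (cball 0 R) :: plane \<Rightarrow> real)" by (intro integrable_real_indicator) auto
  have 2: "integrable lborel (\<lambda>x. (f x)\<^sup>2)" using fin by (subst integrable_iff_bounded) auto
  show ?thesis
  proof (rule Bochner_Integration.integrable_bound[OF Bochner_Integration.integrable_add[OF 1 2]])
    show "AE x in lborel. norm (f x) \<le> norm (indicator (cball 0 R) x + (f x)\<^sup>2)"
    proof (rule AE_I2)
      fix x
      have "0 \<le> (\<bar>f x\<bar> - 1)\<^sup>2" by simp
      then have "2 * \<bar>f x\<bar> \<le> 1 + (f x)\<^sup>2" by (simp add: power2_diff)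
      then have "\<bar>f x\<bar> \<le> 1 + (f x)\<^sup>2" using abs_ge_zero[of "f x"] by linarith
      then show "norm (f x) \<le> norm (indicator (cball 0 R) x + (f x)\<^sup>2)"
        using B(2)[of x] subsetD[OF R, of x] by (cases "x \<in> B") auto
    qed
  qed simp
qed

lemma rho_mult_integrable:
  assumes [measurable]: "k \<in> borel_measurable borel" and "\<And>x. \<bar>k x\<bar> \<le> K"
  shows "integrable lborel (\<lambda>w. rho w * k w)"
proof (rule Bochner_Integration.integrable_bound[of _ "\<lambda>w. K * rho w"])
  show "AE x in lborel. norm (rho x * k x) \<le> norm (K * rho x)"
  proof (rule AE_I2)
    fix x
    have "0 \<le> K" using assms(2)[of x] by linarith
    then show "norm (rho x * k x) \<le> norm (K * rho x)"
      using mult_left_mono[OF assms(2)[of x] rho(2)[of x]] rho(2)[of x] by (simp add: abs_mult mult.commute)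
  qed
qed (use rho_integrable in auto)

lemma rho_mult_integrable':
  assumes g: "integrable lborel g" and "\<epsilon> > 0"
  shows "integrable lborel (\<lambda>w. rho w * g (y - \<epsilon> *\<^sub>R w))"
proof -
  obtain K where K: "0 \<le> K" "\<And>x. \<bar>rho x\<bar> \<le> K" using test_function_bounded[OF rho(1)] by metis
  have [measurable]: "g \<in> borel_measurable borel" using g by auto
  have i: "integrable lborel (\<lambda>w. g (y - \<epsilon> *\<^sub>R w))" using integrable_lborel_affine[OF g, of "-\<epsilon>" y] assms(2) by simp
  show ?thesis
    by (rule Bochner_Integration.integrable_bound[of _ "\<lambda>w. K * g (y - \<epsilon> *\<^sub>R w)"])
      (use K i in \<open>auto simp: abs_mult intro!: mult_right_mono\<close>)
qed

lemma moll_tendsto: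
  assumes k: "continuous_on UNIV k" and K: "\<And>x. \<bar>k x\<bar> \<le> K"
    and y: "y \<longlonglongrightarrow> x" and \<epsilon>: "\<epsilon> \<longlonglongrightarrow> 0" "\<And>n. 0 < \<epsilon> n"
  shows "(\<lambda>n. moll (\<epsilon> n) k (y n)) \<longlonglongrightarrow> k x"
proof -
  have [measurable]: "k \<in> borel_measurable borel" using k by (rule borel_measurable_continuous_onI)
  have "(\<lambda>n. \<integral>w. rho w * k (y n - \<epsilon> n *\<^sub>R w) \<partial>lborel) \<longlonglongrightarrow> (\<integral>w. rho w * k x \<partial>lborel)"
  proof (rule integral_dominated_convergence[where w="\<lambda>w. rho w * K"])
    show "AE w in lborel. (\<lambda>n. rho w * k (y n - \<epsilon> n *\<^sub>R w)) \<longlonglongrightarrow> rho w * k x"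
    proof (intro AE_I2 tendsto_mult tendsto_const)
      fix w
      have "(\<lambda>n. y n - \<epsilon> n *\<^sub>R w) \<longlonglongrightarrow> x - 0 *\<^sub>R w" by (intro tendsto_intros y \<epsilon>)
      then show "(\<lambda>n. k (y n - \<epsilon> n *\<^sub>R w)) \<longlonglongrightarrow> k x"
        using k by (auto simp: continuous_on_eq_continuous_at intro!: isCont_tendsto_compose[of x k])
    qed
    show "AE w in lborel. norm (rho w * k (y n - \<epsilon> n *\<^sub>R w)) \<le> rho w * K" for n
      using K rho(2) by (auto simp: abs_mult intro!: mult_left_mono)
  qed (use rho_integrable in auto)
  then show ?thesis using rho(4) moll_eq[OF \<open>k \<in> borel_measurable borel\<close> \<epsilon>(2)] by simp
qed

lemma moll_bounded:
  assumes [measurable]: "k \<in> borel_measurable borel" and K: "\<And>x. \<bar>k x\<bar> \<le> K" and \<epsilon>: "0 < \<epsilon>"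
  shows "\<bar>moll \<epsilon> k x\<bar> \<le> K"
proof -
  have i: "integrable lborel (\<lambda>w. rho w * k (x - \<epsilon> *\<^sub>R w))" using K by (intro rho_mult_integrable) auto
  have "\<bar>moll \<epsilon> k x\<bar> \<le> (\<integral>w. \<bar>rho w * k (x - \<epsilon> *\<^sub>R w)\<bar> \<partial>lborel)"
    unfolding moll_eq[OF assms(1) \<epsilon>] by (rule integral_abs_bound)
  also have "\<dots> \<le> (\<integral>w. rho w * K \<partial>lborel)"
    using integrable_abs[OF i] rho_integrable K rho(2)
    by (intro integral_mono) (auto simp: abs_mult intro!: mult_left_mono simp del: integrable_abs_iff)
  finally show ?thesis using rho(4) by simp
qed

text \<open>Jensen bounds the squared average by the average of the squares, and after exchanging
  the integrals every translate contributes the same amount. The dilation by \<open>s\<close> costs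
  \<open>1 / s\<^sup>2\<close>, at most 4.\<close>

lemma moll_L2_bound:
  assumes [measurable]: "b \<in> borel_measurable borel" and s: "1/2 \<le> s" and \<epsilon>: "0 < \<epsilon>"
  shows "(\<integral>\<^sup>+x. ennreal ((moll \<epsilon> b (x0 + s *\<^sub>R (x - x0)))\<^sup>2) \<partial>lborel) \<le> 4 * (\<integral>\<^sup>+x. ennreal ((b x)\<^sup>2) \<partial>lborel)"
proof -
  have "(\<integral>\<^sup>+x. ennreal ((moll \<epsilon> b (x0 + s *\<^sub>R (x - x0)))\<^sup>2) \<partial>lborel)
     \<le> (\<integral>\<^sup>+x. \<integral>\<^sup>+w. ennreal (rho w) * ennreal ((b (x0 + s *\<^sub>R (x - x0) - \<epsilon> *\<^sub>R w))\<^sup>2) \<partial>lborel \<partial>lborel)"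
    unfolding moll_eq[OF assms(1) \<epsilon>]
    by (intro nn_integral_mono integral_square_le rho rho_integrable) measurable
  also have "\<dots> = (\<integral>\<^sup>+w. \<integral>\<^sup>+x. ennreal (rho w) * ennreal ((b (x0 + s *\<^sub>R (x - x0) - \<epsilon> *\<^sub>R w))\<^sup>2) \<partial>lborel \<partial>lborel)"
    by (rule lborel_Fubini) measurable
  also have "\<dots> = (\<integral>\<^sup>+w. ennreal (rho w) * (ennreal (1 / s\<^sup>2) * (\<integral>\<^sup>+x. ennreal ((b x)\<^sup>2) \<partial>lborel)) \<partial>lborel)"
  proof (intro nn_integral_cong)
    fix w
    have "(\<lambda>x. (b (x0 + s *\<^sub>R (x - x0) - \<epsilon> *\<^sub>R w))\<^sup>2) = (\<lambda>x. (b ((x0 - s *\<^sub>R x0 - \<epsilon> *\<^sub>R w) + s *\<^sub>R x))\<^sup>2)"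
      by (simp add: algebra_simps)
    then show "(\<integral>\<^sup>+x. ennreal (rho w) * ennreal ((b (x0 + s *\<^sub>R (x - x0) - \<epsilon> *\<^sub>R w))\<^sup>2) \<partial>lborel)
       = ennreal (rho w) * (ennreal (1 / s\<^sup>2) * (\<integral>\<^sup>+x. ennreal ((b x)\<^sup>2) \<partial>lborel))"
      using s nn_integral_lborel_affine[of "\<lambda>x. ennreal ((b x)\<^sup>2)" s "x0 - s *\<^sub>R x0 - \<epsilon> *\<^sub>R w"]
      by (simp add: nn_integral_cmult fun_eq_iff)
  qed
  also have "\<dots> = ennreal (1 / s\<^sup>2) * (\<integral>\<^sup>+x. ennreal ((b x)\<^sup>2) \<partial>lborel)"
    by (simp add: nn_integral_multc nn_integral_rho)
  also have "\<dots> \<le> ennreal 4 * (\<integral>\<^sup>+x. ennreal ((b x)\<^sup>2) \<partial>lborel)"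
  proof (intro mult_right_mono ennreal_leI)
    have "(1/2)\<^sup>2 \<le> s\<^sup>2" using s by (intro power_mono) auto
    moreover have "0 < s\<^sup>2" using s by auto
    ultimately show "1 / s\<^sup>2 \<le> 4" by (simp add: field_simps power2_eq_square)
  qed auto
  finally show ?thesis by simp
qed

text \<open>A density argument: for a bounded continuous \<open>k\<close> the convergence is
  pointwise and dominated, and the remainder \<open>g - k\<close> stays small after dilation and
  mollification by \<open>moll_L2_bound\<close>. The dilation is included because every later use
  contracts or expands the domain at the same time.\<close>

lemma moll_affine_L2_tendsto:
  fixes s \<epsilon> :: "nat \<Rightarrow> real"
  assumes s: "s \<longlonglongrightarrow> 1" "\<And>n. 1/2 \<le> s n" "\<And>n. s n \<le> 2" and \<epsilon>: "\<epsilon> \<longlonglongrightarrow> 0" "\<And>n. 0 < \<epsilon> n" "\<And>n. \<epsilon> n \<le> 1"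
    and g[measurable]: "g \<in> borel_measurable borel" and fin: "(\<integral>\<^sup>+x. ennreal ((g x)\<^sup>2) \<partial>lborel) < \<infinity>"
    and X: "bounded X" "X \<in> sets borel"
  shows "(\<lambda>n. \<integral>\<^sup>+x\<in>X. ennreal ((moll (\<epsilon> n) g (x0 + s n *\<^sub>R (x - x0)) - g x)\<^sup>2) \<partial>lborel) \<longlonglongrightarrow> 0"
proof (rule order_tendstoI)
  have Xm[measurable]: "X \<in> sets borel" by fact
  fix a :: ennreal assume "0 < a"
  then obtain a' where "0 < a'" "a' < a" using dense by blast
  then obtain r where r: "0 < r" "ennreal r < a" by (cases a') auto
  define \<eta> where "\<eta> = r / 30"
  have \<eta>: "0 < \<eta>" using r by (simp add: \<eta>_def)
  obtain R where R: "X \<subseteq> cball 0 R" using X(1) unfolding bounded_iff subset_iff mem_cball_0 by blast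
  define Q where "Q = \<bar>R\<bar>"
  have Q0: "0 \<le> Q" by (simp add: Q_def)
  define B where "B = (cball 0 (norm x0 + 2 * (Q + norm x0) + 1) :: plane set)"
  have B: "bounded B" "B \<in> sets borel" by (auto simp: B_def)
  have XB: "X \<subseteq> B"
  proof
    fix x assume "x \<in> X"
    from \<open>x \<in> X\<close> have "norm x \<le> Q" using subsetD[OF R, of x] by (simp add: Q_def)
    then show "x \<in> B" using norm_ge_zero[of x0] Q0 unfolding B_def mem_cball_0 by argo
  qed
  have SB: "x0 + s n *\<^sub>R (x - x0) - \<epsilon> n *\<^sub>R w \<in> B" if "x \<in> X" "norm w \<le> 1" for n x w
  proof -
    have "norm x \<le> Q" using subsetD[OF R that(1)] by (simp add: Q_def)
    then have "norm (x - x0) \<le> Q + norm x0" using norm_triangle_ineq4[of x x0] by linarith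
    then have "s n * norm (x - x0) \<le> 2 * (Q + norm x0)"
      using s(3)[of n] by (intro mult_mono) auto
    then have "norm (s n *\<^sub>R (x - x0)) \<le> 2 * (Q + norm x0)"
      using s(2)[of n] by simp
    moreover have "norm (\<epsilon> n *\<^sub>R w) \<le> 1" using \<epsilon>(2,3)[of n] that(2) mult_mono[of "\<epsilon> n" 1 "norm w" 1] by simp
    ultimately have "norm (x0 + s n *\<^sub>R (x - x0) - \<epsilon> n *\<^sub>R w) \<le> norm x0 + 2 * (Q + norm x0) + 1"
      using norm_triangle_ineq4[of "x0 + s n *\<^sub>R (x - x0)" "\<epsilon> n *\<^sub>R w"] norm_triangle_ineq[of x0 "s n *\<^sub>R (x - x0)"] by linarith
    then show ?thesis by (simp add: B_def)
  qed
  obtain k K where k: "continuous_on UNIV k" "\<And>x. \<bar>k x\<bar> \<le> (K::real)"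
    "(\<integral>\<^sup>+x\<in>B. ennreal ((g x - k x)\<^sup>2) \<partial>lborel) \<le> ennreal \<eta>"
    by (rule L2_continuous_dense[OF g fin B \<eta>], rule that)
  have km[measurable]: "k \<in> borel_measurable borel" using k(1) by (rule borel_measurable_continuous_onI)
  have Bm[measurable]: "B \<in> sets borel" by fact
  define b where "b x = (g x - k x) * indicator B x" for x
  have bm[measurable]: "b \<in> borel_measurable borel" unfolding b_def[abs_def] by measurable
  have b2: "(\<integral>\<^sup>+x. ennreal ((b x)\<^sup>2) \<partial>lborel) \<le> ennreal \<eta>"
  proof -
    have "ennreal ((b x)\<^sup>2) = ennreal ((g x - k x)\<^sup>2) * indicator B x" for x by (auto simp: b_def indicator_def)
    then show ?thesis using k(3) by simp
  qed
  have bi: "integrable lborel b"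
    by (rule square_integrable_imp_integrable[OF bm _ B(1)]) (use b2 in \<open>auto simp: b_def intro: le_less_trans\<close>)
  define A where "A n = (\<integral>\<^sup>+x. ennreal ((moll (\<epsilon> n) k (x0 + s n *\<^sub>R (x - x0)) - k x)\<^sup>2 * indicator X x) \<partial>lborel)" for n
  have mollm: "(\<lambda>x. moll (\<epsilon> n) f (x0 + s n *\<^sub>R (x - x0))) \<in> borel_measurable borel"
    if [measurable]: "f \<in> borel_measurable borel" for n f
    unfolding moll_eq[OF that \<epsilon>(2)] by measurable
  note [measurable] = mollm[OF km] mollm[OF bm] mollm[OF g]
  have K0: "0 \<le> K" using k(2)[of 0] by linarith
  have "A \<longlonglongrightarrow> 0" unfolding A_def
  proof (rule nn_integral_tendsto_zero[where w="\<lambda>x. ennreal ((2 * K)\<^sup>2) * indicator X x"])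
    show "AE x in lborel. (\<lambda>n. (moll (\<epsilon> n) k (x0 + s n *\<^sub>R (x - x0)) - k x)\<^sup>2 * indicator X x) \<longlonglongrightarrow> 0"
    proof (rule AE_I2)
      fix x
      have "(\<lambda>n. x0 + s n *\<^sub>R (x - x0)) \<longlonglongrightarrow> x0 + 1 *\<^sub>R (x - x0)" by (intro tendsto_intros s)
      then have "(\<lambda>n. moll (\<epsilon> n) k (x0 + s n *\<^sub>R (x - x0))) \<longlonglongrightarrow> k x"
        by (intro moll_tendsto[OF k(1,2) _ \<epsilon>(1,2)]) simp
      then have "(\<lambda>n. (moll (\<epsilon> n) k (x0 + s n *\<^sub>R (x - x0)) - k x)\<^sup>2 * indicator X x) \<longlonglongrightarrow> (k x - k x)\<^sup>2 * indicator X x"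
        by (intro tendsto_intros)
      then show "(\<lambda>n. (moll (\<epsilon> n) k (x0 + s n *\<^sub>R (x - x0)) - k x)\<^sup>2 * indicator X x) \<longlonglongrightarrow> 0" by simp
    qed
    show "AE x in lborel. ennreal ((moll (\<epsilon> n) k (x0 + s n *\<^sub>R (x - x0)) - k x)\<^sup>2 * indicator X x) \<le> ennreal ((2 * K)\<^sup>2) * indicator X x" for n
    proof (rule AE_I2)
      fix x
      have "\<bar>moll (\<epsilon> n) k (x0 + s n *\<^sub>R (x - x0)) - k x\<bar> \<le> 2 * K"
        using moll_bounded[OF km k(2) \<epsilon>(2), of n "x0 + s n *\<^sub>R (x - x0)"] k(2)[of x] by linarith
      then have "(moll (\<epsilon> n) k (x0 + s n *\<^sub>R (x - x0)) - k x)\<^sup>2 \<le> (2 * K)\<^sup>2"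
        using K0 by (subst abs_le_square_iff[symmetric]) simp
      then show "ennreal ((moll (\<epsilon> n) k (x0 + s n *\<^sub>R (x - x0)) - k x)\<^sup>2 * indicator X x) \<le> ennreal ((2 * K)\<^sup>2) * indicator X x"
        by (auto simp: indicator_def intro: ennreal_leI)
    qed
    show "(\<integral>\<^sup>+x. ennreal ((2 * K)\<^sup>2) * indicator X x \<partial>lborel) < \<infinity>"
      using emeasure_bounded_finite[OF X(1)] by (simp add: nn_integral_cmult_indicator ennreal_mult_less_top)
  qed measurable
  then have "\<forall>\<^sub>F n in sequentially. A n < ennreal \<eta>" by (rule order_tendstoD) (use \<eta> in auto)
  then show "\<forall>\<^sub>F n in sequentially. (\<integral>\<^sup>+x\<in>X. ennreal ((moll (\<epsilon> n) g (x0 + s n *\<^sub>R (x - x0)) - g x)\<^sup>2) \<partial>lborel) < a"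
  proof eventually_elim
    fix n assume An: "A n < ennreal \<eta>"
    \<comment> \<open>The kernel vanishes outside the unit ball, and inside it the argument lies in
      \<open>B\<close>, where \<open>g = k + b\<close>.\<close>
    have split: "moll (\<epsilon> n) g (x0 + s n *\<^sub>R (x - x0)) = moll (\<epsilon> n) k (x0 + s n *\<^sub>R (x - x0)) + moll (\<epsilon> n) b (x0 + s n *\<^sub>R (x - x0))"
      if "x \<in> X" for x
    proof -
      have "rho w * g (x0 + s n *\<^sub>R (x - x0) - \<epsilon> n *\<^sub>R w) = rho w * k (x0 + s n *\<^sub>R (x - x0) - \<epsilon> n *\<^sub>R w)
          + rho w * b (x0 + s n *\<^sub>R (x - x0) - \<epsilon> n *\<^sub>R w)" for w
      proof (cases "norm w \<le> 1")
        case True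
        then show ?thesis using SB[OF that True, of n] by (simp add: b_def algebra_simps)
      next
        case False then show ?thesis using rho(3)[of w] by simp
      qed
      then show ?thesis
        unfolding moll_eq[OF g \<epsilon>(2)] moll_eq[OF km \<epsilon>(2)] moll_eq[OF bm \<epsilon>(2)]
        using rho_mult_integrable'[OF bi \<epsilon>(2)] rho_mult_integrable[of "\<lambda>w. k (x0 + s n *\<^sub>R (x - x0) - \<epsilon> n *\<^sub>R w)" K] k(2)
        by simp
    qed
    have "(\<integral>\<^sup>+x\<in>X. ennreal ((moll (\<epsilon> n) g (x0 + s n *\<^sub>R (x - x0)) - g x)\<^sup>2) \<partial>lborel)
      \<le> (\<integral>\<^sup>+x. 3 * ennreal ((moll (\<epsilon> n) k (x0 + s n *\<^sub>R (x - x0)) - k x)\<^sup>2 * indicator X x)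
         + 3 * ennreal ((moll (\<epsilon> n) b (x0 + s n *\<^sub>R (x - x0)))\<^sup>2) + 3 * ennreal ((b x)\<^sup>2) \<partial>lborel)"
    proof (rule nn_integral_mono)
      fix x
      show "ennreal ((moll (\<epsilon> n) g (x0 + s n *\<^sub>R (x - x0)) - g x)\<^sup>2) * indicator X x
         \<le> 3 * ennreal ((moll (\<epsilon> n) k (x0 + s n *\<^sub>R (x - x0)) - k x)\<^sup>2 * indicator X x)
         + 3 * ennreal ((moll (\<epsilon> n) b (x0 + s n *\<^sub>R (x - x0)))\<^sup>2) + 3 * ennreal ((b x)\<^sup>2)"
      proof (cases "x \<in> X")
        case True
        have gk: "g x = k x + b x" using XB True by (auto simp: b_def)
        have "ennreal ((moll (\<epsilon> n) g (x0 + s n *\<^sub>R (x - x0)) - g x)\<^sup>2)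
          \<le> ennreal (3 * (moll (\<epsilon> n) k (x0 + s n *\<^sub>R (x - x0)) - k x)\<^sup>2
              + 3 * (moll (\<epsilon> n) b (x0 + s n *\<^sub>R (x - x0)))\<^sup>2 + 3 * (- b x)\<^sup>2)"
          unfolding split[OF True] gk
          using square_sum3[of "moll (\<epsilon> n) k (x0 + s n *\<^sub>R (x - x0)) - k x" "moll (\<epsilon> n) b (x0 + s n *\<^sub>R (x - x0))" "- b x"]
          by (intro ennreal_leI) (simp add: algebra_simps)
        then show ?thesis using True by (simp add: ennreal_plus ennreal_mult)
      qed auto
    qed
    also have "\<dots> = 3 * A n + 3 * (\<integral>\<^sup>+x. ennreal ((moll (\<epsilon> n) b (x0 + s n *\<^sub>R (x - x0)))\<^sup>2) \<partial>lborel) + 3 * (\<integral>\<^sup>+x. ennreal ((b x)\<^sup>2) \<partial>lborel)"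
      unfolding A_def by (simp add: nn_integral_add nn_integral_cmult)
    also have "\<dots> \<le> 3 * ennreal \<eta> + 3 * (4 * ennreal \<eta>) + 3 * ennreal \<eta>"
      by (intro add_mono mult_left_mono less_imp_le[OF An] b2
          order_trans[OF moll_L2_bound[OF bm s(2) \<epsilon>(2)] mult_left_mono[OF b2]]) auto
    also have "\<dots> = ennreal (18 * \<eta>)"
      using \<eta> by (simp add: ennreal_mult distrib_right[symmetric] mult.assoc[symmetric])
    also have "\<dots> < a" using r \<eta> by (intro le_less_trans[OF _ r(2)] ennreal_leI) (simp add: \<eta>_def)
    finally show "(\<integral>\<^sup>+x\<in>X. ennreal ((moll (\<epsilon> n) g (x0 + s n *\<^sub>R (x - x0)) - g x)\<^sup>2) \<partial>lborel) < a" .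
  qed
qed auto

section \<open>Sobolev functions and their Borel representatives\<close>

text \<open>\<open>f0\<close> is a Borel representative of \<open>f\<close> on \<open>D\<close>, extended by zero.  It turns integrals over \<^term>\<open>lebesgue_on D\<close>
  into integrals with respect to \<^term>\<open>lborel\<close>.\<close>

definition rep :: "plane set \<Rightarrow> (plane \<Rightarrow> real) \<Rightarrow> (plane \<Rightarrow> real) \<Rightarrow> bool" where
  "rep D f f0 \<longleftrightarrow> f0 \<in> borel_measurable borel \<and> (\<forall>x. x \<notin> D \<longrightarrow> f0 x = 0) \<and>
     (AE x in lebesgue. x \<in> D \<longrightarrow> f x = f0 x)"

lemma repD:
  assumes "rep D f f0"
  shows rep_measurable: "f0 \<in> borel_measurable borel" and rep_zero: "\<And>x. x \<notin> D \<Longrightarrow> f0 x = 0"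
    and rep_AE: "AE x in lebesgue. x \<in> D \<longrightarrow> f x = f0 x"
  using assms by (auto simp: rep_def)

lemma rep_self:
  assumes "f \<in> borel_measurable borel" "\<And>x. x \<notin> D \<Longrightarrow> f x = 0"
  shows "rep D f f"
  using assms by (auto simp: rep_def)

lemma rep_lincomb:
  assumes "rep D f f0" "rep D g g0"
  shows "rep D (\<lambda>x. a * f x + b * g x) (\<lambda>x. a * f0 x + b * g0 x)"
proof -
  have [measurable]: "f0 \<in> borel_measurable borel" "g0 \<in> borel_measurable borel"
    using assms by (auto simp: rep_def)
  have "AE x in lebesgue. x \<in> D \<longrightarrow> a * f x + b * g x = a * f0 x + b * g0 x"
    using rep_AE[OF assms(1)] rep_AE[OF assms(2)] by eventually_elim auto
  then show ?thesis using assms by (auto simp: rep_def)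
qed

lemma rep_mult:
  assumes "rep D f f0" "rep D g g0"
  shows "rep D (\<lambda>x. f x * g x) (\<lambda>x. f0 x * g0 x)"
proof -
  have [measurable]: "f0 \<in> borel_measurable borel" "g0 \<in> borel_measurable borel"
    using assms by (auto simp: rep_def)
  have "AE x in lebesgue. x \<in> D \<longrightarrow> f x * g x = f0 x * g0 x"
    using rep_AE[OF assms(1)] rep_AE[OF assms(2)] by eventually_elim auto
  then show ?thesis using assms by (auto simp: rep_def)
qed

lemma rep_mult_right:
  assumes "rep D f f0" and [measurable]: "\<phi> \<in> borel_measurable borel"
  shows "rep D (\<lambda>x. f x * \<phi> x) (\<lambda>x. f0 x * \<phi> x)"
proof -
  have [measurable]: "f0 \<in> borel_measurable borel" using assms by (auto simp: rep_def)
  have "AE x in lebesgue. x \<in> D \<longrightarrow> f x * \<phi> x = f0 x * \<phi> x"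
    using rep_AE[OF assms(1)] by eventually_elim auto
  then show ?thesis using assms by (auto simp: rep_def)
qed

lemma rep_measurable_lebesgue:
  assumes D: "open D" and f: "rep D f f0"
  shows "AE x in lebesgue. f0 x = indicator D x * f x"
    and "(\<lambda>x. indicator D x * f x) \<in> borel_measurable lebesgue"
    and "f \<in> borel_measurable (lebesgue_on D)"
proof -
  show ae: "AE x in lebesgue. f0 x = indicator D x * f x"
    using rep_AE[OF f] by eventually_elim (use rep_zero[OF f] in \<open>auto simp: indicator_def\<close>)
  have "f0 \<in> borel_measurable lebesgue"
    using rep_measurable[OF f] by (intro measurable_completion) simp
  then show m: "(\<lambda>x. indicator D x * f x) \<in> borel_measurable lebesgue"
    by (rule borel_measurable_AE[OF _ ae])
  then show "f \<in> borel_measurable (lebesgue_on D)"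
    using D by (subst borel_measurable_restrict_space_iff) auto
qed

lemma rep_integral:
  assumes D: "open D" and f: "rep D f f0"
  shows "(LINT x|lebesgue_on D. f x) = (\<integral>x. f0 x \<partial>lborel)"
    and "integrable (lebesgue_on D) f \<longleftrightarrow> integrable lborel f0"
proof -
  note m = rep_measurable_lebesgue[OF assms]
  have f0: "f0 \<in> borel_measurable lborel" using rep_measurable[OF f] by simp
  then have f0': "f0 \<in> borel_measurable lebesgue" by (rule measurable_completion)
  have "(LINT x|lebesgue_on D. f x) = (LINT x|lebesgue. indicator D x * f x)"
    using D by (intro lebesgue_on_integral) auto
  also have "\<dots> = (LINT x|lebesgue. f0 x)"
    using m(1) by (intro integral_cong_AE m f0') (auto simp: eq_commute)
  also have "\<dots> = (\<integral>x. f0 x \<partial>lborel)" using f0 by (rule integral_completion)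
  finally show "(LINT x|lebesgue_on D. f x) = (\<integral>x. f0 x \<partial>lborel)" .
  have "integrable (lebesgue_on D) f \<longleftrightarrow> integrable lebesgue (\<lambda>x. indicator D x * f x)"
    using D by (intro lebesgue_on_integral) auto
  also have "\<dots> \<longleftrightarrow> integrable lebesgue f0"
    using m(1) by (intro integrable_cong_AE m f0') (auto simp: eq_commute)
  also have "\<dots> \<longleftrightarrow> integrable lborel f0" using f0 by (rule integrable_completion)
  finally show "integrable (lebesgue_on D) f \<longleftrightarrow> integrable lborel f0" .
qed

lemma rep_exists:
  assumes D: "open D" and f: "f \<in> borel_measurable (lebesgue_on D)"
  shows "\<exists>f0. rep D f f0"
proof -
  have "(\<lambda>x. indicator D x *\<^sub>R f x) \<in> borel_measurable lebesgue"
    using f D by (subst (asm) borel_measurable_restrict_space_iff) auto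
  then obtain g where g[measurable]: "g \<in> borel_measurable lborel" and ae: "AE x in lborel. indicator D x *\<^sub>R f x = g x"
    using completion_ex_borel_measurable_real by blast
  have "AE x in lebesgue. indicator D x *\<^sub>R f x = g x" using ae by (rule AE_completion)
  then have "AE x in lebesgue. x \<in> D \<longrightarrow> f x = indicator D x * g x" by eventually_elim auto
  moreover have "(\<lambda>x. indicator D x * g x) \<in> borel_measurable borel"
    using D g by (intro borel_measurable_times borel_measurable_indicator) auto
  ultimately show ?thesis unfolding rep_def by (intro exI[of _ "\<lambda>x. indicator D x * g x"]) auto
qed

text \<open>Extended values let sums, limits and majorants be handled before finiteness is
  known.\<close>

definition sqnorm :: "(plane \<Rightarrow> real) \<Rightarrow> ennreal" where
  "sqnorm g = (\<integral>\<^sup>+x. ennreal ((g x)\<^sup>2) \<partial>lborel)"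

lemma abs_powr_2: "\<bar>x\<bar> powr 2 = (x::real)\<^sup>2"
  by (cases "x = 0") (auto simp: powr_numeral)

lemma sqnorm_finite_iff:
  "g \<in> borel_measurable borel \<Longrightarrow> sqnorm g < \<infinity> \<longleftrightarrow> integrable lborel (\<lambda>x. (g x)\<^sup>2)"
  unfolding sqnorm_def by (subst integrable_iff_bounded) auto

lemma sqnorm_eq_integral:
  assumes "g \<in> borel_measurable borel" "sqnorm g < \<infinity>"
  shows "sqnorm g = ennreal (\<integral>x. (g x)\<^sup>2 \<partial>lborel)"
  using assms sqnorm_finite_iff[OF assms(1)] unfolding sqnorm_def by (intro nn_integral_eq_integral) auto

lemma sqnorm_add:
  assumes "f \<in> borel_measurable borel" "g \<in> borel_measurable borel"
  shows "sqnorm (\<lambda>x. f x + g x) \<le> 2 * sqnorm f + 2 * sqnorm g"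
  unfolding sqnorm_def using nn_integral_square_add[of f lborel g UNIV] assms by simp

lemma sqnorm_cmult:
  assumes [measurable]: "f \<in> borel_measurable borel"
  shows "sqnorm (\<lambda>x. c * f x) = ennreal (c\<^sup>2) * sqnorm f"
  unfolding sqnorm_def by (simp add: power_mult_distrib ennreal_mult nn_integral_cmult)

lemma sqnorm_lincomb_finite:
  assumes [measurable]: "f \<in> borel_measurable borel" "g \<in> borel_measurable borel" and "sqnorm f < \<infinity>" "sqnorm g < \<infinity>"
  shows "sqnorm (\<lambda>x. a * f x + b * g x) < \<infinity>"
proof -
  have "sqnorm (\<lambda>x. a * f x + b * g x) \<le> 2 * (ennreal (a\<^sup>2) * sqnorm f) + 2 * (ennreal (b\<^sup>2) * sqnorm g)"
    using sqnorm_add[of "\<lambda>x. a * f x" "\<lambda>x. b * g x"] by (simp add: sqnorm_cmult)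
  also have "\<dots> < \<infinity>" using assms by (auto simp: ennreal_mult_less_top)
  finally show ?thesis .
qed

lemma product_integrable:
  assumes [measurable]: "f \<in> borel_measurable borel" "g \<in> borel_measurable borel" and "sqnorm f < \<infinity>" "sqnorm g < \<infinity>"
  shows "integrable lborel (\<lambda>x. f x * g x)"
proof (rule Bochner_Integration.integrable_bound[of _ "\<lambda>x. (f x)\<^sup>2 + (g x)\<^sup>2"])
  show "integrable lborel (\<lambda>x. (f x)\<^sup>2 + (g x)\<^sup>2)"
    using assms by (intro Bochner_Integration.integrable_add) (auto simp: sqnorm_finite_iff[symmetric])
  show "AE x in lborel. norm (f x * g x) \<le> norm ((f x)\<^sup>2 + (g x)\<^sup>2)"
  proof (rule AE_I2)
    fix x
    have "0 \<le> (\<bar>f x\<bar> - \<bar>g x\<bar>)\<^sup>2" by simp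
    then have "2 * \<bar>f x * g x\<bar> \<le> (f x)\<^sup>2 + (g x)\<^sup>2" by (simp add: power2_diff abs_mult)
    then show "norm (f x * g x) \<le> norm ((f x)\<^sup>2 + (g x)\<^sup>2)" using abs_ge_zero[of "f x * g x"] by auto
  qed
qed measurable

lemma in_Lp_2_iff:
  assumes D: "open D" and v: "rep D v v0"
  shows "in_Lp D 2 v \<longleftrightarrow> sqnorm v0 < \<infinity>"
    and "sqnorm v0 < \<infinity> \<Longrightarrow> ennreal ((Lp_norm D 2 v)\<^sup>2) = sqnorm v0"
proof -
  have v0: "v0 \<in> borel_measurable borel" by (rule rep_measurable[OF v])
  have r: "rep D (\<lambda>x. (v x)\<^sup>2) (\<lambda>x. (v0 x)\<^sup>2)"
    using rep_mult[OF v v] by (simp add: power2_eq_square)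
  show "in_Lp D 2 v \<longleftrightarrow> sqnorm v0 < \<infinity>"
    using rep_measurable_lebesgue(3)[OF assms] rep_integral(2)[OF D r] sqnorm_finite_iff[OF v0]
    by (simp add: in_Lp_def abs_powr_2)
  assume fin: "sqnorm v0 < \<infinity>"
  have "0 \<le> (\<integral>x. (v0 x)\<^sup>2 \<partial>lborel)" by (intro Bochner_Integration.integral_nonneg) auto
  then have "(Lp_norm D 2 v)\<^sup>2 = (\<integral>x. (v0 x)\<^sup>2 \<partial>lborel)"
    using rep_integral(1)[OF D r]
    by (simp add: Lp_norm_def abs_powr_2 powr_half_sqrt)
  then show "ennreal ((Lp_norm D 2 v)\<^sup>2) = sqnorm v0" using sqnorm_eq_integral[OF v0 fin] by simp
qed

lemma rep_loc_integrable:
  assumes D: "open D" and v: "rep D v v0" and i: "integrable lborel v0"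
  shows "loc_integrable D v"
  unfolding loc_integrable_def set_integrable_def
proof (intro allI impI)
  fix K assume K: "compact K \<and> K \<subseteq> D"
  have Kl: "K \<in> sets lebesgue" using K by (simp add: compact_imp_closed lebesgue_closedin)
  have v0: "v0 \<in> borel_measurable lborel" using rep_measurable[OF v] by simp
  have i': "integrable lebesgue (\<lambda>x. indicator K x *\<^sub>R v0 x)"
    using i Kl v0 by (intro integrable_mult_indicator) (simp_all add: integrable_completion)
  have ae: "AE x in lebesgue. indicator K x *\<^sub>R v0 x = indicator K x *\<^sub>R v x"
    using rep_AE[OF v] by eventually_elim (use K in \<open>auto simp: indicator_def\<close>)
  have "(\<lambda>x. indicator K x *\<^sub>R v x) \<in> borel_measurable lebesgue"
    by (rule borel_measurable_AE[OF borel_measurable_integrable[OF i'] ae])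
  then show "integrable lebesgue (\<lambda>x. indicator K x *\<^sub>R v x)"
    by (rule Bochner_Integration.integrable_cong_AE_imp[OF i' _ ae])
qed

lemma has_weak_partial_iff:
  assumes D: "open D" and v: "rep D v v0" "integrable lborel v0" and g: "rep D g g0" "integrable lborel g0"
  shows "has_weak_partial D i v g \<longleftrightarrow> weak_deriv_on D i v0 g0"
proof -
  have "(LINT x|lebesgue_on D. v x * partial_deriv i \<phi> x) = (\<integral>x. v0 x * partial_deriv i \<phi> x \<partial>lborel)"
    "(LINT x|lebesgue_on D. g x * \<phi> x) = (\<integral>x. g0 x * \<phi> x \<partial>lborel)" if "test_function D \<phi>" for \<phi>
    using test_function_measurable[OF that] test_function_measurable[OF test_function_partial[OF that]]
    by (auto intro!: rep_integral[OF D] rep_mult_right v g)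
  then show ?thesis
    using rep_loc_integrable[OF D] v g by (auto simp: has_weak_partial_def weak_deriv_on_def)
qed

lemma loc_integrable_times_test:
  assumes D: "open D" and g: "loc_integrable D g" and \<phi>: "test_function D \<phi>"
  shows "integrable (lebesgue_on D) (\<lambda>x. g x * \<phi> x)"
proof -
  obtain K where K: "compact K" "K \<subseteq> D" "\<And>x. x \<notin> K \<Longrightarrow> \<phi> x = 0"
    using \<phi> by (auto simp: test_function_def)
  obtain C where C: "\<And>x. \<bar>\<phi> x\<bar> \<le> C" "0 \<le> C" using test_function_bounded[OF \<phi>] by metis
  define q where "q x = indicator K x * g x" for x
  have q: "integrable lebesgue q"
    using g K unfolding loc_integrable_def set_integrable_def by (simp add: q_def[abs_def])
  have [measurable]: "\<phi> \<in> borel_measurable lebesgue" "q \<in> borel_measurable lebesgue"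
    using test_function_measurable[OF \<phi>] q by (auto intro: measurable_completion)
  have "integrable lebesgue (\<lambda>x. q x * \<phi> x)"
  proof (rule Bochner_Integration.integrable_bound[of _ "\<lambda>x. C * q x"])
    show "AE x in lebesgue. norm (q x * \<phi> x) \<le> norm (C * q x)"
      using C by (intro AE_I2) (auto simp: abs_mult mult.commute[of "\<bar>q _\<bar>"] intro!: mult_right_mono)
  qed (use q in auto)
  moreover have "(\<lambda>x. q x * \<phi> x) = (\<lambda>x. indicator D x * (g x * \<phi> x))"
    using K by (fastforce simp: q_def indicator_def)
  ultimately show ?thesis using D by (simp add: lebesgue_on_integral)
qed

text \<open>Makes the choice in \<open>weak_partial\<close> harmless: the difference of two
  candidates integrates to zero against every test function, so the fundamental lemma
  applies.\<close>

lemma has_weak_partial_unique: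
  assumes D: "open D" and g: "has_weak_partial D i v g" "has_weak_partial D i v h"
  shows "AE x in lebesgue. x \<in> D \<longrightarrow> g x = h x"
proof -
  have l: "loc_integrable D g" "loc_integrable D h" using g by (auto simp: has_weak_partial_def)
  have "AE x in lebesgue. x \<in> D \<longrightarrow> g x - h x = 0"
  proof (rule fundamental_lemma[OF D])
    show "loc_integrable D (\<lambda>x. g x - h x)"
      using l unfolding loc_integrable_def by (auto intro!: set_integral_diff)
    fix \<phi> assume \<phi>: "test_function D \<phi>"
    have e: "(LINT x|lebesgue_on D. g x * \<phi> x) = (LINT x|lebesgue_on D. h x * \<phi> x)"
    proof -
      have "(LINT x|lebesgue_on D. v x * partial_deriv i \<phi> x) = - (LINT x|lebesgue_on D. g x * \<phi> x)"
        "(LINT x|lebesgue_on D. v x * partial_deriv i \<phi> x) = - (LINT x|lebesgue_on D. h x * \<phi> x)"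
        using g \<phi> unfolding has_weak_partial_def by blast+
      then show ?thesis by simp
    qed
    have "(LINT x|lebesgue_on D. (g x - h x) * \<phi> x) = (LINT x|lebesgue_on D. g x * \<phi> x - h x * \<phi> x)"
      by (simp add: left_diff_distrib)
    also have "\<dots> = 0"
      using e loc_integrable_times_test[OF D l(1) \<phi>] loc_integrable_times_test[OF D l(2) \<phi>] by simp
    finally show "(LINT x|lebesgue_on D. (g x - h x) * \<phi> x) = 0" .
  qed
  then show ?thesis by eventually_elim simp
qed

text \<open>\<open>v\<close> is in \<open>H\<^sup>1(D)\<close>, with Borel representatives \<open>v0\<close> of the function and \<open>G\<close> of its gradient.\<close>

definition sob :: "plane set \<Rightarrow> (plane \<Rightarrow> real) \<Rightarrow> (plane \<Rightarrow> real) \<Rightarrow> (2 \<Rightarrow> plane \<Rightarrow> real) \<Rightarrow> bool" where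
  "sob D v v0 G \<longleftrightarrow> rep D v v0 \<and> sqnorm v0 < \<infinity> \<and>
     (\<forall>i. G i \<in> borel_measurable borel \<and> (\<forall>x. x \<notin> D \<longrightarrow> G i x = 0) \<and> sqnorm (G i) < \<infinity> \<and> weak_deriv_on D i v0 (G i))"

lemma sobD:
  assumes "sob D v v0 G"
  shows "rep D v v0" "sqnorm v0 < \<infinity>" "v0 \<in> borel_measurable borel" "G i \<in> borel_measurable borel"
    "\<And>x. x \<notin> D \<Longrightarrow> G i x = 0" "sqnorm (G i) < \<infinity>" "weak_deriv_on D i v0 (G i)" "\<And>x. x \<notin> D \<Longrightarrow> v0 x = 0"
  using assms by (auto simp: sob_def rep_def)

lemma sqnorm_integrable:
  assumes "bounded D" "g \<in> borel_measurable borel" "sqnorm g < \<infinity>" "\<And>x. x \<notin> D \<Longrightarrow> g x = 0"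
  shows "integrable lborel g"
  by (rule square_integrable_imp_integrable[of g D]) (use assms in \<open>simp_all add: sqnorm_def\<close>)

lemma sob_integrable:
  assumes "bounded D" "sob D v v0 G"
  shows "integrable lborel v0" "integrable lborel (G i)"
  using sobD[OF assms(2)] by (auto intro!: sqnorm_integrable[OF assms(1)])

lemma sob_has_weak_partial:
  assumes D: "open D" "bounded D" and v: "sob D v v0 G"
  shows "has_weak_partial D i v (G i)"
  using sobD[OF v] sob_integrable[OF D(2) v]
  by (subst has_weak_partial_iff[OF D(1), of v v0 "G i" "G i"]) (auto intro!: rep_self)

lemma sob_weak_partial:
  assumes D: "open D" "bounded D" and v: "sob D v v0 G"
  shows "rep D (weak_partial D i v) (G i)"
proof -
  have 1: "has_weak_partial D i v (G i)" by (rule sob_has_weak_partial[OF assms])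
  then have "has_weak_partial D i v (weak_partial D i v)"
    unfolding weak_partial_def by (rule someI[of "has_weak_partial D i v"])
  from has_weak_partial_unique[OF D(1) this 1] show ?thesis
    using sobD[OF v] by (auto simp: rep_def)
qed

lemma sob_H1:
  assumes D: "open D" "bounded D" and v: "sob D v v0 G"
  shows "v \<in> H1 D"
proof -
  have "in_Lp D 2 (G i)" for i
    using in_Lp_2_iff(1)[OF D(1) rep_self[of "G i" D]] sobD[OF v] by auto
  then show ?thesis unfolding H1_def using sob_has_weak_partial[OF assms] in_Lp_2_iff(1)[OF D(1)] sobD[OF v] by blast
qed

lemma H1_sob:
  assumes D: "open D" "bounded D" and v: "v \<in> H1 D"
  shows "\<exists>v0 G. sob D v v0 G"
proof -
  obtain v0 where v0: "rep D v v0" using v rep_exists[OF D(1)] by (auto simp: H1_def in_Lp_def)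
  have f0: "sqnorm v0 < \<infinity>" using v v0 in_Lp_2_iff(1)[OF D(1)] by (auto simp: H1_def)
  have "\<exists>g0. g0 \<in> borel_measurable borel \<and> (\<forall>x. x \<notin> D \<longrightarrow> g0 x = 0) \<and> sqnorm g0 < \<infinity> \<and> weak_deriv_on D i v0 g0" for i
  proof -
    obtain g where g: "has_weak_partial D i v g" "in_Lp D 2 g" using v by (auto simp: H1_def)
    obtain g0 where g0: "rep D g g0" using g(2) rep_exists[OF D(1)] by (auto simp: in_Lp_def)
    have fg: "sqnorm g0 < \<infinity>" using g(2) g0 in_Lp_2_iff(1)[OF D(1)] by auto
    have "weak_deriv_on D i v0 g0"
      using g(1) has_weak_partial_iff[OF D(1) v0 _ g0]
        sqnorm_integrable[OF D(2) rep_measurable[OF v0] f0 rep_zero[OF v0]]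
        sqnorm_integrable[OF D(2) rep_measurable[OF g0] fg rep_zero[OF g0]] by auto
    then show ?thesis using fg g0 by (auto simp: rep_def)
  qed
  then obtain G where "\<And>i. G i \<in> borel_measurable borel \<and> (\<forall>x. x \<notin> D \<longrightarrow> G i x = 0) \<and> sqnorm (G i) < \<infinity> \<and> weak_deriv_on D i v0 (G i)"
    by metis
  then show ?thesis using v0 f0 by (auto simp: sob_def)
qed

lemma sob_lincomb:
  assumes D: "open D" "bounded D" and v: "sob D v v0 G" and w: "sob D w w0 H"
  shows "sob D (\<lambda>x. a * v x + b * w x) (\<lambda>x. a * v0 x + b * w0 x) (\<lambda>i x. a * G i x + b * H i x)"
proof -
  note v' = sobD[OF v] and w' = sobD[OF w]
  have m[measurable]: "v0 \<in> borel_measurable borel" "w0 \<in> borel_measurable borel"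
    "G i \<in> borel_measurable borel" "H i \<in> borel_measurable borel" for i using v' w' by auto
  have "weak_deriv_on D i (\<lambda>x. a * v0 x + b * w0 x) (\<lambda>x. a * G i x + b * H i x)" for i
    unfolding weak_deriv_on_def
  proof (intro allI impI)
    fix \<phi> assume \<phi>: "test_function D \<phi>"
    have bnd: "integrable lborel (\<lambda>x. q x * \<psi> x)" if q: "integrable lborel q" and \<psi>: "test_function D \<psi>" for q \<psi>
    proof -
      obtain K where K: "\<And>x. \<bar>\<psi> x\<bar> \<le> K" "0 \<le> K" using test_function_bounded[OF \<psi>] by metis
      have [measurable]: "\<psi> \<in> borel_measurable borel" by (rule test_function_measurable[OF \<psi>])
      show ?thesis
      proof (rule Bochner_Integration.integrable_bound[of _ "\<lambda>x. K * q x"])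
        show "AE x in lborel. norm (q x * \<psi> x) \<le> norm (K * q x)"
          using K by (intro AE_I2) (auto simp: abs_mult mult.commute[of "\<bar>q _\<bar>"] intro!: mult_right_mono)
      qed (use q in auto)
    qed
    note \<phi>' = test_function_partial[OF \<phi>, of i]
    note iv = sob_integrable[OF D(2) v] and iw = sob_integrable[OF D(2) w]
    have "(\<integral>x. (a * v0 x + b * w0 x) * partial_deriv i \<phi> x \<partial>lborel)
      = (\<integral>x. a * (v0 x * partial_deriv i \<phi> x) + b * (w0 x * partial_deriv i \<phi> x) \<partial>lborel)"
      by (intro Bochner_Integration.integral_cong) (auto simp: algebra_simps)
    also have "\<dots> = a * (\<integral>x. v0 x * partial_deriv i \<phi> x \<partial>lborel) + b * (\<integral>x. w0 x * partial_deriv i \<phi> x \<partial>lborel)"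
      using bnd[OF iv(1) \<phi>'] bnd[OF iw(1) \<phi>'] by simp
    also have "\<dots> = a * - (\<integral>x. G i x * \<phi> x \<partial>lborel) + b * - (\<integral>x. H i x * \<phi> x \<partial>lborel)"
      using v'(7) w'(7) \<phi> by (simp add: weak_deriv_on_def)
    also have "\<dots> = - (\<integral>x. a * (G i x * \<phi> x) + b * (H i x * \<phi> x) \<partial>lborel)"
      using bnd[OF iv(2) \<phi>, of i] bnd[OF iw(2) \<phi>, of i] by simp
    also have "(\<integral>x. a * (G i x * \<phi> x) + b * (H i x * \<phi> x) \<partial>lborel) = (\<integral>x. (a * G i x + b * H i x) * \<phi> x \<partial>lborel)"
      by (intro Bochner_Integration.integral_cong) (auto simp: algebra_simps)
    finally show "(\<integral>x. (a * v0 x + b * w0 x) * partial_deriv i \<phi> x \<partial>lborel) = - (\<integral>x. (a * G i x + b * H i x) * \<phi> x \<partial>lborel)" .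
  qed
  then show ?thesis
    using rep_lincomb[OF v'(1) w'(1), of a b] v' w' sqnorm_lincomb_finite[OF _ _ v'(2) w'(2)]
      sqnorm_lincomb_finite[OF _ _ v'(6) w'(6)]
    by (auto simp: sob_def)
qed

lemma sob_diff:
  assumes D: "open D" "bounded D" and v: "sob D v v0 G" and w: "sob D w w0 H"
  shows "sob D (\<lambda>x. v x - w x) (\<lambda>x. v0 x - w0 x) (\<lambda>i x. G i x - H i x)"
  using sob_lincomb[OF assms, of 1 "-1"] by simp

definition ip :: "(2 \<Rightarrow> plane \<Rightarrow> real) \<Rightarrow> (2 \<Rightarrow> plane \<Rightarrow> real) \<Rightarrow> real" where
  "ip G H = (\<Sum>i\<in>UNIV. (\<integral>x. G i x * H i x \<partial>lborel))"

lemma sob_dirichlet: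
  assumes D: "open D" "bounded D" and v: "sob D v v0 G" and w: "sob D w w0 H"
  shows "dirichlet_form D v w = ip G H"
proof -
  note v' = sobD[OF v] and w' = sobD[OF w]
  have i: "integrable lborel (\<lambda>x. G i x * H i x)" for i
    using v' w' by (intro product_integrable) auto
  have r: "rep D (\<lambda>x. weak_partial D i v x * weak_partial D i w x) (\<lambda>x. G i x * H i x)" for i
    by (intro rep_mult sob_weak_partial[OF D v] sob_weak_partial[OF D w])
  have "dirichlet_form D v w = (LINT x|lebesgue_on D. (\<Sum>i\<in>UNIV. weak_partial D i v x * weak_partial D i w x))"
    by (simp add: dirichlet_form_def inner_vec_def weak_grad_def)
  also have "\<dots> = (\<Sum>i\<in>UNIV. (LINT x|lebesgue_on D. weak_partial D i v x * weak_partial D i w x))"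
    using i rep_integral(2)[OF D(1) r] by (intro Bochner_Integration.integral_sum) auto
  also have "\<dots> = ip G H" using rep_integral(1)[OF D(1) r] by (simp add: ip_def)
  finally show ?thesis .
qed

lemma H1_seminorm_sq:
  shows "(H1_seminorm D v)\<^sup>2 = dirichlet_form D v v"
proof -
  have "0 \<le> (LINT x|lebesgue_on D. (norm (weak_grad D v x))\<^sup>2)" by (intro Bochner_Integration.integral_nonneg) auto
  then show ?thesis by (simp add: H1_seminorm_def dirichlet_form_def power2_norm_eq_inner)
qed

lemma sob_seminorm:
  assumes D: "open D" "bounded D" and v: "sob D v v0 G"
  shows "(H1_seminorm D v)\<^sup>2 = ip G G" "ennreal ((H1_seminorm D v)\<^sup>2) = (\<Sum>i\<in>UNIV. sqnorm (G i))"
proof -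
  show 1: "(H1_seminorm D v)\<^sup>2 = ip G G" by (simp add: H1_seminorm_sq sob_dirichlet[OF assms v])
  have "sqnorm (G i) = ennreal (\<integral>x. (G i x)\<^sup>2 \<partial>lborel)" for i
    using sobD[OF v] by (intro sqnorm_eq_integral) auto
  then show "ennreal ((H1_seminorm D v)\<^sup>2) = (\<Sum>i\<in>UNIV. sqnorm (G i))"
    unfolding 1 ip_def by (simp add: power2_eq_square[symmetric])
qed

lemma test_function_sob:
  assumes D: "open D" "bounded D" and \<phi>: "test_function D \<phi>"
  shows "sob D \<phi> \<phi> (\<lambda>i. partial_deriv i \<phi>)"
proof -
  have sq: "sqnorm \<psi> < \<infinity>" if t: "test_function D \<psi>" for \<psi>
  proof -
    obtain K where K: "compact K" "\<And>x. x \<notin> K \<Longrightarrow> \<psi> x = 0" using t by (auto simp: test_function_def)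
    have [measurable]: "\<psi> \<in> borel_measurable borel" by (rule test_function_measurable[OF t])
    have c: "continuous_on K (\<lambda>x. (\<psi> x)\<^sup>2)"
      using test_function_continuous[OF t] by (intro continuous_intros) (auto intro: continuous_on_subset)
    have "integrable lborel (\<lambda>x. indicator K x *\<^sub>R (\<psi> x)\<^sup>2)" by (rule borel_integrable_compact[OF K(1) c])
    moreover have "(\<lambda>x. indicator K x *\<^sub>R (\<psi> x)\<^sup>2) = (\<lambda>x. (\<psi> x)\<^sup>2)"
      by (rule ext) (use K(2) in \<open>auto simp: indicator_def\<close>)
    ultimately show ?thesis by (subst sqnorm_finite_iff) auto
  qed
  note t' = test_function_partial[OF \<phi>]
  have "weak_deriv_on D i \<phi> (partial_deriv i \<phi>)" for i
    unfolding weak_deriv_on_def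
    using test_function_weak_derivative[OF \<phi>] test_function_mono[of D _ UNIV] by blast
  then show ?thesis
    using sq[OF \<phi>] sq[OF t'] test_function_measurable[OF \<phi>] test_function_measurable[OF t']
      test_function_zero[OF \<phi>] test_function_zero[OF t']
    by (auto simp: sob_def intro!: rep_self)
qed

lemma H1_norm_sq:
  "(H1_norm D v)\<^sup>2 = (Lp_norm D 2 v)\<^sup>2 + (H1_seminorm D v)\<^sup>2"
  by (simp add: H1_norm_def)

lemma H1_norm_sob:
  assumes D: "open D" "bounded D" and v: "sob D v v0 G"
  shows "ennreal ((H1_norm D v)\<^sup>2) = sqnorm v0 + (\<Sum>i\<in>UNIV. sqnorm (G i))"
  using sob_seminorm(2)[OF assms] in_Lp_2_iff(2)[OF D(1)] sobD[OF v]
  by (simp add: H1_norm_sq ennreal_plus)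

text \<open>The \<open>H\<^sup>1\<close> norm squared is the sum of the three square norms, so
  convergence splits into components. All later limits of test functions are taken in this
  form.\<close>

lemma H10_sob:
  assumes D: "open D" "bounded D" and v: "sob D v v0 G"
  shows "v \<in> H10 D \<longleftrightarrow> (\<exists>\<phi>. (\<forall>n. test_function D (\<phi> n)) \<and> (\<lambda>n. sqnorm (\<lambda>x. \<phi> n x - v0 x)) \<longlonglongrightarrow> 0 \<and>
     (\<forall>i. (\<lambda>n. sqnorm (\<lambda>x. partial_deriv i (\<phi> n) x - G i x)) \<longlonglongrightarrow> 0))"
proof -
  have "(\<lambda>n. H1_norm D (\<lambda>x. \<phi> n x - v x)) \<longlonglongrightarrow> 0 \<longleftrightarrow> (\<lambda>n. sqnorm (\<lambda>x. \<phi> n x - v0 x)) \<longlonglongrightarrow> 0 \<and>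
     (\<forall>i. (\<lambda>n. sqnorm (\<lambda>x. partial_deriv i (\<phi> n) x - G i x)) \<longlonglongrightarrow> 0)" (is "?L \<longleftrightarrow> ?R")
    if t: "\<And>n. test_function D (\<phi> n)" for \<phi> :: "nat \<Rightarrow> plane \<Rightarrow> real"
  proof -
    have e: "ennreal ((H1_norm D (\<lambda>x. \<phi> n x - v x))\<^sup>2) = sqnorm (\<lambda>x. \<phi> n x - v0 x) + (\<Sum>i\<in>UNIV. sqnorm (\<lambda>x. partial_deriv i (\<phi> n) x - G i x))" for n
      by (rule H1_norm_sob[OF D sob_diff[OF D test_function_sob[OF D t] v]])
    have nn: "0 \<le> H1_norm D w" for w by (simp add: H1_norm_def)
    have "?L \<longleftrightarrow> (\<lambda>n. (H1_norm D (\<lambda>x. \<phi> n x - v x))\<^sup>2) \<longlonglongrightarrow> 0"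
    proof
      assume ?L from tendsto_power[OF this, of 2] show "(\<lambda>n. (H1_norm D (\<lambda>x. \<phi> n x - v x))\<^sup>2) \<longlonglongrightarrow> 0" by simp
    next
      assume "(\<lambda>n. (H1_norm D (\<lambda>x. \<phi> n x - v x))\<^sup>2) \<longlonglongrightarrow> 0"
      from tendsto_real_sqrt[OF this] show ?L using nn by simp
    qed
    also have "\<dots> \<longleftrightarrow> (\<lambda>n. ennreal ((H1_norm D (\<lambda>x. \<phi> n x - v x))\<^sup>2)) \<longlonglongrightarrow> ennreal 0"
      by (rule tendsto_ennreal_iff[symmetric]) auto
    also have "\<dots> \<longleftrightarrow> ?R"
    proof
      assume L: "(\<lambda>n. ennreal ((H1_norm D (\<lambda>x. \<phi> n x - v x))\<^sup>2)) \<longlonglongrightarrow> ennreal 0"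
      have "(\<lambda>n. sqnorm (\<lambda>x. \<phi> n x - v0 x)) \<longlonglongrightarrow> 0"
        by (rule tendsto_sandwich[OF _ _ tendsto_const L[unfolded ennreal_0]]) (auto simp: e)
      moreover have "(\<lambda>n. sqnorm (\<lambda>x. partial_deriv i (\<phi> n) x - G i x)) \<longlonglongrightarrow> 0" for i
      proof (rule tendsto_sandwich[OF _ _ tendsto_const L[unfolded ennreal_0]])
        show "\<forall>\<^sub>F n in sequentially. sqnorm (\<lambda>x. partial_deriv i (\<phi> n) x - G i x) \<le> ennreal ((H1_norm D (\<lambda>x. \<phi> n x - v x))\<^sup>2)"
          unfolding e by (intro always_eventually allI add_increasing member_le_sum) auto
      qed auto
      ultimately show ?R by blast
    next
      assume R: ?R
      then have "(\<lambda>n. sqnorm (\<lambda>x. \<phi> n x - v0 x) + (\<Sum>i\<in>UNIV. sqnorm (\<lambda>x. partial_deriv i (\<phi> n) x - G i x))) \<longlonglongrightarrow> 0 + (\<Sum>i\<in>(UNIV::2 set). 0)"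
        by (intro tendsto_add tendsto_sum) auto
      then show "(\<lambda>n. ennreal ((H1_norm D (\<lambda>x. \<phi> n x - v x))\<^sup>2)) \<longlonglongrightarrow> ennreal 0" unfolding e by simp
    qed
    finally show ?thesis .
  qed
  then show ?thesis unfolding H10_def using sob_H1[OF assms] by blast
qed

section \<open>Smooth approximation on convex domains\<close>

text \<open>The factor \<open>c n\<close> is the one the chain rule produces when a dilated
  mollification is differentiated. Writing the error as \<open>c n\<close> times the mollification
  error plus \<open>(c n - 1) * g\<close> reduces to the preceding case; 32 is twice the square of
  the bound 4.\<close>

lemma scaled_moll_tendsto:
  fixes s \<epsilon> c :: "nat \<Rightarrow> real"
  assumes s: "s \<longlonglongrightarrow> 1" "\<And>n. 1/2 \<le> s n" "\<And>n. s n \<le> 2" and \<epsilon>: "\<epsilon> \<longlonglongrightarrow> 0" "\<And>n. 0 < \<epsilon> n" "\<And>n. \<epsilon> n \<le> 1"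
    and c: "c \<longlonglongrightarrow> 1" "\<And>n. \<bar>c n\<bar> \<le> 4"
    and g[measurable]: "g \<in> borel_measurable borel" and fin: "sqnorm g < \<infinity>"
    and X: "bounded X" "X \<in> sets borel"
  shows "(\<lambda>n. \<integral>\<^sup>+x\<in>X. ennreal ((c n * moll (\<epsilon> n) g (x0 + s n *\<^sub>R (x - x0)) - g x)\<^sup>2) \<partial>lborel) \<longlonglongrightarrow> 0"
proof -
  have [measurable]: "X \<in> sets borel" by fact
  define A where "A n = (\<integral>\<^sup>+x\<in>X. ennreal ((moll (\<epsilon> n) g (x0 + s n *\<^sub>R (x - x0)) - g x)\<^sup>2) \<partial>lborel)" for n
  have A: "A \<longlonglongrightarrow> 0" unfolding A_def
    by (rule moll_affine_L2_tendsto[OF s \<epsilon> g _ X]) (use fin in \<open>simp add: sqnorm_def\<close>)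
  have [measurable]: "(\<lambda>x. moll (\<epsilon> n) g (x0 + s n *\<^sub>R (x - x0))) \<in> borel_measurable borel" for n
    unfolding moll_eq[OF g \<epsilon>(2)] by measurable
  have "(\<lambda>n. (c n - 1)\<^sup>2) \<longlonglongrightarrow> (1 - 1)\<^sup>2" by (intro tendsto_intros c)
  then have "(\<lambda>n. ennreal ((c n - 1)\<^sup>2)) \<longlonglongrightarrow> ennreal 0" by (intro tendsto_ennrealI) simp
  then have "(\<lambda>n. 32 * A n + (2 * sqnorm g) * ennreal ((c n - 1)\<^sup>2)) \<longlonglongrightarrow> 32 * 0 + (2 * sqnorm g) * ennreal 0"
    using A fin by (intro tendsto_add ennreal_tendsto_cmult) (auto simp: ennreal_mult_less_top)
  then have lim: "(\<lambda>n. 32 * A n + (2 * sqnorm g) * ennreal ((c n - 1)\<^sup>2)) \<longlonglongrightarrow> 0" by simp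
  have "(\<integral>\<^sup>+x\<in>X. ennreal ((c n * moll (\<epsilon> n) g (x0 + s n *\<^sub>R (x - x0)) - g x)\<^sup>2) \<partial>lborel)
      \<le> 32 * A n + (2 * sqnorm g) * ennreal ((c n - 1)\<^sup>2)" for n
  proof -
    let ?m = "\<lambda>x. moll (\<epsilon> n) g (x0 + s n *\<^sub>R (x - x0))"
    have "(\<integral>\<^sup>+x\<in>X. ennreal ((c n * ?m x - g x)\<^sup>2) \<partial>lborel)
       \<le> (\<integral>\<^sup>+x. 32 * (ennreal ((?m x - g x)\<^sup>2) * indicator X x) + 2 * ennreal ((c n - 1)\<^sup>2) * ennreal ((g x)\<^sup>2) \<partial>lborel)"
    proof (rule nn_integral_mono)
      fix x
      have "(c n * ?m x - g x)\<^sup>2 = (c n * (?m x - g x) + (c n - 1) * g x)\<^sup>2" by (simp add: algebra_simps)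
      also have "\<dots> \<le> 2 * (c n * (?m x - g x))\<^sup>2 + 2 * ((c n - 1) * g x)\<^sup>2" by (rule square_sum2)
      also have "\<dots> \<le> 32 * (?m x - g x)\<^sup>2 + 2 * (c n - 1)\<^sup>2 * (g x)\<^sup>2"
      proof -
        have "(c n)\<^sup>2 \<le> 4\<^sup>2" using c(2)[of n] by (subst abs_le_square_iff[symmetric]) simp
        then have "(c n)\<^sup>2 * (?m x - g x)\<^sup>2 \<le> 16 * (?m x - g x)\<^sup>2" by (intro mult_right_mono) auto
        then show ?thesis by (simp add: power_mult_distrib)
      qed
      finally have "ennreal ((c n * ?m x - g x)\<^sup>2) \<le> ennreal (32 * (?m x - g x)\<^sup>2 + 2 * (c n - 1)\<^sup>2 * (g x)\<^sup>2)"
        by (rule ennreal_leI)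
      then show "ennreal ((c n * ?m x - g x)\<^sup>2) * indicator X x
         \<le> 32 * (ennreal ((?m x - g x)\<^sup>2) * indicator X x) + 2 * ennreal ((c n - 1)\<^sup>2) * ennreal ((g x)\<^sup>2)"
        by (cases "x \<in> X") (auto simp: ennreal_plus ennreal_mult)
    qed
    also have "\<dots> = 32 * A n + 2 * ennreal ((c n - 1)\<^sup>2) * sqnorm g"
      unfolding A_def sqnorm_def by (simp add: nn_integral_add nn_integral_cmult)
    finally show ?thesis by (simp add: mult_ac)
  qed
  then show ?thesis by (intro tendsto_sandwich[OF _ _ tendsto_const lim]) auto
qed

locale convex_domain =
  fixes D :: "plane set"
  assumes open_D: "open D" and bounded_D: "bounded D" and convex_D: "convex D" and nonempty_D: "D \<noteq> {}"
begin

lemma borel_D [measurable]: "D \<in> sets borel" using open_D by simp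

lemma closure_D: "bounded (closure D)" "closure D \<in> sets borel" "compact (closure D)"
  using bounded_D by (auto simp: compact_closure)

text \<open>With \<open>e\<close> ranging over the ball of radius \<open>\<delta>\<close>, this
  places a whole ball of radius \<open>(1 - t) * \<delta>\<close> around the contracted point inside
  \<open>D\<close>: the room in which a mollifier can act.\<close>

lemma shrink:
  assumes "ball x0 \<delta> \<subseteq> D" "d \<in> closure D" "norm e < \<delta>" "0 \<le> t" "t < 1"
  shows "t *\<^sub>R d + (1 - t) *\<^sub>R (x0 + e) \<in> D"
proof -
  have "x0 + e \<in> interior D" using assms open_D by (auto simp: interior_open dist_norm subset_iff)
  then have "d - (1 - t) *\<^sub>R (d - (x0 + e)) \<in> interior D"
    using assms by (intro mem_interior_closure_convex_shrink[OF convex_D]) auto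
  then show ?thesis using open_D by (simp add: interior_open algebra_simps)
qed

text \<open>Dilation factors: contracting \<open>closure D\<close> towards an interior point by \<open>lam n\<close> leaves room for mollification.\<close>

definition lam :: "nat \<Rightarrow> real" where "lam n = 1 - 1 / real (n + 2)"

lemma lam: "lam \<longlonglongrightarrow> 1" "1/2 \<le> lam n" "lam n < 1" "1 - lam n = 1 / real (n + 2)"
proof -
  have "(\<lambda>n. 1 - 1 / real (n + 2)) \<longlonglongrightarrow> 1 - 0"
    by (intro tendsto_diff tendsto_const LIMSEQ_ignore_initial_segment lim_1_over_n)
  then show "lam \<longlonglongrightarrow> 1" unfolding lam_def[abs_def] by simp
qed (auto simp: lam_def field_simps)

lemma small_radius:
  obtains x0 \<delta> where "ball x0 \<delta> \<subseteq> D" "x0 \<in> D" "0 < \<delta>"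
proof -
  obtain x0 where x0: "x0 \<in> D" using nonempty_D by blast
  with open_D obtain \<delta> where "0 < \<delta>" "ball x0 \<delta> \<subseteq> D" unfolding open_contains_ball by blast
  then show ?thesis using x0 that by blast
qed

text \<open>Contracting before mollifying is essential: the extension of \<open>u0\<close> by zero
  has weak derivatives only on \<open>D\<close>. At a contracted point of \<open>closure D\<close>
  the mollifier sees only values inside \<open>D\<close>, so the approximation is controlled up to
  the boundary.\<close>

lemma H2_smooth_approx:
  assumes u: "u0 \<in> borel_measurable borel" "sqnorm u0 < \<infinity>" "\<And>x. x \<notin> D \<Longrightarrow> u0 x = 0"
    and G: "\<And>i. G i \<in> borel_measurable borel" "\<And>i. sqnorm (G i) < \<infinity>" "\<And>i. weak_deriv_on D i u0 (G i)"
    and GG: "\<And>i j. GG i j \<in> borel_measurable borel" "\<And>i j. sqnorm (GG i j) < \<infinity>"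
      "\<And>i j. weak_deriv_on D j (G i) (GG i j)"
  obtains w where "\<And>n k. Ck k (w n)"
    "(\<lambda>n. \<integral>\<^sup>+x\<in>closure D. ennreal ((w n x - u0 x)\<^sup>2) \<partial>lborel) \<longlonglongrightarrow> 0"
    "\<And>i. (\<lambda>n. \<integral>\<^sup>+x\<in>closure D. ennreal ((partial_deriv i (w n) x - G i x)\<^sup>2) \<partial>lborel) \<longlonglongrightarrow> 0"
    "\<And>i j. (\<lambda>n. \<integral>\<^sup>+x\<in>closure D. ennreal ((partial_deriv i (partial_deriv j (w n)) x - GG i j x)\<^sup>2) \<partial>lborel) \<longlonglongrightarrow> 0"
proof -
  obtain x0 \<delta> where \<delta>: "ball x0 \<delta> \<subseteq> D" "x0 \<in> D" "0 < \<delta>" by (rule small_radius)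
  define \<delta>' where "\<delta>' = min 1 (\<delta> / 2)"
  have \<delta>': "0 < \<delta>'" "\<delta>' \<le> 1" "\<delta>' < \<delta>" using \<delta> by (auto simp: \<delta>'_def)
  \<comment> \<open>The mollification radius is proportional to \<open>1 - lam n\<close>, with a
    factor below \<open>\<delta>\<close>, so that it fits into the room left by the
    contraction.\<close>
  define \<epsilon> where "\<epsilon> n = \<delta>' * (1 / real (n + 2))" for n
  have \<epsilon>0: "\<epsilon> \<longlonglongrightarrow> 0"
    unfolding \<epsilon>_def by (intro tendsto_mult_right_zero LIMSEQ_ignore_initial_segment lim_1_over_n)
  have \<epsilon>1: "0 < \<epsilon> n" "\<epsilon> n \<le> 1" for n
    using \<delta>' mult_mono[of \<delta>' 1 "1 / real (n + 2)" 1] by (auto simp: \<epsilon>_def)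
  have ui: "integrable lborel u0" by (rule sqnorm_integrable[OF bounded_D u])
  define w where "w n x = moll (\<epsilon> n) u0 ((x0 - lam n *\<^sub>R x0) + lam n *\<^sub>R x)" for n x
  have S: "(x0 - lam n *\<^sub>R x0) + lam n *\<^sub>R x = x0 + lam n *\<^sub>R (x - x0)" for n x by (simp add: algebra_simps)
  have in_D: "cball (x0 + lam n *\<^sub>R (x - x0)) (\<epsilon> n) \<subseteq> D" if x: "x \<in> closure D" for x n
  proof
    fix y assume y: "y \<in> cball (x0 + lam n *\<^sub>R (x - x0)) (\<epsilon> n)"
    define e where "e = real (n + 2) *\<^sub>R (y - (x0 + lam n *\<^sub>R (x - x0)))"
    have "norm (y - (x0 + lam n *\<^sub>R (x - x0))) \<le> \<delta>' * (1 / real (n + 2))"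
      using y by (simp add: \<epsilon>_def dist_norm norm_minus_commute)
    then have "real (n + 2) * norm (y - (x0 + lam n *\<^sub>R (x - x0))) \<le> real (n + 2) * (\<delta>' * (1 / real (n + 2)))"
      by (rule mult_left_mono) simp
    then have "norm e \<le> \<delta>'" unfolding e_def norm_scaleR by simp
    then have "norm e < \<delta>" using \<delta>' by simp
    then have "lam n *\<^sub>R x + (1 - lam n) *\<^sub>R (x0 + e) \<in> D" using lam(2-4)[of n]
      by (intro shrink[OF \<delta>(1) x]) auto
    moreover have "(1 - lam n) *\<^sub>R e = y - (x0 + lam n *\<^sub>R (x - x0))" unfolding lam(4) by (simp add: e_def)
    ultimately show "y \<in> D" by (simp add: algebra_simps)
  qed
  have Ckm: "Ck k (moll (\<epsilon> n) u0)" for k n by (rule moll_Ck[OF ui \<epsilon>1(1)])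
  have "Ck k (w n)" for k n unfolding w_def by (rule Ck_affine[OF Ckm])
  moreover
  have d1: "partial_deriv i (w n) = (\<lambda>x. lam n * partial_deriv i (moll (\<epsilon> n) u0) ((x0 - lam n *\<^sub>R x0) + lam n *\<^sub>R x))" for i n
    unfolding w_def using Ckm[of "Suc 0" n] by (intro ext partial_deriv_affine(1)) auto
  have d2: "partial_deriv i (partial_deriv j (w n)) x
     = (lam n)\<^sup>2 * partial_deriv i (partial_deriv j (moll (\<epsilon> n) u0)) ((x0 - lam n *\<^sub>R x0) + lam n *\<^sub>R x)" for i j n x
  proof -
    let ?q = "\<lambda>x. partial_deriv j (moll (\<epsilon> n) u0) ((x0 - lam n *\<^sub>R x0) + lam n *\<^sub>R x)"
    have df: "partial_deriv j (moll (\<epsilon> n) u0) differentiable (at z)" for z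
      using Ckm[of "Suc (Suc 0)" n] by auto
    have "partial_deriv i (\<lambda>x. lam n * ?q x) x = lam n * partial_deriv i ?q x + partial_deriv i (\<lambda>x. lam n) x * ?q x"
      by (rule partial_deriv_mult[OF _ partial_deriv_affine(2)[OF df]]) simp
    also have "partial_deriv i (\<lambda>x. lam n) x = 0"
      by (subst has_derivative_partial_deriv[OF has_derivative_const]) simp
    also have "partial_deriv i ?q x = lam n * partial_deriv i (partial_deriv j (moll (\<epsilon> n) u0)) ((x0 - lam n *\<^sub>R x0) + lam n *\<^sub>R x)"
      by (rule partial_deriv_affine(1)[OF df])
    finally show ?thesis unfolding d1 by (simp add: power2_eq_square)
  qed
  have lam_le: "lam n \<le> 2" "\<bar>lam n\<bar> \<le> 4" "\<bar>(lam n)\<^sup>2\<bar> \<le> 4" "\<bar>1\<bar> \<le> (4::real)" for n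
  proof -
    have l: "0 \<le> lam n" "lam n \<le> 1" using lam(2,3)[of n] by auto
    then have "(lam n)\<^sup>2 \<le> 1" by (simp add: power_le_one)
    then show "lam n \<le> 2" "\<bar>lam n\<bar> \<le> 4" "\<bar>(lam n)\<^sup>2\<bar> \<le> 4" "\<bar>1\<bar> \<le> (4::real)" using l by auto
  qed
  note T = scaled_moll_tendsto[OF lam(1,2) lam_le(1) \<epsilon>0 \<epsilon>1]
  have "(\<lambda>n. \<integral>\<^sup>+x\<in>closure D. ennreal ((w n x - u0 x)\<^sup>2) \<partial>lborel) \<longlonglongrightarrow> 0"
    using T[OF tendsto_const lam_le(4) u(1,2) closure_D(1,2), where ?x0.0=x0] unfolding w_def S by simp
  moreover have "(\<lambda>n. \<integral>\<^sup>+x\<in>closure D. ennreal ((partial_deriv i (w n) x - G i x)\<^sup>2) \<partial>lborel) \<longlonglongrightarrow> 0" for i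
  proof -
    have "(\<integral>\<^sup>+x\<in>closure D. ennreal ((partial_deriv i (w n) x - G i x)\<^sup>2) \<partial>lborel)
       = (\<integral>\<^sup>+x\<in>closure D. ennreal ((lam n * moll (\<epsilon> n) (G i) (x0 + lam n *\<^sub>R (x - x0)) - G i x)\<^sup>2) \<partial>lborel)" for n
      by (intro nn_integral_cong)
        (auto simp: indicator_def d1 S partial_deriv_moll[OF ui \<epsilon>1(1) G(3) in_D])
    then show ?thesis using T[OF lam(1) lam_le(2) G(1)[of i] G(2)[of i] closure_D(1,2), where ?x0.0=x0] by simp
  qed
  moreover have "(\<lambda>n. \<integral>\<^sup>+x\<in>closure D. ennreal ((partial_deriv i (partial_deriv j (w n)) x - GG i j x)\<^sup>2) \<partial>lborel) \<longlonglongrightarrow> 0" for i j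
  proof -
    have "(\<integral>\<^sup>+x\<in>closure D. ennreal ((partial_deriv i (partial_deriv j (w n)) x - GG i j x)\<^sup>2) \<partial>lborel)
       = (\<integral>\<^sup>+x\<in>closure D. ennreal (((lam n)\<^sup>2 * moll (\<epsilon> n) (GG i j) (x0 + lam n *\<^sub>R (x - x0)) - GG i j x)\<^sup>2) \<partial>lborel)" for n
      by (intro nn_integral_cong)
        (auto simp: indicator_def d2 S partial_deriv2_moll[OF ui \<epsilon>1(1) G(3) GG(3) in_D])
    moreover have "(\<lambda>n. (lam n)\<^sup>2) \<longlonglongrightarrow> 1" using tendsto_power[OF lam(1), of 2] by simp
    ultimately show ?thesis using T[OF _ lam_le(3) GG(1)[of i j] GG(2)[of i j] closure_D(1,2), where ?x0.0=x0] by simp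
  qed
  ultimately show ?thesis by (rule that)
qed

lemma bounded_sqnorm:
  assumes [measurable]: "g \<in> borel_measurable borel" and "\<And>x. x \<notin> D \<Longrightarrow> g x = 0" "\<And>x. \<bar>g x\<bar> \<le> K"
  shows "sqnorm g < \<infinity>"
proof -
  have "sqnorm g \<le> (\<integral>\<^sup>+x. ennreal (K\<^sup>2) * indicator D x \<partial>lborel)"
    unfolding sqnorm_def
  proof (rule nn_integral_mono)
    fix x
    have "(g x)\<^sup>2 \<le> K\<^sup>2" using assms(3)[of x] by (subst abs_le_square_iff[symmetric]) simp
    then show "ennreal ((g x)\<^sup>2) \<le> ennreal (K\<^sup>2) * indicator D x"
      using assms(2)[of x] by (cases "x \<in> D") (auto intro: ennreal_leI)
  qed
  also have "\<dots> < \<infinity>"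
    using emeasure_bounded_finite[OF bounded_D] by (simp add: nn_integral_cmult_indicator ennreal_mult_less_top)
  finally show ?thesis .
qed

text \<open>The second claim shows \<open>v \<in> H\<^sup>1\<^sub>0(D)\<close>: dilating \<open>v\<close> moves its support into \<open>D\<close>, after which it can be mollified.\<close>

lemma lipschitz_sob:
  assumes L: "\<And>x y. \<bar>v x - v y\<bar> \<le> L * norm (x - y)" and v0: "\<And>x. x \<notin> D \<Longrightarrow> v x = 0"
    and G: "\<And>i. G i \<in> borel_measurable borel" "\<And>i x. x \<notin> D \<Longrightarrow> G i x = 0" "\<And>i x. \<bar>G i x\<bar> \<le> C"
    and ae: "\<And>i. AE x in lborel. (\<lambda>n. (v (x + (1 / real (Suc n)) *\<^sub>R axis i 1) - v x) * real (Suc n)) \<longlonglongrightarrow> G i x"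
  shows "sob D v v G"
    and "\<exists>\<phi>. (\<forall>n. test_function D (\<phi> n)) \<and> (\<lambda>n. sqnorm (\<lambda>x. \<phi> n x - v x)) \<longlonglongrightarrow> 0 \<and>
     (\<forall>i. (\<lambda>n. sqnorm (\<lambda>x. partial_deriv i (\<phi> n) x - G i x)) \<longlonglongrightarrow> 0) \<and>
     (\<forall>x. (\<lambda>n. \<phi> n x) \<longlonglongrightarrow> v x) \<and> (\<forall>n x y. \<bar>\<phi> n x - \<phi> n y\<bar> \<le> 2 * L * norm (x - y))"
proof -
  have L0: "0 \<le> L"
    using L[of "axis 1 1" 0] abs_ge_zero[of "v (axis 1 1) - v 0"] by simp
  have cont: "continuous_on UNIV v"
  proof (rule lipschitz_on_continuous_on)
    show "L-lipschitz_on UNIV v" using L L0 by (auto simp: lipschitz_on_def dist_norm)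
  qed
  have vm[measurable]: "v \<in> borel_measurable borel" using cont by (rule borel_measurable_continuous_onI)
  have "bounded (v ` closure D)"
    by (intro compact_imp_bounded compact_continuous_image closure_D continuous_on_subset[OF cont]) auto
  then obtain K where K: "\<forall>y\<in>v ` closure D. norm y \<le> K" unfolding bounded_iff by blast
  have vK: "\<bar>v x\<bar> \<le> max K 0" for x
    using v0[of x] K closure_subset[of D] by (cases "x \<in> D") (auto simp: le_max_iff_disj)
  have vfin: "sqnorm v < \<infinity>" by (rule bounded_sqnorm[OF vm v0 vK])
  have Gfin: "sqnorm (G i) < \<infinity>" for i by (rule bounded_sqnorm[OF G])
  have vi: "integrable lborel v" by (rule sqnorm_integrable[OF bounded_D vm vfin v0])
  \<comment> \<open>The zero extension is Lipschitz across the boundary, hence the weak derivative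
    holds on the whole plane and mollification may read points outside \<open>D\<close>.\<close>
  have wd: "weak_deriv_on UNIV i v (G i)" for i
    unfolding weak_deriv_on_def using lipschitz_weak_derivative[OF L vi G(1) ae] by blast
  then have wdD: "weak_deriv_on D i v (G i)" for i
    unfolding weak_deriv_on_def using test_function_mono[of D _ UNIV] by blast
  show "sob D v v G"
    unfolding sob_def using rep_self[OF vm v0] vfin Gfin G wdD by auto
  obtain x0 \<delta> where \<delta>: "ball x0 \<delta> \<subseteq> D" "x0 \<in> D" "0 < \<delta>" by (rule small_radius)
  define \<delta>' where "\<delta>' = min 1 (\<delta> / 2)"
  have \<delta>': "0 < \<delta>'" "\<delta>' \<le> 1" "\<delta>' < \<delta>" using \<delta> by (auto simp: \<delta>'_def)
  define \<epsilon> where "\<epsilon> n = \<delta>' * (1 / real (n + 2))" for n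
  have \<epsilon>0: "\<epsilon> \<longlonglongrightarrow> 0"
    unfolding \<epsilon>_def by (intro tendsto_mult_right_zero LIMSEQ_ignore_initial_segment lim_1_over_n)
  have \<epsilon>1: "0 < \<epsilon> n" "\<epsilon> n \<le> 1" for n
    using \<delta>' mult_mono[of \<delta>' 1 "1 / real (n + 2)" 1] by (auto simp: \<epsilon>_def)
  \<comment> \<open>Reading \<open>v\<close> at expanded points contracts its support by the factor
    \<open>lam n\<close>.\<close>
  define s where "s n = 1 / lam n" for n
  have s: "s \<longlonglongrightarrow> 1" "1/2 \<le> s n" "s n \<le> 2" "0 < s n" "\<bar>s n\<bar> \<le> 4" "s n * lam n = 1" for n
  proof -
    have l: "1/2 \<le> lam n" "lam n < 1" using lam(2,3)[of n] by auto
    show "s \<longlonglongrightarrow> 1" unfolding s_def using tendsto_divide[OF tendsto_const lam(1), of 1] by simp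
    show "1/2 \<le> s n" "s n \<le> 2" "0 < s n" "\<bar>s n\<bar> \<le> 4" "s n * lam n = 1"
      using l by (auto simp: s_def field_simps)
  qed
  define \<phi> where "\<phi> n x = moll (\<epsilon> n) v ((x0 - s n *\<^sub>R x0) + s n *\<^sub>R x)" for n x
  have S: "(x0 - s n *\<^sub>R x0) + s n *\<^sub>R x = x0 + s n *\<^sub>R (x - x0)" for n x by (simp add: algebra_simps)
  have Ckm: "Ck k (moll (\<epsilon> n) v)" for k n by (rule moll_Ck[OF vi \<epsilon>1(1)])
  have t: "test_function D (\<phi> n)" for n
  proof -
    \<comment> \<open>The image of \<open>f\<close> is the compact set of all \<open>x\<close> at
      which the mollification can read a point \<open>y\<close> of \<open>closure D\<close>: solving
      \<open>y = x0 + s n (x - x0) - \<epsilon> n w\<close> for \<open>x\<close> gives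
      \<open>f (y, e)\<close> with \<open>e = lam n \<delta>' w\<close>.\<close>
    define f where "f = (\<lambda>(y, e). lam n *\<^sub>R y + (1 - lam n) *\<^sub>R (x0 + e) :: plane)"
    have "compact (f ` (closure D \<times> cball 0 \<delta>'))"
      unfolding f_def case_prod_beta by (intro compact_continuous_image compact_Times closure_D compact_cball continuous_intros)
    moreover have "f ` (closure D \<times> cball 0 \<delta>') \<subseteq> D"
      unfolding f_def using shrink[OF \<delta>(1)] lam(2,3)[of n] \<delta>' by force
    moreover have "\<phi> n x = 0" if x: "x \<notin> f ` (closure D \<times> cball 0 \<delta>')" for x
    proof -
      have z: "rho w * v (x0 + s n *\<^sub>R (x - x0) - \<epsilon> n *\<^sub>R w) = 0" for w
      proof (rule ccontr)
        assume nz: "rho w * v (x0 + s n *\<^sub>R (x - x0) - \<epsilon> n *\<^sub>R w) \<noteq> 0"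
        define y where "y = x0 + s n *\<^sub>R (x - x0) - \<epsilon> n *\<^sub>R w"
        have w: "norm w \<le> 1" using nz rho(3)[of w] by auto
        have y: "y \<in> closure D" using nz v0[of y] closure_subset[of D] by (auto simp: y_def)
        define e where "e = (lam n * \<delta>') *\<^sub>R w"
        have "norm e \<le> \<delta>'"
        proof -
          have "lam n * \<delta>' * norm w \<le> 1 * \<delta>' * 1"
            using lam(2,3)[of n] \<delta>' w by (intro mult_mono) auto
          then show ?thesis using lam(2)[of n] \<delta>' by (simp add: e_def)
        qed
        then have e: "e \<in> cball 0 \<delta>'" by simp
        have "(1 - lam n) *\<^sub>R e = lam n *\<^sub>R (\<epsilon> n *\<^sub>R w)"
          unfolding lam(4) by (simp add: e_def \<epsilon>_def)
        then have "f (y, e) = lam n *\<^sub>R (x0 + s n *\<^sub>R (x - x0)) + (1 - lam n) *\<^sub>R x0"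
          by (simp add: f_def y_def algebra_simps)
        also have "\<dots> = x0 + (s n * lam n) *\<^sub>R (x - x0)" by (simp add: algebra_simps)
        also have "\<dots> = x" by (simp add: s)
        finally have "f (y, e) = x" .
        then have "x \<in> f ` (closure D \<times> cball 0 \<delta>')" using y e by (intro image_eqI[of _ _ "(y, e)"]) auto
        then show False using x by simp
      qed
      show ?thesis unfolding \<phi>_def S moll_eq[OF vm \<epsilon>1(1)] z by simp
    qed
    moreover have "Ck k (\<phi> n)" for k unfolding \<phi>_def by (rule Ck_affine[OF Ckm])
    ultimately show ?thesis unfolding test_function_def by blast
  qed
  have d1: "partial_deriv i (\<phi> n) x = s n * moll (\<epsilon> n) (G i) (x0 + s n *\<^sub>R (x - x0))" for i n x
  proof -
    have "partial_deriv i (\<phi> n) x = s n * partial_deriv i (moll (\<epsilon> n) v) ((x0 - s n *\<^sub>R x0) + s n *\<^sub>R x)"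
      unfolding \<phi>_def using Ckm[of "Suc 0" n] by (intro partial_deriv_affine(1)) auto
    then show ?thesis unfolding S using partial_deriv_moll[OF vi \<epsilon>1(1) wd, of _ n i] by simp
  qed
  have restrict: "sqnorm q = (\<integral>\<^sup>+x\<in>D. ennreal ((q x)\<^sup>2) \<partial>lborel)" if "\<And>x. x \<notin> D \<Longrightarrow> q x = 0" for q
    unfolding sqnorm_def by (intro nn_integral_cong) (use that in \<open>auto simp: indicator_def\<close>)
  note T = scaled_moll_tendsto[OF s(1-3) \<epsilon>0 \<epsilon>1]
  have "sqnorm (\<lambda>x. \<phi> n x - v x) = (\<integral>\<^sup>+x\<in>D. ennreal ((1 * moll (\<epsilon> n) v (x0 + s n *\<^sub>R (x - x0)) - v x)\<^sup>2) \<partial>lborel)" for n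
    using v0 test_function_zero[OF t] by (subst restrict) (auto simp: \<phi>_def S)
  then have 1: "(\<lambda>n. sqnorm (\<lambda>x. \<phi> n x - v x)) \<longlonglongrightarrow> 0"
    using T[OF tendsto_const _ vm vfin bounded_D borel_D, where ?x0.0=x0] by simp
  have "sqnorm (\<lambda>x. partial_deriv i (\<phi> n) x - G i x) = (\<integral>\<^sup>+x\<in>D. ennreal ((s n * moll (\<epsilon> n) (G i) (x0 + s n *\<^sub>R (x - x0)) - G i x)\<^sup>2) \<partial>lborel)" for i n
    using G(2) test_function_zero[OF test_function_partial[OF t]] by (subst restrict) (auto simp: d1[symmetric])
  then have 2: "(\<lambda>n. sqnorm (\<lambda>x. partial_deriv i (\<phi> n) x - G i x)) \<longlonglongrightarrow> 0" for i
    using T[OF s(1) s(5) G(1)[of i] Gfin[of i] bounded_D borel_D, where ?x0.0=x0] by simp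
  have 3: "(\<lambda>n. \<phi> n x) \<longlonglongrightarrow> v x" for x
  proof -
    have "(\<lambda>n. x0 + s n *\<^sub>R (x - x0)) \<longlonglongrightarrow> x0 + 1 *\<^sub>R (x - x0)" by (intro tendsto_intros s)
    then show ?thesis unfolding \<phi>_def S by (intro moll_tendsto[OF cont vK _ \<epsilon>0 \<epsilon>1(1)]) simp
  qed
  \<comment> \<open>Averaging preserves Lipschitz constants, and the dilation multiplies them by
    \<open>s n \<le> 2\<close>.\<close>
  have 4: "\<bar>\<phi> n x - \<phi> n y\<bar> \<le> 2 * L * norm (x - y)" for n x y
  proof -
    let ?S = "\<lambda>x. x0 + s n *\<^sub>R (x - x0)"
    have i: "integrable lborel (\<lambda>w. rho w * v (?S x - \<epsilon> n *\<^sub>R w))" for x by (rule rho_mult_integrable'[OF vi \<epsilon>1(1)])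
    have eq: "\<phi> n x - \<phi> n y = (\<integral>w. rho w * v (?S x - \<epsilon> n *\<^sub>R w) - rho w * v (?S y - \<epsilon> n *\<^sub>R w) \<partial>lborel)"
      unfolding \<phi>_def S moll_eq[OF vm \<epsilon>1(1)] using i by simp
    have "\<bar>\<phi> n x - \<phi> n y\<bar> \<le> (\<integral>w. \<bar>rho w * v (?S x - \<epsilon> n *\<^sub>R w) - rho w * v (?S y - \<epsilon> n *\<^sub>R w)\<bar> \<partial>lborel)"
      unfolding eq by (rule integral_abs_bound)
    also have "\<dots> \<le> (\<integral>w. rho w * (2 * L * norm (x - y)) \<partial>lborel)"
    proof (rule integral_mono)
      fix w
      have "\<bar>v (?S x - \<epsilon> n *\<^sub>R w) - v (?S y - \<epsilon> n *\<^sub>R w)\<bar> \<le> L * norm (s n *\<^sub>R (x - y))"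
        using L[of "?S x - \<epsilon> n *\<^sub>R w" "?S y - \<epsilon> n *\<^sub>R w"] by (simp add: algebra_simps)
      also have "\<dots> = s n * (L * norm (x - y))" using s(4)[of n] by simp
      also have "\<dots> \<le> 2 * (L * norm (x - y))" using s(3)[of n] L0 by (intro mult_right_mono) auto
      finally have "\<bar>v (?S x - \<epsilon> n *\<^sub>R w) - v (?S y - \<epsilon> n *\<^sub>R w)\<bar> \<le> 2 * L * norm (x - y)" by simp
      then have "rho w * \<bar>v (?S x - \<epsilon> n *\<^sub>R w) - v (?S y - \<epsilon> n *\<^sub>R w)\<bar> \<le> rho w * (2 * L * norm (x - y))"
        by (rule mult_left_mono) (rule rho)
      then show "\<bar>rho w * v (?S x - \<epsilon> n *\<^sub>R w) - rho w * v (?S y - \<epsilon> n *\<^sub>R w)\<bar> \<le> rho w * (2 * L * norm (x - y))"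
        using rho(2)[of w] by (simp add: right_diff_distrib[symmetric] abs_mult)
    qed (use i rho_integrable in auto)
    finally show ?thesis using rho(4) by simp
  qed
  show "\<exists>\<phi>. (\<forall>n. test_function D (\<phi> n)) \<and> (\<lambda>n. sqnorm (\<lambda>x. \<phi> n x - v x)) \<longlonglongrightarrow> 0 \<and>
     (\<forall>i. (\<lambda>n. sqnorm (\<lambda>x. partial_deriv i (\<phi> n) x - G i x)) \<longlonglongrightarrow> 0) \<and>
     (\<forall>x. (\<lambda>n. \<phi> n x) \<longlonglongrightarrow> v x) \<and> (\<forall>n x y. \<bar>\<phi> n x - \<phi> n y\<bar> \<le> 2 * L * norm (x - y))"
    using t 1 2 3 4 by blast
qed

end

section \<open>A logarithmic Sobolev estimate\<close>

lemma ray_derivative: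
  assumes "\<And>x. \<phi> differentiable (at x)"
  shows "((\<lambda>t. \<phi> (x + t *\<^sub>R d)) has_real_derivative (grad \<phi> (x + t *\<^sub>R d) \<bullet> d)) (at t)"
proof -
  have "((\<lambda>s. \<phi> (x + s *\<^sub>R d)) has_derivative (\<lambda>s. grad \<phi> (x + t *\<^sub>R d) \<bullet> (s *\<^sub>R d))) (at t)"
  proof (rule has_derivative_compose[of "\<lambda>s. x + s *\<^sub>R d" _ _ _ \<phi>])
    show "((\<lambda>s. x + s *\<^sub>R d) has_derivative (\<lambda>s. s *\<^sub>R d)) (at t)" by (auto intro!: derivative_eq_intros)
    show "(\<phi> has_derivative (\<lambda>h. grad \<phi> (x + t *\<^sub>R d) \<bullet> h)) (at (x + t *\<^sub>R d))"
      by (rule has_derivative_grad[OF assms])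
  qed
  moreover have "(\<lambda>s. grad \<phi> (x + t *\<^sub>R d) \<bullet> (s *\<^sub>R d)) = (*) (grad \<phi> (x + t *\<^sub>R d) \<bullet> d)"
    by (auto simp: mult.commute)
  ultimately show ?thesis by (simp add: has_field_derivative_def)
qed

definition grad_sq :: "(plane \<Rightarrow> real) \<Rightarrow> plane \<Rightarrow> real" where
  "grad_sq w x = (\<Sum>i\<in>UNIV. (partial_deriv i w x)\<^sup>2)"

lemma grad_sq: "grad_sq w x = (norm (grad w x))\<^sup>2" "0 \<le> grad_sq w x"
  by (simp_all add: grad_sq_def power2_norm_eq_inner inner_vec_def sum_nonneg flip: power2_eq_square)

lemma inner_grad_sq: "(grad w x \<bullet> d)\<^sup>2 \<le> grad_sq w x * (norm d)\<^sup>2"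
proof -
  have "\<bar>grad w x \<bullet> d\<bar> \<le> norm (grad w x) * norm d" by (rule Cauchy_Schwarz_ineq2)
  then have "\<bar>grad w x \<bullet> d\<bar>\<^sup>2 \<le> (norm (grad w x) * norm d)\<^sup>2" by (intro power_mono) auto
  then show ?thesis by (simp add: grad_sq power_mult_distrib)
qed

text \<open>Averaging over \<open>z + c *\<^sub>R y\<close> with \<open>y\<close> in this set stands
  in for polar coordinates: such points are at distance between \<open>c\<close> and
  \<open>2 c\<close> from \<open>z\<close>.\<close>

definition annulus :: "plane set" where "annulus = {y. 1 \<le> norm y \<and> norm y \<le> 2}"

lemma annulus: "annulus \<in> sets borel" "emeasure lborel annulus < \<infinity>" "0 < measure lborel annulus"
proof -
  have c: "annulus = cball 0 2 - ball 0 1" by (auto simp: annulus_def)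
  show m: "annulus \<in> sets borel" unfolding c by (intro sets.Diff) auto
  have b: "bounded annulus" unfolding c by (intro bounded_subset[OF bounded_cball]) auto
  then show f: "emeasure lborel annulus < \<infinity>" by (rule emeasure_bounded_finite)
  define p :: plane where "p = (3/2) *\<^sub>R axis 1 1"
  have "ball p (1/2) \<subseteq> annulus"
  proof
    fix y assume y: "y \<in> ball p (1/2)"
    have "norm p = 3/2" by (simp add: p_def)
    then show "y \<in> annulus" using y norm_triangle_ineq2[of p y] norm_triangle_ineq2[of y p]
      by (auto simp: annulus_def dist_norm norm_minus_commute)
  qed
  then have "measure lborel (ball p (1/2)) \<le> measure lborel annulus"
    using f m by (intro measure_mono_fmeasurable) (auto simp: fmeasurable_def)
  moreover have "0 < measure lborel (ball p (1/2))" by (rule content_ball_pos) simp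
  ultimately show "0 < measure lborel annulus" by linarith
qed

text \<open>For fixed \<open>x\<close> the scales \<open>h e\<^sup>s\<close> at which \<open>x - z\<close> falls into the dilated annulus form an interval of
  length \<open>ln 2\<close>.  Averaging the fundamental theorem over rays in logarithmic scale thus costs only a factor \<open>ln (R / h)\<close>.\<close>

lemma log_window:
  assumes "0 < h"
  shows "(\<integral>\<^sup>+s. indicator {0..S} s * indicator annulus ((1 / (h * exp s)) *\<^sub>R (x - z)) \<partial>lborel) \<le> (1::ennreal)"
proof (cases "x = z")
  case True then show ?thesis by (simp add: annulus_def)
next
  case False
  define r where "r = norm (x - z)"
  have r: "0 < r" using False by (simp add: r_def)
  have "indicator {0..S} s * indicator annulus ((1 / (h * exp s)) *\<^sub>R (x - z)) \<le> (indicator {ln (r / h) - ln 2..ln (r / h)} s :: ennreal)" for s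
  proof (cases "((1 / (h * exp s)) *\<^sub>R (x - z)) \<in> annulus")
    case True
    then have 1: "1 \<le> r / (h * exp s)" "r / (h * exp s) \<le> 2" using assms by (auto simp: annulus_def r_def)
    have e: "r / (h * exp s) = exp (ln (r / h) - s)" using r assms by (simp add: exp_diff)
    have "0 \<le> ln (r / h) - s" using 1(1) unfolding e by simp
    moreover have "ln (r / h) - s \<le> ln 2" using 1(2) unfolding e by (metis exp_le_cancel_iff exp_ln zero_less_numeral)
    ultimately show ?thesis by (auto simp: indicator_def)
  qed auto
  then have "(\<integral>\<^sup>+s. indicator {0..S} s * indicator annulus ((1 / (h * exp s)) *\<^sub>R (x - z)) \<partial>lborel)
     \<le> (\<integral>\<^sup>+s. indicator {ln (r / h) - ln 2..ln (r / h)} s \<partial>lborel)" by (intro nn_integral_mono)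
  also have "\<dots> = ennreal (ln 2)" by simp
  also have "\<dots> \<le> ennreal 1" using ln_2_less_1 by (intro ennreal_leI) simp
  finally show ?thesis by simp
qed

text \<open>Along the curve \<open>z + h e\<^sup>s y\<close> the function runs from
  \<open>z + h y\<close> to a point where it vanishes, for \<open>s\<close> in an interval of length
  \<open>ln (R / h)\<close>. The squared derivative carries the factor
  \<open>(h e\<^sup>s)\<^sup>2\<close>, exactly the Jacobian of
  \<open>y \<mapsto> z + h e\<^sup>s y\<close>, so after integrating over the annulus each
  \<open>x\<close> is weighted only by the length of its window of scales, at most 1. The Lipschitz
  bound covers the gap between \<open>z\<close> and \<open>z + h y\<close>. Both constants 8 are
  \<open>2 * 4\<close>: a split square and \<open>norm y \<le> 2\<close>.\<close>

lemma discrete_sobolev_smooth: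
  assumes \<phi>: "test_function UNIV \<phi>" and R: "\<And>x. R \<le> norm (x - z) \<Longrightarrow> \<phi> x = 0"
    and h: "0 < h" "h \<le> R" and L: "\<And>x y. \<bar>\<phi> x - \<phi> y\<bar> \<le> L * norm (x - y)"
  shows "ennreal (measure lborel annulus * (\<phi> z)\<^sup>2)
     \<le> ennreal (8 * ln (R / h)) * (\<Sum>i\<in>UNIV. sqnorm (partial_deriv i \<phi>)) + ennreal (8 * L\<^sup>2 * h\<^sup>2 * measure lborel annulus)"
proof -
  define S where "S = ln (R / h)"
  have S: "0 \<le> S" "h * exp S = R" using h by (auto simp: S_def)
  have [measurable]: "\<phi> \<in> borel_measurable borel" "partial_deriv i \<phi> \<in> borel_measurable borel" for i
    using test_function_measurable[OF \<phi>] test_function_measurable[OF test_function_partial[OF \<phi>]] by auto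
  have [measurable]: "annulus \<in> sets borel" by (rule annulus)
  have q[measurable]: "grad_sq \<phi> \<in> borel_measurable borel" unfolding grad_sq_def[abs_def] by measurable
  have gc: "continuous_on UNIV (grad \<phi>)"
    unfolding grad_def[abs_def] using test_function_continuous[OF test_function_partial[OF \<phi>]]
    by (intro continuous_on_vec_lambda) auto
  have L0: "0 \<le> L" using L[of "axis 1 1" 0] abs_ge_zero[of "\<phi> (axis 1 1) - \<phi> 0"] by simp
  have ray: "ennreal ((\<phi> (z + h *\<^sub>R y))\<^sup>2) \<le> ennreal S * (\<integral>\<^sup>+s. ennreal (4 * (h * exp s)\<^sup>2 * grad_sq \<phi> (z + (h * exp s) *\<^sub>R y)) * indicator {0..S} s \<partial>lborel)"
    if y: "y \<in> annulus" for y
  proof -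
    define F where "F s = \<phi> (z + (h * exp s) *\<^sub>R y)" for s
    define F' where "F' s = (grad \<phi> (z + (h * exp s) *\<^sub>R y) \<bullet> y) * (h * exp s)" for s
    have dF: "(F has_real_derivative F' s) (at s)" for s
    proof -
      have "((\<lambda>t. \<phi> (z + t *\<^sub>R y)) has_real_derivative (grad \<phi> (z + (h * exp s) *\<^sub>R y) \<bullet> y)) (at (h * exp s))"
        by (rule ray_derivative[OF test_function_differentiable[OF \<phi>]])
      moreover have "((\<lambda>s. h * exp s) has_real_derivative h * exp s) (at s)"
        by (auto intro!: derivative_eq_intros)
      ultimately show ?thesis unfolding F_def F'_def by (rule DERIV_chain2)
    qed
    have cF: "continuous_on {0..S} F'"
      unfolding F'_def by (intro continuous_intros continuous_on_compose2[OF gc]) auto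
    have "F S = 0" unfolding F_def S(2)
      using y h by (intro R) (simp add: annulus_def)
    moreover have "F 0 = \<phi> (z + h *\<^sub>R y)" by (simp add: F_def)
    ultimately have "ennreal ((\<phi> (z + h *\<^sub>R y))\<^sup>2) = ennreal ((F S - F 0)\<^sup>2)" by simp
    also have "\<dots> \<le> ennreal (S - 0) * (\<integral>\<^sup>+s. ennreal ((F' s)\<^sup>2) * indicator {0..S} s \<partial>lborel)"
      by (rule ftc_square[OF S(1) dF cF])
    also have "\<dots> \<le> ennreal S * (\<integral>\<^sup>+s. ennreal (4 * (h * exp s)\<^sup>2 * grad_sq \<phi> (z + (h * exp s) *\<^sub>R y)) * indicator {0..S} s \<partial>lborel)"
    proof (intro mult_mono nn_integral_mono mult_right_mono ennreal_leI)
      fix s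
      have "(norm y)\<^sup>2 \<le> 2\<^sup>2" using y by (intro power_mono) (auto simp: annulus_def)
      then have "(grad \<phi> (z + (h * exp s) *\<^sub>R y) \<bullet> y)\<^sup>2 \<le> grad_sq \<phi> (z + (h * exp s) *\<^sub>R y) * 4"
        using grad_sq(2) by (intro order_trans[OF inner_grad_sq] mult_left_mono) auto
      then have "(grad \<phi> (z + (h * exp s) *\<^sub>R y) \<bullet> y)\<^sup>2 * (h * exp s)\<^sup>2 \<le> grad_sq \<phi> (z + (h * exp s) *\<^sub>R y) * 4 * (h * exp s)\<^sup>2"
        by (intro mult_right_mono) auto
      then show "(F' s)\<^sup>2 \<le> 4 * (h * exp s)\<^sup>2 * grad_sq \<phi> (z + (h * exp s) *\<^sub>R y)"
        unfolding F'_def power_mult_distrib by (simp add: mult_ac)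
    qed auto
    finally show ?thesis .
  qed
  have "ennreal ((\<phi> z)\<^sup>2) * emeasure lborel annulus = (\<integral>\<^sup>+y. ennreal ((\<phi> z)\<^sup>2) * indicator annulus y \<partial>lborel)"
    by (simp add: nn_integral_cmult_indicator)
  also have "\<dots> \<le> (\<integral>\<^sup>+y. 2 * (ennreal S * (\<integral>\<^sup>+s. ennreal (4 * (h * exp s)\<^sup>2 * grad_sq \<phi> (z + (h * exp s) *\<^sub>R y)) * indicator {0..S} s * indicator annulus y \<partial>lborel))
      + ennreal (8 * L\<^sup>2 * h\<^sup>2) * indicator annulus y \<partial>lborel)"
  proof (rule nn_integral_mono)
    fix y
    show "ennreal ((\<phi> z)\<^sup>2) * indicator annulus y \<le> 2 * (ennreal S * (\<integral>\<^sup>+s. ennreal (4 * (h * exp s)\<^sup>2 * grad_sq \<phi> (z + (h * exp s) *\<^sub>R y)) * indicator {0..S} s * indicator annulus y \<partial>lborel))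
      + ennreal (8 * L\<^sup>2 * h\<^sup>2) * indicator annulus y"
    proof (cases "y \<in> annulus")
      case True
      have "\<bar>\<phi> z - \<phi> (z + h *\<^sub>R y)\<bar> \<le> L * (h * norm y)" using L[of z "z + h *\<^sub>R y"] h by simp
      also have "\<dots> \<le> L * (h * 2)" using True L0 h by (intro mult_left_mono) (auto simp: annulus_def)
      finally have "(\<phi> z - \<phi> (z + h *\<^sub>R y))\<^sup>2 \<le> (L * (h * 2))\<^sup>2"
        using L0 h by (subst abs_le_square_iff[symmetric]) simp
      then have "(\<phi> z)\<^sup>2 \<le> 2 * (\<phi> (z + h *\<^sub>R y))\<^sup>2 + 8 * L\<^sup>2 * h\<^sup>2"
        using square_sum2[of "\<phi> (z + h *\<^sub>R y)" "\<phi> z - \<phi> (z + h *\<^sub>R y)"] by (simp add: power_mult_distrib)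
      then have "ennreal ((\<phi> z)\<^sup>2) \<le> ennreal (2 * (\<phi> (z + h *\<^sub>R y))\<^sup>2 + 8 * L\<^sup>2 * h\<^sup>2)" by (rule ennreal_leI)
      also have "\<dots> = 2 * ennreal ((\<phi> (z + h *\<^sub>R y))\<^sup>2) + ennreal (8 * L\<^sup>2 * h\<^sup>2)"
        by (subst ennreal_plus) (auto simp: ennreal_mult)
      also have "\<dots> \<le> 2 * (ennreal S * (\<integral>\<^sup>+s. ennreal (4 * (h * exp s)\<^sup>2 * grad_sq \<phi> (z + (h * exp s) *\<^sub>R y)) * indicator {0..S} s \<partial>lborel)) + ennreal (8 * L\<^sup>2 * h\<^sup>2)"
        by (intro add_mono mult_left_mono ray True) auto
      finally show ?thesis using True by simp
    qed auto
  qed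
  also have "\<dots> = 2 * (ennreal S * (\<integral>\<^sup>+y. \<integral>\<^sup>+s. ennreal (4 * (h * exp s)\<^sup>2 * grad_sq \<phi> (z + (h * exp s) *\<^sub>R y)) * indicator {0..S} s * indicator annulus y \<partial>lborel \<partial>lborel))
      + ennreal (8 * L\<^sup>2 * h\<^sup>2) * emeasure lborel annulus"
    by (simp add: nn_integral_add nn_integral_cmult nn_integral_cmult_indicator)
  also have "(\<integral>\<^sup>+y. \<integral>\<^sup>+s. ennreal (4 * (h * exp s)\<^sup>2 * grad_sq \<phi> (z + (h * exp s) *\<^sub>R y)) * indicator {0..S} s * indicator annulus y \<partial>lborel \<partial>lborel)
     = (\<integral>\<^sup>+s. \<integral>\<^sup>+y. ennreal (4 * (h * exp s)\<^sup>2 * grad_sq \<phi> (z + (h * exp s) *\<^sub>R y)) * indicator {0..S} s * indicator annulus y \<partial>lborel \<partial>lborel)"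
    by (rule lborel_Fubini) measurable
  also have "\<dots> = (\<integral>\<^sup>+s. \<integral>\<^sup>+x. ennreal (4 * grad_sq \<phi> x) * (indicator {0..S} s * indicator annulus ((1 / (h * exp s)) *\<^sub>R (x - z))) \<partial>lborel \<partial>lborel)"
  proof (rule nn_integral_cong)
    fix s
    define c where "c = h * exp s"
    have c: "0 < c" using h by (simp add: c_def)
    have "(\<integral>\<^sup>+y. ennreal (4 * c\<^sup>2 * grad_sq \<phi> (z + c *\<^sub>R y)) * indicator {0..S} s * indicator annulus y \<partial>lborel)
       = (\<integral>\<^sup>+y. ennreal (c\<^sup>2) * (ennreal (4 * grad_sq \<phi> (z + c *\<^sub>R y)) * (indicator {0..S} s * indicator annulus ((1 / c) *\<^sub>R ((z + c *\<^sub>R y) - z)))) \<partial>lborel)"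
    proof (intro nn_integral_cong)
      fix y
      have "ennreal (4 * c\<^sup>2 * grad_sq \<phi> (z + c *\<^sub>R y)) = ennreal (c\<^sup>2) * ennreal (4 * grad_sq \<phi> (z + c *\<^sub>R y))"
        by (subst ennreal_mult[symmetric]) (auto simp: grad_sq(2) mult_ac)
      moreover have "(1 / c) *\<^sub>R ((z + c *\<^sub>R y) - z) = y" using c by simp
      ultimately show "ennreal (4 * c\<^sup>2 * grad_sq \<phi> (z + c *\<^sub>R y)) * indicator {0..S} s * indicator annulus y
        = ennreal (c\<^sup>2) * (ennreal (4 * grad_sq \<phi> (z + c *\<^sub>R y)) * (indicator {0..S} s * indicator annulus ((1 / c) *\<^sub>R ((z + c *\<^sub>R y) - z))))"
        by (simp add: mult.assoc)
    qed
    also have "\<dots> = ennreal (c\<^sup>2) * (ennreal (1 / c\<^sup>2) * (\<integral>\<^sup>+x. ennreal (4 * grad_sq \<phi> x) * (indicator {0..S} s * indicator annulus ((1 / c) *\<^sub>R (x - z))) \<partial>lborel))"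
    proof -
      define K where "K x = ennreal (4 * grad_sq \<phi> x) * (indicator {0..S} s * indicator annulus ((1 / c) *\<^sub>R (x - z)))" for x
      have Km[measurable]: "K \<in> borel_measurable borel" unfolding K_def[abs_def] by measurable
      have "(\<integral>\<^sup>+y. ennreal (c\<^sup>2) * K (z + c *\<^sub>R y) \<partial>lborel) = ennreal (c\<^sup>2) * (ennreal (1 / c\<^sup>2) * (\<integral>\<^sup>+x. K x \<partial>lborel))"
        using c by (simp add: nn_integral_cmult nn_integral_lborel_affine[OF Km])
      then show ?thesis unfolding K_def .
    qed
    also have "\<dots> = (\<integral>\<^sup>+x. ennreal (4 * grad_sq \<phi> x) * (indicator {0..S} s * indicator annulus ((1 / c) *\<^sub>R (x - z))) \<partial>lborel)"
      using c by (simp add: mult.assoc[symmetric] flip: ennreal_mult)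
    finally show "(\<integral>\<^sup>+y. ennreal (4 * (h * exp s)\<^sup>2 * grad_sq \<phi> (z + (h * exp s) *\<^sub>R y)) * indicator {0..S} s * indicator annulus y \<partial>lborel)
       = (\<integral>\<^sup>+x. ennreal (4 * grad_sq \<phi> x) * (indicator {0..S} s * indicator annulus ((1 / (h * exp s)) *\<^sub>R (x - z))) \<partial>lborel)"
      by (simp add: c_def)
  qed
  also have "\<dots> = (\<integral>\<^sup>+x. \<integral>\<^sup>+s. ennreal (4 * grad_sq \<phi> x) * (indicator {0..S} s * indicator annulus ((1 / (h * exp s)) *\<^sub>R (x - z))) \<partial>lborel \<partial>lborel)"
    by (rule lborel_Fubini) measurable
  also have "\<dots> \<le> (\<integral>\<^sup>+x. ennreal (4 * grad_sq \<phi> x) * 1 \<partial>lborel)"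
  proof (rule nn_integral_mono)
    fix x
    have "(\<integral>\<^sup>+s. ennreal (4 * grad_sq \<phi> x) * (indicator {0..S} s * indicator annulus ((1 / (h * exp s)) *\<^sub>R (x - z))) \<partial>lborel)
      = ennreal (4 * grad_sq \<phi> x) * (\<integral>\<^sup>+s. indicator {0..S} s * indicator annulus ((1 / (h * exp s)) *\<^sub>R (x - z)) \<partial>lborel)"
      by (rule nn_integral_cmult) measurable
    also have "\<dots> \<le> ennreal (4 * grad_sq \<phi> x) * 1"
      by (rule mult_left_mono[OF log_window[OF h(1)]]) simp
    finally show "(\<integral>\<^sup>+s. ennreal (4 * grad_sq \<phi> x) * (indicator {0..S} s * indicator annulus ((1 / (h * exp s)) *\<^sub>R (x - z))) \<partial>lborel)
      \<le> ennreal (4 * grad_sq \<phi> x) * 1" .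
  qed
  also have "\<dots> = 4 * (\<Sum>i\<in>UNIV. sqnorm (partial_deriv i \<phi>))"
  proof -
    have "(\<integral>\<^sup>+x. ennreal (4 * grad_sq \<phi> x) * 1 \<partial>lborel)
      = (\<integral>\<^sup>+x. 4 * (ennreal ((partial_deriv 1 \<phi> x)\<^sup>2) + ennreal ((partial_deriv 2 \<phi> x)\<^sup>2)) \<partial>lborel)"
      by (intro nn_integral_cong) (simp add: grad_sq_def sum_2 ennreal_plus distrib_left ennreal_mult)
    also have "\<dots> = 4 * (\<Sum>i\<in>UNIV. sqnorm (partial_deriv i \<phi>))"
      unfolding sqnorm_def sum_2 by (simp add: nn_integral_cmult nn_integral_add)
    finally show ?thesis .
  qed
  finally have "ennreal ((\<phi> z)\<^sup>2) * emeasure lborel annulus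
     \<le> 2 * (ennreal S * (4 * (\<Sum>i\<in>UNIV. sqnorm (partial_deriv i \<phi>)))) + ennreal (8 * L\<^sup>2 * h\<^sup>2) * emeasure lborel annulus"
    by (simp add: mult_left_mono add_right_mono)
  also have "emeasure lborel annulus = ennreal (measure lborel annulus)"
    using annulus(2) by (simp add: emeasure_eq_ennreal_measure less_top[symmetric])
  finally show ?thesis
    using S(1) by (simp add: S_def[symmetric] ennreal_mult mult_ac)
qed

section \<open>Taylor estimates in the mean\<close>

definition hess_sq :: "(plane \<Rightarrow> real) \<Rightarrow> plane \<Rightarrow> real" where
  "hess_sq w x = (\<Sum>i\<in>UNIV. grad_sq (partial_deriv i w) x)"

lemma hess_sq_nonneg: "0 \<le> hess_sq w x"
  by (simp add: hess_sq_def sum_nonneg grad_sq)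

lemma Ck_measurable: "Ck k f \<Longrightarrow> f \<in> borel_measurable borel"
  using Ck_continuous borel_measurable_continuous_onI by blast

lemma C2_facts:
  assumes "\<And>k. Ck k w"
  shows "w differentiable (at x)" "partial_deriv i w differentiable (at x)"
    "continuous_on UNIV (partial_deriv i w)" "continuous_on UNIV (partial_deriv j (partial_deriv i w))"
    "continuous_on UNIV (grad w)" "continuous_on UNIV (grad (partial_deriv i w))"
proof -
  show "w differentiable (at x)" "partial_deriv i w differentiable (at x)"
    "continuous_on UNIV (partial_deriv i w)" "continuous_on UNIV (partial_deriv j (partial_deriv i w))" for i j
    using assms[of "Suc 0"] assms[of "Suc (Suc 0)"] by auto
  then show "continuous_on UNIV (grad w)" "continuous_on UNIV (grad (partial_deriv i w))"
    unfolding grad_def[abs_def] by (auto intro!: continuous_on_vec_lambda)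
qed

text \<open>The function \<open>F\<close> runs from the first order expansion of \<open>w\<close>
  about \<open>x\<close> at \<open>t = 0\<close> to \<open>w a\<close> at \<open>t = 1\<close>.
  First derivatives cancel in \<open>F'\<close>, which leaves \<open>1 - t\<close> times the second
  derivative in direction \<open>a - x\<close>.\<close>

lemma taylor_square:
  assumes w: "\<And>k. Ck k w"
  shows "ennreal ((w a - w x - grad w x \<bullet> (a - x))\<^sup>2) \<le>
    (\<integral>\<^sup>+t. ennreal ((1 - t)\<^sup>2 * norm (a - x) ^ 4 * hess_sq w (x + t *\<^sub>R (a - x))) * indicator {0..1} t \<partial>lborel)"
proof -
  define d where "d = a - x"
  define v where "v t = (\<chi> i. grad (partial_deriv i w) (x + t *\<^sub>R d) \<bullet> d)" for t
  define F where "F t = w (x + t *\<^sub>R d) + (1 - t) * (grad w (x + t *\<^sub>R d) \<bullet> d)" for t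
  define F' where "F' t = (1 - t) * (v t \<bullet> d)" for t
  note c = C2_facts[OF w]
  have dF: "(F has_real_derivative F' t) (at t)" for t
  proof -
    have 1: "((\<lambda>t. w (x + t *\<^sub>R d)) has_real_derivative (grad w (x + t *\<^sub>R d) \<bullet> d)) (at t)"
      by (rule ray_derivative[OF c(1)])
    have 2: "((\<lambda>t. \<Sum>i\<in>UNIV. partial_deriv i w (x + t *\<^sub>R d) * d $ i) has_real_derivative
        (\<Sum>i\<in>UNIV. (grad (partial_deriv i w) (x + t *\<^sub>R d) \<bullet> d) * d $ i)) (at t)"
      by (intro DERIV_sum DERIV_cmult_right ray_derivative c)
    have 3: "(\<lambda>t. \<Sum>i\<in>UNIV. partial_deriv i w (x + t *\<^sub>R d) * d $ i) = (\<lambda>t. grad w (x + t *\<^sub>R d) \<bullet> d)"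
      by (simp add: inner_vec_def)
    have 4: "(\<Sum>i\<in>UNIV. (grad (partial_deriv i w) (x + t *\<^sub>R d) \<bullet> d) * d $ i) = v t \<bullet> d"
      by (simp add: v_def inner_vec_def)
    have "((\<lambda>t. 1 - t) has_real_derivative -1) (at t)" by (auto intro!: derivative_eq_intros)
    from DERIV_add[OF 1 DERIV_mult[OF this 2[unfolded 3 4]]]
    show ?thesis unfolding F_def F'_def by (simp add: algebra_simps)
  qed
  have cF: "continuous_on {0..1} F'"
    unfolding F'_def v_def
    by (intro continuous_intros continuous_on_vec_lambda continuous_on_compose2[OF c(6)]) auto
  have "(F' t)\<^sup>2 \<le> (1 - t)\<^sup>2 * norm d ^ 4 * hess_sq w (x + t *\<^sub>R d)" for t
  proof -
    have "\<bar>v t \<bullet> d\<bar> \<le> norm (v t) * norm d" by (rule Cauchy_Schwarz_ineq2)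
    then have "\<bar>v t \<bullet> d\<bar>\<^sup>2 \<le> (norm (v t) * norm d)\<^sup>2" by (intro power_mono) auto
    moreover have "(norm (v t))\<^sup>2 = (\<Sum>i\<in>UNIV. (v t $ i)\<^sup>2)"
      unfolding power2_norm_eq_inner[of "v t"] by (simp add: inner_vec_def power2_eq_square)
    ultimately have "(v t \<bullet> d)\<^sup>2 \<le> (\<Sum>i\<in>UNIV. (v t $ i)\<^sup>2) * (norm d)\<^sup>2"
      by (simp add: power_mult_distrib)
    also have "\<dots> = (\<Sum>i\<in>UNIV. (grad (partial_deriv i w) (x + t *\<^sub>R d) \<bullet> d)\<^sup>2) * (norm d)\<^sup>2"
      by (simp add: v_def)
    also have "\<dots> \<le> (\<Sum>i\<in>UNIV. grad_sq (partial_deriv i w) (x + t *\<^sub>R d) * (norm d)\<^sup>2) * (norm d)\<^sup>2"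
      by (intro mult_right_mono sum_mono inner_grad_sq) auto
    also have "\<dots> = norm d ^ 4 * hess_sq w (x + t *\<^sub>R d)"
      by (simp add: hess_sq_def sum_distrib_left sum_distrib_right power4_eq_xxxx power2_eq_square mult_ac)
    finally have "(1 - t)\<^sup>2 * (v t \<bullet> d)\<^sup>2 \<le> (1 - t)\<^sup>2 * (norm d ^ 4 * hess_sq w (x + t *\<^sub>R d))"
      by (intro mult_left_mono) auto
    then show ?thesis by (simp add: F'_def power_mult_distrib mult.assoc)
  qed
  then have le: "(\<integral>\<^sup>+t. ennreal ((F' t)\<^sup>2) * indicator {0..1} t \<partial>lborel)
     \<le> (\<integral>\<^sup>+t. ennreal ((1 - t)\<^sup>2 * norm d ^ 4 * hess_sq w (x + t *\<^sub>R d)) * indicator {0..1} t \<partial>lborel)"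
    by (intro nn_integral_mono mult_right_mono ennreal_leI) auto
  have "ennreal ((F 1 - F 0)\<^sup>2) \<le> ennreal (1 - 0) * (\<integral>\<^sup>+t. ennreal ((F' t)\<^sup>2) * indicator {0..1} t \<partial>lborel)"
    by (rule ftc_square[OF _ dF cF]) simp
  also have "\<dots> \<le> (\<integral>\<^sup>+t. ennreal ((1 - t)\<^sup>2 * norm d ^ 4 * hess_sq w (x + t *\<^sub>R d)) * indicator {0..1} t \<partial>lborel)"
    using le by simp
  finally show ?thesis by (simp add: F_def d_def diff_diff_eq)
qed

text \<open>In the integrated Taylor remainder the factor \<open>(1 - t)\<^sup>2\<close> cancels the Jacobian of the contraction
  of \<open>K\<close> towards \<open>a\<close>.\<close>

lemma taylor_L2:
  assumes w: "\<And>k. Ck k w" and K: "convex K" "K \<in> sets borel" "a \<in> K" and \<delta>: "\<And>x. x \<in> K \<Longrightarrow> norm (a - x) \<le> \<delta>"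
  shows "(\<integral>\<^sup>+x\<in>K. ennreal ((w a - w x - grad w x \<bullet> (a - x))\<^sup>2) \<partial>lborel)
    \<le> ennreal (\<delta> ^ 4) * (\<integral>\<^sup>+x\<in>K. ennreal (hess_sq w x) \<partial>lborel)"
proof -
  have [measurable]: "K \<in> sets borel" by fact
  note c = C2_facts[OF w]
  have hc: "continuous_on UNIV (hess_sq w)"
    unfolding hess_sq_def[abs_def] grad_sq_def using c by (intro continuous_intros) auto
  have [measurable]: "hess_sq w \<in> borel_measurable borel" using hc by (rule borel_measurable_continuous_onI)
  have "(\<integral>\<^sup>+x\<in>K. ennreal ((w a - w x - grad w x \<bullet> (a - x))\<^sup>2) \<partial>lborel)
     \<le> (\<integral>\<^sup>+x. \<integral>\<^sup>+t. ennreal (\<delta> ^ 4) * (indicator {0..1} t * (ennreal ((1 - t)\<^sup>2) * (ennreal (hess_sq w (t *\<^sub>R a + (1 - t) *\<^sub>R x)) * indicator K (t *\<^sub>R a + (1 - t) *\<^sub>R x)))) \<partial>lborel \<partial>lborel)"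
  proof (rule nn_integral_mono)
    fix x
    show "ennreal ((w a - w x - grad w x \<bullet> (a - x))\<^sup>2) * indicator K x
      \<le> (\<integral>\<^sup>+t. ennreal (\<delta> ^ 4) * (indicator {0..1} t * (ennreal ((1 - t)\<^sup>2) * (ennreal (hess_sq w (t *\<^sub>R a + (1 - t) *\<^sub>R x)) * indicator K (t *\<^sub>R a + (1 - t) *\<^sub>R x)))) \<partial>lborel)"
    proof (cases "x \<in> K")
      case True
      have "ennreal ((w a - w x - grad w x \<bullet> (a - x))\<^sup>2) \<le>
        (\<integral>\<^sup>+t. ennreal ((1 - t)\<^sup>2 * norm (a - x) ^ 4 * hess_sq w (x + t *\<^sub>R (a - x))) * indicator {0..1} t \<partial>lborel)"
        by (rule taylor_square[OF w])
      also have "\<dots> \<le> (\<integral>\<^sup>+t. ennreal (\<delta> ^ 4) * (indicator {0..1} t * (ennreal ((1 - t)\<^sup>2) * (ennreal (hess_sq w (t *\<^sub>R a + (1 - t) *\<^sub>R x)) * indicator K (t *\<^sub>R a + (1 - t) *\<^sub>R x)))) \<partial>lborel)"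
      proof (rule nn_integral_mono)
        fix t
        show "ennreal ((1 - t)\<^sup>2 * norm (a - x) ^ 4 * hess_sq w (x + t *\<^sub>R (a - x))) * indicator {0..1} t
          \<le> ennreal (\<delta> ^ 4) * (indicator {0..1} t * (ennreal ((1 - t)\<^sup>2) * (ennreal (hess_sq w (t *\<^sub>R a + (1 - t) *\<^sub>R x)) * indicator K (t *\<^sub>R a + (1 - t) *\<^sub>R x))))"
        proof (cases "t \<in> {0..1}")
          case t: True
          have e: "x + t *\<^sub>R (a - x) = t *\<^sub>R a + (1 - t) *\<^sub>R x" by (simp add: algebra_simps)
          have "t *\<^sub>R a + (1 - t) *\<^sub>R x \<in> K" using t K(1,3) True by (auto intro: convexD)
          moreover have "norm (a - x) ^ 4 \<le> \<delta> ^ 4" using \<delta>[OF True] by (intro power_mono) auto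
          then have "norm (a - x) ^ 4 * ((1 - t)\<^sup>2 * hess_sq w (t *\<^sub>R a + (1 - t) *\<^sub>R x)) \<le> \<delta> ^ 4 * ((1 - t)\<^sup>2 * hess_sq w (t *\<^sub>R a + (1 - t) *\<^sub>R x))"
            by (intro mult_right_mono) (auto simp: hess_sq_nonneg)
          then have "ennreal ((1 - t)\<^sup>2 * norm (a - x) ^ 4 * hess_sq w (t *\<^sub>R a + (1 - t) *\<^sub>R x)) \<le> ennreal (\<delta> ^ 4 * ((1 - t)\<^sup>2 * hess_sq w (t *\<^sub>R a + (1 - t) *\<^sub>R x)))"
            by (intro ennreal_leI) (simp add: mult_ac)
          ultimately show ?thesis using t unfolding e by (simp add: ennreal_mult hess_sq_nonneg)
        qed auto
      qed
      finally show ?thesis using True by simp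
    qed auto
  qed
  also have "\<dots> = (\<integral>\<^sup>+t. \<integral>\<^sup>+x. ennreal (\<delta> ^ 4) * (indicator {0..1} t * (ennreal ((1 - t)\<^sup>2) * (ennreal (hess_sq w (t *\<^sub>R a + (1 - t) *\<^sub>R x)) * indicator K (t *\<^sub>R a + (1 - t) *\<^sub>R x)))) \<partial>lborel \<partial>lborel)"
    by (rule lborel_Fubini) measurable
  also have "\<dots> \<le> (\<integral>\<^sup>+t. ennreal (\<delta> ^ 4) * (\<integral>\<^sup>+x\<in>K. ennreal (hess_sq w x) \<partial>lborel) * indicator {0..1::real} t \<partial>lborel)"
  proof (rule nn_integral_mono)
    fix t :: real
    \<comment> \<open>At \<open>t = 1\<close> the contraction degenerates to the point
      \<open>a\<close>, but there the factor \<open>(1 - t)\<^sup>2\<close> vanishes.\<close>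
    show "(\<integral>\<^sup>+x. ennreal (\<delta> ^ 4) * (indicator {0..1} t * (ennreal ((1 - t)\<^sup>2) * (ennreal (hess_sq w (t *\<^sub>R a + (1 - t) *\<^sub>R x)) * indicator K (t *\<^sub>R a + (1 - t) *\<^sub>R x)))) \<partial>lborel)
      \<le> ennreal (\<delta> ^ 4) * (\<integral>\<^sup>+x\<in>K. ennreal (hess_sq w x) \<partial>lborel) * indicator {0..1} t"
    proof (cases "t \<in> {0..1} \<and> t \<noteq> 1")
      case True
      define Q where "Q x = ennreal (hess_sq w x) * indicator K x" for x
      have Qm[measurable]: "Q \<in> borel_measurable borel" unfolding Q_def[abs_def] by measurable
      have "(\<integral>\<^sup>+x. ennreal (\<delta> ^ 4) * (indicator {0..1} t * (ennreal ((1 - t)\<^sup>2) * Q (t *\<^sub>R a + (1 - t) *\<^sub>R x))) \<partial>lborel)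
        = ennreal (\<delta> ^ 4) * (ennreal ((1 - t)\<^sup>2) * (ennreal (1 / (1 - t)\<^sup>2) * (\<integral>\<^sup>+x. Q x \<partial>lborel)))"
        using True by (simp add: nn_integral_cmult nn_integral_lborel_affine[OF Qm])
      also have "\<dots> = ennreal (\<delta> ^ 4) * (\<integral>\<^sup>+x. Q x \<partial>lborel)"
        using True by (simp add: mult.assoc[symmetric] ennreal_mult[symmetric] del: ennreal_mult)
      finally show ?thesis using True by (simp add: Q_def)
    qed auto
  qed
  also have "\<dots> = ennreal (\<delta> ^ 4) * (\<integral>\<^sup>+x\<in>K. ennreal (hess_sq w x) \<partial>lborel)"
    by (simp add: nn_integral_cmult_indicator)
  finally show ?thesis .
qed

text \<open>The first order expansion of \<open>w\<close> about \<open>x\<close>, evaluated at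
  \<open>a\<close>, is squared and averaged over \<open>x\<close> in \<open>K\<close>. The powers of
  \<open>\<delta>\<close> are kept explicit because \<open>K\<close> will shrink to
  \<open>a\<close>.\<close>

lemma vertex_value_bound:
  assumes w: "\<And>k. Ck k w" and K: "convex K" "K \<in> sets borel" "a \<in> K" and \<delta>: "\<And>x. x \<in> K \<Longrightarrow> norm (a - x) \<le> \<delta>"
  shows "ennreal ((w a)\<^sup>2) * emeasure lborel K \<le> 3 * (\<integral>\<^sup>+x\<in>K. ennreal ((w x)\<^sup>2) \<partial>lborel)
    + 3 * (ennreal (\<delta>\<^sup>2) * (\<integral>\<^sup>+x\<in>K. ennreal (grad_sq w x) \<partial>lborel))
    + 3 * (ennreal (\<delta> ^ 4) * (\<integral>\<^sup>+x\<in>K. ennreal (hess_sq w x) \<partial>lborel))"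
proof -
  have [measurable]: "K \<in> sets borel" by fact
  note c = C2_facts[OF w]
  have [measurable]: "w \<in> borel_measurable borel" by (rule Ck_measurable[OF w])
  have [measurable]: "partial_deriv i w \<in> borel_measurable borel" for i using c(3) by (rule borel_measurable_continuous_onI)
  have [measurable]: "grad_sq w \<in> borel_measurable borel" unfolding grad_sq_def[abs_def] by measurable
  have [measurable]: "(\<lambda>x::plane. x $ i) \<in> borel_measurable borel" for i
    by (intro borel_measurable_continuous_onI continuous_intros)
  have [measurable]: "(\<lambda>x. grad w x \<bullet> (a - x)) \<in> borel_measurable borel" unfolding inner_vec_def by (simp add: vector_minus_component) measurable
  define R where "R x = w a - w x - grad w x \<bullet> (a - x)" for x
  have [measurable]: "R \<in> borel_measurable borel" unfolding R_def[abs_def] by measurable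
  have "ennreal ((w a)\<^sup>2) * emeasure lborel K = (\<integral>\<^sup>+x\<in>K. ennreal ((w a)\<^sup>2) \<partial>lborel)"
    by (simp add: nn_integral_cmult_indicator)
  also have "\<dots> \<le> (\<integral>\<^sup>+x. 3 * (ennreal ((w x)\<^sup>2) * indicator K x) + 3 * (ennreal (\<delta>\<^sup>2) * (ennreal (grad_sq w x) * indicator K x))
      + 3 * (ennreal ((R x)\<^sup>2) * indicator K x) \<partial>lborel)"
  proof (rule nn_integral_mono)
    fix x
    show "ennreal ((w a)\<^sup>2) * indicator K x \<le> 3 * (ennreal ((w x)\<^sup>2) * indicator K x) + 3 * (ennreal (\<delta>\<^sup>2) * (ennreal (grad_sq w x) * indicator K x))
      + 3 * (ennreal ((R x)\<^sup>2) * indicator K x)"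
    proof (cases "x \<in> K")
      case True
      have "w a = w x + grad w x \<bullet> (a - x) + R x" by (simp add: R_def)
      then have "(w a)\<^sup>2 \<le> 3 * (w x)\<^sup>2 + 3 * (grad w x \<bullet> (a - x))\<^sup>2 + 3 * (R x)\<^sup>2" using square_sum3 by metis
      also have "(grad w x \<bullet> (a - x))\<^sup>2 \<le> \<delta>\<^sup>2 * grad_sq w x"
      proof -
        have "(norm (a - x))\<^sup>2 \<le> \<delta>\<^sup>2" using \<delta>[OF True] by (intro power_mono) auto
        then have "grad_sq w x * (norm (a - x))\<^sup>2 \<le> grad_sq w x * \<delta>\<^sup>2" by (intro mult_left_mono grad_sq)
        then show ?thesis using inner_grad_sq[of w x "a - x"] by (simp add: mult.commute)
      qed
      finally have "ennreal ((w a)\<^sup>2) \<le> ennreal (3 * (w x)\<^sup>2 + 3 * (\<delta>\<^sup>2 * grad_sq w x) + 3 * (R x)\<^sup>2)"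
        by (intro ennreal_leI) simp
      then show ?thesis using True by (simp add: ennreal_plus ennreal_mult grad_sq(2))
    qed auto
  qed
  also have "\<dots> = 3 * (\<integral>\<^sup>+x\<in>K. ennreal ((w x)\<^sup>2) \<partial>lborel)
    + 3 * (ennreal (\<delta>\<^sup>2) * (\<integral>\<^sup>+x\<in>K. ennreal (grad_sq w x) \<partial>lborel)) + 3 * (\<integral>\<^sup>+x\<in>K. ennreal ((R x)\<^sup>2) \<partial>lborel)"
    by (simp add: nn_integral_add nn_integral_cmult)
  also have "\<dots> \<le> 3 * (\<integral>\<^sup>+x\<in>K. ennreal ((w x)\<^sup>2) \<partial>lborel)
    + 3 * (ennreal (\<delta>\<^sup>2) * (\<integral>\<^sup>+x\<in>K. ennreal (grad_sq w x) \<partial>lborel))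
    + 3 * (ennreal (\<delta> ^ 4) * (\<integral>\<^sup>+x\<in>K. ennreal (hess_sq w x) \<partial>lborel))"
    unfolding R_def by (intro add_mono mult_left_mono order_refl taylor_L2[OF w K \<delta>]) auto
  finally show ?thesis .
qed

section \<open>Boundary values\<close>

context convex_domain
begin

definition diam :: real where "diam = diameter (closure D)"

lemma diam: "x \<in> closure D \<Longrightarrow> y \<in> closure D \<Longrightarrow> norm (x - y) \<le> diam" "0 < diam"
proof -
  show "norm (x - y) \<le> diam" if "x \<in> closure D" "y \<in> closure D" for x y
    using diameter_bounded_bound[OF closure_D(1) that] by (simp add: diam_def dist_norm)
  obtain x0 \<delta> where \<delta>: "ball x0 \<delta> \<subseteq> D" "x0 \<in> D" "0 < \<delta>" by (rule small_radius)
  define y where "y = x0 + (\<delta> / 2) *\<^sub>R axis 1 1"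
  have "norm (y - x0) = \<delta> / 2" using \<delta> by (simp add: y_def)
  moreover have "y \<in> closure D" using \<delta> closure_subset[of D] by (force simp: y_def dist_norm)
  moreover have "x0 \<in> closure D" using \<delta> closure_subset by blast
  ultimately have "\<delta> / 2 \<le> diam" using \<open>\<And>x y. x \<in> closure D \<Longrightarrow> y \<in> closure D \<Longrightarrow> norm (x - y) \<le> diam\<close> by metis
  then show "0 < diam" using \<delta> by linarith
qed

text \<open>The homothetic copy of the domain with centre \<open>a\<close> and ratio \<open>r\<close>: for a boundary point \<open>a\<close> it replaces
  \<open>D \<inter> ball a r\<close>, with measure known exactly.\<close>

definition corner :: "plane \<Rightarrow> real \<Rightarrow> plane set" where
  "corner a r = (\<lambda>y. (a - r *\<^sub>R a) + r *\<^sub>R y) ` closure D"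

lemma corner:
  assumes a: "a \<in> closure D" and r: "0 < r" "r \<le> 1"
  shows "convex (corner a r)" "corner a r \<in> sets borel" "a \<in> corner a r" "corner a r \<subseteq> closure D"
    "\<And>x. x \<in> corner a r \<Longrightarrow> norm (a - x) \<le> r * diam"
    "emeasure lborel (corner a r) = ennreal (r\<^sup>2) * emeasure lborel (closure D)"
proof -
  show "convex (corner a r)" unfolding corner_def by (intro convex_affinity convex_closure convex_D)
  have "compact (corner a r)" unfolding corner_def by (intro compact_continuous_image closure_D continuous_intros)
  then show m: "corner a r \<in> sets borel" by (simp add: borel_compact)
  show "a \<in> corner a r" unfolding corner_def using a by (intro image_eqI[of _ _ a]) auto
  show "corner a r \<subseteq> closure D"
  proof
    fix x assume "x \<in> corner a r"
    then obtain y where y: "y \<in> closure D" "x = (a - r *\<^sub>R a) + r *\<^sub>R y" by (auto simp: corner_def)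
    have "x = (1 - r) *\<^sub>R a + r *\<^sub>R y" using y(2) by (simp add: algebra_simps)
    then show "x \<in> closure D" using convexD[OF convex_closure[OF convex_D] a y(1), of "1 - r" r] r by simp
  qed
  show "norm (a - x) \<le> r * diam" if x: "x \<in> corner a r" for x
  proof -
    obtain y where y: "y \<in> closure D" "x = (a - r *\<^sub>R a) + r *\<^sub>R y" using x by (auto simp: corner_def)
    have "a - x = r *\<^sub>R (a - y)" using y(2) by (simp add: algebra_simps)
    then show ?thesis using diam(1)[OF a y(1)] r by simp
  qed
  have [measurable]: "corner a r \<in> sets borel" by (rule m)
  have "emeasure lborel (closure D) = (\<integral>\<^sup>+y. indicator (corner a r) ((a - r *\<^sub>R a) + r *\<^sub>R y) \<partial>lborel)"
  proof -
    have "(a - r *\<^sub>R a) + r *\<^sub>R y \<in> corner a r \<longleftrightarrow> y \<in> closure D" for y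
    proof
      assume "(a - r *\<^sub>R a) + r *\<^sub>R y \<in> corner a r"
      then obtain y' where "y' \<in> closure D" "(a - r *\<^sub>R a) + r *\<^sub>R y = (a - r *\<^sub>R a) + r *\<^sub>R y'"
        unfolding corner_def by blast
      then show "y \<in> closure D" using r by simp
    qed (auto simp: corner_def)
    then have "(\<lambda>y. indicator (corner a r) ((a - r *\<^sub>R a) + r *\<^sub>R y)) = (indicator (closure D) :: plane \<Rightarrow> ennreal)"
      by (auto simp: indicator_def fun_eq_iff)
    then show ?thesis using closure_D by simp
  qed
  also have "\<dots> = ennreal (1 / r\<^sup>2) * emeasure lborel (corner a r)"
    using r by (subst nn_integral_lborel_affine) auto
  finally show "emeasure lborel (corner a r) = ennreal (r\<^sup>2) * emeasure lborel (closure D)"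
    using r by (simp add: mult.assoc[symmetric] flip: ennreal_mult)
qed

text \<open>Translating by \<open>r * diam\<close> along an outer normal at \<open>a\<close> moves the corner out of \<open>D\<close>.\<close>

lemma friedrichs_corner:
  assumes a: "a \<in> closure D" "a \<notin> D" and r: "0 < r" "r \<le> 1" and \<phi>: "test_function D \<phi>"
  shows "(\<integral>\<^sup>+x\<in>corner a r. ennreal ((\<phi> x)\<^sup>2) \<partial>lborel)
    \<le> ennreal ((r * diam)\<^sup>2) * (\<integral>\<^sup>+x\<in>cball a (2 * r * diam). ennreal (grad_sq \<phi> x) \<partial>lborel)"
proof -
  note C = corner[OF a(1) r]
  have [measurable]: "corner a r \<in> sets borel" by (rule C)
  have [measurable]: "\<phi> \<in> borel_measurable borel" "partial_deriv i \<phi> \<in> borel_measurable borel" for i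
    using test_function_measurable[OF \<phi>] test_function_measurable[OF test_function_partial[OF \<phi>]] by auto
  have q[measurable]: "grad_sq \<phi> \<in> borel_measurable borel" unfolding grad_sq_def[abs_def] by measurable
  have gc: "continuous_on UNIV (grad \<phi>)"
    unfolding grad_def[abs_def] using test_function_continuous[OF test_function_partial[OF \<phi>]]
    by (intro continuous_on_vec_lambda) auto
  have a_rel: "a \<notin> rel_interior D" using a(2) rel_interior_subset by blast
  obtain n where n: "n \<noteq> 0" "\<And>y. y \<in> closure D \<Longrightarrow> n \<bullet> a \<le> n \<bullet> y"
    "\<And>y. y \<in> rel_interior D \<Longrightarrow> n \<bullet> a < n \<bullet> y"
    by (rule supporting_hyperplane_relative_frontier[OF convex_D a(1) a_rel], rule that)
  define e where "e = (- 1 / norm n) *\<^sub>R n"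
  have ne: "norm e = 1" using n by (simp add: e_def)
  have eD: "e \<bullet> (y - a) \<le> 0" if "y \<in> closure D" for y
    using n(2)[OF that] n(1) by (simp add: e_def inner_diff_right divide_simps)
  \<comment> \<open>Equality is excluded by openness: a point of \<open>D\<close> on the supporting
    line could be pushed a little along the outer normal \<open>e\<close> without leaving
    \<open>D\<close>.\<close>
  have e_notin: "y \<notin> D" if "0 \<le> e \<bullet> (y - a)" for y
  proof
    assume "y \<in> D"
    then obtain \<tau> where \<tau>: "0 < \<tau>" "ball y \<tau> \<subseteq> D" using open_D unfolding open_contains_ball by blast
    have "y + (\<tau> / 2) *\<^sub>R e \<in> ball y \<tau>" using \<tau> ne by (simp add: dist_norm)
    then have "y + (\<tau> / 2) *\<^sub>R e \<in> closure D" using \<tau> closure_subset by blast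
    then have "e \<bullet> (y + (\<tau> / 2) *\<^sub>R e - a) \<le> 0" by (rule eD)
    moreover have "e \<bullet> e = 1" using ne by (simp add: dot_square_norm)
    then have "e \<bullet> (y + (\<tau> / 2) *\<^sub>R e - a) = e \<bullet> (y - a) + \<tau> / 2" by (simp add: inner_diff_right inner_add_right)
    ultimately show False using that \<tau> by linarith
  qed
  define d where "d = (r * diam) *\<^sub>R e"
  have nd: "norm d = r * diam" using r diam(2) ne by (simp add: d_def)
  \<comment> \<open>Points of the corner are within \<open>r * diam\<close> of \<open>a\<close>, and
    the translation adds at most the same distance.\<close>
  define B where "B = cball a (2 * r * diam)"
  have [measurable]: "B \<in> sets borel" by (simp add: B_def)
  have "(\<integral>\<^sup>+x\<in>corner a r. ennreal ((\<phi> x)\<^sup>2) \<partial>lborel)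
    \<le> (\<integral>\<^sup>+x. \<integral>\<^sup>+t. ennreal ((r * diam)\<^sup>2) * (indicator {0..1} t * (ennreal (grad_sq \<phi> (t *\<^sub>R d + 1 *\<^sub>R x)) * indicator B (t *\<^sub>R d + 1 *\<^sub>R x))) \<partial>lborel \<partial>lborel)"
  proof (rule nn_integral_mono)
    fix x
    show "ennreal ((\<phi> x)\<^sup>2) * indicator (corner a r) x
      \<le> (\<integral>\<^sup>+t. ennreal ((r * diam)\<^sup>2) * (indicator {0..1} t * (ennreal (grad_sq \<phi> (t *\<^sub>R d + 1 *\<^sub>R x)) * indicator B (t *\<^sub>R d + 1 *\<^sub>R x))) \<partial>lborel)"
    proof (cases "x \<in> corner a r")
      case True
      have xa: "norm (x - a) \<le> r * diam" using C(5)[OF True] by (simp add: norm_minus_commute)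
      have "\<phi> (x + d) = 0"
      proof (rule test_function_zero[OF \<phi> e_notin])
        have "\<bar>e \<bullet> (x - a)\<bar> \<le> norm e * norm (x - a)" by (rule Cauchy_Schwarz_ineq2)
        then have "- (r * diam) \<le> e \<bullet> (x - a)" using xa ne by simp
        moreover have "e \<bullet> e = 1" using ne by (simp add: dot_square_norm)
        then have "e \<bullet> (x + d - a) = e \<bullet> (x - a) + r * diam" by (simp add: d_def inner_diff_right inner_add_right)
        ultimately show "0 \<le> e \<bullet> (x + d - a)" by linarith
      qed
      then have "ennreal ((\<phi> x)\<^sup>2) = ennreal ((\<phi> (x + 1 *\<^sub>R d) - \<phi> (x + 0 *\<^sub>R d))\<^sup>2)" by simp
      also have "\<dots> \<le> ennreal (1 - 0) * (\<integral>\<^sup>+t. ennreal ((grad \<phi> (x + t *\<^sub>R d) \<bullet> d)\<^sup>2) * indicator {0..1} t \<partial>lborel)"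
        by (rule ftc_square[of 0 1 "\<lambda>t. \<phi> (x + t *\<^sub>R d)"])
           (auto intro!: ray_derivative test_function_differentiable[OF \<phi>] continuous_intros continuous_on_compose2[OF gc])
      also have "\<dots> \<le> (\<integral>\<^sup>+t. ennreal ((r * diam)\<^sup>2) * (indicator {0..1} t * (ennreal (grad_sq \<phi> (t *\<^sub>R d + 1 *\<^sub>R x)) * indicator B (t *\<^sub>R d + 1 *\<^sub>R x))) \<partial>lborel)"
        unfolding diff_zero ennreal_1 mult_1_left
      proof (rule nn_integral_mono)
        fix t
        show "ennreal ((grad \<phi> (x + t *\<^sub>R d) \<bullet> d)\<^sup>2) * indicator {0..1} t
          \<le> ennreal ((r * diam)\<^sup>2) * (indicator {0..1} t * (ennreal (grad_sq \<phi> (t *\<^sub>R d + 1 *\<^sub>R x)) * indicator B (t *\<^sub>R d + 1 *\<^sub>R x)))"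
        proof (cases "t \<in> {0..1}")
          case t: True
          have e: "t *\<^sub>R d + 1 *\<^sub>R x = x + t *\<^sub>R d" by simp
          have "t * norm d \<le> norm d" by (rule mult_left_le_one_le) (use t in auto)
          then have "norm (t *\<^sub>R d) \<le> r * diam" using t unfolding nd[symmetric] by simp
          then have "norm (a - (x + t *\<^sub>R d)) \<le> 2 * r * diam"
            using xa norm_triangle_ineq[of "x - a" "t *\<^sub>R d"] by (simp add: norm_minus_commute algebra_simps)
          then have "x + t *\<^sub>R d \<in> B" by (simp add: B_def dist_norm)
          moreover have "ennreal ((grad \<phi> (x + t *\<^sub>R d) \<bullet> d)\<^sup>2) \<le> ennreal (grad_sq \<phi> (x + t *\<^sub>R d) * (r * diam)\<^sup>2)"
            using inner_grad_sq[of \<phi> "x + t *\<^sub>R d" d] nd by (intro ennreal_leI) simp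
          ultimately show ?thesis using t unfolding e by (simp add: ennreal_mult grad_sq(2) mult.commute)
        qed auto
      qed
      finally show ?thesis using True by simp
    qed auto
  qed
  also have "\<dots> = (\<integral>\<^sup>+t. \<integral>\<^sup>+x. ennreal ((r * diam)\<^sup>2) * (indicator {0..1} t * (ennreal (grad_sq \<phi> (t *\<^sub>R d + 1 *\<^sub>R x)) * indicator B (t *\<^sub>R d + 1 *\<^sub>R x))) \<partial>lborel \<partial>lborel)"
    by (rule lborel_Fubini) measurable
  also have "\<dots> = (\<integral>\<^sup>+t. ennreal ((r * diam)\<^sup>2) * (\<integral>\<^sup>+x\<in>B. ennreal (grad_sq \<phi> x) \<partial>lborel) * indicator {0..1::real} t \<partial>lborel)"
  proof (rule nn_integral_cong)
    fix t :: real
    define Q where "Q x = ennreal (grad_sq \<phi> x) * indicator B x" for x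
    have Qm[measurable]: "Q \<in> borel_measurable borel" unfolding Q_def[abs_def] by measurable
    have "(\<integral>\<^sup>+x. ennreal ((r * diam)\<^sup>2) * (indicator {0..1} t * Q (t *\<^sub>R d + 1 *\<^sub>R x)) \<partial>lborel)
      = ennreal ((r * diam)\<^sup>2) * (indicator {0..1} t * (ennreal (1 / 1\<^sup>2) * (\<integral>\<^sup>+x. Q x \<partial>lborel)))"
      by (subst nn_integral_lborel_affine[OF Qm, symmetric, of 1 "t *\<^sub>R d"]) (simp_all add: nn_integral_cmult)
    then show "(\<integral>\<^sup>+x. ennreal ((r * diam)\<^sup>2) * (indicator {0..1} t * (ennreal (grad_sq \<phi> (t *\<^sub>R d + 1 *\<^sub>R x)) * indicator B (t *\<^sub>R d + 1 *\<^sub>R x))) \<partial>lborel)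
      = ennreal ((r * diam)\<^sup>2) * (\<integral>\<^sup>+x\<in>B. ennreal (grad_sq \<phi> x) \<partial>lborel) * indicator {0..1} t"
      by (simp add: Q_def mult_ac)
  qed
  also have "\<dots> = ennreal ((r * diam)\<^sup>2) * (\<integral>\<^sup>+x\<in>B. ennreal (grad_sq \<phi> x) \<partial>lborel)"
    by (simp add: nn_integral_cmult_indicator)
  finally show ?thesis by (simp add: B_def)
qed

text \<open>The estimate passes from approximating test functions to \<open>u0\<close>. Two squares
  are split on the way, which accounts for the factor 4; all approximation errors are collected in
  \<open>E n\<close> and vanish in the limit.\<close>

lemma friedrichs_corner_H10:
  assumes a: "a \<in> closure D" "a \<notin> D" and r: "0 < r" "r \<le> 1" and u: "u \<in> H10 D" "sob D u u0 G"
  shows "(\<integral>\<^sup>+x\<in>corner a r. ennreal ((u0 x)\<^sup>2) \<partial>lborel)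
    \<le> 4 * (ennreal ((r * diam)\<^sup>2) * (\<Sum>i\<in>UNIV. \<integral>\<^sup>+x\<in>cball a (2 * r * diam). ennreal ((G i x)\<^sup>2) \<partial>lborel))"
proof -
  note u' = sobD[OF u(2)]
  have [measurable]: "corner a r \<in> sets borel" by (rule corner[OF a(1) r])
  have [measurable]: "u0 \<in> borel_measurable borel" "G i \<in> borel_measurable borel" for i using u' by auto
  let ?B = "cball a (2 * r * diam)"
  obtain \<phi> where \<phi>: "\<And>n. test_function D (\<phi> n)" "(\<lambda>n. sqnorm (\<lambda>x. \<phi> n x - u0 x)) \<longlonglongrightarrow> 0"
     "\<And>i. (\<lambda>n. sqnorm (\<lambda>x. partial_deriv i (\<phi> n) x - G i x)) \<longlonglongrightarrow> 0"
    using H10_sob[OF open_D bounded_D u(2)] u(1) by blast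
  have [measurable]: "\<phi> n \<in> borel_measurable borel" "partial_deriv i (\<phi> n) \<in> borel_measurable borel" for i n
    using test_function_measurable[OF \<phi>(1)] test_function_measurable[OF test_function_partial[OF \<phi>(1)]] by auto
  define E where "E n = 2 * sqnorm (\<lambda>x. \<phi> n x - u0 x)
     + 4 * (ennreal ((r * diam)\<^sup>2) * (\<Sum>i\<in>UNIV. sqnorm (\<lambda>x. partial_deriv i (\<phi> n) x - G i x)))" for n
  have "E \<longlonglongrightarrow> 2 * 0 + 4 * (ennreal ((r * diam)\<^sup>2) * (\<Sum>i\<in>(UNIV::2 set). 0))"
    unfolding E_def by (intro tendsto_add ennreal_tendsto_cmult tendsto_sum \<phi>) auto
  then have E: "E \<longlonglongrightarrow> 0" by simp
  let ?X = "\<integral>\<^sup>+x\<in>corner a r. ennreal ((u0 x)\<^sup>2) \<partial>lborel"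
  let ?Y = "4 * (ennreal ((r * diam)\<^sup>2) * (\<Sum>i\<in>UNIV. \<integral>\<^sup>+x\<in>?B. ennreal ((G i x)\<^sup>2) \<partial>lborel))"
  have sub: "(\<integral>\<^sup>+x\<in>A. ennreal ((q x)\<^sup>2) \<partial>lborel) \<le> sqnorm q" for A q
    unfolding sqnorm_def by (intro nn_integral_mono) (auto simp: indicator_def)
  have [measurable]: "?B \<in> sets borel" by simp
  have grad_bound: "(\<integral>\<^sup>+x\<in>?B. ennreal (grad_sq (\<phi> n) x) \<partial>lborel)
      \<le> 2 * (\<Sum>i\<in>UNIV. \<integral>\<^sup>+x\<in>?B. ennreal ((G i x)\<^sup>2) \<partial>lborel) + 2 * (\<Sum>i\<in>UNIV. sqnorm (\<lambda>x. partial_deriv i (\<phi> n) x - G i x))" for n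
  proof -
    have "(\<integral>\<^sup>+x\<in>?B. ennreal (grad_sq (\<phi> n) x) \<partial>lborel) = (\<Sum>i\<in>UNIV. \<integral>\<^sup>+x\<in>?B. ennreal ((partial_deriv i (\<phi> n) x)\<^sup>2) \<partial>lborel)"
      unfolding sum_2 by (subst nn_integral_add[symmetric], measurable) (simp add: grad_sq_def sum_2 ennreal_plus distrib_right)
    also have "\<dots> \<le> (\<Sum>i\<in>UNIV. 2 * (\<integral>\<^sup>+x\<in>?B. ennreal ((G i x)\<^sup>2) \<partial>lborel) + 2 * sqnorm (\<lambda>x. partial_deriv i (\<phi> n) x - G i x))"
    proof (rule sum_mono)
      fix i
      have "(\<integral>\<^sup>+x\<in>?B. ennreal ((partial_deriv i (\<phi> n) x)\<^sup>2) \<partial>lborel) = (\<integral>\<^sup>+x\<in>?B. ennreal ((G i x + (partial_deriv i (\<phi> n) x - G i x))\<^sup>2) \<partial>lborel)" by simp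
      also have "\<dots> \<le> 2 * (\<integral>\<^sup>+x\<in>?B. ennreal ((G i x)\<^sup>2) \<partial>lborel) + 2 * (\<integral>\<^sup>+x\<in>?B. ennreal ((partial_deriv i (\<phi> n) x - G i x)\<^sup>2) \<partial>lborel)"
        by (rule nn_integral_square_add) auto
      also have "\<dots> \<le> 2 * (\<integral>\<^sup>+x\<in>?B. ennreal ((G i x)\<^sup>2) \<partial>lborel) + 2 * sqnorm (\<lambda>x. partial_deriv i (\<phi> n) x - G i x)"
        by (intro add_mono mult_left_mono sub) auto
      finally show "(\<integral>\<^sup>+x\<in>?B. ennreal ((partial_deriv i (\<phi> n) x)\<^sup>2) \<partial>lborel)
         \<le> 2 * (\<integral>\<^sup>+x\<in>?B. ennreal ((G i x)\<^sup>2) \<partial>lborel) + 2 * sqnorm (\<lambda>x. partial_deriv i (\<phi> n) x - G i x)" .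
    qed
    finally show ?thesis by (simp add: sum.distrib sum_distrib_left)
  qed
  have "?X \<le> ?Y + E n" for n
  proof -
    have "?X = (\<integral>\<^sup>+x\<in>corner a r. ennreal ((\<phi> n x + (u0 x - \<phi> n x))\<^sup>2) \<partial>lborel)" by simp
    also have "\<dots> \<le> 2 * (\<integral>\<^sup>+x\<in>corner a r. ennreal ((\<phi> n x)\<^sup>2) \<partial>lborel) + 2 * (\<integral>\<^sup>+x\<in>corner a r. ennreal ((u0 x - \<phi> n x)\<^sup>2) \<partial>lborel)"
      by (rule nn_integral_square_add) auto
    also have "\<dots> \<le> 2 * (ennreal ((r * diam)\<^sup>2) * (\<integral>\<^sup>+x\<in>?B. ennreal (grad_sq (\<phi> n) x) \<partial>lborel)) + 2 * sqnorm (\<lambda>x. \<phi> n x - u0 x)"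
    proof (intro add_mono mult_left_mono friedrichs_corner[OF a r \<phi>(1)])
      show "(\<integral>\<^sup>+x\<in>corner a r. ennreal ((u0 x - \<phi> n x)\<^sup>2) \<partial>lborel) \<le> sqnorm (\<lambda>x. \<phi> n x - u0 x)"
        using sub[of "\<lambda>x. \<phi> n x - u0 x" "corner a r"] by (simp add: power2_commute)
    qed auto
    also have "\<dots> \<le> 2 * (ennreal ((r * diam)\<^sup>2) * (2 * (\<Sum>i\<in>UNIV. \<integral>\<^sup>+x\<in>?B. ennreal ((G i x)\<^sup>2) \<partial>lborel) + 2 * (\<Sum>i\<in>UNIV. sqnorm (\<lambda>x. partial_deriv i (\<phi> n) x - G i x)))) + 2 * sqnorm (\<lambda>x. \<phi> n x - u0 x)"
      by (intro add_mono mult_left_mono grad_bound) auto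
    also have "\<dots> = ?Y + E n"
    proof -
      have "2 * (p * (2 * g + 2 * h)) + 2 * s = 4 * (p * g) + (2 * s + 4 * (p * h))" for p g h s :: ennreal
        by (simp add: distrib_left mult.left_commute[of p 2] add_ac)
      then show ?thesis unfolding E_def .
    qed
    finally show "?X \<le> ?Y + E n" .
  qed
  moreover have "(\<lambda>n. ?Y + E n) \<longlonglongrightarrow> ?Y + 0" by (intro tendsto_add tendsto_const E)
  ultimately have "?X \<le> ?Y + 0" by (intro LIMSEQ_le_const) auto
  then show ?thesis by simp
qed

lemma measure_closure_D: "emeasure lborel (closure D) = ennreal (measure lborel (closure D))" "0 < measure lborel (closure D)"
proof -
  have fin: "emeasure lborel (closure D) < \<infinity>" by (rule emeasure_bounded_finite[OF closure_D(1)])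
  then show "emeasure lborel (closure D) = ennreal (measure lborel (closure D))"
    by (simp add: emeasure_eq_ennreal_measure less_top[symmetric])
  obtain x0 \<delta> where \<delta>: "ball x0 \<delta> \<subseteq> D" "x0 \<in> D" "0 < \<delta>" by (rule small_radius)
  have "measure lborel (ball x0 \<delta>) \<le> measure lborel (closure D)"
    using fin \<delta> closure_subset[of D] closure_D(2) by (intro measure_mono_fmeasurable) (auto simp: fmeasurable_def)
  moreover have "0 < measure lborel (ball x0 \<delta>)" by (rule content_ball_pos[OF \<delta>(3)])
  ultimately show "0 < measure lborel (closure D)" by linarith
qed

text \<open>On a corner of ratio \<open>r\<close> the square of \<open>w n a\<close> is bounded by the mean of the squares of \<open>w n\<close>, of its gradient times \<open>r\<close>
  and of its Hessian times \<open>r\<^sup>2\<close>.  After \<open>n\<close> tends to infinity, the Friedrichs inequality leaves the energy of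
  \<open>u\<close> near \<open>a\<close>, which vanishes as \<open>r\<close> tends to zero.\<close>

lemma boundary_value_tendsto:
  assumes a: "a \<in> closure D" "a \<notin> D" and u: "u \<in> H10 D" "sob D u u0 G"
    and GG: "\<And>i j. GG i j \<in> borel_measurable borel" "\<And>i j. sqnorm (GG i j) < \<infinity>"
    and w: "\<And>n k. Ck k (w n)"
    and \<alpha>: "(\<lambda>n. \<integral>\<^sup>+x\<in>closure D. ennreal ((w n x - u0 x)\<^sup>2) \<partial>lborel) \<longlonglongrightarrow> 0"
    and \<beta>: "\<And>i. (\<lambda>n. \<integral>\<^sup>+x\<in>closure D. ennreal ((partial_deriv i (w n) x - G i x)\<^sup>2) \<partial>lborel) \<longlonglongrightarrow> 0"
    and \<gamma>: "\<And>i j. (\<lambda>n. \<integral>\<^sup>+x\<in>closure D. ennreal ((partial_deriv i (partial_deriv j (w n)) x - GG i j x)\<^sup>2) \<partial>lborel) \<longlonglongrightarrow> 0"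
  shows "(\<lambda>n. w n a) \<longlonglongrightarrow> 0"
proof -
  note u' = sobD[OF u(2)]
  have um[measurable]: "u0 \<in> borel_measurable borel" "G i \<in> borel_measurable borel" "GG i j \<in> borel_measurable borel" for i j
    using u' GG by auto
  note c = C2_facts[OF w]
  have wm[measurable]: "w n \<in> borel_measurable borel" "partial_deriv i (w n) \<in> borel_measurable borel"
    "partial_deriv j (partial_deriv i (w n)) \<in> borel_measurable borel" for n i j
    using Ck_measurable[OF w] borel_measurable_continuous_onI[OF c(3)] borel_measurable_continuous_onI[OF c(4)] by auto
  define A where "A n = (\<integral>\<^sup>+x\<in>closure D. ennreal ((w n x - u0 x)\<^sup>2) \<partial>lborel)" for n
  define B where "B i n = (\<integral>\<^sup>+x\<in>closure D. ennreal ((partial_deriv i (w n) x - G i x)\<^sup>2) \<partial>lborel)" for i n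
  define H where "H j i n = (\<integral>\<^sup>+x\<in>closure D. ennreal ((partial_deriv j (partial_deriv i (w n)) x - GG j i x)\<^sup>2) \<partial>lborel)" for i j n
  define g where "g r = (\<Sum>i\<in>UNIV. \<integral>\<^sup>+x\<in>cball a (2 * r * diam). ennreal ((G i x)\<^sup>2) \<partial>lborel)" for r
  define \<Gamma> where "\<Gamma> = (\<Sum>i\<in>UNIV. \<Sum>j\<in>UNIV. sqnorm (GG j i))"
  define E where "E r n = 6 * A n + 6 * (ennreal ((r * diam)\<^sup>2) * (\<Sum>i\<in>UNIV. B i n)) + 6 * (ennreal ((r * diam) ^ 4) * (\<Sum>i\<in>UNIV. \<Sum>j\<in>UNIV. H j i n))" for r n
  \<comment> \<open>The part of the bound that survives as \<open>n\<close> tends to infinity: 30 is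
    \<open>3 * 8 + 3 * 2\<close>, from the function and its gradient, and 6 is \<open>3 * 2\<close>,
    from the second derivatives.\<close>
  define Q where "Q r = 30 * (ennreal ((r * diam)\<^sup>2) * g r) + 6 * (ennreal ((r * diam) ^ 4) * \<Gamma>)" for r
  define m where "m = measure lborel (closure D)"
  have m: "0 < m" unfolding m_def by (rule measure_closure_D)
  have \<Gamma>fin: "\<Gamma> < \<infinity>" using GG(2) by (auto simp: \<Gamma>_def sum_2)
  have E0: "E r \<longlonglongrightarrow> 0" for r
  proof -
    have "E r \<longlonglongrightarrow> 6 * 0 + 6 * (ennreal ((r * diam)\<^sup>2) * (\<Sum>i\<in>(UNIV::2 set). 0)) + 6 * (ennreal ((r * diam) ^ 4) * (\<Sum>i\<in>(UNIV::2 set). \<Sum>j\<in>(UNIV::2 set). 0))"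
      unfolding E_def A_def B_def H_def by (intro tendsto_add ennreal_tendsto_cmult tendsto_sum \<alpha> \<beta> \<gamma>) auto
    then show ?thesis by simp
  qed
  have bound: "ennreal ((w n a)\<^sup>2 * m) \<le> ennreal (1 / r\<^sup>2) * Q r + ennreal (1 / r\<^sup>2) * E r n" if r: "0 < r" "r \<le> 1" for r n
  proof -
    note C = corner[OF a(1) r]
    let ?K = "corner a r"
    have [measurable]: "?K \<in> sets borel" by (rule C)
    have KB: "?K \<subseteq> cball a (2 * r * diam)"
    proof
      fix x assume "x \<in> ?K"
      from C(5)[OF this] have "norm (a - x) \<le> r * diam" .
      moreover have "0 \<le> r * diam" using r diam(2) by simp
      ultimately show "x \<in> cball a (2 * r * diam)" by (simp add: dist_norm)
    qed
    have mono: "(\<integral>\<^sup>+x\<in>?K. ennreal (q x) \<partial>lborel) \<le> (\<integral>\<^sup>+x\<in>X. ennreal (q x) \<partial>lborel)" if "?K \<subseteq> X" for q X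
      by (intro nn_integral_mono) (use that in \<open>auto simp: indicator_def\<close>)
    have 1: "(\<integral>\<^sup>+x\<in>?K. ennreal ((w n x)\<^sup>2) \<partial>lborel) \<le> 8 * (ennreal ((r * diam)\<^sup>2) * g r) + 2 * A n"
    proof -
      have "(\<integral>\<^sup>+x\<in>?K. ennreal ((w n x)\<^sup>2) \<partial>lborel) = (\<integral>\<^sup>+x\<in>?K. ennreal ((u0 x + (w n x - u0 x))\<^sup>2) \<partial>lborel)" by simp
      also have "\<dots> \<le> 2 * (\<integral>\<^sup>+x\<in>?K. ennreal ((u0 x)\<^sup>2) \<partial>lborel) + 2 * (\<integral>\<^sup>+x\<in>?K. ennreal ((w n x - u0 x)\<^sup>2) \<partial>lborel)"
        by (rule nn_integral_square_add) auto
      also have "\<dots> \<le> 2 * (4 * (ennreal ((r * diam)\<^sup>2) * g r)) + 2 * A n"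
        unfolding g_def A_def by (intro add_mono mult_left_mono friedrichs_corner_H10[OF a r u] mono C) auto
      also have "2 * (4 * (ennreal ((r * diam)\<^sup>2) * g r)) = 8 * (ennreal ((r * diam)\<^sup>2) * g r)"
        by (simp add: mult.assoc[symmetric])
      finally show ?thesis .
    qed
    have 2: "(\<integral>\<^sup>+x\<in>?K. ennreal (grad_sq (w n) x) \<partial>lborel) \<le> 2 * g r + 2 * (\<Sum>i\<in>UNIV. B i n)"
    proof -
      have "(\<integral>\<^sup>+x\<in>?K. ennreal (grad_sq (w n) x) \<partial>lborel) = (\<Sum>i\<in>UNIV. \<integral>\<^sup>+x\<in>?K. ennreal ((partial_deriv i (w n) x)\<^sup>2) \<partial>lborel)"
        unfolding sum_2 by (subst nn_integral_add[symmetric]) (auto simp: grad_sq_def sum_2 ennreal_plus distrib_right)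
      also have "\<dots> \<le> (\<Sum>i\<in>UNIV. 2 * (\<integral>\<^sup>+x\<in>cball a (2 * r * diam). ennreal ((G i x)\<^sup>2) \<partial>lborel) + 2 * B i n)"
      proof (rule sum_mono)
        fix i
        have "(\<integral>\<^sup>+x\<in>?K. ennreal ((partial_deriv i (w n) x)\<^sup>2) \<partial>lborel) = (\<integral>\<^sup>+x\<in>?K. ennreal ((G i x + (partial_deriv i (w n) x - G i x))\<^sup>2) \<partial>lborel)" by simp
        also have "\<dots> \<le> 2 * (\<integral>\<^sup>+x\<in>?K. ennreal ((G i x)\<^sup>2) \<partial>lborel) + 2 * (\<integral>\<^sup>+x\<in>?K. ennreal ((partial_deriv i (w n) x - G i x)\<^sup>2) \<partial>lborel)"
          by (rule nn_integral_square_add) auto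
        also have "\<dots> \<le> 2 * (\<integral>\<^sup>+x\<in>cball a (2 * r * diam). ennreal ((G i x)\<^sup>2) \<partial>lborel) + 2 * B i n"
          unfolding B_def by (intro add_mono mult_left_mono mono KB C) auto
        finally show "(\<integral>\<^sup>+x\<in>?K. ennreal ((partial_deriv i (w n) x)\<^sup>2) \<partial>lborel)
          \<le> 2 * (\<integral>\<^sup>+x\<in>cball a (2 * r * diam). ennreal ((G i x)\<^sup>2) \<partial>lborel) + 2 * B i n" .
      qed
      finally show ?thesis by (simp add: g_def sum.distrib sum_distrib_left)
    qed
    have 3: "(\<integral>\<^sup>+x\<in>?K. ennreal (hess_sq (w n) x) \<partial>lborel) \<le> 2 * \<Gamma> + 2 * (\<Sum>i\<in>UNIV. \<Sum>j\<in>UNIV. H j i n)"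
    proof -
      have "(\<integral>\<^sup>+x\<in>?K. ennreal (hess_sq (w n) x) \<partial>lborel) = (\<Sum>i\<in>UNIV. \<Sum>j\<in>UNIV. \<integral>\<^sup>+x\<in>?K. ennreal ((partial_deriv j (partial_deriv i (w n)) x)\<^sup>2) \<partial>lborel)"
        unfolding sum_2 by (simp add: nn_integral_add[symmetric] hess_sq_def grad_sq_def sum_2 ennreal_plus distrib_right)
      also have "\<dots> \<le> (\<Sum>i\<in>UNIV. \<Sum>j\<in>UNIV. 2 * sqnorm (GG j i) + 2 * H j i n)"
      proof (intro sum_mono)
        fix i j
        have "(\<integral>\<^sup>+x\<in>?K. ennreal ((partial_deriv j (partial_deriv i (w n)) x)\<^sup>2) \<partial>lborel)
          = (\<integral>\<^sup>+x\<in>?K. ennreal ((GG j i x + (partial_deriv j (partial_deriv i (w n)) x - GG j i x))\<^sup>2) \<partial>lborel)" by simp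
        also have "\<dots> \<le> 2 * (\<integral>\<^sup>+x\<in>?K. ennreal ((GG j i x)\<^sup>2) \<partial>lborel) + 2 * (\<integral>\<^sup>+x\<in>?K. ennreal ((partial_deriv j (partial_deriv i (w n)) x - GG j i x)\<^sup>2) \<partial>lborel)"
          by (rule nn_integral_square_add) auto
        also have "\<dots> \<le> 2 * sqnorm (GG j i) + 2 * H j i n"
        proof (intro add_mono mult_left_mono)
          show "(\<integral>\<^sup>+x\<in>?K. ennreal ((GG j i x)\<^sup>2) \<partial>lborel) \<le> sqnorm (GG j i)"
            unfolding sqnorm_def by (intro nn_integral_mono) (auto simp: indicator_def)
        qed (auto simp: H_def intro!: mono C)
        finally show "(\<integral>\<^sup>+x\<in>?K. ennreal ((partial_deriv j (partial_deriv i (w n)) x)\<^sup>2) \<partial>lborel) \<le> 2 * sqnorm (GG j i) + 2 * H j i n" .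
      qed
      finally show ?thesis by (simp add: \<Gamma>_def sum.distrib sum_distrib_left)
    qed
    have "ennreal ((w n a)\<^sup>2) * emeasure lborel ?K \<le> 3 * (\<integral>\<^sup>+x\<in>?K. ennreal ((w n x)\<^sup>2) \<partial>lborel)
      + 3 * (ennreal ((r * diam)\<^sup>2) * (\<integral>\<^sup>+x\<in>?K. ennreal (grad_sq (w n) x) \<partial>lborel))
      + 3 * (ennreal ((r * diam) ^ 4) * (\<integral>\<^sup>+x\<in>?K. ennreal (hess_sq (w n) x) \<partial>lborel))"
      by (rule vertex_value_bound[OF w C(1,2,3,5)])
    also have "\<dots> \<le> 3 * (8 * (ennreal ((r * diam)\<^sup>2) * g r) + 2 * A n) + 3 * (ennreal ((r * diam)\<^sup>2) * (2 * g r + 2 * (\<Sum>i\<in>UNIV. B i n)))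
      + 3 * (ennreal ((r * diam) ^ 4) * (2 * \<Gamma> + 2 * (\<Sum>i\<in>UNIV. \<Sum>j\<in>UNIV. H j i n)))"
      by (intro add_mono mult_left_mono 1 2 3) auto
    also have "\<dots> = Q r + E r n"
    proof -
      have "3 * (8 * (p * g) + 2 * A) + 3 * (p * (2 * g + 2 * B)) + 3 * (q * (2 * c + 2 * d))
         = 30 * (p * g) + 6 * (q * c) + (6 * A + 6 * (p * B) + 6 * (q * d))" for p q g A B c d :: ennreal
      proof -
        have "3 * (8 * (p * g) + 2 * A) + 3 * (p * (2 * g + 2 * B)) + 3 * (q * (2 * c + 2 * d))
          = (24 * (p * g) + 6 * (p * g)) + 6 * (q * c) + (6 * A + 6 * (p * B) + 6 * (q * d))"
          by (simp add: distrib_left mult.assoc[symmetric] mult.commute[of p 2] mult.commute[of q 2] mult.commute[of _ "2::ennreal"] add_ac)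
        also have "24 * (p * g) + 6 * (p * g) = 30 * (p * g)" by (simp add: distrib_right[symmetric])
        finally show ?thesis .
      qed
      then show ?thesis unfolding Q_def E_def by simp
    qed
    finally have "ennreal (1 / r\<^sup>2) * (ennreal ((w n a)\<^sup>2) * (ennreal (r\<^sup>2) * ennreal m)) \<le> ennreal (1 / r\<^sup>2) * (Q r + E r n)"
      unfolding C(6) measure_closure_D(1) m_def by (rule mult_left_mono) simp
    moreover have "ennreal (1 / r\<^sup>2) * (ennreal ((w n a)\<^sup>2) * (ennreal (r\<^sup>2) * ennreal m)) = ennreal ((w n a)\<^sup>2 * m)"
      using r m by (simp add: ennreal_mult[symmetric])
    ultimately show ?thesis by (simp add: distrib_left)
  qed
  define r where "r k = 1 / real (Suc k)" for k
  have r: "0 < r k" "r k \<le> 1" "r \<longlonglongrightarrow> 0" for k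
  proof -
    show "r \<longlonglongrightarrow> 0" unfolding r_def by (rule LIMSEQ_Suc[OF lim_1_over_n])
  qed (auto simp: r_def)
  \<comment> \<open>Absolute continuity of the integral: the balls shrink to the null set
    \<open>{a}\<close>.\<close>
  have g0: "(\<lambda>k. g (r k)) \<longlonglongrightarrow> 0"
  proof -
    have [measurable]: "cball a (2 * r k * diam) \<in> sets borel" for k by simp
    have "(\<lambda>k. \<integral>\<^sup>+x. ennreal ((G i x)\<^sup>2 * indicator (cball a (2 * r k * diam)) x) \<partial>lborel) \<longlonglongrightarrow> 0" for i
    proof (rule nn_integral_tendsto_zero[where w="\<lambda>x. ennreal ((G i x)\<^sup>2)"])
      show "AE x in lborel. (\<lambda>k. (G i x)\<^sup>2 * indicator (cball a (2 * r k * diam)) x) \<longlonglongrightarrow> 0"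
        using AE_lborel_singleton[of a]
      proof eventually_elim
        fix x assume x: "x \<noteq> a"
        have "(\<lambda>k. 2 * r k * diam) \<longlonglongrightarrow> 2 * 0 * diam" by (intro tendsto_intros r)
        then have "\<forall>\<^sub>F k in sequentially. 2 * r k * diam < dist a x"
          by (rule order_tendstoD) (use x in auto)
        then have "\<forall>\<^sub>F k in sequentially. (G i x)\<^sup>2 * indicator (cball a (2 * r k * diam)) x = 0"
          by eventually_elim auto
        then show "(\<lambda>k. (G i x)\<^sup>2 * indicator (cball a (2 * r k * diam)) x) \<longlonglongrightarrow> 0" by (rule tendsto_eventually)
      qed
      show "AE x in lborel. ennreal ((G i x)\<^sup>2 * indicator (cball a (2 * r k * diam)) x) \<le> ennreal ((G i x)\<^sup>2)" for k
        by (intro AE_I2 ennreal_leI) (auto simp: indicator_def)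
      show "(\<integral>\<^sup>+x. ennreal ((G i x)\<^sup>2) \<partial>lborel) < \<infinity>" using u'(6) by (simp add: sqnorm_def)
    qed measurable
    then have "(\<lambda>k. \<Sum>i\<in>UNIV. \<integral>\<^sup>+x. ennreal ((G i x)\<^sup>2 * indicator (cball a (2 * r k * diam)) x) \<partial>lborel) \<longlonglongrightarrow> (\<Sum>i\<in>(UNIV::2 set). 0)"
      by (intro tendsto_sum)
    then show ?thesis by (simp add: g_def ennreal_mult ennreal_indicator)
  qed
  \<comment> \<open>The corner has measure \<open>r\<^sup>2 m\<close>, so \<open>Q r\<close> has to
    be small compared with \<open>r\<^sup>2\<close>. After the division the gradient term keeps the
    factor \<open>g r\<close> and the Hessian term keeps \<open>r\<^sup>2\<close>.\<close>
  have Q0: "(\<lambda>k. ennreal (1 / (r k)\<^sup>2) * Q (r k)) \<longlonglongrightarrow> 0"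
  proof -
    have e: "ennreal (1 / (r k)\<^sup>2) * Q (r k) = 30 * (ennreal (diam\<^sup>2) * g (r k)) + (6 * \<Gamma>) * ennreal ((r k)\<^sup>2 * diam ^ 4)" for k
    proof -
      have 1: "ennreal (1 / (r k)\<^sup>2) * ennreal ((r k * diam)\<^sup>2) = ennreal (diam\<^sup>2)"
        using r(1)[of k] by (simp add: ennreal_mult[symmetric] power_mult_distrib)
      have "1 / (r k)\<^sup>2 * (r k * diam) ^ 4 = (r k)\<^sup>2 * diam ^ 4"
        using r(1)[of k] by (simp add: power_mult_distrib power4_eq_xxxx power2_eq_square)
      then have 2: "ennreal (1 / (r k)\<^sup>2) * ennreal ((r k * diam) ^ 4) = ennreal ((r k)\<^sup>2 * diam ^ 4)"
        by (simp add: ennreal_mult[symmetric] del: ennreal_mult)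
      have "c * (30 * (p * g) + 6 * (q * t)) = 30 * ((c * p) * g) + (6 * t) * (c * q)" for c p q g t :: ennreal
        by (simp add: distrib_left mult_ac)
      then show ?thesis unfolding Q_def using 1 2 by simp
    qed
    have "(\<lambda>k. (r k)\<^sup>2 * diam ^ 4) \<longlonglongrightarrow> 0\<^sup>2 * diam ^ 4" by (intro tendsto_intros r)
    then have "(\<lambda>k. ennreal ((r k)\<^sup>2 * diam ^ 4)) \<longlonglongrightarrow> ennreal 0" by (intro tendsto_ennrealI) simp
    then have "(\<lambda>k. 30 * (ennreal (diam\<^sup>2) * g (r k)) + (6 * \<Gamma>) * ennreal ((r k)\<^sup>2 * diam ^ 4)) \<longlonglongrightarrow> 30 * (ennreal (diam\<^sup>2) * 0) + (6 * \<Gamma>) * ennreal 0"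
      using \<Gamma>fin by (intro tendsto_add ennreal_tendsto_cmult g0) (auto simp: ennreal_mult_less_top)
    then show ?thesis unfolding e by simp
  qed
  have "(\<lambda>n. ennreal ((w n a)\<^sup>2 * m)) \<longlonglongrightarrow> 0"
  proof (rule order_tendstoI)
    fix y :: ennreal assume "0 < y"
    then have "\<forall>\<^sub>F k in sequentially. ennreal (1 / (r k)\<^sup>2) * Q (r k) < y" by (rule order_tendstoD(2)[OF Q0])
    then obtain k where k: "ennreal (1 / (r k)\<^sup>2) * Q (r k) < y" by (auto simp: eventually_sequentially)
    have "(\<lambda>n. ennreal (1 / (r k)\<^sup>2) * Q (r k) + ennreal (1 / (r k)\<^sup>2) * E (r k) n) \<longlonglongrightarrow> ennreal (1 / (r k)\<^sup>2) * Q (r k) + ennreal (1 / (r k)\<^sup>2) * 0"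
      by (intro tendsto_add tendsto_const ennreal_tendsto_cmult E0) auto
    then have "\<forall>\<^sub>F n in sequentially. ennreal (1 / (r k)\<^sup>2) * Q (r k) + ennreal (1 / (r k)\<^sup>2) * E (r k) n < y"
      by (rule order_tendstoD(2)) (use k in simp)
    then show "\<forall>\<^sub>F n in sequentially. ennreal ((w n a)\<^sup>2 * m) < y"
      by eventually_elim (rule le_less_trans[OF bound[OF r(1,2)]])
  qed auto
  then have "(\<lambda>n. (w n a)\<^sup>2 * m) \<longlonglongrightarrow> 0"
    using m tendsto_ennreal_iff[of "\<lambda>n. (w n a)\<^sup>2 * m" sequentially 0] by simp
  then have "(\<lambda>n. (w n a)\<^sup>2 * m / m) \<longlonglongrightarrow> 0 / m" by (intro tendsto_intros) (use m in auto)
  then have "(\<lambda>n. (w n a)\<^sup>2) \<longlonglongrightarrow> 0" using m by simp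
  from tendsto_real_sqrt[OF this] have "(\<lambda>n. \<bar>w n a\<bar>) \<longlonglongrightarrow> 0" by simp
  then show ?thesis by (rule tendsto_rabs_zero_cancel)
qed

end

section \<open>Triangular meshes\<close>

lemma open_triangle_hull:
  assumes "open_triangle T"
  obtains a b c where "\<not> affine_dependent {a, b, c}" "a \<noteq> b" "a \<noteq> c" "b \<noteq> c"
    "closure T = convex hull {a, b, c}" "vertices T = {a, b, c}" "open T" "convex T" "T \<noteq> {}"
    "area T = \<bar>(a - c) $ 1 * (b - c) $ 2 - (a - c) $ 2 * (b - c) $ 1\<bar> / 2"
proof -
  obtain a b c where abc: "\<not> collinear {a, b, c}" "T = interior (convex hull {a, b, c})"
    using assms by (auto simp: open_triangle_def)
  have ad: "\<not> affine_dependent {a, b, c}" "a \<noteq> b" "a \<noteq> c" "b \<noteq> c"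
    using abc(1) by (auto simp: collinear_3_eq_affine_dependent)
  have "card {a, b, c} = Suc DIM(plane)" using ad by simp
  then have ne: "T \<noteq> {}" unfolding abc(2) using interior_convex_hull_eq_empty ad(1) by blast
  have comp: "compact (convex hull {a, b, c})" by (intro finite_imp_compact_convex_hull) auto
  have cl: "closure T = convex hull {a, b, c}"
    unfolding abc(2) using convex_closure_interior[of "convex hull {a, b, c}"] ne abc(2) comp
    by (simp add: compact_imp_closed)
  have v: "vertices T = {a, b, c}"
    unfolding vertices_def cl using extreme_point_of_convex_hull_affine_independent[OF ad(1)] by auto
  have "negligible (frontier (convex hull {a, b, c}))" by (intro negligible_convex_frontier) auto
  then have "area T = measure lebesgue (convex hull {a, b, c})"
    unfolding area_def abc(2) using comp by (intro measure_interior compact_imp_bounded)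
  also have "\<dots> = measure lborel (convex hull {a, b, c})"
    using comp by (intro measure_completion) (auto simp: borel_compact)
  also have "\<dots> = \<bar>(a - c) $ 1 * (b - c) $ 2 - (a - c) $ 2 * (b - c) $ 1\<bar> / 2"
  proof -
    have "(c $ 1 - a $ 1) * (b $ 2 - a $ 2) - (b $ 1 - a $ 1) * (c $ 2 - a $ 2)
      = - ((a - c) $ 1 * (b - c) $ 2 - (a - c) $ 2 * (b - c) $ 1)" by (simp add: algebra_simps)
    then show ?thesis unfolding content_triangle by (simp only: abs_minus_cancel)
  qed
  finally have ar: "area T = \<bar>(a - c) $ 1 * (b - c) $ 2 - (a - c) $ 2 * (b - c) $ 1\<bar> / 2" .
  show ?thesis using that[OF ad cl v _ _ ne ar] abc(2) by (simp add: convex_interior)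
qed

text \<open>Cramer's rule: a vector is recovered from its products with two edge vectors, at the
  price of the reciprocal of their determinant, which is twice the area of the triangle.\<close>

lemma solve_2x2_bound:
  fixes p q d :: plane
  assumes "norm p \<le> h" "norm q \<le> h" and "A \<le> \<bar>p $ 1 * q $ 2 - p $ 2 * q $ 1\<bar>" "0 < A"
  shows "norm d \<le> 2 * h / A * (\<bar>d \<bullet> p\<bar> + \<bar>d \<bullet> q\<bar>)"
proof -
  define \<Delta> where "\<Delta> = p $ 1 * q $ 2 - p $ 2 * q $ 1"
  have c: "\<bar>p $ i\<bar> \<le> h" "\<bar>q $ i\<bar> \<le> h" for i
    using component_le_norm_cart[of p i] component_le_norm_cart[of q i] assms by linarith+
  have h0: "0 \<le> h" using assms(1) norm_ge_zero[of p] by linarith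
  have ip: "d \<bullet> p = d $ 1 * p $ 1 + d $ 2 * p $ 2" "d \<bullet> q = d $ 1 * q $ 1 + d $ 2 * q $ 2"
    by (simp_all add: inner_vec_def sum_2)
  have 1: "d $ 1 * \<Delta> = (d \<bullet> p) * q $ 2 - (d \<bullet> q) * p $ 2" "d $ 2 * \<Delta> = (d \<bullet> q) * p $ 1 - (d \<bullet> p) * q $ 1"
    unfolding ip \<Delta>_def by (simp_all add: algebra_simps)
  have gen: "\<bar>X * s - Y * t\<bar> \<le> h * (\<bar>X\<bar> + \<bar>Y\<bar>)" if "\<bar>s\<bar> \<le> h" "\<bar>t\<bar> \<le> h" for X Y s t :: real
  proof -
    have "\<bar>X * s - Y * t\<bar> \<le> \<bar>X\<bar> * \<bar>s\<bar> + \<bar>Y\<bar> * \<bar>t\<bar>" using abs_triangle_ineq4[of "X * s" "Y * t"] by (simp add: abs_mult)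
    also have "\<dots> \<le> \<bar>X\<bar> * h + \<bar>Y\<bar> * h" using that by (intro add_mono mult_left_mono) auto
    finally show ?thesis by (simp add: algebra_simps)
  qed
  let ?s = "\<bar>d \<bullet> p\<bar> + \<bar>d \<bullet> q\<bar>"
  have 2: "\<bar>d $ 1\<bar> * \<bar>\<Delta>\<bar> \<le> h * ?s" "\<bar>d $ 2\<bar> * \<bar>\<Delta>\<bar> \<le> h * ?s"
    unfolding abs_mult[symmetric] 1 using gen[OF c(2) c(1)] gen[OF c(1) c(2), where X="d \<bullet> q" and Y="d \<bullet> p"] by (auto simp: add.commute)
  have 3: "\<bar>d $ i\<bar> * A \<le> \<bar>d $ i\<bar> * \<bar>\<Delta>\<bar>" for i using assms by (intro mult_left_mono) (auto simp: \<Delta>_def)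
  have "norm d * A \<le> (\<bar>d $ 1\<bar> + \<bar>d $ 2\<bar>) * A"
    using norm_le_l1_cart[of d] assms by (intro mult_right_mono) (auto simp: sum_2)
  also have "\<dots> \<le> h * ?s + h * ?s" unfolding distrib_right using 2 3[of 1] 3[of 2] by linarith
  finally show ?thesis using assms(4) by (simp add: field_simps)
qed

text \<open>Only the slope is named; the constant term cancels in every difference of
  values.\<close>

definition affine_on :: "plane set \<Rightarrow> (plane \<Rightarrow> real) \<Rightarrow> plane \<Rightarrow> bool" where
  "affine_on S v \<alpha> \<longleftrightarrow> (\<exists>\<beta>. \<forall>x\<in>S. v x = \<alpha> \<bullet> x + \<beta>)"

lemma affine_onD: "affine_on S v \<alpha> \<Longrightarrow> x \<in> S \<Longrightarrow> y \<in> S \<Longrightarrow> v x - v y = \<alpha> \<bullet> (x - y)"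
  by (auto simp: affine_on_def inner_diff_right)

definition elem_grad :: "(plane \<Rightarrow> real) \<Rightarrow> plane set \<Rightarrow> plane" where
  "elem_grad v T = (SOME \<alpha>. affine_on (closure T) v \<alpha>)"

text \<open>A half-space is convex, so it contains the hull of \<open>S\<close> once it contains
  \<open>S\<close>. This discrete maximum principle yields positivity, uniqueness and the bound on
  the sum of the nodal basis.\<close>

lemma affine_nonneg_hull:
  assumes "affine_on (convex hull S) v \<alpha>" "\<And>a. a \<in> S \<Longrightarrow> 0 \<le> v a" "x \<in> convex hull S"
  shows "0 \<le> v x"
proof -
  obtain \<beta> where \<beta>: "\<And>x. x \<in> convex hull S \<Longrightarrow> v x = \<alpha> \<bullet> x + \<beta>" using assms(1) by (auto simp: affine_on_def)
  have "S \<subseteq> {x. - \<beta> \<le> \<alpha> \<bullet> x}"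
  proof
    fix a assume "a \<in> S"
    then show "a \<in> {x. - \<beta> \<le> \<alpha> \<bullet> x}" using assms(2)[of a] \<beta>[of a] hull_inc[of a S] by simp
  qed
  then have "convex hull S \<subseteq> {x. - \<beta> \<le> \<alpha> \<bullet> x}"
    by (rule hull_minimal[where S=convex, OF _ convex_halfspace_ge])
  then show ?thesis using \<beta>[OF assms(3)] assms(3) by auto
qed

text \<open>One mesh of the family. The area constant \<open>cq\<close> is a parameter shared by all
  meshes, so every constant built from \<open>D\<close> and \<open>cq\<close> alone is independent
  of \<open>h\<close>.\<close>

locale fe_mesh = convex_domain +
  fixes Th :: "plane set set" and h cq :: real and z :: "nat \<Rightarrow> plane" and \<phi> :: "nat \<Rightarrow> plane \<Rightarrow> real"
  assumes adm: "admissible_triangulation D Th" and mesh_size: "max_edge_length Th = h"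
    and h: "0 < h" "h \<le> 1" and cq: "0 < cq" "\<And>T. T \<in> Th \<Longrightarrow> cq * h\<^sup>2 \<le> area T"
    and lagrange: "lagrange_basis D Th z \<phi>"
begin

abbreviation "N \<equiv> fe_dim D Th"
abbreviation "V \<equiv> fe_space D Th"

lemma Th: "finite Th" "\<And>T. T \<in> Th \<Longrightarrow> open_triangle T" "\<And>T. T \<in> Th \<Longrightarrow> T \<subseteq> D"
  "(\<Union>T\<in>Th. closure T) = closure D" "\<And>T T'. T \<in> Th \<Longrightarrow> T' \<in> Th \<Longrightarrow> T \<noteq> T' \<Longrightarrow> T \<inter> T' = {}"
  using adm by (auto simp: admissible_triangulation_def pairwise_def disjnt_def)

lemma edge_length_le:
  assumes T: "T \<in> Th" and ad: "\<not> affine_dependent {a, b, c}" "a \<noteq> b" and cl: "closure T = convex hull {a, b, c}"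
  shows "norm (a - b) \<le> h"
proof -
  \<comment> \<open>\<open>Max\<close> bounds its elements only for finite sets; a polytope has
    finitely many faces, hence finitely many edges.\<close>
  have fin: "finite (\<Union>T\<in>Th. diameter ` edges T)"
  proof (intro finite_UN_I Th(1) finite_imageI)
    fix S assume "S \<in> Th"
    from Th(2)[OF this] obtain a' b' c' where "closure S = convex hull {a', b', c'}"
      by (rule open_triangle_hull)
    then have "polytope (closure S)" by (simp add: polytope_convex_hull)
    then have "finite {F. F face_of closure S}" by (rule finite_polytope_faces)
    then show "finite (edges S)" by (rule finite_subset[rotated]) (auto simp: edges_def edge_of_def)
  qed
  have "convex hull {a, b} face_of convex hull {a, b, c}"
    unfolding face_of_convex_hull_affine_independent[OF ad(1)] by (intro exI[of _ "{a, b}"]) auto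
  moreover have "aff_dim (convex hull {a, b}) = 1" using ad(2) by (simp only: aff_dim_convex_hull aff_dim_2 if_False)
  ultimately have e: "convex hull {a, b} \<in> edges T" by (simp add: edges_def edge_of_def cl)
  have "norm (a - b) = dist a b" by (simp add: dist_norm)
  also have "\<dots> \<le> diameter (convex hull {a, b})"
    by (intro diameter_bounded_bound compact_imp_bounded finite_imp_compact_convex_hull hull_inc) auto
  also have "\<dots> \<le> Max (\<Union>T\<in>Th. diameter ` edges T)" using e T by (intro Max_ge fin) auto
  finally show ?thesis using mesh_size by (simp add: max_edge_length_def)
qed

text \<open>The bound on \<open>d\<close> is Cramer's rule with a determinant of at least
  \<open>2 * cq * h\<^sup>2\<close>: the area condition of quasi-uniformity excludes flat
  triangles.\<close>

lemma triangle:
  assumes T: "T \<in> Th"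
  obtains a b c where "closure T = convex hull {a, b, c}" "vertices T = {a, b, c}"
    "norm (a - c) \<le> h" "norm (b - c) \<le> h"
    "\<And>d. norm d \<le> 1 / (cq * h) * (\<bar>d \<bullet> (a - c)\<bar> + \<bar>d \<bullet> (b - c)\<bar>)" "area T \<le> h\<^sup>2"
proof -
  obtain a b c where t: "\<not> affine_dependent {a, b, c}" "a \<noteq> b" "a \<noteq> c" "b \<noteq> c"
    "closure T = convex hull {a, b, c}" "vertices T = {a, b, c}" "open T" "convex T" "T \<noteq> {}"
    "area T = \<bar>(a - c) $ 1 * (b - c) $ 2 - (a - c) $ 2 * (b - c) $ 1\<bar> / 2"
    by (rule open_triangle_hull[OF Th(2)[OF T]])
  have 1: "norm (a - c) \<le> h"
    by (rule edge_length_le[OF T, of a c b]) (use t in \<open>simp_all add: insert_commute\<close>)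
  have 2: "norm (b - c) \<le> h"
    by (rule edge_length_le[OF T, of b c a]) (use t in \<open>simp_all add: insert_commute\<close>)
  have A: "2 * (cq * h\<^sup>2) \<le> \<bar>(a - c) $ 1 * (b - c) $ 2 - (a - c) $ 2 * (b - c) $ 1\<bar>"
    using cq(2)[OF T] unfolding t(10) by simp
  have A0: "0 < 2 * (cq * h\<^sup>2)" using cq h by simp
  have 3: "norm d \<le> 1 / (cq * h) * (\<bar>d \<bullet> (a - c)\<bar> + \<bar>d \<bullet> (b - c)\<bar>)" for d
  proof -
    have "2 * h / (2 * (cq * h\<^sup>2)) = 1 / (cq * h)" using cq h by (simp add: power2_eq_square)
    then show ?thesis using solve_2x2_bound[OF 1 2 A A0, of d] by simp
  qed
  have c: "\<bar>(a - c) $ i\<bar> \<le> h" "\<bar>(b - c) $ i\<bar> \<le> h" for i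
    using component_le_norm_cart[of "a - c" i] component_le_norm_cart[of "b - c" i] 1 2 by linarith+
  have "\<bar>(a - c) $ 1 * (b - c) $ 2\<bar> \<le> h * h" "\<bar>(a - c) $ 2 * (b - c) $ 1\<bar> \<le> h * h"
    unfolding abs_mult using c h by (intro mult_mono; simp)+
  then have "\<bar>(a - c) $ 1 * (b - c) $ 2 - (a - c) $ 2 * (b - c) $ 1\<bar> \<le> 2 * (h * h)" by linarith
  then have 4: "area T \<le> h\<^sup>2" unfolding t(10) power2_eq_square by simp
  show ?thesis by (rule that[OF t(5,6) 1 2 3 4])
qed

lemma T_facts:
  assumes T: "T \<in> Th"
  shows "open T" "convex T" "T \<in> sets borel" "emeasure lborel T = ennreal (area T)" "0 < area T" "area T \<le> h\<^sup>2"
    "closure T = convex hull (vertices T)" "closure T \<subseteq> closure D" "vertices T \<subseteq> closure T"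
    "measure lborel T = area T"
proof -
  show o: "open T" "convex T" by (rule open_triangle_hull[OF Th(2)[OF T]], assumption)+
  then show m: "T \<in> sets borel" by simp
  have "bounded T" using Th(3)[OF T] bounded_D bounded_subset by blast
  then have "emeasure lborel T < \<infinity>" by (rule emeasure_bounded_finite)
  moreover have a: "measure lborel T = area T" using m by (simp add: area_def measure_completion)
  ultimately show "emeasure lborel T = ennreal (area T)" "measure lborel T = area T"
    by (simp_all add: emeasure_eq_ennreal_measure less_top[symmetric])
  show "0 < area T" using cq(2)[OF T] cq(1) h by (smt (verit) mult_pos_pos zero_less_power)
  show "area T \<le> h\<^sup>2" by (rule triangle[OF T])
  show c: "closure T = convex hull (vertices T)" by (rule triangle[OF T]) simp
  show "closure T \<subseteq> closure D" using Th(4) T by blast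
  show "vertices T \<subseteq> closure T" unfolding c by (rule hull_subset)
qed

lemma diam_T:
  assumes T: "T \<in> Th" and xy: "x \<in> closure T" "y \<in> closure T"
  shows "norm (x - y) \<le> h"
proof -
  obtain a b c where t: "\<not> affine_dependent {a, b, c}" "a \<noteq> b" "a \<noteq> c" "b \<noteq> c"
    "closure T = convex hull {a, b, c}" by (rule open_triangle_hull[OF Th(2)[OF T]])
  have "\<exists>u\<in>{a, b, c}. \<exists>v\<in>{a, b, c}. \<forall>x\<in>convex hull {a, b, c}. \<forall>y\<in>convex hull {a, b, c}. norm (x - y) \<le> norm (u - v)"
    by (rule simplex_extremal_le) auto
  then obtain u v where uv: "u \<in> {a, b, c}" "v \<in> {a, b, c}" "norm (x - y) \<le> norm (u - v)" using xy t(5) by blast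
  have "norm (a - b) \<le> h" "norm (a - c) \<le> h" "norm (b - c) \<le> h"
    using t by (auto intro: edge_length_le[OF T, of a b c] edge_length_le[OF T, of a c b] edge_length_le[OF T, of b c a]
      simp: insert_commute)
  then have "norm (u - v) \<le> h" using uv(1,2) h by (auto simp: norm_minus_commute)
  then show ?thesis using uv(3) by linarith
qed

lemma V_affine:
  assumes v: "v \<in> V" and T: "T \<in> Th"
  shows "affine_on (closure T) v (elem_grad v T)"
proof -
  have "\<exists>a b. \<forall>x\<in>T. v x = a \<bullet> x + b" using v T by (simp add: fe_space_def)
  then obtain a b where ab: "\<forall>x\<in>T. v x = a \<bullet> x + b" by (elim exE)
  have cv: "continuous_on (closure T) v"
    using v T_facts(8)[OF T] by (auto simp: fe_space_def intro: continuous_on_subset)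
  have "v x = a \<bullet> x + b" if "x \<in> closure T" for x
  proof -
    have "v x - a \<bullet> x = b"
      by (rule continuous_constant_on_closure[OF _ _ that]) (use cv ab in \<open>auto intro!: continuous_intros\<close>)
    then show ?thesis by simp
  qed
  then have "affine_on (closure T) v a" by (auto simp: affine_on_def)
  then show ?thesis unfolding elem_grad_def by (rule someI)
qed

lemma V_zero: "v \<in> V \<Longrightarrow> x \<notin> D \<Longrightarrow> v x = 0"
  by (auto simp: fe_space_def)

lemma V_lincomb:
  assumes "v \<in> V" "w \<in> V"
  shows "(\<lambda>x. a * v x + b * w x) \<in> V"
proof -
  have "\<exists>c d. \<forall>x\<in>T. a * v x + b * w x = c \<bullet> x + d" if T: "T \<in> Th" for T
  proof -
    have "\<exists>c d. \<forall>x\<in>T. v x = c \<bullet> x + d" "\<exists>c d. \<forall>x\<in>T. w x = c \<bullet> x + d"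
      using assms T by (simp_all add: fe_space_def)
    then obtain c d c' d' where "\<forall>x\<in>T. v x = c \<bullet> x + d" "\<forall>x\<in>T. w x = c' \<bullet> x + d'"
      by (elim exE)
    then show ?thesis
      by (intro exI[of _ "a *\<^sub>R c + b *\<^sub>R c'"] exI[of _ "a * d + b * d'"]) (auto simp: inner_add_left algebra_simps)
  qed
  then show ?thesis using assms by (auto simp: fe_space_def intro!: continuous_intros)
qed

lemma V_zero_fun: "(\<lambda>x. 0) \<in> V"
  by (auto simp: fe_space_def intro: exI[of _ 0])

lemma V_sum:
  assumes "finite J" "\<And>j. j \<in> J \<Longrightarrow> f j \<in> V"
  shows "(\<lambda>x. \<Sum>j\<in>J. c j * f j x) \<in> V"
  using assms
proof (induction J)
  case (insert j J)
  then have "(\<lambda>x. c j * f j x + 1 * (\<Sum>j\<in>J. c j * f j x)) \<in> V" by (intro V_lincomb) auto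
  then show ?case using insert by simp
qed (simp add: V_zero_fun)

section \<open>Nodal values and the Lagrange basis\<close>

lemma basis: "j \<in> {1..N} \<Longrightarrow> \<phi> j \<in> V" "i \<in> {1..N} \<Longrightarrow> j \<in> {1..N} \<Longrightarrow> \<phi> j (z i) = (if i = j then 1 else 0)"
  "bij_betw z {1..N} (interior_nodes D Th)"
  using lagrange by (auto simp: lagrange_basis_def)

lemma vertex_cases:
  assumes "T \<in> Th" "a \<in> vertices T"
  obtains "a \<notin> D" | j where "j \<in> {1..N}" "a = z j"
proof (cases "a \<in> D")
  case True
  then have "a \<in> interior_nodes D Th" using assms by (auto simp: interior_nodes_def)
  then have "a \<in> z ` {1..N}" using basis(3) by (simp add: bij_betw_def)
  then show ?thesis using that(2) by (elim imageE)
qed (rule that)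

text \<open>On each triangle the function is affine, and its vertex values are nonnegative: interior
  vertices are nodes and at boundary vertices it is zero.\<close>

lemma V_nonneg:
  assumes v: "v \<in> V" and nn: "\<And>j. j \<in> {1..N} \<Longrightarrow> 0 \<le> v (z j)"
  shows "0 \<le> v x"
proof (cases "x \<in> D")
  case True
  then obtain T where T: "T \<in> Th" "x \<in> closure T" using Th(4) closure_subset by blast
  show ?thesis
  proof (rule affine_nonneg_hull[of "vertices T"])
    show "affine_on (convex hull vertices T) v (elem_grad v T)" using V_affine[OF v T(1)] T_facts(7)[OF T(1)] by simp
    show "0 \<le> v a" if "a \<in> vertices T" for a
      using vertex_cases[OF T(1) that] nn V_zero[OF v] by (metis order_refl)
    show "x \<in> convex hull vertices T" using T T_facts(7) by simp
  qed
qed (simp add: V_zero[OF v])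

text \<open>The difference of the two sides vanishes at all nodes, so positivity applies to it with
  either sign.\<close>

lemma V_expansion:
  assumes v: "v \<in> V"
  shows "v = (\<lambda>x. \<Sum>j=1..N. v (z j) * \<phi> j x)"
proof -
  define w where "w = (\<lambda>x. \<Sum>j=1..N. v (z j) * \<phi> j x)"
  have w: "w \<in> V" unfolding w_def by (rule V_sum) (auto simp: basis(1))
  have eq: "w (z i) = v (z i)" if "i \<in> {1..N}" for i
    unfolding w_def using that basis(2) by (simp add: if_distrib[of "\<lambda>x. _ * x"] cong: if_cong)
  have "0 \<le> 1 * v x + (-1) * w x" for x by (rule V_nonneg[OF V_lincomb[OF v w]]) (simp add: eq)
  moreover have "0 \<le> 1 * w x + (-1) * v x" for x by (rule V_nonneg[OF V_lincomb[OF w v]]) (simp add: eq)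
  ultimately have "v x = w x" for x by (intro antisym) simp_all
  then have "v = w" by (rule ext)
  then show ?thesis unfolding w_def .
qed

text \<open>Whatever coefficients the choice in \<open>fe_coeff\<close> returns, evaluation at the
  node \<open>z j\<close> singles out the \<open>j\<close>-th one.\<close>

lemma fe_coeff_eq:
  assumes v: "v \<in> V" and j: "j \<in> {1..N}"
  shows "fe_coeff N \<phi> v j = v (z j)"
proof -
  define c where "c = fe_coeff N \<phi> v"
  have "v = (\<lambda>x. \<Sum>j=1..N. c j * \<phi> j x)"
    unfolding c_def fe_coeff_def by (rule someI[of "\<lambda>c. v = (\<lambda>x. \<Sum>j=1..N. c j * \<phi> j x)"]) (rule V_expansion[OF v])
  then have "v (z j) = (\<Sum>i=1..N. c i * \<phi> i (z j))" by (rule fun_cong)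
  also have "\<dots> = c j" using j basis(2) by (simp add: if_distrib[of "\<lambda>x. _ * x"] cong: if_cong)
  finally show ?thesis by (simp add: c_def)
qed

lemma basis_nonneg: "j \<in> {1..N} \<Longrightarrow> 0 \<le> \<phi> j x"
  by (rule V_nonneg) (auto simp: basis)

text \<open>The sum is 1 at interior vertices and 0 at boundary vertices, so 1 minus the sum is
  affine with nonnegative vertex values. Equality fails next to the boundary, whose vertices carry
  no basis function.\<close>

lemma basis_sum_le: 
  assumes "T \<in> Th" "x \<in> closure T"
  shows "(\<Sum>j=1..N. \<phi> j x) \<le> 1"
proof -
  define w where "w = (\<lambda>x. \<Sum>j=1..N. 1 * \<phi> j x)"
  have w: "w \<in> V" unfolding w_def by (rule V_sum) (auto simp: basis(1))
  have eq: "w (z i) = 1" if "i \<in> {1..N}" for i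
    unfolding w_def using that basis(2) by simp
  obtain \<beta> where \<beta>: "\<forall>x\<in>closure T. w x = elem_grad w T \<bullet> x + \<beta>" using V_affine[OF w assms(1)] by (auto simp: affine_on_def)
  have aff: "affine_on (convex hull vertices T) (\<lambda>x. 1 - w x) (- elem_grad w T)"
    unfolding affine_on_def T_facts(7)[OF assms(1), symmetric] using \<beta> by (intro exI[of _ "1 - \<beta>"]) auto
  have "0 \<le> 1 - w x"
  proof (rule affine_nonneg_hull[OF aff])
    show "0 \<le> 1 - w a" if "a \<in> vertices T" for a
      by (rule vertex_cases[OF assms(1) that]) (auto simp: V_zero[OF w] eq)
    show "x \<in> convex hull vertices T" using assms T_facts(7) by simp
  qed
  then show ?thesis by (simp add: w_def)
qed

end

section \<open>Gradients of finite element functions and the discrete Sobolev inequality\<close>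

context fe_mesh
begin

text \<open>The triangles are open, so on the edges, a null set, the value is 0.\<close>

definition fe_grad :: "(plane \<Rightarrow> real) \<Rightarrow> 2 \<Rightarrow> plane \<Rightarrow> real" where
  "fe_grad v i x = (\<Sum>T\<in>Th. indicator T x * (elem_grad v T $ i))"

lemma sum_indicator_T:
  fixes f :: "plane set \<Rightarrow> 'b::{semiring_1}"
  assumes "T \<in> Th" "x \<in> T"
  shows "(\<Sum>S\<in>Th. indicator S x * f S) = f T"
proof -
  have "(\<Sum>S\<in>Th. indicator S x * f S) = (\<Sum>S\<in>Th. if S = T then f S else 0)"
    using Th(5) assms by (intro sum.cong) (auto simp: indicator_def)
  also have "\<dots> = f T" using assms Th(1) by simp
  finally show ?thesis .
qed

lemma fe_grad_T: "T \<in> Th \<Longrightarrow> x \<in> T \<Longrightarrow> fe_grad v i x = elem_grad v T $ i"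
  unfolding fe_grad_def by (rule sum_indicator_T)

lemma fe_grad_outside: "x \<notin> \<Union>Th \<Longrightarrow> fe_grad v i x = 0"
  by (auto simp: fe_grad_def indicator_def)

lemma fe_grad_zero: "x \<notin> D \<Longrightarrow> fe_grad v i x = 0"
  using Th(3) by (intro fe_grad_outside) auto

lemma fe_grad_measurable [measurable]: "fe_grad v i \<in> borel_measurable borel"
  unfolding fe_grad_def[abs_def] using T_facts(3)
  by (intro borel_measurable_sum borel_measurable_times borel_measurable_indicator) auto

lemma AE_frontier_T: "T \<in> Th \<Longrightarrow> AE x in lborel. x \<in> closure T \<longrightarrow> x \<in> T"
proof -
  assume T: "T \<in> Th"
  have "negligible (frontier T)" by (rule negligible_convex_frontier[OF T_facts(2)[OF T]])
  then have "AE x in lebesgue. x \<notin> frontier T" by (intro AE_not_in) (simp add: negligible_iff_null_sets)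
  then have "AE x in lborel. x \<notin> frontier T" by (simp only: AE_completion_iff)
  then show ?thesis by eventually_elim (use T_facts(1)[OF T] in \<open>auto simp: frontier_def interior_open\<close>)
qed

lemma AE_mesh: "AE x in lborel. x \<in> closure D \<longrightarrow> x \<in> \<Union>Th"
proof -
  have "AE x in lborel. \<forall>T\<in>Th. x \<in> closure T \<longrightarrow> x \<in> T"
    using Th(1) AE_frontier_T by (intro AE_finite_allI) auto
  then show ?thesis by eventually_elim (use Th(4) in blast)
qed

text \<open>The segment from \<open>x\<close> to \<open>y\<close> is covered by finitely many closed
  pieces, where it runs in a closed triangle or in the complement of \<open>D\<close>. On each piece
  the bound is immediate, and Lipschitz bounds on a finite closed cover of an interval combine to
  one on the interval.\<close>

lemma V_lipschitz:
  assumes v: "v \<in> V" and L: "\<And>T. T \<in> Th \<Longrightarrow> norm (elem_grad v T) \<le> L" "0 \<le> L"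
  shows "\<bar>v x - v y\<bar> \<le> L * norm (x - y)"
proof -
  define p where "p t = x + t *\<^sub>R (y - x)" for t :: real
  have pc: "continuous_on UNIV p" unfolding p_def by (intro continuous_intros)
  define U where "U S = {t. p t \<in> S}" for S
  have pd: "norm (p s - p t) = \<bar>s - t\<bar> * norm (y - x)" for s t
    unfolding p_def by (simp add: scaleR_diff_left[symmetric])
  have "(L * norm (y - x))-lipschitz_on {0..1} (\<lambda>t. v (p t))"
  proof (rule lipschitz_on_closed_Union[where I="insert (- D) (closure ` Th)" and U=U])
    fix S assume S: "S \<in> insert (- D) (closure ` Th)"
    then have "closed S" using open_D by (auto simp: closed_Compl)
    then show "closed (U S)" unfolding U_def
      using continuous_closed_vimage[OF _ , of S p] pc by (simp add: continuous_on_eq_continuous_at vimage_def)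
    show "(L * norm (y - x))-lipschitz_on (U S) (\<lambda>t. v (p t))"
    proof (rule lipschitz_onI)
      fix s t assume st: "s \<in> U S" "t \<in> U S"
      show "dist (v (p s)) (v (p t)) \<le> L * norm (y - x) * dist s t"
      proof (cases "S = - D")
        case True
        then show ?thesis using st V_zero[OF v] L(2) by (simp add: U_def)
      next
        case False
        then obtain T where T: "T \<in> Th" "S = closure T" using S by auto
        have "v (p s) - v (p t) = elem_grad v T \<bullet> (p s - p t)"
          using st T(2) by (intro affine_onD[OF V_affine[OF v T(1)]]) (auto simp: U_def)
        also have "\<bar>elem_grad v T \<bullet> (p s - p t)\<bar> \<le> norm (elem_grad v T) * norm (p s - p t)" by (rule Cauchy_Schwarz_ineq2)
        also have "\<dots> \<le> L * norm (p s - p t)" using L(1)[OF T(1)] by (intro mult_right_mono) auto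
        finally show ?thesis unfolding pd by (simp add: dist_real_def mult_ac)
      qed
    qed (use L in auto)
  next
    show "{0..1} \<subseteq> (\<Union>S\<in>insert (- D) (closure ` Th). U S)"
    proof
      fix t :: real
      show "t \<in> (\<Union>S\<in>insert (- D) (closure ` Th). U S)"
      proof (cases "p t \<in> D")
        case True
        then obtain T where "T \<in> Th" "p t \<in> closure T" using Th(4) closure_subset by blast
        then show ?thesis by (auto simp: U_def)
      qed (auto simp: U_def)
    qed
  qed (use Th(1) L in auto)
  then have "dist (v (p 0)) (v (p 1)) \<le> L * norm (y - x) * dist 0 (1::real)"
    by (rule lipschitz_onD) auto
  then show ?thesis by (simp add: p_def dist_real_def norm_minus_commute)
qed

lemma V_derivative:
  assumes v: "v \<in> V"
  shows "AE x in lborel. (\<lambda>n. (v (x + (1 / real (Suc n)) *\<^sub>R axis i 1) - v x) * real (Suc n)) \<longlonglongrightarrow> fe_grad v i x"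
  using AE_mesh
proof eventually_elim
  fix x assume x: "x \<in> closure D \<longrightarrow> x \<in> \<Union>Th"
  have lim: "(\<lambda>n. x + (1 / real (Suc n)) *\<^sub>R axis i 1) \<longlonglongrightarrow> x + 0 *\<^sub>R axis i 1"
    by (intro tendsto_intros LIMSEQ_Suc[OF lim_1_over_n])
  have ev: "\<forall>\<^sub>F n in sequentially. x + (1 / real (Suc n)) *\<^sub>R axis i 1 \<in> S" if "open S" "x \<in> S" for S
    using topological_tendstoD[OF lim that(1)] that(2) by simp
  show "(\<lambda>n. (v (x + (1 / real (Suc n)) *\<^sub>R axis i 1) - v x) * real (Suc n)) \<longlonglongrightarrow> fe_grad v i x"
  proof (cases "x \<in> closure D")
    case True
    then obtain T where T: "T \<in> Th" "x \<in> T" using x by auto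
    have "\<forall>\<^sub>F n in sequentially. (v (x + (1 / real (Suc n)) *\<^sub>R axis i 1) - v x) * real (Suc n) = fe_grad v i x"
      using ev[OF T_facts(1)[OF T(1)] T(2)]
    proof eventually_elim
      fix n assume n: "x + (1 / real (Suc n)) *\<^sub>R axis i 1 \<in> T"
      have "v (x + (1 / real (Suc n)) *\<^sub>R axis i 1) - v x = elem_grad v T \<bullet> ((x + (1 / real (Suc n)) *\<^sub>R axis i 1) - x)"
        using n T closure_subset[of T] by (intro affine_onD[OF V_affine[OF v T(1)]]) auto
      then show "(v (x + (1 / real (Suc n)) *\<^sub>R axis i 1) - v x) * real (Suc n) = fe_grad v i x"
        by (simp add: inner_axis fe_grad_T[OF T])
    qed
    then show ?thesis by (rule tendsto_eventually)
  next
    case False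
    then have "\<forall>\<^sub>F n in sequentially. x + (1 / real (Suc n)) *\<^sub>R axis i 1 \<in> - closure D" by (intro ev) auto
    then have "\<forall>\<^sub>F n in sequentially. (v (x + (1 / real (Suc n)) *\<^sub>R axis i 1) - v x) * real (Suc n) = fe_grad v i x"
    proof eventually_elim
      fix n assume "x + (1 / real (Suc n)) *\<^sub>R axis i 1 \<in> - closure D"
      then have "x + (1 / real (Suc n)) *\<^sub>R axis i 1 \<notin> D" "x \<notin> D" using False closure_subset by blast+
      then show "(v (x + (1 / real (Suc n)) *\<^sub>R axis i 1) - v x) * real (Suc n) = fe_grad v i x"
        using V_zero[OF v] fe_grad_zero by simp
    qed
    then show ?thesis by (rule tendsto_eventually)
  qed
qed

lemma fe_grad_le:
  assumes L: "\<And>T. T \<in> Th \<Longrightarrow> norm (elem_grad v T) \<le> L" "0 \<le> L"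
  shows "\<bar>fe_grad v i x\<bar> \<le> L"
proof (cases "x \<in> \<Union>Th")
  case True
  then obtain T where T: "T \<in> Th" "x \<in> T" by auto
  then show ?thesis using component_le_norm_cart[of "elem_grad v T" i] L(1)[OF T(1)] by (simp add: fe_grad_T[OF T])
qed (use L in \<open>simp add: fe_grad_outside\<close>)

lemma V_approx:
  assumes v: "v \<in> V" and L: "\<And>T. T \<in> Th \<Longrightarrow> norm (elem_grad v T) \<le> L" "0 \<le> L"
  shows "sob D v v (fe_grad v)"
    and "\<exists>\<phi>. (\<forall>n. test_function D (\<phi> n)) \<and> (\<lambda>n. sqnorm (\<lambda>x. \<phi> n x - v x)) \<longlonglongrightarrow> 0 \<and>
     (\<forall>i. (\<lambda>n. sqnorm (\<lambda>x. partial_deriv i (\<phi> n) x - fe_grad v i x)) \<longlonglongrightarrow> 0) \<and>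
     (\<forall>x. (\<lambda>n. \<phi> n x) \<longlonglongrightarrow> v x) \<and> (\<forall>n x y. \<bar>\<phi> n x - \<phi> n y\<bar> \<le> 2 * L * norm (x - y))"
  by (rule lipschitz_sob[OF V_lipschitz[OF v L] V_zero[OF v] fe_grad_measurable fe_grad_zero fe_grad_le[OF L] V_derivative[OF v]]; assumption)+

lemma elem_grad_bound:
  obtains L where "\<And>T. T \<in> Th \<Longrightarrow> norm (elem_grad v T) \<le> L" "0 \<le> L"
proof
  show "norm (elem_grad v T) \<le> (\<Sum>T\<in>Th. norm (elem_grad v T))" if "T \<in> Th" for T
    using that Th(1) by (intro member_le_sum) auto
  show "0 \<le> (\<Sum>T\<in>Th. norm (elem_grad v T))" by (intro sum_nonneg) auto
qed

lemma V_sob: "v \<in> V \<Longrightarrow> sob D v v (fe_grad v)"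
proof -
  assume v: "v \<in> V"
  obtain L where L: "\<And>T. T \<in> Th \<Longrightarrow> norm (elem_grad v T) \<le> L" "0 \<le> L" by (rule elem_grad_bound, rule that)
  show ?thesis by (rule V_approx(1)[OF v L])
qed

lemma V_H10: "v \<in> V \<Longrightarrow> v \<in> H10 D"
proof -
  assume v: "v \<in> V"
  obtain L where L: "\<And>T. T \<in> Th \<Longrightarrow> norm (elem_grad v T) \<le> L" "0 \<le> L" by (rule elem_grad_bound, rule that)
  show ?thesis unfolding H10_sob[OF open_D bounded_D V_sob[OF v]] using V_approx(2)[OF v L] by blast
qed

text \<open>A single triangle, on which the gradient is constant, already carries the energy
  \<open>(norm (elem_grad v T))\<^sup>2 * area T\<close>.\<close>

lemma inverse_estimate:
  assumes v: "v \<in> V" and T: "T \<in> Th"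
  shows "(norm (elem_grad v T))\<^sup>2 * (cq * h\<^sup>2) \<le> ip (fe_grad v) (fe_grad v)"
proof -
  have c: "(elem_grad v T $ i)\<^sup>2 * area T \<le> (\<integral>x. fe_grad v i x * fe_grad v i x \<partial>lborel)" for i
  proof -
    have "integrable lborel (\<lambda>x. fe_grad v i x * fe_grad v i x)"
      using sobD[OF V_sob[OF v]] by (intro product_integrable) auto
    moreover have "integrable lborel (\<lambda>x. (elem_grad v T $ i)\<^sup>2 * indicator T x)"
      using T_facts(3,4)[OF T] by (intro integrable_mult_right integrable_real_indicator) auto
    ultimately have "(\<integral>x. (elem_grad v T $ i)\<^sup>2 * indicator T x \<partial>lborel) \<le> (\<integral>x. fe_grad v i x * fe_grad v i x \<partial>lborel)"
      by (intro integral_mono) (auto simp: indicator_def fe_grad_T[OF T] power2_eq_square)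
    then show ?thesis using T_facts(10)[OF T] by simp
  qed
  have "(norm (elem_grad v T))\<^sup>2 * (cq * h\<^sup>2) \<le> (norm (elem_grad v T))\<^sup>2 * area T"
    by (intro mult_left_mono cq T) auto
  also have "\<dots> = (\<Sum>i\<in>UNIV. (elem_grad v T $ i)\<^sup>2 * area T)"
    unfolding power2_norm_eq_inner by (simp add: inner_vec_def sum_distrib_right power2_eq_square)
  also have "\<dots> \<le> ip (fe_grad v) (fe_grad v)" unfolding ip_def by (intro sum_mono c)
  finally show ?thesis .
qed

text \<open>The numbers 16 and 32 are the 8 of the smooth estimate times 2, from splitting off the
  approximation error, and times 4, from the Lipschitz constant \<open>2 * L\<close> of the
  approximants. The \<open>+ 1\<close> inside \<open>ln\<close> comes from the radius
  \<open>diam + 1\<close>, the one outside from \<open>ln (1 / h) \<le> ell h\<close>. Only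
  \<open>D\<close> and \<open>cq\<close> occur.\<close>

definition sobolev_const :: real where
  "sobolev_const = 16 * (ln (diam + 1) + 1) / measure lborel annulus + 32 / cq"

lemma ip_nonneg: "0 \<le> ip G G"
  unfolding ip_def by (intro sum_nonneg Bochner_Integration.integral_nonneg) auto

text \<open>The smooth estimate is applied to the test functions approximating \<open>v\<close>; their Lipschitz constant is controlled by
  the inverse estimate.\<close>

lemma discrete_sobolev:
  assumes v: "v \<in> V" and x: "x \<in> D"
  shows "(v x)\<^sup>2 \<le> sobolev_const * ell h * ip (fe_grad v) (fe_grad v)"
proof -
  define S where "S = ip (fe_grad v) (fe_grad v)"
  have S0: "0 \<le> S" unfolding S_def by (rule ip_nonneg)
  define m where "m = measure lborel annulus"
  have m: "0 < m" unfolding m_def by (rule annulus)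
  \<comment> \<open>Chosen so that the inverse estimate bounds all element gradients by
    \<open>L\<close>; then \<open>L\<^sup>2 * h\<^sup>2 = S / cq\<close> is free of
    \<open>h\<close>.\<close>
  define L where "L = sqrt (S / (cq * h\<^sup>2))"
  have L0: "0 \<le> L" using S0 cq(1) by (simp add: L_def)
  have L2: "L\<^sup>2 * h\<^sup>2 = S / cq" using S0 cq(1) h by (simp add: L_def)
  have L: "norm (elem_grad v T) \<le> L" if T: "T \<in> Th" for T
    unfolding L_def using inverse_estimate[OF v T] cq(1) h
    by (intro real_le_rsqrt) (simp add: S_def pos_le_divide_eq)
  obtain \<psi> where \<psi>: "\<And>n. test_function D (\<psi> n)"
     "\<And>i. (\<lambda>n. sqnorm (\<lambda>x. partial_deriv i (\<psi> n) x - fe_grad v i x)) \<longlonglongrightarrow> 0"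
     "\<And>x. (\<lambda>n. \<psi> n x) \<longlonglongrightarrow> v x" "\<And>n x y. \<bar>\<psi> n x - \<psi> n y\<bar> \<le> 2 * L * norm (x - y)"
    using V_approx(2)[OF v L L0] by blast
  note sv = sobD[OF V_sob[OF v]]
  \<comment> \<open>Strictly larger than the diameter, so the approximants vanish at distance
    \<open>R\<close> from \<open>x\<close>, and at least 1, so \<open>h \<le> R\<close>.\<close>
  define R where "R = diam + 1"
  have R: "1 \<le> R" using diam(2) by (simp add: R_def)
  have z: "\<psi> n y = 0" if "R \<le> norm (y - x)" for n y
  proof (rule test_function_zero[OF \<psi>(1)])
    show "y \<notin> D" using diam(1)[of y x] x that closure_subset[of D] by (auto simp: R_def)
  qed
  define X where "X = (\<Sum>i\<in>UNIV. sqnorm (fe_grad v i))"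
  have XS: "X = ennreal S"
    unfolding X_def S_def using sob_seminorm[OF open_D bounded_D V_sob[OF v]] by simp
  define c where "c = 8 * ln (R / h)"
  have c0: "0 \<le> c" unfolding c_def using R h by simp
  define e where "e n = (\<Sum>i\<in>UNIV. sqnorm (\<lambda>x. partial_deriv i (\<psi> n) x - fe_grad v i x))" for n
  have e0: "e \<longlonglongrightarrow> 0"
  proof -
    have "e \<longlonglongrightarrow> (\<Sum>i\<in>(UNIV::2 set). 0)" unfolding e_def by (intro tendsto_sum \<psi>)
    then show ?thesis by simp
  qed
  have b: "ennreal (m * (\<psi> n x)\<^sup>2) \<le> ennreal c * (2 * X + 2 * e n) + ennreal (32 * S / cq * m)" for n
  proof -
    have "ennreal (m * (\<psi> n x)\<^sup>2) \<le> ennreal c * (\<Sum>i\<in>UNIV. sqnorm (partial_deriv i (\<psi> n))) + ennreal (8 * (2 * L)\<^sup>2 * h\<^sup>2 * m)"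
      unfolding c_def m_def
      by (rule discrete_sobolev_smooth[OF test_function_mono[OF \<psi>(1)] z h(1) _ \<psi>(4)]) (use R h in auto)
    also have "8 * (2 * L)\<^sup>2 * h\<^sup>2 * m = 32 * S / cq * m"
    proof -
      have "8 * (2 * L)\<^sup>2 * h\<^sup>2 * m = 32 * (L\<^sup>2 * h\<^sup>2) * m" by (simp add: power_mult_distrib)
      then show ?thesis unfolding L2 by simp
    qed
    also have "ennreal c * (\<Sum>i\<in>UNIV. sqnorm (partial_deriv i (\<psi> n))) + ennreal (32 * S / cq * m)
      \<le> ennreal c * (2 * X + 2 * e n) + ennreal (32 * S / cq * m)"
    proof (intro add_mono mult_left_mono)
      have "sqnorm (partial_deriv i (\<psi> n)) \<le> 2 * sqnorm (fe_grad v i) + 2 * sqnorm (\<lambda>x. partial_deriv i (\<psi> n) x - fe_grad v i x)" for i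
        using sqnorm_add[of "fe_grad v i" "\<lambda>x. partial_deriv i (\<psi> n) x - fe_grad v i x"]
          test_function_measurable[OF test_function_partial[OF \<psi>(1)]] by simp
      then have "(\<Sum>i\<in>UNIV. sqnorm (partial_deriv i (\<psi> n))) \<le> (\<Sum>i\<in>UNIV. 2 * sqnorm (fe_grad v i) + 2 * sqnorm (\<lambda>x. partial_deriv i (\<psi> n) x - fe_grad v i x))"
        by (rule sum_mono)
      then show "(\<Sum>i\<in>UNIV. sqnorm (partial_deriv i (\<psi> n))) \<le> 2 * X + 2 * e n"
        by (simp add: X_def e_def sum.distrib sum_distrib_left)
    qed auto
    finally show ?thesis .
  qed
  have "(\<lambda>n. ennreal (m * (\<psi> n x)\<^sup>2)) \<longlonglongrightarrow> ennreal (m * (v x)\<^sup>2)"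
    by (intro tendsto_ennrealI tendsto_intros \<psi>)
  moreover have "(\<lambda>n. ennreal c * (2 * X + 2 * e n) + ennreal (32 * S / cq * m)) \<longlonglongrightarrow> ennreal c * (2 * X + 2 * 0) + ennreal (32 * S / cq * m)"
    by (intro tendsto_add tendsto_const ennreal_tendsto_cmult e0) auto
  ultimately have "ennreal (m * (v x)\<^sup>2) \<le> ennreal c * (2 * X + 2 * 0) + ennreal (32 * S / cq * m)"
    by (rule LIMSEQ_le) (use b in auto)
  also have "\<dots> = ennreal (c * (2 * S) + 32 * S / cq * m)"
    unfolding XS using c0 S0 cq(1) m by (simp add: ennreal_mult ennreal_plus)
  finally have "m * (v x)\<^sup>2 \<le> c * (2 * S) + 32 * S / cq * m"
    using c0 S0 cq(1) m by (subst (asm) ennreal_le_iff) auto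
  also have "\<dots> \<le> (8 * ((ln R + 1) * ell h)) * (2 * S) + 32 * S / cq * m * ell h"
  proof (intro add_mono mult_right_mono)
    have l1: "1 \<le> ell h" "ln (1 / h) \<le> ell h" by (auto simp: ell_def)
    have "ln (R / h) = ln R + ln (1 / h)" using R h by (simp add: ln_div)
    also have "\<dots> \<le> ln R * ell h + 1 * ell h"
      using l1 R mult_left_mono[OF l1(1), of "ln R"] by (intro add_mono) auto
    finally show "c \<le> 8 * ((ln R + 1) * ell h)" by (simp add: c_def distrib_right)
    have "0 \<le> 32 * S / cq * m" using S0 cq(1) m by simp
    then show "32 * S / cq * m \<le> 32 * S / cq * m * ell h" using mult_left_mono[OF l1(1)] by fastforce
  qed (use S0 in auto)
  also have "\<dots> = m * (sobolev_const * ell h * S)"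
    unfolding sobolev_const_def m_def[symmetric] R_def[symmetric] using m cq(1) by (simp add: field_simps)
  finally show ?thesis using m unfolding S_def by simp
qed

lemma sobolev_const_pos: "0 < sobolev_const"
proof -
  have "0 \<le> ln (diam + 1)" using diam(2) by simp
  then have "0 \<le> 16 * (ln (diam + 1) + 1) / measure lborel annulus" using annulus(3) by simp
  then show ?thesis unfolding sobolev_const_def using cq(1) by (intro add_nonneg_pos) auto
qed

end

section \<open>Interpolation and best approximation\<close>

lemma square_sum4: "(a + b + c + d)\<^sup>2 \<le> 4 * a\<^sup>2 + 4 * b\<^sup>2 + 4 * c\<^sup>2 + 4 * (d::real)\<^sup>2"
proof -
  have "0 \<le> (a - b)\<^sup>2 + (a - c)\<^sup>2 + (a - d)\<^sup>2 + (b - c)\<^sup>2 + (b - d)\<^sup>2 + (c - d)\<^sup>2" by simp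
  then show ?thesis by (simp add: power2_eq_square algebra_simps)
qed

context fe_mesh
begin

text \<open>Only interior nodes enter, whether or not \<open>w\<close> vanishes on the boundary; the error estimates carry a bound \<open>\<eta>\<close> for the
  values of \<open>w\<close> at boundary vertices.\<close>

definition interp :: "(plane \<Rightarrow> real) \<Rightarrow> plane \<Rightarrow> real" where
  "interp w = (\<lambda>x. \<Sum>j=1..N. w (z j) * \<phi> j x)"

lemma interp_V: "interp w \<in> V"
  unfolding interp_def by (rule V_sum) (auto simp: basis(1))

lemma interp_node: "i \<in> {1..N} \<Longrightarrow> interp w (z i) = w (z i)"
  unfolding interp_def using basis(2) by (simp add: if_distrib[of "\<lambda>x. _ * x"] cong: if_cong)

lemma interp_vertex:
  assumes "T \<in> Th" "a \<in> vertices T" and \<eta>: "\<And>T a. T \<in> Th \<Longrightarrow> a \<in> vertices T \<Longrightarrow> a \<notin> D \<Longrightarrow> \<bar>w a\<bar> \<le> \<eta>" "0 \<le> \<eta>"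
  shows "\<bar>w a - interp w a\<bar> \<le> \<eta>"
  by (rule vertex_cases[OF assms(1,2)]) (use \<eta> assms V_zero[OF interp_V] interp_node in auto)

text \<open>Along an edge the derivative of the interpolant is a difference of two vertex values,
  and that of \<open>w\<close> at \<open>x\<close> is the same difference up to two Taylor
  remainders and two vertex errors. Cramer's rule recovers the gradient error from two edges, and
  the averaged Taylor estimate bounds the remainders.\<close>

lemma interp_element:
  assumes T: "T \<in> Th" and w: "\<And>k. Ck k w"
    and \<eta>: "\<And>T a. T \<in> Th \<Longrightarrow> a \<in> vertices T \<Longrightarrow> a \<notin> D \<Longrightarrow> \<bar>w a\<bar> \<le> \<eta>" "0 \<le> \<eta>"
  shows "(\<integral>\<^sup>+x\<in>T. ennreal ((norm (grad w x - elem_grad (interp w) T))\<^sup>2) \<partial>lborel)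
    \<le> ennreal (48 * h\<^sup>2 / cq\<^sup>2) * (\<integral>\<^sup>+x\<in>T. ennreal (hess_sq w x) \<partial>lborel) + ennreal (64 * \<eta>\<^sup>2 / (cq * h)\<^sup>2) * emeasure lborel T"
proof -
  note tf = T_facts[OF T]
  have [measurable]: "T \<in> sets borel" by (rule tf)
  note c = C2_facts[OF w]
  have [measurable]: "w \<in> borel_measurable borel" by (rule Ck_measurable[OF w])
  have [measurable]: "partial_deriv i w \<in> borel_measurable borel" for i using c(3) by (rule borel_measurable_continuous_onI)
  have [measurable]: "(\<lambda>x::plane. x $ i) \<in> borel_measurable borel" for i
    by (intro borel_measurable_continuous_onI continuous_intros)
  have "continuous_on UNIV (hess_sq w)"
    unfolding hess_sq_def[abs_def] grad_sq_def using c by (intro continuous_intros) auto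
  then have [measurable]: "hess_sq w \<in> borel_measurable borel" by (rule borel_measurable_continuous_onI)
  define v where "v = interp w"
  have v: "v \<in> V" unfolding v_def by (rule interp_V)
  define R where "R a x = w a - w x - grad w x \<bullet> (a - x)" for a x
  have [measurable]: "R a \<in> borel_measurable borel" for a
    unfolding R_def[abs_def] inner_vec_def by (simp add: vector_minus_component)
  obtain a b d where t: "closure T = convex hull {a, b, d}" "vertices T = {a, b, d}"
    "norm (a - d) \<le> h" "norm (b - d) \<le> h"
    "\<And>e. norm e \<le> 1 / (cq * h) * (\<bar>e \<bullet> (a - d)\<bar> + \<bar>e \<bullet> (b - d)\<bar>)" "area T \<le> h\<^sup>2"
    by (rule triangle[OF T], rule that)
  \<comment> \<open>Each of the two edges contributes \<open>2 * \<eta>\<close> and both end in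
    \<open>d\<close>, whence \<open>4 * \<eta>\<close> and \<open>2 * \<bar>R d x\<bar>\<close>;
    squaring a sum of four terms multiplies by 4.\<close>
  have pt: "(norm (grad w x - elem_grad v T))\<^sup>2 \<le> 1 / (cq * h)\<^sup>2 * (64 * \<eta>\<^sup>2 + 4 * (R a x)\<^sup>2 + 4 * (R b x)\<^sup>2 + 16 * (R d x)\<^sup>2)" for x
  proof -
    let ?e = "grad w x - elem_grad v T"
    have E: "\<bar>?e \<bullet> (p - d)\<bar> \<le> 2 * \<eta> + \<bar>R p x\<bar> + \<bar>R d x\<bar>" if p: "p \<in> {a, b}" for p
    proof -
      have pv: "p \<in> vertices T" "d \<in> vertices T" using p t(2) by auto
      have "elem_grad v T \<bullet> (p - d) = v p - v d"
        using tf(9) pv by (intro affine_onD[OF V_affine[OF v T], symmetric]) auto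
      moreover have "grad w x \<bullet> (p - d) = (w p - R p x) - (w d - R d x)"
        by (simp add: R_def inner_diff_right)
      ultimately have "?e \<bullet> (p - d) = (w p - v p) - (w d - v d) - R p x + R d x"
        by (simp add: inner_diff_left)
      moreover have "\<bar>w p - v p\<bar> \<le> \<eta>" "\<bar>w d - v d\<bar> \<le> \<eta>"
        unfolding v_def
        by (rule interp_vertex[OF T pv(1)], (rule \<eta>; assumption)+)
           (rule interp_vertex[OF T pv(2)], (rule \<eta>; assumption)+)
      ultimately show ?thesis by linarith
    qed
    have "norm ?e \<le> 1 / (cq * h) * (\<bar>?e \<bullet> (a - d)\<bar> + \<bar>?e \<bullet> (b - d)\<bar>)" by (rule t)
    also have "\<dots> \<le> 1 / (cq * h) * (4 * \<eta> + \<bar>R a x\<bar> + \<bar>R b x\<bar> + 2 * \<bar>R d x\<bar>)"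
      using E[of a] E[of b] cq(1) h by (intro mult_left_mono) auto
    finally have "(norm ?e)\<^sup>2 \<le> (1 / (cq * h) * (4 * \<eta> + \<bar>R a x\<bar> + \<bar>R b x\<bar> + 2 * \<bar>R d x\<bar>))\<^sup>2"
      by (intro power_mono) auto
    also have "\<dots> = 1 / (cq * h)\<^sup>2 * (4 * \<eta> + \<bar>R a x\<bar> + \<bar>R b x\<bar> + 2 * \<bar>R d x\<bar>)\<^sup>2"
      by (simp add: power_mult_distrib power_divide)
    also have "\<dots> \<le> 1 / (cq * h)\<^sup>2 * (4 * (4 * \<eta>)\<^sup>2 + 4 * \<bar>R a x\<bar>\<^sup>2 + 4 * \<bar>R b x\<bar>\<^sup>2 + 4 * (2 * \<bar>R d x\<bar>)\<^sup>2)"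
      by (intro mult_left_mono square_sum4) auto
    finally show ?thesis by (simp add: power_mult_distrib)
  qed
  have TR: "(\<integral>\<^sup>+x\<in>T. ennreal ((R p x)\<^sup>2) \<partial>lborel) \<le> ennreal (h ^ 4) * (\<integral>\<^sup>+x\<in>T. ennreal (hess_sq w x) \<partial>lborel)" if p: "p \<in> vertices T" for p
  proof -
    have pc: "p \<in> closure T" using p tf(9) by auto
    have "(\<integral>\<^sup>+x\<in>T. ennreal ((R p x)\<^sup>2) \<partial>lborel) \<le> (\<integral>\<^sup>+x\<in>closure T. ennreal ((R p x)\<^sup>2) \<partial>lborel)"
      using closure_subset[of T] by (intro nn_integral_mono) (auto simp: indicator_def)
    also have "\<dots> \<le> ennreal (h ^ 4) * (\<integral>\<^sup>+x\<in>closure T. ennreal (hess_sq w x) \<partial>lborel)"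
      unfolding R_def by (rule taylor_L2[OF w _ _ pc]) (use tf(2) diam_T[OF T pc] in \<open>auto intro: convex_closure\<close>)
    also have "(\<integral>\<^sup>+x\<in>closure T. ennreal (hess_sq w x) \<partial>lborel) = (\<integral>\<^sup>+x\<in>T. ennreal (hess_sq w x) \<partial>lborel)"
    proof (rule nn_integral_cong_AE)
      show "AE x in lborel. ennreal (hess_sq w x) * indicator (closure T) x = ennreal (hess_sq w x) * indicator T x"
        using AE_frontier_T[OF T] by eventually_elim (use closure_subset[of T] in \<open>auto simp: indicator_def\<close>)
    qed
    finally show ?thesis .
  qed
  define k where "k = 1 / (cq * h)\<^sup>2"
  have k: "0 < k" using cq(1) h by (simp add: k_def)
  let ?H = "\<integral>\<^sup>+x\<in>T. ennreal (hess_sq w x) \<partial>lborel"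
  let ?I = "\<lambda>p. \<integral>\<^sup>+x\<in>T. ennreal ((R p x)\<^sup>2) \<partial>lborel"
  have "(\<integral>\<^sup>+x\<in>T. ennreal ((norm (grad w x - elem_grad v T))\<^sup>2) \<partial>lborel)
     \<le> (\<integral>\<^sup>+x. ennreal (64 * \<eta>\<^sup>2 * k) * indicator T x + ennreal (4 * k) * (ennreal ((R a x)\<^sup>2) * indicator T x)
        + ennreal (4 * k) * (ennreal ((R b x)\<^sup>2) * indicator T x) + ennreal (16 * k) * (ennreal ((R d x)\<^sup>2) * indicator T x) \<partial>lborel)"
  proof (rule nn_integral_mono)
    fix x
    have "ennreal ((norm (grad w x - elem_grad v T))\<^sup>2) \<le> ennreal (64 * \<eta>\<^sup>2 * k + 4 * k * (R a x)\<^sup>2 + 4 * k * (R b x)\<^sup>2 + 16 * k * (R d x)\<^sup>2)"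
      using pt[of x] unfolding k_def[symmetric] by (intro ennreal_leI) (simp add: algebra_simps)
    also have "\<dots> = ennreal (64 * \<eta>\<^sup>2 * k) + ennreal (4 * k) * ennreal ((R a x)\<^sup>2) + ennreal (4 * k) * ennreal ((R b x)\<^sup>2) + ennreal (16 * k) * ennreal ((R d x)\<^sup>2)"
      using k by (simp add: ennreal_plus ennreal_mult[symmetric])
    finally show "ennreal ((norm (grad w x - elem_grad v T))\<^sup>2) * indicator T x \<le> ennreal (64 * \<eta>\<^sup>2 * k) * indicator T x + ennreal (4 * k) * (ennreal ((R a x)\<^sup>2) * indicator T x)
        + ennreal (4 * k) * (ennreal ((R b x)\<^sup>2) * indicator T x) + ennreal (16 * k) * (ennreal ((R d x)\<^sup>2) * indicator T x)"
      by (cases "x \<in> T") auto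
  qed
  also have "\<dots> = ennreal (64 * \<eta>\<^sup>2 * k) * emeasure lborel T + ennreal (4 * k) * ?I a + ennreal (4 * k) * ?I b + ennreal (16 * k) * ?I d"
    by (simp add: nn_integral_add nn_integral_cmult nn_integral_cmult_indicator)
  also have "\<dots> \<le> ennreal (64 * \<eta>\<^sup>2 * k) * emeasure lborel T + ennreal (4 * k) * (ennreal (h ^ 4) * ?H) + ennreal (4 * k) * (ennreal (h ^ 4) * ?H) + ennreal (16 * k) * (ennreal (h ^ 4) * ?H)"
    using t(2) by (intro add_mono mult_left_mono TR) auto
  also have "\<dots> = ennreal (64 * \<eta>\<^sup>2 * k) * emeasure lborel T + ennreal (24 * (k * h ^ 4)) * ?H"
  proof -
    \<comment> \<open>The coefficients of the three remainders add up to
      \<open>4 + 4 + 16 = 24\<close>, within the 48 of the claim.\<close>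
    have "ennreal (4 * k) * (ennreal (h ^ 4) * ?H) + ennreal (4 * k) * (ennreal (h ^ 4) * ?H) + ennreal (16 * k) * (ennreal (h ^ 4) * ?H)
      = (ennreal (4 * k * h ^ 4) + ennreal (4 * k * h ^ 4) + ennreal (16 * k * h ^ 4)) * ?H"
      using k h by (simp add: distrib_right ennreal_mult mult.assoc)
    also have "ennreal (4 * k * h ^ 4) + ennreal (4 * k * h ^ 4) + ennreal (16 * k * h ^ 4) = ennreal (24 * (k * h ^ 4))"
      using k h by (simp add: ennreal_plus[symmetric] del: ennreal_plus)
    finally show ?thesis by (simp add: add.assoc)
  qed
  also have "\<dots> \<le> ennreal (64 * \<eta>\<^sup>2 / (cq * h)\<^sup>2) * emeasure lborel T + ennreal (48 * h\<^sup>2 / cq\<^sup>2) * ?H"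
  proof (intro add_mono mult_right_mono ennreal_leI)
    have "k * h ^ 4 = h\<^sup>2 / cq\<^sup>2" using h cq(1) by (simp add: k_def power4_eq_xxxx power2_eq_square)
    moreover have "24 * (h\<^sup>2 / cq\<^sup>2) \<le> 48 * (h\<^sup>2 / cq\<^sup>2)" by (intro mult_right_mono) auto
    ultimately show "24 * (k * h ^ 4) \<le> 48 * h\<^sup>2 / cq\<^sup>2" by simp
    show "64 * \<eta>\<^sup>2 * k \<le> 64 * \<eta>\<^sup>2 / (cq * h)\<^sup>2" by (simp add: k_def)
  qed auto
  finally show ?thesis unfolding v_def by (simp add: add.commute)
qed

lemma sum_T_le:
  assumes [measurable]: "f \<in> borel_measurable borel"
  shows "(\<Sum>T\<in>Th. \<integral>\<^sup>+x\<in>T. f x \<partial>lborel) \<le> (\<integral>\<^sup>+x\<in>closure D. f x \<partial>lborel)"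
proof -
  have [measurable]: "T \<in> sets borel" if "T \<in> Th" for T using T_facts(3)[OF that] .
  have "(\<Sum>T\<in>Th. \<integral>\<^sup>+x\<in>T. f x \<partial>lborel) = (\<integral>\<^sup>+x. (\<Sum>T\<in>Th. f x * indicator T x) \<partial>lborel)"
    by (rule nn_integral_sum[symmetric]) auto
  also have "\<dots> \<le> (\<integral>\<^sup>+x\<in>closure D. f x \<partial>lborel)"
  proof (rule nn_integral_mono)
    fix x
    show "(\<Sum>T\<in>Th. f x * indicator T x) \<le> f x * indicator (closure D) x"
    proof (cases "x \<in> \<Union>Th")
      case True
      then obtain T where T: "T \<in> Th" "x \<in> T" by auto
      have "(\<Sum>T\<in>Th. f x * indicator T x) = f x"
        using sum_indicator_T[OF T, of "\<lambda>_. f x"] by (simp add: mult.commute)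
      moreover have "x \<in> closure D" using T Th(3) closure_subset by blast
      ultimately show ?thesis by simp
    next
      case False
      then have "(\<Sum>T\<in>Th. f x * indicator T x) = (\<Sum>T\<in>Th. 0)" by (intro sum.cong) auto
      then show ?thesis by simp
    qed
  qed
  finally show ?thesis .
qed

lemma interp_error:
  assumes w: "\<And>k. Ck k w"
    and \<eta>: "\<And>T a. T \<in> Th \<Longrightarrow> a \<in> vertices T \<Longrightarrow> a \<notin> D \<Longrightarrow> \<bar>w a\<bar> \<le> \<eta>" "0 \<le> \<eta>"
  shows "(\<Sum>i\<in>UNIV. \<integral>\<^sup>+x\<in>closure D. ennreal ((partial_deriv i w x - fe_grad (interp w) i x)\<^sup>2) \<partial>lborel)
    \<le> ennreal (48 * h\<^sup>2 / cq\<^sup>2) * (\<integral>\<^sup>+x\<in>closure D. ennreal (hess_sq w x) \<partial>lborel) + ennreal (64 * \<eta>\<^sup>2 / (cq * h)\<^sup>2) * emeasure lborel (closure D)"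
proof -
  note c = C2_facts[OF w]
  have pm[measurable]: "partial_deriv i w \<in> borel_measurable borel" for i using c(3) by (rule borel_measurable_continuous_onI)
  have "continuous_on UNIV (hess_sq w)"
    unfolding hess_sq_def[abs_def] grad_sq_def using c by (intro continuous_intros) auto
  then have [measurable]: "hess_sq w \<in> borel_measurable borel" by (rule borel_measurable_continuous_onI)
  have Tm: "T \<in> sets borel" if "T \<in> Th" for T using T_facts(3)[OF that] .
  have [measurable]: "closure D \<in> sets borel" by simp
  let ?v = "interp w"
  have "(\<Sum>i\<in>UNIV. \<integral>\<^sup>+x\<in>closure D. ennreal ((partial_deriv i w x - fe_grad ?v i x)\<^sup>2) \<partial>lborel)
    = (\<integral>\<^sup>+x\<in>closure D. ennreal (\<Sum>i\<in>UNIV. (partial_deriv i w x - fe_grad ?v i x)\<^sup>2) \<partial>lborel)"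
    unfolding sum_2 by (subst nn_integral_add[symmetric], measurable) (simp add: ennreal_plus distrib_right)
  also have "\<dots> = (\<integral>\<^sup>+x. (\<Sum>T\<in>Th. ennreal ((norm (grad w x - elem_grad ?v T))\<^sup>2) * indicator T x) \<partial>lborel)"
  proof (rule nn_integral_cong_AE)
    show "AE x in lborel. ennreal (\<Sum>i\<in>UNIV. (partial_deriv i w x - fe_grad ?v i x)\<^sup>2) * indicator (closure D) x
      = (\<Sum>T\<in>Th. ennreal ((norm (grad w x - elem_grad ?v T))\<^sup>2) * indicator T x)"
      using AE_mesh
    proof eventually_elim
      fix x assume x: "x \<in> closure D \<longrightarrow> x \<in> \<Union>Th"
      show "ennreal (\<Sum>i\<in>UNIV. (partial_deriv i w x - fe_grad ?v i x)\<^sup>2) * indicator (closure D) x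
        = (\<Sum>T\<in>Th. ennreal ((norm (grad w x - elem_grad ?v T))\<^sup>2) * indicator T x)"
      proof (cases "x \<in> \<Union>Th")
        case True
        then obtain T where T: "T \<in> Th" "x \<in> T" by auto
        have "x \<in> closure D" using T Th(3) closure_subset by blast
        moreover have "(\<Sum>i\<in>UNIV. (partial_deriv i w x - fe_grad ?v i x)\<^sup>2) = (norm (grad w x - elem_grad ?v T))\<^sup>2"
          unfolding power2_norm_eq_inner by (simp add: inner_vec_def fe_grad_T[OF T] power2_eq_square)
        ultimately show ?thesis
          using sum_indicator_T[OF T, of "\<lambda>T. ennreal ((norm (grad w x - elem_grad ?v T))\<^sup>2)"]
          by (simp add: mult.commute)
      next
        case False
        then have "x \<notin> closure D" using x by blast
        moreover have "(\<Sum>T\<in>Th. ennreal ((norm (grad w x - elem_grad ?v T))\<^sup>2) * indicator T x) = (\<Sum>T\<in>Th. 0)"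
          using False by (intro sum.cong) auto
        ultimately show ?thesis by simp
      qed
    qed
  qed
  also have "\<dots> = (\<Sum>T\<in>Th. \<integral>\<^sup>+x\<in>T. ennreal ((norm (grad w x - elem_grad ?v T))\<^sup>2) \<partial>lborel)"
  proof (rule nn_integral_sum)
    fix T assume "T \<in> Th"
    note Tm[OF this, measurable]
    have "continuous_on UNIV (\<lambda>x. (norm (grad w x - elem_grad ?v T))\<^sup>2)" by (intro continuous_intros c)
    then have [measurable]: "(\<lambda>x. (norm (grad w x - elem_grad ?v T))\<^sup>2) \<in> borel_measurable borel" by (rule borel_measurable_continuous_onI)
    show "(\<lambda>x. ennreal ((norm (grad w x - elem_grad ?v T))\<^sup>2) * indicator T x) \<in> borel_measurable lborel"
      by measurable
  qed
  also have "\<dots> \<le> (\<Sum>T\<in>Th. ennreal (48 * h\<^sup>2 / cq\<^sup>2) * (\<integral>\<^sup>+x\<in>T. ennreal (hess_sq w x) \<partial>lborel) + ennreal (64 * \<eta>\<^sup>2 / (cq * h)\<^sup>2) * emeasure lborel T)"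
    by (intro sum_mono interp_element w \<eta>)
  also have "\<dots> = ennreal (48 * h\<^sup>2 / cq\<^sup>2) * (\<Sum>T\<in>Th. \<integral>\<^sup>+x\<in>T. ennreal (hess_sq w x) \<partial>lborel) + ennreal (64 * \<eta>\<^sup>2 / (cq * h)\<^sup>2) * (\<Sum>T\<in>Th. \<integral>\<^sup>+x\<in>T. 1 \<partial>lborel)"
    using Tm by (simp add: sum.distrib sum_distrib_left)
  also have "\<dots> \<le> ennreal (48 * h\<^sup>2 / cq\<^sup>2) * (\<integral>\<^sup>+x\<in>closure D. ennreal (hess_sq w x) \<partial>lborel) + ennreal (64 * \<eta>\<^sup>2 / (cq * h)\<^sup>2) * (\<integral>\<^sup>+x\<in>closure D. 1 \<partial>lborel)"
    by (intro add_mono mult_left_mono sum_T_le) auto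
  finally show ?thesis by simp
qed

text \<open>The function \<open>v\<close> interpolates \<open>w n\<close> for \<open>n\<close> so
  large that the smoothing errors and the boundary values of \<open>w n\<close> together weigh less
  than \<open>e\<close>. The boundary values enter divided by \<open>h\<^sup>2\<close>, but the mesh
  is fixed while \<open>n\<close> tends to infinity. The constant is
  \<open>192 = 2 * 48 * 2\<close>: two split squares around the interpolation estimate.\<close>

lemma best_approximation:
  assumes u: "u \<in> H10 D" "sob D u u0 G"
    and GG: "\<And>i j. GG i j \<in> borel_measurable borel" "\<And>i j. sqnorm (GG i j) < \<infinity>"
      "\<And>i j. weak_deriv_on D j (G i) (GG i j)" and e: "(0::ennreal) < e"
  shows "\<exists>v\<in>V. (\<Sum>i\<in>UNIV. sqnorm (\<lambda>x. G i x - fe_grad v i x)) \<le> ennreal (192 * h\<^sup>2 / cq\<^sup>2) * (\<Sum>i\<in>UNIV. \<Sum>j\<in>UNIV. sqnorm (GG i j)) + e"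
proof -
  note u' = sobD[OF u(2)]
  have um[measurable]: "u0 \<in> borel_measurable borel" "G i \<in> borel_measurable borel" "GG i j \<in> borel_measurable borel" for i j
    using u' GG by auto
  obtain w where w: "\<And>n k. Ck k (w n)"
    and wa: "(\<lambda>n. \<integral>\<^sup>+x\<in>closure D. ennreal ((w n x - u0 x)\<^sup>2) \<partial>lborel) \<longlonglongrightarrow> 0"
    and wb: "\<And>i. (\<lambda>n. \<integral>\<^sup>+x\<in>closure D. ennreal ((partial_deriv i (w n) x - G i x)\<^sup>2) \<partial>lborel) \<longlonglongrightarrow> 0"
    and wc: "\<And>i j. (\<lambda>n. \<integral>\<^sup>+x\<in>closure D. ennreal ((partial_deriv i (partial_deriv j (w n)) x - GG i j x)\<^sup>2) \<partial>lborel) \<longlonglongrightarrow> 0"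
  proof (rule H2_smooth_approx[where ?u0.0=u0 and G=G and GG=GG])
    show "u0 \<in> borel_measurable borel" "sqnorm u0 < \<infinity>" "x \<notin> D \<Longrightarrow> u0 x = 0"
      "G i \<in> borel_measurable borel" "sqnorm (G i) < \<infinity>" "weak_deriv_on D i u0 (G i)" for x i
      by (fact u')+
    show "GG i j \<in> borel_measurable borel" "sqnorm (GG i j) < \<infinity>" "weak_deriv_on D j (G i) (GG i j)" for i j
      by (fact GG)+
  qed (rule that)
  note c = C2_facts[OF w]
  have wm[measurable]: "w n \<in> borel_measurable borel" "partial_deriv i (w n) \<in> borel_measurable borel"
    "partial_deriv j (partial_deriv i (w n)) \<in> borel_measurable borel" for n i j
    using Ck_measurable[OF w] borel_measurable_continuous_onI[OF c(3)] borel_measurable_continuous_onI[OF c(4)] by auto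
  have [measurable]: "closure D \<in> sets borel" by simp
  define Bd where "Bd = (\<Union>T\<in>Th. vertices T) - D"
  have Bd: "finite Bd"
  proof -
    have "finite (vertices T)" if "T \<in> Th" for T by (rule triangle[OF that]) simp
    then show ?thesis unfolding Bd_def using Th(1) by auto
  qed
  define \<eta> where "\<eta> n = (\<Sum>a\<in>Bd. \<bar>w n a\<bar>)" for n
  have \<eta>: "\<bar>w n a\<bar> \<le> \<eta> n" if "T \<in> Th" "a \<in> vertices T" "a \<notin> D" for T a n
    unfolding \<eta>_def using that Bd by (intro member_le_sum) (auto simp: Bd_def)
  have \<eta>0: "0 \<le> \<eta> n" for n unfolding \<eta>_def by (intro sum_nonneg) auto
  have "(\<lambda>n. w n a) \<longlonglongrightarrow> 0" if a: "a \<in> Bd" for a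
  proof (rule boundary_value_tendsto[OF _ _ u GG(1,2) w wa wb wc])
    obtain T where T: "T \<in> Th" "a \<in> vertices T" "a \<notin> D" using a by (auto simp: Bd_def)
    show "a \<notin> D" by fact
    show "a \<in> closure D" using T_facts(8,9)[OF T(1)] T(2) by blast
  qed
  then have "\<eta> \<longlonglongrightarrow> (\<Sum>a\<in>Bd. \<bar>0\<bar>)" unfolding \<eta>_def by (intro tendsto_sum tendsto_rabs)
  then have \<eta>lim: "\<eta> \<longlonglongrightarrow> 0" by simp
  define B where "B n = (\<Sum>i\<in>UNIV. \<integral>\<^sup>+x\<in>closure D. ennreal ((partial_deriv i (w n) x - G i x)\<^sup>2) \<partial>lborel)" for n
  define H where "H n = (\<Sum>i\<in>UNIV. \<Sum>j\<in>UNIV. \<integral>\<^sup>+x\<in>closure D. ennreal ((partial_deriv j (partial_deriv i (w n)) x - GG j i x)\<^sup>2) \<partial>lborel)" for n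
  define \<Gamma> where "\<Gamma> = (\<Sum>i\<in>UNIV. \<Sum>j\<in>UNIV. sqnorm (GG i j))"
  define k where "k = ennreal (48 * h\<^sup>2 / cq\<^sup>2)"
  define m where "m = measure lborel (closure D)"
  define E where "E n = 2 * B n + 4 * (k * H n) + ennreal (128 * m / (cq * h)\<^sup>2 * (\<eta> n)\<^sup>2)" for n
  have "(\<lambda>n. 128 * m / (cq * h)\<^sup>2 * (\<eta> n)\<^sup>2) \<longlonglongrightarrow> 128 * m / (cq * h)\<^sup>2 * 0\<^sup>2" by (intro tendsto_intros \<eta>lim)
  then have l1: "(\<lambda>n. ennreal (128 * m / (cq * h)\<^sup>2 * (\<eta> n)\<^sup>2)) \<longlonglongrightarrow> ennreal 0" by (intro tendsto_ennrealI) simp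
  have l2: "B \<longlonglongrightarrow> (\<Sum>i\<in>(UNIV::2 set). 0)" unfolding B_def by (intro tendsto_sum wb)
  have l3: "H \<longlonglongrightarrow> (\<Sum>i\<in>(UNIV::2 set). \<Sum>j\<in>(UNIV::2 set). 0)" unfolding H_def by (intro tendsto_sum wc)
  have "E \<longlonglongrightarrow> 2 * 0 + 4 * (k * 0) + ennreal 0"
    unfolding E_def using l1 l2 l3 by (intro tendsto_add ennreal_tendsto_cmult) (auto simp: k_def)
  then have "E \<longlonglongrightarrow> 0" by simp
  then have "\<forall>\<^sub>F n in sequentially. E n < e" using e by (rule order_tendstoD)
  then obtain n where n: "E n < e" by (auto simp: eventually_sequentially)
  let ?v = "interp (w n)"
  have v: "?v \<in> V" by (rule interp_V)
  have hess: "(\<integral>\<^sup>+x\<in>closure D. ennreal (hess_sq (w n) x) \<partial>lborel) \<le> 2 * \<Gamma> + 2 * H n"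
  proof -
    have "(\<integral>\<^sup>+x\<in>closure D. ennreal (hess_sq (w n) x) \<partial>lborel) = (\<Sum>i\<in>UNIV. \<Sum>j\<in>UNIV. \<integral>\<^sup>+x\<in>closure D. ennreal ((partial_deriv j (partial_deriv i (w n)) x)\<^sup>2) \<partial>lborel)"
      unfolding sum_2 by (simp add: nn_integral_add[symmetric] hess_sq_def grad_sq_def sum_2 ennreal_plus distrib_right)
    also have "\<dots> \<le> (\<Sum>i\<in>UNIV. \<Sum>j\<in>UNIV. 2 * sqnorm (GG j i) + 2 * (\<integral>\<^sup>+x\<in>closure D. ennreal ((partial_deriv j (partial_deriv i (w n)) x - GG j i x)\<^sup>2) \<partial>lborel))"
    proof (intro sum_mono)
      fix i j
      have "(\<integral>\<^sup>+x\<in>closure D. ennreal ((partial_deriv j (partial_deriv i (w n)) x)\<^sup>2) \<partial>lborel)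
        = (\<integral>\<^sup>+x\<in>closure D. ennreal ((GG j i x + (partial_deriv j (partial_deriv i (w n)) x - GG j i x))\<^sup>2) \<partial>lborel)" by simp
      also have "\<dots> \<le> 2 * (\<integral>\<^sup>+x\<in>closure D. ennreal ((GG j i x)\<^sup>2) \<partial>lborel) + 2 * (\<integral>\<^sup>+x\<in>closure D. ennreal ((partial_deriv j (partial_deriv i (w n)) x - GG j i x)\<^sup>2) \<partial>lborel)"
        by (rule nn_integral_square_add) auto
      also have "\<dots> \<le> 2 * sqnorm (GG j i) + 2 * (\<integral>\<^sup>+x\<in>closure D. ennreal ((partial_deriv j (partial_deriv i (w n)) x - GG j i x)\<^sup>2) \<partial>lborel)"
      proof (intro add_mono mult_left_mono)
        show "(\<integral>\<^sup>+x\<in>closure D. ennreal ((GG j i x)\<^sup>2) \<partial>lborel) \<le> sqnorm (GG j i)"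
          unfolding sqnorm_def by (intro nn_integral_mono) (auto simp: indicator_def)
      qed auto
      finally show "(\<integral>\<^sup>+x\<in>closure D. ennreal ((partial_deriv j (partial_deriv i (w n)) x)\<^sup>2) \<partial>lborel)
        \<le> 2 * sqnorm (GG j i) + 2 * (\<integral>\<^sup>+x\<in>closure D. ennreal ((partial_deriv j (partial_deriv i (w n)) x - GG j i x)\<^sup>2) \<partial>lborel)" .
    qed
    also have "\<dots> = 2 * (\<Sum>i\<in>UNIV. \<Sum>j\<in>UNIV. sqnorm (GG j i)) + 2 * H n"
      by (simp add: H_def sum.distrib sum_distrib_left)
    also have "(\<Sum>i\<in>UNIV. \<Sum>j\<in>UNIV. sqnorm (GG j i)) = \<Gamma>" unfolding \<Gamma>_def by (rule sum.swap)
    finally show ?thesis .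
  qed
  have "(\<Sum>i\<in>UNIV. sqnorm (\<lambda>x. G i x - fe_grad ?v i x))
    \<le> (\<Sum>i\<in>UNIV. 2 * (\<integral>\<^sup>+x\<in>closure D. ennreal ((partial_deriv i (w n) x - G i x)\<^sup>2) \<partial>lborel)
      + 2 * (\<integral>\<^sup>+x\<in>closure D. ennreal ((partial_deriv i (w n) x - fe_grad ?v i x)\<^sup>2) \<partial>lborel))"
  proof (rule sum_mono)
    fix i
    have zz: "G i x = 0" "fe_grad ?v i x = 0" if "x \<notin> closure D" for x
    proof -
      have "x \<notin> D" using that closure_subset by blast
      then show "G i x = 0" "fe_grad ?v i x = 0" using u'(5) fe_grad_zero by auto
    qed
    have "sqnorm (\<lambda>x. G i x - fe_grad ?v i x) = (\<integral>\<^sup>+x\<in>closure D. ennreal (((G i x - partial_deriv i (w n) x) + (partial_deriv i (w n) x - fe_grad ?v i x))\<^sup>2) \<partial>lborel)"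
      unfolding sqnorm_def
      by (intro nn_integral_cong) (use zz in \<open>auto simp: indicator_def\<close>)
    also have "\<dots> \<le> 2 * (\<integral>\<^sup>+x\<in>closure D. ennreal ((G i x - partial_deriv i (w n) x)\<^sup>2) \<partial>lborel)
       + 2 * (\<integral>\<^sup>+x\<in>closure D. ennreal ((partial_deriv i (w n) x - fe_grad ?v i x)\<^sup>2) \<partial>lborel)"
      by (rule nn_integral_square_add) auto
    finally show "sqnorm (\<lambda>x. G i x - fe_grad ?v i x) \<le> 2 * (\<integral>\<^sup>+x\<in>closure D. ennreal ((partial_deriv i (w n) x - G i x)\<^sup>2) \<partial>lborel)
      + 2 * (\<integral>\<^sup>+x\<in>closure D. ennreal ((partial_deriv i (w n) x - fe_grad ?v i x)\<^sup>2) \<partial>lborel)"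
      by (simp add: power2_commute)
  qed
  also have "\<dots> = 2 * B n + 2 * (\<Sum>i\<in>UNIV. \<integral>\<^sup>+x\<in>closure D. ennreal ((partial_deriv i (w n) x - fe_grad ?v i x)\<^sup>2) \<partial>lborel)"
    by (simp add: B_def sum.distrib sum_distrib_left)
  also have "\<dots> \<le> 2 * B n + 2 * (k * (\<integral>\<^sup>+x\<in>closure D. ennreal (hess_sq (w n) x) \<partial>lborel) + ennreal (64 * (\<eta> n)\<^sup>2 / (cq * h)\<^sup>2) * emeasure lborel (closure D))"
    unfolding k_def by (intro add_mono mult_left_mono interp_error w \<eta> \<eta>0 order_refl) auto
  also have "\<dots> \<le> 2 * B n + 2 * (k * (2 * \<Gamma> + 2 * H n) + ennreal (64 * (\<eta> n)\<^sup>2 / (cq * h)\<^sup>2) * emeasure lborel (closure D))"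
    by (intro add_mono mult_left_mono hess order_refl) auto
  also have "\<dots> = 4 * (k * \<Gamma>) + E n"
  proof -
    have "2 * (ennreal (64 * (\<eta> n)\<^sup>2 / (cq * h)\<^sup>2) * emeasure lborel (closure D)) = ennreal (128 * m / (cq * h)\<^sup>2 * (\<eta> n)\<^sup>2)"
    proof -
      have m: "0 < m" unfolding m_def by (rule measure_closure_D)
      have "2 * (ennreal q * ennreal m) = ennreal (2 * (q * m))" if "0 \<le> q" for q
        using m that by (simp add: ennreal_mult)
      then have "2 * (ennreal (64 * (\<eta> n)\<^sup>2 / (cq * h)\<^sup>2) * ennreal m) = ennreal (2 * (64 * (\<eta> n)\<^sup>2 / (cq * h)\<^sup>2 * m))"
        by simp
      also have "2 * (64 * (\<eta> n)\<^sup>2 / (cq * h)\<^sup>2 * m) = 128 * m / (cq * h)\<^sup>2 * (\<eta> n)\<^sup>2" by simp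
      finally show ?thesis unfolding measure_closure_D(1) m_def .
    qed
    moreover have "2 * b + 2 * (k * (2 * g + 2 * h) + x) = 4 * (k * g) + (2 * b + 4 * (k * h) + 2 * x)" for b k g h x :: ennreal
      by (simp add: distrib_left mult.left_commute[of k 2] add_ac)
    ultimately show ?thesis unfolding E_def by (simp only:)
  qed
  also have "4 * (k * \<Gamma>) = ennreal (192 * h\<^sup>2 / cq\<^sup>2) * \<Gamma>"
  proof -
    have "4 * ennreal q = ennreal (4 * q)" if "0 \<le> q" for q using that by (simp add: ennreal_mult)
    then have "4 * k = ennreal (4 * (48 * h\<^sup>2 / cq\<^sup>2))" unfolding k_def by simp
    also have "4 * (48 * h\<^sup>2 / cq\<^sup>2) = 192 * h\<^sup>2 / cq\<^sup>2" by simp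
    finally show ?thesis by (simp add: mult.assoc[symmetric])
  qed
  also have "ennreal (192 * h\<^sup>2 / cq\<^sup>2) * \<Gamma> + E n \<le> ennreal (192 * h\<^sup>2 / cq\<^sup>2) * \<Gamma> + e"
    using n by (intro add_left_mono less_imp_le)
  finally show ?thesis using v unfolding \<Gamma>_def by blast
qed

end

section \<open>Galerkin projection and discrete Green functions\<close>

text \<open>Elimination of the last unknown. With \<open>y\<close> solving the leading block for the
  last column, the Schur complement \<open>s\<close> is the value of the quadratic form at the
  vector \<open>(- y, 1)\<close> and hence positive, so the last unknown is found by
  division.\<close>

lemma positive_definite_solvable:
  fixes A :: "nat \<Rightarrow> nat \<Rightarrow> real"
  assumes sym: "\<And>i j. i \<in> {1..n} \<Longrightarrow> j \<in> {1..n} \<Longrightarrow> A i j = A j i"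
    and pos: "\<And>c. \<exists>i\<in>{1..n}. c i \<noteq> 0 \<Longrightarrow> 0 < (\<Sum>i=1..n. \<Sum>j=1..n. c i * c j * A i j)"
  shows "\<exists>x. \<forall>i\<in>{1..n}. (\<Sum>j=1..n. A i j * x j) = b i"
  using assms
proof (induction n arbitrary: b)
  case (Suc n)
  let ?m = "Suc n"
  have pos_n: "0 < (\<Sum>i=1..n. \<Sum>j=1..n. c i * c j * A i j)" if c: "\<exists>i\<in>{1..n}. c i \<noteq> 0" for c
  proof -
    have "0 < (\<Sum>i=1..?m. \<Sum>j=1..?m. (c(?m := 0)) i * (c(?m := 0)) j * A i j)"
    proof (rule Suc.prems(2))
      obtain i where "i \<in> {1..n}" "c i \<noteq> 0" using c by blast
      then show "\<exists>i\<in>{1..?m}. (c(?m := 0)) i \<noteq> 0" by (intro bexI[of _ i]) auto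
    qed
    also have "\<dots> = (\<Sum>i=1..n. \<Sum>j=1..n. c i * c j * A i j)"
      by (simp add: sum.cl_ivl_Suc)
    finally show ?thesis .
  qed
  have IH: "\<exists>x. \<forall>i\<in>{1..n}. (\<Sum>j=1..n. A i j * x j) = b i" for b
    by (rule Suc.IH) (use Suc.prems(1) pos_n in auto)
  obtain y where y: "\<And>i. i \<in> {1..n} \<Longrightarrow> (\<Sum>j=1..n. A i j * y j) = A i ?m" using IH[of "\<lambda>i. A i ?m"] by blast
  obtain x where x: "\<And>i. i \<in> {1..n} \<Longrightarrow> (\<Sum>j=1..n. A i j * x j) = b i" using IH[of b] by blast
  define s where "s = A ?m ?m - (\<Sum>j=1..n. A ?m j * y j)"
  have "s > 0"
  proof -
    define c where "c i = (if i = ?m then 1 else - y i)" for i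
    have "0 < (\<Sum>i=1..?m. \<Sum>j=1..?m. c i * c j * A i j)"
      by (rule Suc.prems(2)) (auto simp: c_def intro!: bexI[of _ ?m])
    also have "\<dots> = (\<Sum>i=1..?m. c i * (\<Sum>j=1..?m. A i j * c j))"
      unfolding sum_distrib_left by (intro sum.cong refl) (simp add: mult_ac)
    also have "\<dots> = (\<Sum>i=1..?m. c i * (A i ?m - (\<Sum>j=1..n. A i j * y j)))"
    proof (intro sum.cong refl arg_cong[where f="(*) _"])
      fix i
      have "(\<Sum>j=1..n. A i j * c j) = - (\<Sum>j=1..n. A i j * y j)"
        unfolding sum_negf[symmetric] by (intro sum.cong) (auto simp: c_def)
      then show "(\<Sum>j=1..?m. A i j * c j) = A i ?m - (\<Sum>j=1..n. A i j * y j)"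
        by (simp add: c_def)
    qed
    also have "\<dots> = (\<Sum>i=1..n. c i * (A i ?m - (\<Sum>j=1..n. A i j * y j))) + s" by (simp add: s_def c_def)
    also have "(\<Sum>i=1..n. c i * (A i ?m - (\<Sum>j=1..n. A i j * y j))) = 0" using y by (intro sum.neutral) auto
    finally show ?thesis by simp
  qed
  define t where "t = (b ?m - (\<Sum>j=1..n. A ?m j * x j)) / s"
  define X where "X i = (if i = ?m then t else x i - t * y i)" for i
  have X: "(\<Sum>j=1..?m. A i j * X j) = (\<Sum>j=1..n. A i j * x j) + t * (A i ?m - (\<Sum>j=1..n. A i j * y j))" for i
  proof -
    have "(\<Sum>j=1..n. A i j * X j) = (\<Sum>j=1..n. A i j * x j - t * (A i j * y j))"
      by (intro sum.cong) (auto simp: X_def algebra_simps)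
    then show ?thesis by (simp add: X_def sum_subtractf sum_distrib_left[symmetric] algebra_simps)
  qed
  have "(\<Sum>j=1..?m. A i j * X j) = b i" if i: "i \<in> {1..?m}" for i
  proof (cases "i = ?m")
    case True
    then show ?thesis unfolding X True s_def[symmetric] using \<open>s > 0\<close> by (simp add: t_def)
  next
    case False
    then have "i \<in> {1..n}" using i by auto
    then show ?thesis unfolding X using x y by simp
  qed
  then show ?case by blast
qed simp

section \<open>The energy inner product\<close>

context convex_domain
begin

abbreviation "energy \<equiv> dirichlet_form D"

lemma energy_commute: "energy v w = energy w v"
  by (simp add: dirichlet_form_def inner_commute)

lemma energy_lincomb:
  assumes v: "sob D v v0 G" and w: "sob D w w0 H" and y: "sob D y y0 K"
  shows "energy (\<lambda>x. a * v x + b * w x) y = a * energy v y + b * energy w y"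
proof -
  note v' = sobD[OF v] and w' = sobD[OF w] and y' = sobD[OF y]
  have i: "integrable lborel (\<lambda>x. G i x * K i x)" "integrable lborel (\<lambda>x. H i x * K i x)" for i
    using v' w' y' by (auto intro!: product_integrable)
  have "energy (\<lambda>x. a * v x + b * w x) y = ip (\<lambda>i x. a * G i x + b * H i x) K"
    by (rule sob_dirichlet[OF open_D bounded_D sob_lincomb[OF open_D bounded_D v w] y])
  also have "\<dots> = (\<Sum>i\<in>UNIV. (\<integral>x. a * (G i x * K i x) + b * (H i x * K i x) \<partial>lborel))"
    by (simp add: ip_def algebra_simps)
  also have "\<dots> = a * ip G K + b * ip H K"
    using i by (simp add: ip_def sum.distrib sum_distrib_left)
  finally show ?thesis using sob_dirichlet[OF open_D bounded_D v y] sob_dirichlet[OF open_D bounded_D w y] by simp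
qed

lemma energy_diff:
  assumes v: "sob D v v0 G" and w: "sob D w w0 H" and y: "sob D y y0 K"
  shows "energy (\<lambda>x. v x - w x) y = energy v y - energy w y"
  using energy_lincomb[OF assms, of 1 "-1"] by simp

lemma energy_nonneg: "0 \<le> energy v v"
  unfolding H1_seminorm_sq[symmetric] by simp

end

context fe_mesh
begin

lemma energy_V: "v \<in> V \<Longrightarrow> w \<in> V \<Longrightarrow> energy v w = ip (fe_grad v) (fe_grad w)"
  by (rule sob_dirichlet[OF open_D bounded_D V_sob V_sob])

lemma V_diff: "v \<in> V \<Longrightarrow> w \<in> V \<Longrightarrow> (\<lambda>x. v x - w x) \<in> V"
  using V_lincomb[of v w 1 "-1"] by simp

lemma energy_sum:
  assumes f: "\<And>j. j \<in> J \<Longrightarrow> f j \<in> V" and J: "finite J" and y: "sob D y y0 K"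
  shows "energy (\<lambda>x. \<Sum>j\<in>J. c j * f j x) y = (\<Sum>j\<in>J. c j * energy (f j) y)"
  using J f
proof (induction J)
  case empty
  have "energy (\<lambda>x. 0 * 0 + 0 * 0) y = 0 * energy (\<lambda>x. 0) y + 0 * energy (\<lambda>x. 0) y"
    by (rule energy_lincomb[OF V_sob[OF V_zero_fun] V_sob[OF V_zero_fun] y])
  then show ?case by simp
next
  case (insert j J)
  have s: "(\<lambda>x. \<Sum>j\<in>J. c j * f j x) \<in> V" using insert by (intro V_sum) auto
  have "energy (\<lambda>x. c j * f j x + 1 * (\<Sum>j\<in>J. c j * f j x)) y = c j * energy (f j) y + 1 * energy (\<lambda>x. \<Sum>j\<in>J. c j * f j x) y"
    by (rule energy_lincomb[OF V_sob V_sob[OF s] y]) (use insert in auto)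
  then show ?case using insert by simp
qed

lemma z_in_D: "j \<in> {1..N} \<Longrightarrow> z j \<in> D"
  using basis(3) by (auto simp: bij_betw_def interior_nodes_def)

lemma V_sobolev: "v \<in> V \<Longrightarrow> j \<in> {1..N} \<Longrightarrow> (v (z j))\<^sup>2 \<le> sobolev_const * ell h * energy v v"
  using discrete_sobolev z_in_D energy_V by simp

text \<open>Definiteness comes from the discrete Sobolev inequality: zero energy forces all nodal
  values to vanish.\<close>

lemma V_definite:
  assumes v: "v \<in> V" and 0: "energy v v = 0"
  shows "v = (\<lambda>x. 0)"
proof -
  have "v (z j) = 0" if "j \<in> {1..N}" for j using V_sobolev[OF v that] 0 by simp
  then have "(\<Sum>j=1..N. v (z j) * \<phi> j x) = 0" for x by (intro sum.neutral) auto
  then show ?thesis using V_expansion[OF v] by simp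
qed

text \<open>The coefficients solve the stiffness system with the \<open>k\<close>-th unit vector as
  right-hand side; the stiffness matrix is positive definite because energy is definite on
  \<open>V\<close>.\<close>

lemma green_exists:
  assumes k: "k \<in> {1..N}"
  shows "\<exists>g\<in>V. \<forall>v\<in>V. energy g v = v (z k)"
proof -
  define A where "A i j = energy (\<phi> i) (\<phi> j)" for i j
  have comb: "(\<lambda>x. \<Sum>j=1..N. c j * \<phi> j x) \<in> V" for c by (rule V_sum) (auto simp: basis(1))
  have aaA: "energy (\<lambda>x. \<Sum>j=1..N. c j * \<phi> j x) (\<phi> i) = (\<Sum>j=1..N. c j * A j i)" if "i \<in> {1..N}" for c i
    unfolding A_def by (rule energy_sum[OF _ _ V_sob]) (use that basis(1) in auto)
  have "\<exists>x. \<forall>i\<in>{1..N}. (\<Sum>j=1..N. A i j * x j) = (if i = k then 1 else 0)"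
  proof (rule positive_definite_solvable)
    show "A i j = A j i" for i j by (simp add: A_def energy_commute)
    fix c :: "nat \<Rightarrow> real" assume c: "\<exists>i\<in>{1..N}. c i \<noteq> 0"
    let ?v = "\<lambda>x. \<Sum>j=1..N. c j * \<phi> j x"
    have "energy ?v ?v = (\<Sum>i=1..N. c i * energy (\<phi> i) ?v)"
      by (rule energy_sum[OF _ _ V_sob[OF comb]]) (auto simp: basis(1))
    also have "\<dots> = (\<Sum>i=1..N. c i * (\<Sum>j=1..N. c j * A j i))"
      using aaA by (intro sum.cong) (auto simp: energy_commute[of "\<phi> _"])
    also have "\<dots> = (\<Sum>i=1..N. \<Sum>j=1..N. c i * c j * A i j)"
      by (simp add: sum_distrib_left A_def energy_commute[of "\<phi> _" "\<phi> _"] mult.assoc)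
    finally have e: "energy ?v ?v = (\<Sum>i=1..N. \<Sum>j=1..N. c i * c j * A i j)" .
    obtain i where i: "i \<in> {1..N}" "c i \<noteq> 0" using c by blast
    have "?v (z i) = c i" using i basis(2) by (simp add: if_distrib[of "\<lambda>x. _ * x"] cong: if_cong)
    then have "?v \<noteq> (\<lambda>x. 0)" using i(2) fun_cong[of ?v "\<lambda>x. 0" "z i"] by fastforce
    then have "energy ?v ?v \<noteq> 0" using V_definite[OF comb, of c] by blast
    then have "0 < energy ?v ?v" using energy_nonneg[of ?v] by simp
    then show "0 < (\<Sum>i=1..N. \<Sum>j=1..N. c i * c j * A i j)" unfolding e .
  qed
  then obtain x where x: "\<And>i. i \<in> {1..N} \<Longrightarrow> (\<Sum>j=1..N. A i j * x j) = (if i = k then 1 else 0)" by blast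
  define g where "g = (\<lambda>y. \<Sum>j=1..N. x j * \<phi> j y)"
  have g: "g \<in> V" unfolding g_def by (rule comb)
  have gi: "energy (\<phi> i) g = (if i = k then 1 else 0)" if "i \<in> {1..N}" for i
    using aaA[OF that, of x] x[OF that] unfolding g_def
    by (simp add: energy_commute[of "\<phi> i"] A_def mult.commute)
  have "energy g v = v (z k)" if v: "v \<in> V" for v
  proof -
    have "energy v g = energy (\<lambda>x. \<Sum>j=1..N. v (z j) * \<phi> j x) g" by (subst V_expansion[OF v]) (rule refl)
    also have "\<dots> = (\<Sum>j=1..N. v (z j) * energy (\<phi> j) g)" by (rule energy_sum[OF _ _ V_sob[OF g]]) (auto simp: basis(1))
    also have "\<dots> = (\<Sum>j=1..N. if j = k then v (z j) else 0)" by (intro sum.cong) (auto simp: gi)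
    also have "\<dots> = v (z k)" using k by simp
    finally show ?thesis by (simp add: energy_commute[of g])
  qed
  then show ?thesis using g by blast
qed

definition green :: "nat \<Rightarrow> plane \<Rightarrow> real" where
  "green k = (SOME g. g \<in> V \<and> (\<forall>v\<in>V. energy g v = v (z k)))"

text \<open>The reproducing property applied to \<open>green k\<close> itself identifies its energy
  with its value at \<open>z k\<close>. The discrete Sobolev inequality then bounds the square of
  this number by \<open>sobolev_const * ell h\<close> times the number, and dividing gives the third
  claim.\<close>

lemma green:
  assumes "k \<in> {1..N}"
  shows "green k \<in> V" "v \<in> V \<Longrightarrow> energy (green k) v = v (z k)" "energy (green k) (green k) \<le> sobolev_const * ell h"
proof -
  have "\<exists>g. g \<in> V \<and> (\<forall>v\<in>V. energy g v = v (z k))" using green_exists[OF assms] by blast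
  from someI_ex[OF this] have "green k \<in> V \<and> (\<forall>v\<in>V. energy (green k) v = v (z k))"
    unfolding green_def .
  then show 1: "green k \<in> V" and 2: "v \<in> V \<Longrightarrow> energy (green k) v = v (z k)" for v by auto
  let ?g = "energy (green k) (green k)"
  have "?g\<^sup>2 \<le> sobolev_const * ell h * ?g" using V_sobolev[OF 1 assms] 2[OF 1] by simp
  moreover have "0 \<le> ?g" by (rule energy_nonneg)
  moreover have "0 < sobolev_const * ell h" using sobolev_const_pos by (intro mult_pos_pos) (auto simp: ell_def)
  ultimately show "?g \<le> sobolev_const * ell h"
    by (cases "?g = 0") (auto simp: power2_eq_square)
qed

text \<open>The Galerkin solution whose load at node \<open>z j\<close> is \<open>b j\<close>; for
  the exact loads it is the Galerkin projection of \<open>u\<close>.\<close>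

definition riesz :: "(nat \<Rightarrow> real) \<Rightarrow> plane \<Rightarrow> real" where
  "riesz b = (\<lambda>x. \<Sum>j=1..N. b j * green j x)"

lemma riesz:
  shows "riesz b \<in> V" "v \<in> V \<Longrightarrow> energy (riesz b) v = (\<Sum>j=1..N. b j * v (z j))"
proof -
  show 1: "riesz b \<in> V" unfolding riesz_def by (rule V_sum) (auto simp: green)
  assume v: "v \<in> V"
  have "energy (riesz b) v = (\<Sum>j=1..N. b j * energy (green j) v)"
    unfolding riesz_def by (rule energy_sum[OF _ _ V_sob[OF v]]) (auto simp: green)
  then show "energy (riesz b) v = (\<Sum>j=1..N. b j * v (z j))" using green(2)[OF _ v] by simp
qed

lemma riesz_energy: "energy (riesz b) (riesz b) = (\<Sum>i=1..N. \<Sum>j=1..N. b i * b j * energy (green i) (green j))"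
proof -
  have "energy (riesz b) (riesz b) = (\<Sum>i=1..N. b i * riesz b (z i))" using riesz by simp
  also have "\<dots> = (\<Sum>i=1..N. b i * (\<Sum>j=1..N. b j * energy (green i) (green j)))"
  proof (intro sum.cong refl arg_cong[where f="(*) _"])
    fix i assume i: "i \<in> {1..N}"
    have "riesz b (z i) = energy (riesz b) (green i)" using green[OF i] riesz(1) by (simp add: energy_commute[of "riesz b"])
    also have "\<dots> = (\<Sum>j=1..N. b j * green i (z j))" by (rule riesz(2)[OF green(1)[OF i]])
    also have "\<dots> = (\<Sum>j=1..N. b j * energy (green i) (green j))"
    proof (intro sum.cong refl)
      fix j assume j: "j \<in> {1..N}"
      have "green i (z j) = energy (green i) (green j)"
        using green(2)[OF j green(1)[OF i]] energy_commute[of "green i" "green j"] by argo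
      then show "b j * green i (z j) = b j * energy (green i) (green j)" by simp
    qed
    finally show "riesz b (z i) = (\<Sum>j=1..N. b j * energy (green i) (green j))" .
  qed
  finally show ?thesis by (simp add: sum_distrib_left mult.assoc)
qed

text \<open>On \<open>V\<close> the energy products with \<open>riesz F\<close> and with
  \<open>u\<close> agree, so \<open>riesz F - u\<close> is orthogonal to \<open>U - riesz F\<close>;
  by definiteness the latter is \<open>riesz\<close> of the load difference. The loads
  \<open>\<beta>\<close> are arbitrary, so the identity serves for each sample path and for any
  comparison function in \<open>V\<close>.\<close>

lemma error_decomposition:
  assumes u: "sob D u u0 G" and F: "\<And>v. v \<in> V \<Longrightarrow> energy u v = (\<Sum>j=1..N. F j * v (z j))"
    and U: "U \<in> V" and \<beta>: "\<And>v. v \<in> V \<Longrightarrow> energy U v = (\<Sum>j=1..N. \<beta> j * v (z j))"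
  shows "(H1_seminorm D (\<lambda>x. U x - u x))\<^sup>2 =
    (\<Sum>i=1..N. \<Sum>j=1..N. (\<beta> i - F i) * (\<beta> j - F j) * energy (green i) (green j)) + (H1_seminorm D (\<lambda>x. riesz F x - u x))\<^sup>2"
proof -
  note r = riesz(1)[of F]
  have dV: "(\<lambda>x. U x - riesz F x) \<in> V" by (rule V_diff[OF U r])
  have e: "(\<lambda>x. U x - riesz F x) = riesz (\<lambda>j. \<beta> j - F j)"
  proof -
    let ?d = "\<lambda>x. (U x - riesz F x) - riesz (\<lambda>j. \<beta> j - F j) x"
    have dd: "?d \<in> V" by (rule V_diff[OF dV riesz(1)])
    have "energy ?d ?d = energy (\<lambda>x. U x - riesz F x) ?d - energy (riesz (\<lambda>j. \<beta> j - F j)) ?d"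
      by (rule energy_diff[OF V_sob[OF dV] V_sob[OF riesz(1)] V_sob[OF dd]])
    also have "energy (\<lambda>x. U x - riesz F x) ?d = energy U ?d - energy (riesz F) ?d"
      by (rule energy_diff[OF V_sob[OF U] V_sob[OF r] V_sob[OF dd]])
    finally have "energy ?d ?d = 0"
      using \<beta>[OF dd] riesz(2)[OF dd] by (simp add: left_diff_distrib sum_subtractf)
    from V_definite[OF dd this] show ?thesis by (auto simp: fun_eq_iff)
  qed
  let ?p = "\<lambda>x. U x - riesz F x" and ?q = "\<lambda>x. riesz F x - u x"
  have sp: "sob D ?p ?p (fe_grad ?p)" by (rule V_sob[OF dV])
  have sq: "sob D ?q (\<lambda>x. riesz F x - u0 x) (\<lambda>i x. fe_grad (riesz F) i x - G i x)"
    by (rule sob_diff[OF open_D bounded_D V_sob[OF r] u])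
  have s: "(\<lambda>x. U x - u x) = (\<lambda>x. 1 * ?p x + 1 * ?q x)" by simp
  have orth: "energy ?q ?p = 0"
  proof -
    have "energy ?q ?p = energy (riesz F) ?p - energy u ?p" by (rule energy_diff[OF V_sob[OF r] u sp])
    then show ?thesis using F[OF dV] riesz(2)[OF dV] by simp
  qed
  have st: "sob D (\<lambda>x. 1 * ?p x + 1 * ?q x) (\<lambda>x. 1 * ?p x + 1 * (riesz F x - u0 x))
     (\<lambda>i x. 1 * fe_grad ?p i x + 1 * (fe_grad (riesz F) i x - G i x))"
    by (rule sob_lincomb[OF open_D bounded_D sp sq])
  have "energy (\<lambda>x. 1 * ?p x + 1 * ?q x) (\<lambda>x. 1 * ?p x + 1 * ?q x)
     = 1 * energy ?p (\<lambda>x. 1 * ?p x + 1 * ?q x) + 1 * energy ?q (\<lambda>x. 1 * ?p x + 1 * ?q x)"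
    by (rule energy_lincomb[OF sp sq st])
  also have "energy ?p (\<lambda>x. 1 * ?p x + 1 * ?q x) = 1 * energy ?p ?p + 1 * energy ?q ?p"
    by (subst energy_commute) (rule energy_lincomb[OF sp sq sp])
  also have "energy ?q (\<lambda>x. 1 * ?p x + 1 * ?q x) = 1 * energy ?p ?q + 1 * energy ?q ?q"
    by (subst energy_commute) (rule energy_lincomb[OF sp sq sq])
  finally have "energy (\<lambda>x. 1 * ?p x + 1 * ?q x) (\<lambda>x. 1 * ?p x + 1 * ?q x) = energy ?p ?p + energy ?q ?q"
    using orth by (simp add: energy_commute[of ?p ?q])
  then show ?thesis unfolding H1_seminorm_sq s[symmetric] by (simp add: e riesz_energy)
qed

text \<open>Cea's lemma: every \<open>v\<close> in \<open>V\<close> is the Galerkin solution for its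
  own loads \<open>energy (\<phi> j) v\<close>, and in the decomposition of its error the quadratic
  form is an energy, hence nonnegative.\<close>

lemma galerkin_optimal:
  assumes u: "sob D u u0 G" and F: "\<And>v. v \<in> V \<Longrightarrow> energy u v = (\<Sum>j=1..N. F j * v (z j))" and v: "v \<in> V"
  shows "(H1_seminorm D (\<lambda>x. riesz F x - u x))\<^sup>2 \<le> (H1_seminorm D (\<lambda>x. v x - u x))\<^sup>2"
proof -
  define \<beta> where "\<beta> j = energy v (green j) - 0" for j
  obtain b where b: "\<And>w. w \<in> V \<Longrightarrow> energy v w = (\<Sum>j=1..N. b j * w (z j))"
  proof
    fix w assume w: "w \<in> V"
    have "energy v w = energy (\<lambda>x. \<Sum>j=1..N. w (z j) * \<phi> j x) v" by (subst energy_commute, subst V_expansion[OF w]) (rule refl)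
    also have "\<dots> = (\<Sum>j=1..N. w (z j) * energy (\<phi> j) v)" by (rule energy_sum[OF _ _ V_sob[OF v]]) (auto simp: basis(1))
    finally show "energy v w = (\<Sum>j=1..N. energy (\<phi> j) v * w (z j))" by (simp add: mult.commute)
  qed
  have "0 \<le> (\<Sum>i=1..N. \<Sum>j=1..N. (b i - F i) * (b j - F j) * energy (green i) (green j))"
    using riesz_energy[of "\<lambda>j. b j - F j"] energy_nonneg by metis
  then show ?thesis using error_decomposition[OF u F v b] by simp
qed

end

section \<open>The sampling noise\<close>

text \<open>Only products of a variable with itself have a nonzero mean, which removes both the
  terms with \<open>i \<noteq> j\<close> and those mixing two triangles.\<close>

lemma (in prob_space) uncorrelated_quadratic_form:
  fixes Z :: "'i \<Rightarrow> nat \<Rightarrow> 'a \<Rightarrow> real"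
  assumes S: "finite S" and i: "\<And>T i. T \<in> S \<Longrightarrow> i \<in> {1..N} \<Longrightarrow> Z T i \<in> borel_measurable M"
    "\<And>T i. T \<in> S \<Longrightarrow> i \<in> {1..N} \<Longrightarrow> integrable M (\<lambda>\<omega>. (Z T i \<omega>)\<^sup>2)"
    and 0: "\<And>T i R j. T \<in> S \<Longrightarrow> i \<in> {1..N} \<Longrightarrow> R \<in> S \<Longrightarrow> j \<in> {1..N} \<Longrightarrow> (T, i) \<noteq> (R, j) \<Longrightarrow> expectation (\<lambda>\<omega>. Z T i \<omega> * Z R j \<omega>) = 0"
  shows "expectation (\<lambda>\<omega>. \<Sum>i=1..N. \<Sum>j=1..N. (\<Sum>T\<in>S. Z T i \<omega>) * (\<Sum>T\<in>S. Z T j \<omega>) * A i j)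
      = (\<Sum>i=1..N. A i i * (\<Sum>T\<in>S. expectation (\<lambda>\<omega>. (Z T i \<omega>)\<^sup>2)))"
    and "integrable M (\<lambda>\<omega>. \<Sum>i=1..N. \<Sum>j=1..N. (\<Sum>T\<in>S. Z T i \<omega>) * (\<Sum>T\<in>S. Z T j \<omega>) * A i j)"
proof -
  have ii: "integrable M (\<lambda>\<omega>. Z T i \<omega> * Z R j \<omega>)" if "T \<in> S" "i \<in> {1..N}" "R \<in> S" "j \<in> {1..N}" for T i R j
  proof (rule Bochner_Integration.integrable_bound[of _ "\<lambda>\<omega>. (Z T i \<omega>)\<^sup>2 + (Z R j \<omega>)\<^sup>2"])
    show "AE \<omega> in M. norm (Z T i \<omega> * Z R j \<omega>) \<le> norm ((Z T i \<omega>)\<^sup>2 + (Z R j \<omega>)\<^sup>2)"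
    proof (rule AE_I2)
      fix \<omega>
      have "0 \<le> (\<bar>Z T i \<omega>\<bar> - \<bar>Z R j \<omega>\<bar>)\<^sup>2" by simp
      then have "2 * \<bar>Z T i \<omega> * Z R j \<omega>\<bar> \<le> (Z T i \<omega>)\<^sup>2 + (Z R j \<omega>)\<^sup>2" by (simp add: power2_diff abs_mult)
      then show "norm (Z T i \<omega> * Z R j \<omega>) \<le> norm ((Z T i \<omega>)\<^sup>2 + (Z R j \<omega>)\<^sup>2)" using abs_ge_zero[of "Z T i \<omega> * Z R j \<omega>"] by auto
    qed
  qed (use i that in auto)
  have e: "(\<lambda>\<omega>. \<Sum>i=1..N. \<Sum>j=1..N. (\<Sum>T\<in>S. Z T i \<omega>) * (\<Sum>T\<in>S. Z T j \<omega>) * A i j)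
    = (\<lambda>\<omega>. \<Sum>i=1..N. \<Sum>j=1..N. \<Sum>T\<in>S. \<Sum>R\<in>S. (Z T i \<omega> * Z R j \<omega>) * A i j)"
    unfolding sum_product by (simp only: sum_distrib_right)
  show "integrable M (\<lambda>\<omega>. \<Sum>i=1..N. \<Sum>j=1..N. (\<Sum>T\<in>S. Z T i \<omega>) * (\<Sum>T\<in>S. Z T j \<omega>) * A i j)"
    unfolding e by (intro Bochner_Integration.integrable_sum integrable_mult_left) (auto intro: ii)
  have "expectation (\<lambda>\<omega>. \<Sum>i=1..N. \<Sum>j=1..N. (\<Sum>T\<in>S. Z T i \<omega>) * (\<Sum>T\<in>S. Z T j \<omega>) * A i j)
    = (\<Sum>i=1..N. \<Sum>j=1..N. \<Sum>T\<in>S. \<Sum>R\<in>S. expectation (\<lambda>\<omega>. Z T i \<omega> * Z R j \<omega>) * A i j)"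
    unfolding e
    by (subst Bochner_Integration.integral_sum, intro Bochner_Integration.integrable_sum integrable_mult_left ii, assumption+,
        intro sum.cong refl)+ (simp add: ii)
  also have "\<dots> = (\<Sum>i=1..N. \<Sum>j=1..N. if j = i then A i i * (\<Sum>T\<in>S. expectation (\<lambda>\<omega>. (Z T i \<omega>)\<^sup>2)) else 0)"
  proof (intro sum.cong refl)
    fix i j assume ij: "i \<in> {1..N}" "j \<in> {1..N}"
    show "(\<Sum>T\<in>S. \<Sum>R\<in>S. expectation (\<lambda>\<omega>. Z T i \<omega> * Z R j \<omega>) * A i j)
      = (if j = i then A i i * (\<Sum>T\<in>S. expectation (\<lambda>\<omega>. (Z T i \<omega>)\<^sup>2)) else 0)"
    proof (cases "j = i")
      case True
      have "(\<Sum>R\<in>S. expectation (\<lambda>\<omega>. Z T i \<omega> * Z R i \<omega>) * A i i) = expectation (\<lambda>\<omega>. (Z T i \<omega>)\<^sup>2) * A i i" if T: "T \<in> S" for T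
      proof -
        have "(\<Sum>R\<in>S. expectation (\<lambda>\<omega>. Z T i \<omega> * Z R i \<omega>) * A i i) = (\<Sum>R\<in>S. if R = T then expectation (\<lambda>\<omega>. (Z T i \<omega>)\<^sup>2) * A i i else 0)"
          using 0[OF T ij(1) _ ij(1)] by (intro sum.cong) (auto simp: power2_eq_square)
        then show ?thesis using S T by simp
      qed
      then show ?thesis using True by (simp add: sum_distrib_left mult.commute)
    next
      case False
      then have "(\<Sum>T\<in>S. \<Sum>R\<in>S. expectation (\<lambda>\<omega>. Z T i \<omega> * Z R j \<omega>) * A i j) = (\<Sum>T\<in>S. \<Sum>R\<in>S. 0)"
        using 0 ij by (intro sum.cong refl) auto
      then show ?thesis using False by simp
    qed
  qed
  also have "\<dots> = (\<Sum>i=1..N. A i i * (\<Sum>T\<in>S. expectation (\<lambda>\<omega>. (Z T i \<omega>)\<^sup>2)))" by simp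
  finally show "expectation (\<lambda>\<omega>. \<Sum>i=1..N. \<Sum>j=1..N. (\<Sum>T\<in>S. Z T i \<omega>) * (\<Sum>T\<in>S. Z T j \<omega>) * A i j)
      = (\<Sum>i=1..N. A i i * (\<Sum>T\<in>S. expectation (\<lambda>\<omega>. (Z T i \<omega>)\<^sup>2)))" .
qed

text \<open>The load depends on \<open>f\<close> only through \<open>f0\<close>: since \<open>Y T j\<close> has a density, \<open>f (Y T j)\<close> and \<open>f0 (Y T j)\<close> agree almost surely.\<close>

locale fe_sampling = fe_mesh + prob_space M for M :: "'w measure" +
  fixes f f0 :: "plane \<Rightarrow> real" and Y :: "plane set \<Rightarrow> nat \<Rightarrow> 'w \<Rightarrow> plane"
  assumes samples: "IS_samples M D Th \<phi> Y" and f0: "rep D f f0" "sqnorm f0 < \<infinity>"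
begin

definition active :: "plane set \<Rightarrow> nat \<Rightarrow> bool" where
  "active T j \<longleftrightarrow> T \<inter> supp (\<phi> j) \<noteq> {}"

lemma inactive_zero: "\<not> active T j \<Longrightarrow> x \<in> T \<Longrightarrow> \<phi> j x = 0"
  using closure_subset[of "{x. \<phi> j x \<noteq> 0}"] by (auto simp: active_def supp_def)

lemma f0_measurable [measurable]: "f0 \<in> borel_measurable borel"
  by (rule rep_measurable[OF f0(1)])

lemma basis_measurable [measurable]: "j \<in> {1..N} \<Longrightarrow> \<phi> j \<in> borel_measurable borel"
  using sobD(3)[OF V_sob[OF basis(1)]] .

lemma basis_le_1: "T \<in> Th \<Longrightarrow> j \<in> {1..N} \<Longrightarrow> x \<in> T \<Longrightarrow> \<phi> j x \<le> 1"
proof -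
  assume T: "T \<in> Th" "j \<in> {1..N}" "x \<in> T"
  have "\<phi> j x \<le> (\<Sum>j=1..N. \<phi> j x)" using T basis_nonneg by (intro member_le_sum) auto
  also have "\<dots> \<le> 1" using T closure_subset by (intro basis_sum_le[OF T(1)]) auto
  finally show ?thesis .
qed

lemma density_nonneg: "T \<in> Th \<Longrightarrow> j \<in> {1..N} \<Longrightarrow> 0 \<le> IS_density \<phi> T j x"
  unfolding IS_density_def using basis_nonneg less_imp_le[OF T_facts(5)]
  by (intro mult_nonneg_nonneg divide_nonneg_nonneg) auto

lemma density_measurable: "T \<in> Th \<Longrightarrow> j \<in> {1..N} \<Longrightarrow> IS_density \<phi> T j \<in> borel_measurable borel"
proof -
  assume "T \<in> Th" "j \<in> {1..N}"
  note T_facts(3)[OF this(1), measurable] basis_measurable[OF this(2), measurable]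
  show ?thesis unfolding IS_density_def[abs_def] by measurable
qed

lemma Y_distributed:
  assumes "T \<in> Th" "j \<in> {1..N}" "active T j"
  shows "distributed M lborel (Y T j) (\<lambda>x. ennreal (IS_density \<phi> T j x))"
  using samples assms by (auto simp: IS_samples_def sample_index_def active_def)

lemma Y_AE:
  assumes a: "T \<in> Th" "j \<in> {1..N}" "active T j"
  shows "AE \<omega> in M. f (Y T j \<omega>) = f0 (Y T j \<omega>)"
proof -
  have "AE x in lborel. x \<in> D \<longrightarrow> f x = f0 x" using rep_AE[OF f0(1)] by (simp only: AE_completion_iff)
  then have "AE x in lborel. 0 < ennreal (IS_density \<phi> T j x) \<longrightarrow> f x = f0 x"
    by eventually_elim (use Th(3)[OF a(1)] in \<open>auto simp: IS_density_def indicator_def split: if_splits\<close>)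
  then have "AE x in density lborel (\<lambda>x. ennreal (IS_density \<phi> T j x)). f x = f0 x"
    using density_measurable[OF a(1,2)] by (subst AE_density) auto
  then have "AE x in distr M lborel (Y T j). f x = f0 x"
    unfolding distributed_distr_eq_density[OF Y_distributed[OF a]] .
  then show ?thesis using distributed_measurable[OF Y_distributed[OF a]] by (rule AE_distrD[rotated])
qed

section \<open>Moments of the samples\<close>

definition local_sq :: "plane set \<Rightarrow> nat \<Rightarrow> real" where
  "local_sq T j = (\<integral>x. indicator T x * (\<phi> j x * (f0 x)\<^sup>2) \<partial>lborel)"

definition local_load :: "plane set \<Rightarrow> nat \<Rightarrow> real" where
  "local_load T j = (\<integral>x. indicator T x * (\<phi> j x * f0 x) \<partial>lborel)"

lemma f0_sq_integrable: "integrable lborel (\<lambda>x. (f0 x)\<^sup>2)"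
  using f0(2) sqnorm_finite_iff[OF f0_measurable] by blast

lemma f0_integrable: "integrable lborel f0"
  by (rule sqnorm_integrable[OF bounded_D f0_measurable f0(2) rep_zero[OF f0(1)]])

lemma weighted_integrable:
  assumes T: "T \<in> Th" "j \<in> {1..N}" and g: "integrable lborel g"
  shows "integrable lborel (\<lambda>x. indicator T x * (\<phi> j x * g x))"
proof (rule Bochner_Integration.integrable_bound[OF g])
  note T_facts(3)[OF T(1), measurable] basis_measurable[OF T(2), measurable]
  have [measurable]: "g \<in> borel_measurable borel" using g by auto
  show "(\<lambda>x. indicator T x * (\<phi> j x * g x)) \<in> borel_measurable lborel" by measurable
  show "AE x in lborel. norm (indicator T x * (\<phi> j x * g x)) \<le> norm (g x)"
  proof (rule AE_I2)
    fix x
    show "norm (indicator T x * (\<phi> j x * g x)) \<le> norm (g x)"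
    proof (cases "x \<in> T")
      case True
      have "\<bar>\<phi> j x\<bar> \<le> 1" using basis_le_1[OF T True] basis_nonneg[OF T(2)] by simp
      then show ?thesis using True mult_right_mono[of "\<bar>\<phi> j x\<bar>" 1 "\<bar>g x\<bar>"] by (simp add: abs_mult)
    qed simp
  qed
qed

lemma Y_moments:
  assumes a: "T \<in> Th" "j \<in> {1..N}" "active T j"
  shows "expectation (\<lambda>\<omega>. f0 (Y T j \<omega>)) = 3 / area T * local_load T j"
    and "expectation (\<lambda>\<omega>. (f0 (Y T j \<omega>))\<^sup>2) = 3 / area T * local_sq T j"
    and "integrable M (\<lambda>\<omega>. (f0 (Y T j \<omega>))\<^sup>2)"
proof -
  note d = Y_distributed[OF a]
  have eq: "(\<lambda>x. IS_density \<phi> T j x * g x) = (\<lambda>x. 3 / area T * (indicator T x * (\<phi> j x * g x)))" for g :: "plane \<Rightarrow> real"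
    by (simp add: IS_density_def fun_eq_iff)
  have "expectation (\<lambda>\<omega>. g (Y T j \<omega>)) = (\<integral>x. IS_density \<phi> T j x * g x \<partial>lborel)" if "g \<in> borel_measurable borel" for g
    using distributed_integral[OF d, of g] that density_nonneg[OF a(1,2)] by simp
  then have *: "expectation (\<lambda>\<omega>. g (Y T j \<omega>)) = 3 / area T * (\<integral>x. indicator T x * (\<phi> j x * g x) \<partial>lborel)" if "g \<in> borel_measurable borel" for g
    using that unfolding eq by simp
  show "expectation (\<lambda>\<omega>. f0 (Y T j \<omega>)) = 3 / area T * local_load T j"
    unfolding local_load_def by (rule *) simp
  show "expectation (\<lambda>\<omega>. (f0 (Y T j \<omega>))\<^sup>2) = 3 / area T * local_sq T j"
    unfolding local_sq_def using *[of "\<lambda>x. (f0 x)\<^sup>2"] by simp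
  have "integrable M (\<lambda>\<omega>. (\<lambda>x. (f0 x)\<^sup>2) (Y T j \<omega>)) \<longleftrightarrow> integrable lborel (\<lambda>x. IS_density \<phi> T j x * (f0 x)\<^sup>2)"
    by (rule distributed_integrable[OF d, symmetric]) (use density_nonneg[OF a(1,2)] in auto)
  also have "integrable lborel (\<lambda>x. IS_density \<phi> T j x * (f0 x)\<^sup>2)"
    unfolding eq by (intro integrable_mult_right weighted_integrable a f0_sq_integrable)
  finally show "integrable M (\<lambda>\<omega>. (f0 (Y T j \<omega>))\<^sup>2)" by simp
qed

text \<open>Pairs without a sample get the value 0. This is the correct error, because the local
  load of such a pair vanishes as well.\<close>

definition noise :: "plane set \<Rightarrow> nat \<Rightarrow> 'w \<Rightarrow> real" where
  "noise T j \<omega> = (if active T j then area T / 3 * f0 (Y T j \<omega>) - local_load T j else 0)"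

lemma Y_measurable: "T \<in> Th \<Longrightarrow> j \<in> {1..N} \<Longrightarrow> active T j \<Longrightarrow> Y T j \<in> borel_measurable M"
  using distributed_measurable[OF Y_distributed] by simp

lemma noise_measurable: "T \<in> Th \<Longrightarrow> j \<in> {1..N} \<Longrightarrow> noise T j \<in> borel_measurable M"
proof (cases "active T j")
  case True
  assume "T \<in> Th" "j \<in> {1..N}"
  note Y_measurable[OF this True, measurable]
  show ?thesis unfolding noise_def[abs_def] using True by measurable
qed (simp add: noise_def[abs_def])

lemma noise_moments:
  assumes a: "T \<in> Th" "j \<in> {1..N}"
  shows "integrable M (noise T j)" "expectation (noise T j) = 0"
    "integrable M (\<lambda>\<omega>. (noise T j \<omega>)\<^sup>2)" "expectation (\<lambda>\<omega>. (noise T j \<omega>)\<^sup>2) \<le> area T / 3 * local_sq T j"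
proof -
  have sq0: "0 \<le> local_sq T j" unfolding local_sq_def
    using basis_nonneg[OF a(2)] by (intro Bochner_Integration.integral_nonneg) auto
  have A: "0 < area T" by (rule T_facts(5)[OF a(1)])
  have "integrable M (noise T j) \<and> expectation (noise T j) = 0 \<and>
    integrable M (\<lambda>\<omega>. (noise T j \<omega>)\<^sup>2) \<and> expectation (\<lambda>\<omega>. (noise T j \<omega>)\<^sup>2) \<le> area T / 3 * local_sq T j"
  proof (cases "active T j")
    case True
    show ?thesis
    proof (intro conjI)
      note m = Y_moments[OF a True]
      note Y_measurable[OF a True, measurable]
      have i1: "integrable M (\<lambda>\<omega>. f0 (Y T j \<omega>))"
        by (rule square_integrable_imp_integrable[OF _ m(3)]) measurable
      have n: "noise T j = (\<lambda>\<omega>. area T / 3 * f0 (Y T j \<omega>) - local_load T j)"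
        using True by (simp add: noise_def fun_eq_iff)
      show "integrable M (noise T j)" unfolding n using i1 by simp
      show "expectation (noise T j) = 0" unfolding n using i1 A m(1) by (simp add: prob_space)
      have n2: "(noise T j \<omega>)\<^sup>2 = (area T / 3)\<^sup>2 * (f0 (Y T j \<omega>))\<^sup>2 - 2 * (area T / 3) * local_load T j * f0 (Y T j \<omega>) + (local_load T j)\<^sup>2" for \<omega>
        unfolding n by (simp add: power2_diff power_mult_distrib power_divide algebra_simps)
      show "integrable M (\<lambda>\<omega>. (noise T j \<omega>)\<^sup>2)" unfolding n2 using i1 m(3) by simp
      have "expectation (\<lambda>\<omega>. (noise T j \<omega>)\<^sup>2) = (area T / 3)\<^sup>2 * (3 / area T * local_sq T j) - 2 * (area T / 3) * local_load T j * (3 / area T * local_load T j) + (local_load T j)\<^sup>2"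
        unfolding n2 using i1 m by (simp add: prob_space)
      \<comment> \<open>The weight \<open>(area T / 3)\<^sup>2\<close> meets the density factor
        \<open>3 / area T\<close>, leaving one factor \<open>area T / 3\<close>; the squared mean is
        then dropped.\<close>
      also have "\<dots> = area T / 3 * local_sq T j - (local_load T j)\<^sup>2"
        using A by (simp add: power2_eq_square field_simps)
      finally show "expectation (\<lambda>\<omega>. (noise T j \<omega>)\<^sup>2) \<le> area T / 3 * local_sq T j" by simp
    qed
  next
    case False
    then have n: "noise T j = (\<lambda>\<omega>. 0)" by (simp add: noise_def fun_eq_iff)
    show ?thesis unfolding n using sq0 A by auto
  qed
  then show "integrable M (noise T j)" "expectation (noise T j) = 0"
    "integrable M (\<lambda>\<omega>. (noise T j \<omega>)\<^sup>2)" "expectation (\<lambda>\<omega>. (noise T j \<omega>)\<^sup>2) \<le> area T / 3 * local_sq T j" by auto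
qed

text \<open>Two distinct samples are independent and their errors centred, so the mean of the
  product factorises to zero; inactive pairs contribute the zero function.\<close>

lemma noise_uncorrelated:
  assumes a: "T \<in> Th" "i \<in> {1..N}" "R \<in> Th" "j \<in> {1..N}" "(T, i) \<noteq> (R, j)"
  shows "expectation (\<lambda>\<omega>. noise T i \<omega> * noise R j \<omega>) = 0"
proof (cases "active T i \<and> active R j")
  case True
  let ?I = "sample_index D Th \<phi>" and ?J = "{(T, i), (R, j)}"
  have J: "?J \<subseteq> ?I" using a True by (auto simp: sample_index_def active_def)
  have "indep_vars (\<lambda>_. borel) (\<lambda>(T, j). Y T j) ?I" using samples by (simp add: IS_samples_def)
  then have "indep_vars (\<lambda>_. borel) (\<lambda>(T, j). Y T j) ?J" using J by (rule indep_vars_subset)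
  then have "indep_vars (\<lambda>_. borel) (\<lambda>p \<omega>. (\<lambda>y. area (fst p) / 3 * f0 y - local_load (fst p) (snd p)) ((\<lambda>(T, j). Y T j) p \<omega>)) ?J"
    by (rule indep_vars_compose2) measurable
  then have iv: "indep_vars (\<lambda>_. borel) (\<lambda>p. noise (fst p) (snd p)) ?J"
    by (rule iffD1[OF indep_vars_cong, rotated -1]) (use True in \<open>auto simp: noise_def fun_eq_iff\<close>)
  have "(\<integral>\<omega>. (\<Prod>p\<in>?J. noise (fst p) (snd p) \<omega>) \<partial>M) = (\<Prod>p\<in>?J. \<integral>\<omega>. noise (fst p) (snd p) \<omega> \<partial>M)"
    by (rule indep_vars_lebesgue_integral[OF _ iv]) (use a noise_moments(1) in auto)
  then show ?thesis using a noise_moments(2) by simp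
qed (auto simp: noise_def)

definition load :: "nat \<Rightarrow> real" where
  "load j = (\<integral>x. f0 x * \<phi> j x \<partial>lborel)"

lemma load_sum:
  assumes j: "j \<in> {1..N}"
  shows "load j = (\<Sum>T\<in>Th. local_load T j)"
proof -
  note basis_measurable[OF j, measurable]
  have "(\<Sum>T\<in>Th. local_load T j) = (\<integral>x. (\<Sum>T\<in>Th. indicator T x * (\<phi> j x * f0 x)) \<partial>lborel)"
    unfolding local_load_def by (rule Bochner_Integration.integral_sum[symmetric]) (intro weighted_integrable j f0_integrable)
  also have "\<dots> = load j" unfolding load_def
  proof (rule integral_cong_AE)
    show "AE x in lborel. (\<Sum>T\<in>Th. indicator T x * (\<phi> j x * f0 x)) = f0 x * \<phi> j x"
      using AE_mesh
    proof eventually_elim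
      fix x assume x: "x \<in> closure D \<longrightarrow> x \<in> \<Union>Th"
      show "(\<Sum>T\<in>Th. indicator T x * (\<phi> j x * f0 x)) = f0 x * \<phi> j x"
      proof (cases "x \<in> \<Union>Th")
        case True
        then obtain T where T: "T \<in> Th" "x \<in> T" by auto
        show ?thesis using sum_indicator_T[OF T, of "\<lambda>_. \<phi> j x * f0 x"] by simp
      next
        case False
        then have "x \<notin> D" using x closure_subset by blast
        then show ?thesis using rep_zero[OF f0(1)] by simp
      qed
    qed
    show "(\<lambda>x. \<Sum>T\<in>Th. indicator T x * (\<phi> j x * f0 x)) \<in> borel_measurable lborel"
    proof (intro borel_measurable_sum)
      fix T assume "T \<in> Th"
      note T_facts(3)[OF this, measurable]
      show "(\<lambda>x. indicator T x * (\<phi> j x * f0 x)) \<in> borel_measurable lborel" by measurable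
    qed
  qed measurable
  finally show ?thesis by simp
qed

lemma local_load_inactive:
  assumes "T \<in> Th" "\<not> active T j" shows "local_load T j = 0"
proof -
  have "(\<lambda>x. indicator T x * (\<phi> j x * f0 x)) = (\<lambda>x. 0)"
    using inactive_zero[OF assms(2)] by (auto simp: indicator_def fun_eq_iff)
  then show ?thesis by (simp add: local_load_def)
qed

text \<open>Regrouping the samples by node exhibits the random functional as the exact load plus the
  summed noise, the shape to which \<open>error_decomposition\<close> applies.\<close>

lemma F_IS_expansion:
  assumes v: "v \<in> V" and eq: "\<And>T j. T \<in> Th \<Longrightarrow> j \<in> {1..N} \<Longrightarrow> active T j \<Longrightarrow> f (Y T j \<omega>) = f0 (Y T j \<omega>)"
  shows "F_IS D Th \<phi> f Y \<omega> v = (\<Sum>j=1..N. (load j + (\<Sum>T\<in>Th. noise T j \<omega>)) * v (z j))"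
proof -
  have l: "load j + (\<Sum>T\<in>Th. noise T j \<omega>) = (\<Sum>T\<in>Th. if active T j then area T / 3 * f (Y T j \<omega>) else 0)" if j: "j \<in> {1..N}" for j
    unfolding load_sum[OF j] sum.distrib[symmetric]
    by (intro sum.cong) (auto simp: noise_def local_load_inactive eq[OF _ j])
  have "F_IS D Th \<phi> f Y \<omega> v = 1 / 3 * (\<Sum>T\<in>Th. area T * (\<Sum>j=1..N. if active T j then v (z j) * f (Y T j \<omega>) else 0))"
  proof -
    have "(\<Sum>j | j \<in> {1..N} \<and> T \<inter> supp (\<phi> j) \<noteq> {}. fe_coeff N \<phi> v j * f (Y T j \<omega>))
      = (\<Sum>j=1..N. if active T j then v (z j) * f (Y T j \<omega>) else 0)" for T
    proof -
      have "(\<Sum>j | j \<in> {1..N} \<and> T \<inter> supp (\<phi> j) \<noteq> {}. fe_coeff N \<phi> v j * f (Y T j \<omega>))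
        = (\<Sum>j | j \<in> {1..N} \<and> active T j. v (z j) * f (Y T j \<omega>))"
        by (intro sum.cong) (auto simp: active_def fe_coeff_eq[OF v])
      also have "\<dots> = (\<Sum>j=1..N. if active T j then v (z j) * f (Y T j \<omega>) else 0)"
        by (rule sum.inter_filter) simp
      finally show ?thesis .
    qed
    then show ?thesis unfolding F_IS_def by (simp only:)
  qed
  also have "\<dots> = (\<Sum>T\<in>Th. \<Sum>j=1..N. (if active T j then area T / 3 * f (Y T j \<omega>) else 0) * v (z j))"
    unfolding sum_distrib_left by (intro sum.cong refl) auto
  also have "\<dots> = (\<Sum>j=1..N. \<Sum>T\<in>Th. (if active T j then area T / 3 * f (Y T j \<omega>) else 0) * v (z j))"
    by (rule sum.swap)
  also have "\<dots> = (\<Sum>j=1..N. (load j + (\<Sum>T\<in>Th. noise T j \<omega>)) * v (z j))"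
    using l by (intro sum.cong refl) (simp add: sum_distrib_right)
  finally show ?thesis .
qed

text \<open>The triangles are disjoint and the basis functions sum to at most 1, so each point is
  counted with total weight at most 1.\<close>

lemma local_sq_total: "(\<Sum>j=1..N. \<Sum>T\<in>Th. local_sq T j) \<le> (\<integral>x. (f0 x)\<^sup>2 \<partial>lborel)"
proof -
  have i: "integrable lborel (\<lambda>x. indicator T x * (\<phi> j x * (f0 x)\<^sup>2))" if "T \<in> Th" "j \<in> {1..N}" for T j
    by (rule weighted_integrable[OF that f0_sq_integrable])
  have "(\<Sum>j=1..N. \<Sum>T\<in>Th. local_sq T j) = (\<Sum>j=1..N. (\<integral>x. (\<Sum>T\<in>Th. indicator T x * (\<phi> j x * (f0 x)\<^sup>2)) \<partial>lborel))"
    unfolding local_sq_def by (intro sum.cong refl Bochner_Integration.integral_sum[symmetric] i)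
  also have "\<dots> = (\<integral>x. (\<Sum>j=1..N. \<Sum>T\<in>Th. indicator T x * (\<phi> j x * (f0 x)\<^sup>2)) \<partial>lborel)"
    by (intro Bochner_Integration.integral_sum[symmetric] Bochner_Integration.integrable_sum i)
  also have "\<dots> \<le> (\<integral>x. (f0 x)\<^sup>2 \<partial>lborel)"
  proof (rule integral_mono)
    show "integrable lborel (\<lambda>x. \<Sum>j=1..N. \<Sum>T\<in>Th. indicator T x * (\<phi> j x * (f0 x)\<^sup>2))"
      by (intro Bochner_Integration.integrable_sum i)
    fix x
    have e: "(\<Sum>j=1..N. \<Sum>T\<in>Th. indicator T x * (\<phi> j x * (f0 x)\<^sup>2)) = (\<Sum>T\<in>Th. indicator T x * ((\<Sum>j=1..N. \<phi> j x) * (f0 x)\<^sup>2))"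
      by (subst sum.swap) (simp add: sum_distrib_left sum_distrib_right)
    show "(\<Sum>j=1..N. \<Sum>T\<in>Th. indicator T x * (\<phi> j x * (f0 x)\<^sup>2)) \<le> (f0 x)\<^sup>2"
    proof (cases "x \<in> \<Union>Th")
      case True
      then obtain T where T: "T \<in> Th" "x \<in> T" by auto
      have "(\<Sum>j=1..N. \<phi> j x) \<le> 1" using T closure_subset by (intro basis_sum_le[OF T(1)]) auto
      then have "(\<Sum>j=1..N. \<phi> j x) * (f0 x)\<^sup>2 \<le> 1 * (f0 x)\<^sup>2" by (intro mult_right_mono) auto
      then show ?thesis unfolding e sum_indicator_T[OF T, of "\<lambda>_. (\<Sum>j=1..N. \<phi> j x) * (f0 x)\<^sup>2"] by simp
    next
      case False
      then have "(\<Sum>T\<in>Th. indicator T x * ((\<Sum>j=1..N. \<phi> j x) * (f0 x)\<^sup>2)) = (\<Sum>T\<in>Th. 0)" by (intro sum.cong) auto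
      then show ?thesis unfolding e by simp
    qed
  qed (rule f0_sq_integrable)
  finally show ?thesis .
qed

text \<open>Taking expectations in the pathwise decomposition leaves the noise variances, weighted
  by the diagonal energies \<open>energy (green i) (green i)\<close>. These energies are bounded
  uniformly in \<open>i\<close>, and the variances sum by \<open>local_sq_total\<close>;
  \<open>area T \<le> h\<^sup>2\<close> provides the factor \<open>h\<^sup>2 / 3\<close>.\<close>

theorem mean_square_error:
  assumes u: "sob D u u0 G" "\<And>v. v \<in> V \<Longrightarrow> energy u v = (\<integral>x. f0 x * v x \<partial>lborel)"
    and U: "IS_solution M D Th \<phi> f Y U" and v: "v \<in> V"
  shows "(\<integral>\<^sup>+\<omega>. ennreal ((H1_seminorm D (\<lambda>x. U \<omega> x - u x))\<^sup>2) \<partial>M)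
    \<le> ennreal (sobolev_const * ell h * (h\<^sup>2 / 3) * (\<integral>x. (f0 x)\<^sup>2 \<partial>lborel)) + ennreal ((H1_seminorm D (\<lambda>x. v x - u x))\<^sup>2)"
proof -
  have F: "energy u w = (\<Sum>j=1..N. load j * w (z j))" if w: "w \<in> V" for w
  proof -
    have i: "integrable lborel (\<lambda>x. f0 x * \<phi> j x)" if "j \<in> {1..N}" for j
      using sobD[OF V_sob[OF basis(1)[OF that]]] f0(2) by (intro product_integrable) auto
    have "energy u w = (\<integral>x. (\<Sum>j=1..N. w (z j) * (f0 x * \<phi> j x)) \<partial>lborel)"
      unfolding u(2)[OF w] by (subst V_expansion[OF w]) (simp add: sum_distrib_left mult_ac)
    also have "\<dots> = (\<Sum>j=1..N. w (z j) * load j)"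
      unfolding load_def using i by (subst Bochner_Integration.integral_sum) auto
    finally show ?thesis by (simp add: mult.commute)
  qed
  define Q where "Q \<omega> = (\<Sum>i=1..N. \<Sum>j=1..N. (\<Sum>T\<in>Th. noise T i \<omega>) * (\<Sum>T\<in>Th. noise T j \<omega>) * energy (green i) (green j))" for \<omega>
  define e where "e = (H1_seminorm D (\<lambda>x. riesz load x - u x))\<^sup>2"
  have Q0: "0 \<le> Q \<omega>" for \<omega> unfolding Q_def using riesz_energy[symmetric] energy_nonneg by simp
  note qf = uncorrelated_quadratic_form[OF Th(1) noise_measurable noise_moments(3) noise_uncorrelated, where A="\<lambda>i j. energy (green i) (green j)"]
  have iQ: "integrable M Q" unfolding Q_def by (rule qf(2))
  \<comment> \<open>There are finitely many pairs of a triangle and a node, so \<open>f\<close> can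
    be replaced by \<open>f0\<close> at all samples simultaneously.\<close>
  have "AE \<omega> in M. \<forall>T\<in>Th. \<forall>j\<in>{1..N}. active T j \<longrightarrow> f (Y T j \<omega>) = f0 (Y T j \<omega>)"
  proof (intro AE_finite_allI Th(1) finite_atLeastAtMost)
    fix T j assume a: "T \<in> Th" "j \<in> {1..N}"
    show "AE \<omega> in M. active T j \<longrightarrow> f (Y T j \<omega>) = f0 (Y T j \<omega>)"
      by (cases "active T j") (use Y_AE[OF a] in auto)
  qed
  moreover have "AE \<omega> in M. \<forall>v\<in>V. energy (U \<omega>) v = F_IS D Th \<phi> f Y \<omega> v"
    using U by (auto simp: IS_solution_def)
  ultimately have "AE \<omega> in M. ennreal ((H1_seminorm D (\<lambda>x. U \<omega> x - u x))\<^sup>2) = ennreal (Q \<omega>) + ennreal e"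
    using AE_space
  proof eventually_elim
    fix \<omega> assume eq: "\<forall>T\<in>Th. \<forall>j\<in>{1..N}. active T j \<longrightarrow> f (Y T j \<omega>) = f0 (Y T j \<omega>)"
      and sol: "\<forall>v\<in>V. energy (U \<omega>) v = F_IS D Th \<phi> f Y \<omega> v" and \<omega>: "\<omega> \<in> space M"
    have "U \<omega> \<in> V" using U \<omega> by (simp add: IS_solution_def)
    have "energy (U \<omega>) w = (\<Sum>j=1..N. (load j + (\<Sum>T\<in>Th. noise T j \<omega>)) * w (z j))" if "w \<in> V" for w
      using sol F_IS_expansion[OF that] eq that by auto
    from error_decomposition[OF u(1) F \<open>U \<omega> \<in> V\<close> this]
    have "(H1_seminorm D (\<lambda>x. U \<omega> x - u x))\<^sup>2 = Q \<omega> + e" by (simp add: Q_def e_def)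
    then show "ennreal ((H1_seminorm D (\<lambda>x. U \<omega> x - u x))\<^sup>2) = ennreal (Q \<omega>) + ennreal e"
      using Q0 by (simp add: e_def ennreal_plus)
  qed
  then have "(\<integral>\<^sup>+\<omega>. ennreal ((H1_seminorm D (\<lambda>x. U \<omega> x - u x))\<^sup>2) \<partial>M) = (\<integral>\<^sup>+\<omega>. ennreal (Q \<omega>) + ennreal e \<partial>M)"
    by (rule nn_integral_cong_AE)
  also have "\<dots> = ennreal (expectation Q) + ennreal e"
    using iQ Q0 by (simp add: nn_integral_add nn_integral_eq_integral emeasure_space_1)
  also have "\<dots> \<le> ennreal (sobolev_const * ell h * (h\<^sup>2 / 3) * (\<integral>x. (f0 x)\<^sup>2 \<partial>lborel)) + ennreal ((H1_seminorm D (\<lambda>x. v x - u x))\<^sup>2)"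
  proof (intro add_mono ennreal_leI)
    show "e \<le> (H1_seminorm D (\<lambda>x. v x - u x))\<^sup>2" unfolding e_def by (rule galerkin_optimal[OF u(1) F v])
    have K: "0 \<le> sobolev_const * ell h" using sobolev_const_pos by (intro mult_nonneg_nonneg) (auto simp: ell_def)
    have sq0: "0 \<le> local_sq T j" if "j \<in> {1..N}" for T j unfolding local_sq_def
      using basis_nonneg[OF that] by (intro Bochner_Integration.integral_nonneg) auto
    have "expectation Q = (\<Sum>i=1..N. energy (green i) (green i) * (\<Sum>T\<in>Th. expectation (\<lambda>\<omega>. (noise T i \<omega>)\<^sup>2)))"
      unfolding Q_def by (rule qf(1))
    also have "\<dots> \<le> (\<Sum>i=1..N. (sobolev_const * ell h) * (\<Sum>T\<in>Th. h\<^sup>2 / 3 * local_sq T i))"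
    proof (intro sum_mono mult_mono)
      fix i assume i: "i \<in> {1..N}"
      show "energy (green i) (green i) \<le> sobolev_const * ell h" by (rule green(3)[OF i])
      show "expectation (\<lambda>\<omega>. (noise T i \<omega>)\<^sup>2) \<le> h\<^sup>2 / 3 * local_sq T i" if T: "T \<in> Th" for T
      proof -
        have "area T / 3 * local_sq T i \<le> h\<^sup>2 / 3 * local_sq T i"
          using T_facts(6)[OF T] sq0[OF i] by (intro mult_right_mono) auto
        then show ?thesis using noise_moments(4)[OF T i] by linarith
      qed
      show "0 \<le> (\<Sum>T\<in>Th. expectation (\<lambda>\<omega>. (noise T i \<omega>)\<^sup>2))"
        by (intro sum_nonneg Bochner_Integration.integral_nonneg) auto
    qed (rule K)
    also have "\<dots> = sobolev_const * ell h * (h\<^sup>2 / 3) * (\<Sum>j=1..N. \<Sum>T\<in>Th. local_sq T j)"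
      by (simp add: sum_distrib_left mult.assoc)
    also have "\<dots> \<le> sobolev_const * ell h * (h\<^sup>2 / 3) * (\<integral>x. (f0 x)\<^sup>2 \<partial>lborel)"
      using K by (intro mult_left_mono local_sq_total) auto
    finally show "expectation Q \<le> sobolev_const * ell h * (h\<^sup>2 / 3) * (\<integral>x. (f0 x)\<^sup>2 \<partial>lborel)" .
  qed
  finally show ?thesis .
qed

end

section \<open>The error estimate\<close>

text \<open>The constant may depend on \<open>f\<close>, so no norm comparison is needed beyond the case \<open>f = 0\<close>.\<close>

lemma Lp_embeds_L2:
  assumes D: "open D" "bounded D" and p: "2 < p" and f: "in_Lp D p f" and f0: "rep D f f0"
  shows "sqnorm f0 < \<infinity>" and "\<exists>K\<ge>0. sqrt (\<integral>x. (f0 x)\<^sup>2 \<partial>lborel) \<le> K * Lp_norm D p f"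
proof -
  have Dm[measurable]: "D \<in> sets borel" using D by simp
  have [measurable]: "f0 \<in> borel_measurable borel" by (rule rep_measurable[OF f0])
  have Dfin: "emeasure lborel D < \<infinity>" using D(2) by (rule emeasure_bounded_finite)
  have ae: "AE x in lborel. x \<in> D \<longrightarrow> f x = f0 x" using rep_AE[OF f0] by (simp only: AE_completion_iff)
  have "sqnorm f0 < \<infinity> \<and> (Lp_norm D p f = 0 \<longrightarrow> sqnorm f0 = 0)"
  proof (cases "p = \<infinity>")
    case True
    define s where "s = esssup (lebesgue_on D) (\<lambda>x. ennreal \<bar>f x\<bar>)"
    have fm[measurable]: "f \<in> borel_measurable (lebesgue_on D)" using f by (simp add: in_Lp_def)
    have s: "s < \<infinity>" using f True by (simp add: in_Lp_def s_def)
    have "AE x in lebesgue_on D. ennreal \<bar>f x\<bar> \<le> s" unfolding s_def by (rule esssup_AE)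
    then have "AE x in lebesgue. x \<in> D \<longrightarrow> ennreal \<bar>f x\<bar> \<le> s"
      using D(1) by (subst (asm) AE_restrict_space_iff) auto
    then have "AE x in lborel. x \<in> D \<longrightarrow> ennreal \<bar>f x\<bar> \<le> s" by (simp only: AE_completion_iff)
    with ae have "AE x in lborel. ennreal ((f0 x)\<^sup>2) \<le> s\<^sup>2 * indicator D x"
    proof eventually_elim
      case (elim x)
      show ?case
      proof (cases "x \<in> D")
        case True
        then have "(ennreal \<bar>f0 x\<bar>)\<^sup>2 \<le> s\<^sup>2" using elim by (intro power_mono) auto
        then show ?thesis using True by (simp add: ennreal_power)
      qed (simp add: rep_zero[OF f0])
    qed
    then have "sqnorm f0 \<le> (\<integral>\<^sup>+x. s\<^sup>2 * indicator D x \<partial>lborel)"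
      unfolding sqnorm_def by (rule nn_integral_mono_AE)
    also have "\<dots> = s\<^sup>2 * emeasure lborel D" by (simp add: nn_integral_cmult_indicator)
    finally have le: "sqnorm f0 \<le> s\<^sup>2 * emeasure lborel D" .
    have "s\<^sup>2 * emeasure lborel D < \<infinity>" using s Dfin by (simp add: ennreal_mult_less_top power2_eq_square)
    moreover have "s = 0" if "Lp_norm D p f = 0"
      using that True s by (auto simp: Lp_norm_def s_def[symmetric] enn2real_eq_0_iff)
    ultimately show ?thesis using le by (auto intro: le_less_trans)
  next
    case False
    define r where "r = enn2real p"
    have r: "2 < r" using p False unfolding r_def
      by (cases p) (auto simp: ennreal_less_iff[symmetric] simp flip: ennreal_numeral)
    have "rep D (\<lambda>x. \<bar>f x\<bar> powr r) (\<lambda>x. \<bar>f0 x\<bar> powr r)"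
      unfolding rep_def
    proof (intro conjI allI impI)
      show "(\<lambda>x. \<bar>f0 x\<bar> powr r) \<in> borel_measurable borel" by measurable
      show "AE x in lebesgue. x \<in> D \<longrightarrow> \<bar>f x\<bar> powr r = \<bar>f0 x\<bar> powr r"
        using rep_AE[OF f0] by eventually_elim auto
    qed (simp add: rep_zero[OF f0])
    note ri = rep_integral[OF D(1) this]
    have i: "integrable lborel (\<lambda>x. \<bar>f0 x\<bar> powr r)"
      using f False ri(2) by (simp add: in_Lp_def r_def)
    have "integrable lborel (\<lambda>x. indicator D x + \<bar>f0 x\<bar> powr r)"
      using i Dfin by (intro Bochner_Integration.integrable_add) auto
    then have "integrable lborel (\<lambda>x. (f0 x)\<^sup>2)"
    proof (rule Bochner_Integration.integrable_bound)
      show "AE x in lborel. norm ((f0 x)\<^sup>2) \<le> norm (indicator D x + \<bar>f0 x\<bar> powr r)"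
      proof (rule AE_I2)
        fix x
        \<comment> \<open>Where \<open>\<bar>f0 x\<bar> \<le> 1\<close> the indicator dominates,
          elsewhere the power with exponent \<open>r > 2\<close>.\<close>
        have "(f0 x)\<^sup>2 \<le> indicator D x + \<bar>f0 x\<bar> powr r"
        proof (cases "x \<in> D")
          case True
          show ?thesis
          proof (cases "\<bar>f0 x\<bar> \<le> 1")
            case False
            then have "\<bar>f0 x\<bar> powr 2 \<le> \<bar>f0 x\<bar> powr r" using r by (intro powr_mono) auto
            then show ?thesis using True by (simp only: abs_powr_2) simp
          qed (use True in \<open>simp add: abs_square_le_1 add_increasing2\<close>)
        qed (simp add: rep_zero[OF f0])
        then show "norm ((f0 x)\<^sup>2) \<le> norm (indicator D x + \<bar>f0 x\<bar> powr r)" by simp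
      qed
    qed measurable
    then have "sqnorm f0 < \<infinity>" using sqnorm_finite_iff[of f0] by simp
    moreover have "sqnorm f0 = 0" if "Lp_norm D p f = 0"
    proof -
      have "(\<integral>x. \<bar>f0 x\<bar> powr r \<partial>lborel) = 0" using that False ri(1) by (simp add: Lp_norm_def r_def)
      then have "AE x in lborel. \<bar>f0 x\<bar> powr r = 0" using i by (subst (asm) integral_nonneg_eq_0_iff_AE) auto
      then have "AE x in lborel. ennreal ((f0 x)\<^sup>2) = 0" by eventually_elim auto
      then show ?thesis unfolding sqnorm_def by (subst nn_integral_0_iff_AE) auto
    qed
    ultimately show ?thesis by blast
  qed
  then have fin: "sqnorm f0 < \<infinity>" and z: "Lp_norm D p f = 0 \<Longrightarrow> sqnorm f0 = 0" by auto
  show "sqnorm f0 < \<infinity>" by (rule fin)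
  have e: "sqnorm f0 = ennreal (\<integral>x. (f0 x)\<^sup>2 \<partial>lborel)" by (rule sqnorm_eq_integral) (use fin in auto)
  have nn: "0 \<le> (\<integral>x. (f0 x)\<^sup>2 \<partial>lborel)" "0 \<le> Lp_norm D p f" by (auto simp: Lp_norm_def)
  show "\<exists>K\<ge>0. sqrt (\<integral>x. (f0 x)\<^sup>2 \<partial>lborel) \<le> K * Lp_norm D p f"
  proof (cases "Lp_norm D p f = 0")
    case True
    then have "(\<integral>x. (f0 x)\<^sup>2 \<partial>lborel) = 0" using z e nn(1) by simp
    then show ?thesis by (intro exI[of _ 0]) simp
  next
    case False
    then show ?thesis using nn by (intro exI[of _ "sqrt (\<integral>x. (f0 x)\<^sup>2 \<partial>lborel) / Lp_norm D p f"]) simp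
  qed
qed

text \<open>The weak derivatives of the chosen \<open>weak_partial D i u\<close> are also weak
  derivatives of the Borel representative \<open>G i\<close>, since the two agree almost everywhere
  on \<open>D\<close>.\<close>

lemma H2_sob:
  assumes D: "open D" "bounded D" and u: "u \<in> H2 D" and s: "sob D u u0 G"
  obtains GG where "\<And>i j. GG i j \<in> borel_measurable borel" "\<And>i j. sqnorm (GG i j) < \<infinity>"
    "\<And>i j. weak_deriv_on D j (G i) (GG i j)" "(\<Sum>i\<in>UNIV. \<Sum>j\<in>UNIV. sqnorm (GG i j)) \<le> ennreal ((H2_norm D u)\<^sup>2)"
proof -
  have "\<forall>i. \<exists>g H. sob D (weak_partial D i u) g H" using u H1_sob[OF D] by (auto simp: H2_def)
  then obtain g GG where gG: "\<And>i. sob D (weak_partial D i u) (g i) (GG i)" by metis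
  note sG = sobD[OF gG]
  have w: "weak_deriv_on D j (G i) (GG i j)" for i j
    using sob_has_weak_partial[OF D gG, of j i] sob_integrable[OF D(2) s] sob_integrable[OF D(2) gG]
    by (subst (asm) has_weak_partial_iff[OF D(1) sob_weak_partial[OF D s] _ rep_self[of "GG i j"]]) (use sG in auto)
  have n: "sqnorm (GG i j) = ennreal ((Lp_norm D 2 (weak_partial D j (weak_partial D i u)))\<^sup>2)" for i j
    by (rule in_Lp_2_iff(2)[OF D(1) sob_weak_partial[OF D gG], symmetric]) (rule sG)
  have "(\<Sum>i\<in>UNIV. \<Sum>j\<in>UNIV. sqnorm (GG i j)) = ennreal (\<Sum>i\<in>UNIV. \<Sum>j\<in>UNIV. (Lp_norm D 2 (weak_partial D j (weak_partial D i u)))\<^sup>2)"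
    unfolding n by (simp add: sum_nonneg)
  also have "\<dots> \<le> ennreal ((H2_norm D u)\<^sup>2)"
    unfolding H2_norm_def by (intro ennreal_leI) (simp add: sum_nonneg)
  finally show ?thesis using that[of GG] sG w by blast
qed

lemma (in fe_sampling) L2_error_bound:
  assumes u: "u \<in> H10 D" "sob D u u0 G" "\<And>v. v \<in> V \<Longrightarrow> energy u v = (\<integral>x. f0 x * v x \<partial>lborel)"
    and GG: "\<And>i j. GG i j \<in> borel_measurable borel" "\<And>i j. sqnorm (GG i j) < \<infinity>"
      "\<And>i j. weak_deriv_on D j (G i) (GG i j)" "(\<Sum>i\<in>UNIV. \<Sum>j\<in>UNIV. sqnorm (GG i j)) \<le> ennreal (B\<^sup>2)" and B: "0 \<le> B"
    and U: "IS_solution M D Th \<phi> f Y U"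
  shows "L2_H10_norm M D (\<lambda>\<omega> x. U \<omega> x - u x)
    \<le> ennreal (sqrt (192 / cq\<^sup>2) * h * B + sqrt (sobolev_const / 3) * sqrt (ell h) * h * sqrt (\<integral>x. (f0 x)\<^sup>2 \<partial>lborel))"
proof -
  define E where "E = (\<integral>\<^sup>+\<omega>. ennreal ((H1_seminorm D (\<lambda>x. U \<omega> x - u x))\<^sup>2) \<partial>M)"
  define F where "F = (\<integral>x. (f0 x)\<^sup>2 \<partial>lborel)"
  define a where "a = 192 * h\<^sup>2 / cq\<^sup>2 * B\<^sup>2"
  define b where "b = sobolev_const * ell h * (h\<^sup>2 / 3) * F"
  have F0: "0 \<le> F" unfolding F_def by simp
  have a0: "0 \<le> a" unfolding a_def by simp
  have b0: "0 \<le> b" unfolding b_def using sobolev_const_pos F0 by (auto simp: ell_def)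
  \<comment> \<open>The best approximation bound holds up to an arbitrary \<open>e\<close>, which
    has to disappear before the square root is taken.\<close>
  have *: "E \<le> ennreal b + ennreal a + ennreal e" if e: "0 < e" for e :: real
  proof -
    have "0 < ennreal e" using e by simp
    from best_approximation[OF u(1,2) GG(1-3) this] obtain v where v: "v \<in> V"
      and le: "(\<Sum>i\<in>UNIV. sqnorm (\<lambda>x. G i x - fe_grad v i x)) \<le> ennreal (192 * h\<^sup>2 / cq\<^sup>2) * (\<Sum>i\<in>UNIV. \<Sum>j\<in>UNIV. sqnorm (GG i j)) + ennreal e"
      by blast
    have "ennreal ((H1_seminorm D (\<lambda>x. v x - u x))\<^sup>2) = (\<Sum>i\<in>UNIV. sqnorm (\<lambda>x. fe_grad v i x - G i x))"
      by (rule sob_seminorm(2)[OF open_D bounded_D sob_diff[OF open_D bounded_D V_sob[OF v] u(2)]])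
    also have "\<dots> = (\<Sum>i\<in>UNIV. sqnorm (\<lambda>x. G i x - fe_grad v i x))"
      unfolding sqnorm_def by (simp add: power2_commute)
    also note le
    also have "ennreal (192 * h\<^sup>2 / cq\<^sup>2) * (\<Sum>i\<in>UNIV. \<Sum>j\<in>UNIV. sqnorm (GG i j)) + ennreal e
      \<le> ennreal (192 * h\<^sup>2 / cq\<^sup>2) * ennreal (B\<^sup>2) + ennreal e"
      by (intro add_right_mono mult_left_mono GG(4)) simp
    also have "ennreal (192 * h\<^sup>2 / cq\<^sup>2) * ennreal (B\<^sup>2) = ennreal a"
      unfolding a_def by (rule ennreal_mult[symmetric]) auto
    finally have le': "ennreal ((H1_seminorm D (\<lambda>x. v x - u x))\<^sup>2) \<le> ennreal a + ennreal e" .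
    have "E \<le> ennreal b + ennreal ((H1_seminorm D (\<lambda>x. v x - u x))\<^sup>2)"
      unfolding E_def b_def F_def by (rule mean_square_error[OF u(2,3) U v])
    also have "\<dots> \<le> ennreal b + (ennreal a + ennreal e)" by (rule add_left_mono[OF le'])
    finally show ?thesis by (simp only: add.assoc)
  qed
  have "E \<le> ennreal b + ennreal a" by (rule ennreal_le_epsilon) (rule *)
  then have E: "E \<le> ennreal (a + b)" using a0 b0 by (simp add: ennreal_plus add.commute)
  then have fin: "E \<noteq> \<infinity>" by (auto simp: top_unique)
  have "sqrt (enn2real E) \<le> sqrt (a + b)"
    using enn2real_leI[OF _ E] a0 b0 by simp
  also have "\<dots> \<le> sqrt a + sqrt b" using a0 b0 by (rule sqrt_add_le_add_sqrt)
  also have "sqrt a = sqrt (192 / cq\<^sup>2) * h * B" unfolding a_def using h B by (simp add: real_sqrt_mult real_sqrt_divide)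
  also have "sqrt b = sqrt (sobolev_const / 3) * sqrt (ell h) * h * sqrt F" unfolding b_def using h by (simp add: real_sqrt_mult real_sqrt_divide)
  finally show ?thesis unfolding L2_H10_norm_def E_def[symmetric] Let_def F_def[symmetric] using fin by (simp add: ennreal_leI)
qed

theorem theorem4p4:
  fixes D :: "plane set"
    and \<T> :: "real \<Rightarrow> plane set set"
    and z :: "real \<Rightarrow> nat \<Rightarrow> plane"
    and \<phi> :: "real \<Rightarrow> nat \<Rightarrow> plane \<Rightarrow> real"
    and p :: ennreal
    and f u :: "plane \<Rightarrow> real"
    and M :: "'w measure"
    and Y :: "real \<Rightarrow> plane set \<Rightarrow> nat \<Rightarrow> 'w \<Rightarrow> plane"
    and u_IS :: "real \<Rightarrow> 'w \<Rightarrow> plane \<Rightarrow> real"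
  assumes "convex_polygonal_domain D"
    and "triangulation_family D \<T>" and "quasi_uniform \<T>"
    and "\<forall>h\<in>{0<..1}. lagrange_basis D (\<T> h) (z h) (\<phi> h)"
    and "2 < p" and "in_Lp D p f"
    and "weak_solution_Poisson D f u" and "u \<in> H10 D \<inter> H2 D"
    and "prob_space M"
    and "\<forall>h\<in>{0<..1}. IS_samples M D (\<T> h) (\<phi> h) (Y h)"
    and "\<forall>h\<in>{0<..1}. IS_solution M D (\<T> h) (\<phi> h) f (Y h) (u_IS h)"
  shows "\<exists>C>0. \<forall>h\<in>{0<..1}.
    L2_H10_norm M D (\<lambda>\<omega> x. u_IS h \<omega> x - u x)
      \<le> ennreal (C * h * H2_norm D u
          + C * ell h powr (1 / 2 + enn2real (1 / p)) * h powr (1 - 2 * enn2real (1 / p))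
              * Lp_norm D p f)"
proof -
  interpret prob_space M by fact
  interpret convex_domain D by unfold_locales (use assms(1) in \<open>auto simp: convex_polygonal_domain_def\<close>)
  obtain cq where cq: "0 < cq" "\<And>h T. h \<in> {0<..1} \<Longrightarrow> T \<in> \<T> h \<Longrightarrow> cq * h\<^sup>2 \<le> area T"
    using assms(3) by (auto simp: quasi_uniform_def)
  obtain f0 where f0: "rep D f f0" using rep_exists[OF open_D] assms(6) by (auto simp: in_Lp_def)
  note L2 = Lp_embeds_L2[OF open_D bounded_D assms(5,6) f0]
  obtain K where K: "0 \<le> K" "sqrt (\<integral>x. (f0 x)\<^sup>2 \<partial>lborel) \<le> K * Lp_norm D p f" using L2(2) by blast
  have u: "u \<in> H10 D" "u \<in> H2 D" using assms(8) by auto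
  then have "u \<in> H1 D" by (simp add: H10_def)
  then obtain u0 G where s: "sob D u u0 G" using H1_sob[OF open_D bounded_D] by blast
  obtain GG where GG: "\<And>i j. GG i j \<in> borel_measurable borel" "\<And>i j. sqnorm (GG i j) < \<infinity>"
    "\<And>i j. weak_deriv_on D j (G i) (GG i j)" "(\<Sum>i\<in>UNIV. \<Sum>j\<in>UNIV. sqnorm (GG i j)) \<le> ennreal ((H2_norm D u)\<^sup>2)"
    by (rule H2_sob[OF open_D bounded_D u(2) s], rule that)
  \<comment> \<open>For infinite \<open>p\<close> the quotient is 0, in accordance with the
    convention; \<open>2 < p\<close> gives \<open>q \<le> 1 / 2\<close>, so the exponent
    \<open>1 - 2 * q\<close> lies in \<open>[0, 1]\<close>.\<close>
  define q where "q = enn2real (1 / p)"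
  have q: "0 \<le> q" "q \<le> 1 / 2"
  proof -
    show "q \<le> 1 / 2"
    proof (cases p)
      case (real r)
      then have "2 < r" using assms(5) ennreal_less_iff[of 2 r] by simp
      then have "1 / p = ennreal (1 / r)" using real divide_ennreal[of 1 r] by simp
      then show ?thesis using \<open>2 < r\<close> by (simp add: q_def)
    qed (simp add: q_def)
  qed (simp add: q_def)
  have H0: "0 \<le> H2_norm D u" by (simp add: H2_norm_def sum_nonneg)
  have P0: "0 \<le> Lp_norm D p f" by (simp add: Lp_norm_def)
  \<comment> \<open>The Sobolev constant is referred to by its global name, with only
    \<open>D\<close> and \<open>cq\<close> as arguments, so that \<open>C\<close> is fixed before
    any \<open>h\<close> is chosen.\<close>
  define S where "S = sqrt (fe_mesh.sobolev_const D cq / 3)"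
  define C where "C = max (sqrt (192 / cq\<^sup>2)) (S * K)"
  have C: "0 < C" unfolding C_def using cq(1) by (simp add: less_max_iff_disj)
  show ?thesis
  proof (intro exI conjI ballI)
    show "0 < C" by fact
    fix h :: real assume hI: "h \<in> {0<..1}"
    interpret fe_sampling D "\<T> h" h cq "z h" "\<phi> h" M f f0 "Y h"
      by unfold_locales (use assms hI cq f0 L2(1) in \<open>auto simp: triangulation_family_def\<close>)
    have "energy u v = (\<integral>x. f0 x * v x \<partial>lborel)" if v: "v \<in> V" for v
    proof -
      have "energy u v = (LINT x|lebesgue_on D. f x * v x)"
        using assms(7) V_H10[OF v] by (simp add: weak_solution_Poisson_def)
      also have "\<dots> = (\<integral>x. f0 x * v x \<partial>lborel)"
        using sobD(3)[OF V_sob[OF v]] by (intro rep_integral(1) open_D rep_mult_right f0)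
      finally show ?thesis .
    qed
    note bound = L2_error_bound[OF u(1) s this GG H0 assms(11)[rule_format, OF hI]]
    have l: "1 \<le> ell h" by (simp add: ell_def)
    have S0: "0 \<le> S" unfolding S_def using sobolev_const_pos by simp
    have "sqrt (192 / cq\<^sup>2) * h * H2_norm D u \<le> C * h * H2_norm D u"
      using h H0 by (intro mult_right_mono) (auto simp: C_def)
    moreover have "S * sqrt (ell h) * h * sqrt (\<integral>x. (f0 x)\<^sup>2 \<partial>lborel) \<le> C * ell h powr (1 / 2 + q) * h powr (1 - 2 * q) * Lp_norm D p f"
    proof -
      have 1: "sqrt (ell h) \<le> ell h powr (1 / 2 + q)"
        using l q by (simp add: powr_half_sqrt[symmetric] powr_mono)
      have "h powr 1 \<le> h powr (1 - 2 * q)" using h q by (intro powr_mono') auto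
      then have 2: "h \<le> h powr (1 - 2 * q)" using h by simp
      have "S * sqrt (ell h) * h * sqrt (\<integral>x. (f0 x)\<^sup>2 \<partial>lborel)
        \<le> S * ell h powr (1 / 2 + q) * h powr (1 - 2 * q) * (K * Lp_norm D p f)"
        using 1 2 K S0 h l by (intro mult_mono mult_nonneg_nonneg) auto
      also have "\<dots> = (S * K) * (ell h powr (1 / 2 + q) * h powr (1 - 2 * q) * Lp_norm D p f)" by simp
      also have "\<dots> \<le> C * (ell h powr (1 / 2 + q) * h powr (1 - 2 * q) * Lp_norm D p f)"
        using P0 by (intro mult_right_mono) (auto simp: C_def)
      finally show ?thesis by (simp add: mult.assoc)
    qed
    ultimately show "L2_H10_norm M D (\<lambda>\<omega> x. u_IS h \<omega> x - u x)
      \<le> ennreal (C * h * H2_norm D u + C * ell h powr (1 / 2 + enn2real (1 / p)) * h powr (1 - 2 * enn2real (1 / p)) * Lp_norm D p f)"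
      unfolding q_def[symmetric] using bound by (intro order_trans[OF bound] ennreal_leI add_mono) (simp_all add: S_def)
  qed
qed

end
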